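(* Let $r\ge 1$, let $\mathcal{L}$ be a homogeneous Lagrangian on $\mathrm{Imm}\,T^r_nX$ and let $L$ be the associated non-homogeneous Lagrangian in a chart, so that $\mathcal{L}=\det(\mathbf{x})\,L\circ\rho^r_n$ on $W^r$. Then on $W^s$, $s\ge 2r$, the following relations hold (all sums over $I$ are restricted to $|I|\le r$): $$\mathcal{E}_\sigma(\mathcal{L})=\det(\mathbf{x})\,E_\sigma(L)\circ\rho^s_n,$$ $$\mathcal{E}^{j_1,\dots,j_k}_\sigma(\mathcal{L})=(-1)^k\det(\mathbf{x})\sum_{|I|\ge k}(-1)^{|I|}\sum_{(I_1,\dots,I_k)}\mathcal{S}^+_{j_1,\dots,j_k}z^{j_1}_{I_1}\cdots z^{j_k}_{I_k}\,E^I_\sigma(L)\circ\rho^s_n\qquad(k\ge1),$$ $$\mathcal{E}_p(\mathcal{L})=-\det(\mathbf{x})\,\big(y^\sigma_pE_\sigma(L)\big)\circ\rho^s_n,$$ $$\mathcal{E}^j_p(\mathcal{L})=\det(\mathbf{x})\Big[z^j_p\,L\circ\rho^s_n+y^\sigma_p\sum_{1\le|I|\le r}(-1)^{|I|}z^j_I\,E^I_\sigma(L)\circ\rho^s_n\Big],$$ $$\mathcal{E}^{j_1,\dots,j_k}_p(\mathcal{L})=(-1)^{k+1}\det(\mathbf{x})\,y^\sigma_p\sum_{|I|\ge k}(-1)^{|I|}\sum_{(I_1,\dots,I_k)}\mathcal{S}^+_{j_1,\dots,j_k}z^{j_1}_{I_1}\cdots z^{j_k}_{I_k}\,E^I_\sigma(L)\circ\rho^s_n\qquad(k\ge2).$$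 Here $\sigma=1,\dots,m$ and $p=1,\dots,n$, and repeated indices are summed.
   Context: Velocities. $X$ is a smooth manifold of dimension $N=n+m$, $n\ge 1$. $T^r_nX$ is the manifold of $(r,n)$-velocities, i.e. $r$-jets $j^r_0\gamma$ at $0$ of smooth maps $\gamma$ from a neighbourhood of $0\in\mathbb{R}^n$ to $X$; $\mathrm{Imm}\,T^r_nX$ is the open subset of regular velocities (jets of immersions). A chart $(V,(x^A))$ of $X$ induces coordinates $x^A_{j_1,\dots,j_k}(j^r_0\gamma)=\partial^k(x^A\circ\gamma)/\partial t^{j_1}\cdots\partial t^{j_k}|_0$, $0\le k\le r$, symmetric in the lower indices. Functions of lower order are pulled back to higher-order velocities without notation. Group and quotient. $L^r_n$ is the group of $r$-jets at $0$ of local diffeomorphisms of $\mathbb{R}^n$ fixing $0$; it acts on the right on $T^r_nX$ by $j^r_0\gamma\cdot j^r_0\alpha=j^r_0(\gamma\circ\alpha)$; for $a=j^r_0\alpha$, $\det(a)$ is the Jacobian determinant of $\alpha$ at $0$. $P^r_nX=\mathrm{Imm}\,T^r_nX/L^r_n$, with projection $\rho^r_n$ (a smooth principal bundle). Multi-indices. A multi-index $I$ of length $|I|=k$ is a sequence $(i_1,\dots,i_k)$ in $\{1,\dots,n\}$; sums over multi-indices run over all sequences; $IJ$ is juxtaposition. $\sum_{(I_1,\dots,I_k)}$ runs over all partitions of (the positions of) $I$ into $k$ nonempty subsets, partitions differing by a permutation of the subsets being identified. $\mathcal{S}^+_{j_1,\dots,j_k}$ is the symmetrization projector (average over all permutations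 of $j_1,\dots,j_k$). Derivatives. $\partial^{j_1,\dots,j_k}_A=\frac{r_1!\cdots r_n!}{k!}\frac{\partial}{\partial x^A_{j_1,\dots,j_k}}$, $r_l$ being the number of occurrences of $l$ in $(j_1,\dots,j_k)$; on $T^s_nX$, $d_i=\sum_{|J|\le s-1}x^A_{iJ}\partial^J_A$; the $d_i$ commute and $d_J=\prod_{j\in J}d_j$. Charts. Split the coordinates of a chart of $X$ into $x^i$ ($i=1,\dots,n$) and $x^\sigma$ ($\sigma=1,\dots,m$). $W^r$ is the set of regular velocities over $V$ with $\det(\mathbf{x}):=\det(x^i_j)\ne0$; there $(z^i_j)$ is the inverse matrix of $(x^i_j)$, $z^i_{j_1,\dots,j_k}=z^p_{j_1}d_pz^i_{j_2,\dots,j_k}$ ($k\ge2$), and $y^\sigma=x^\sigma$, $y^\sigma_{i_1,\dots,i_k}=z^j_{i_1}d_jy^\sigma_{i_2,\dots,i_k}$. The $z^i_I$ and $y^\sigma_I$ are symmetric in $I$; the $y^\sigma_I$ are $L^r_n$-invariant and $(x^i,y^\sigma_I)_{|I|\le r}$ are coordinates on $\rho^r_n(W^r)$. There $\Delta^{j_1,\dots,j_k}_\sigma=\frac{r_1!\cdots r_n!}{k!}\frac{\partial}{\partial y^\sigma_{j_1,\dots,j_k}}$ and (on $P^s_nX$) $D_i=\frac{\partial}{\partial x^i}+\sum_{|J|\le s-1}y^\sigma_{iJ}\Delta^J_\sigma$; the $D_i$ commute, $D_J=\prod_{j\in J}D_j$. Homogeneous Lagrangian: a smooth real function $\mathcal{L}$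 on $\mathrm{Imm}\,T^r_nX$ with $\mathcal{L}(x\cdot a)=\det(a)\mathcal{L}(x)$ for all $a\in L^r_n$; the associated non-homogeneous Lagrangian in a chart is the smooth function $L$ on $\rho^r_n(W^r)$ with $\mathcal{L}=\det(\mathbf{x})\,L\circ\rho^r_n$. Lie–Euler operators: $\mathcal{E}^I_A(\mathcal{L})=\sum_{|J|\le r-|I|}(-1)^{|J|}\binom{|I|+|J|}{|I|}d_J\partial^{IJ}_A\mathcal{L}$ and $E^I_\sigma(L)=\sum_{|J|\le r-|I|}(-1)^{|J|}\binom{|I|+|J|}{|I|}D_J\Delta^{IJ}_\sigma L$, $|I|\le r$; $\mathcal{E}_A=\mathcal{E}^\emptyset_A$ and $E_\sigma=E^\emptyset_\sigma$. *)

theory Defs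
  imports
    "HOL-Analysis.Analysis"
    "HOL-Combinatorics.Permutations"
    "HOL-Library.Multiset"
    "HOL-Library.Disjoint_Sets"
begin

section \<open>Smooth functions\<close>

text \<open>
  The coordinate space with coordinates indexed by a type \<open>'i\<close> is \<open>'i \<Rightarrow> real\<close> with the product
  topology.  For finite \<open>'i\<close> it is Euclidean space.  Infinite \<open>'i\<close> is needed for jet coordinates,
  because the order of the jets is a natural number and cannot occur in a type: a function of jets
  of order \<open>r\<close> is a function of infinitely many coordinates which ignores those of order \<open>> r\<close>.
  This also makes the pull-back of functions to higher order the identity.
\<close>

definition pderiv_at :: "'i \<Rightarrow> (('i \<Rightarrow> real) \<Rightarrow> real) \<Rightarrow> ('i \<Rightarrow> real) \<Rightarrow> real" where
  "pderiv_at i f u = deriv (\<lambda>t. f (u(i := t))) (u i)"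

text \<open>
  \<open>C\<^sup>\<infinity>\<close> (for open \<open>W\<close>): all iterated partial derivatives exist and are continuous.
  \<open>foldr pderiv_at [i\<^sub>1, \<dots>, i\<^sub>k] f\<close> is the iterated partial derivative along \<open>i\<^sub>1, \<dots>, i\<^sub>k\<close>.
\<close>
definition smooth_fun_on :: "('i \<Rightarrow> real) set \<Rightarrow> (('i \<Rightarrow> real) \<Rightarrow> real) \<Rightarrow> bool" where
  "smooth_fun_on W f \<longleftrightarrow>
     (\<forall>ks. continuous_on W (foldr pderiv_at ks f) \<and>
       (\<forall>u\<in>W. \<forall>i. (\<lambda>t. foldr pderiv_at ks f (u(i := t))) differentiable at (u i)))"

definition smooth_map_on :: "('i \<Rightarrow> real) set \<Rightarrow> (('i \<Rightarrow> real) \<Rightarrow> 'j \<Rightarrow> real) \<Rightarrow> bool" where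
  "smooth_map_on W f \<longleftrightarrow> (\<forall>j. smooth_fun_on W (\<lambda>u. f u j))"

abbreviation origin :: "'i \<Rightarrow> real" where
  "origin \<equiv> (\<lambda>_. 0)"

definition deriv0 :: "'n list \<Rightarrow> (('n \<Rightarrow> real) \<Rightarrow> real) \<Rightarrow> real" where
  "deriv0 J f = foldr pderiv_at J f origin"


section \<open>Smooth manifolds\<close>

type_synonym ('x, 'a) chart = "'x set \<times> ('x \<Rightarrow> 'a \<Rightarrow> real)"

record ('x, 'a) manifold =
  mtop :: "'x topology"
  charts :: "('x, 'a) chart set"

definition is_chart :: "'x topology \<Rightarrow> ('x, 'a::finite) chart \<Rightarrow> bool" where
  "is_chart X c \<longleftrightarrow> (case c of (V, \<phi>) \<Rightarrow>
     openin X V \<and> open (\<phi> ` V) \<and>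
     homeomorphic_map (subtopology X V) (top_of_set (\<phi> ` V)) \<phi>)"

definition smooth_transition :: "('x, 'a::finite) chart \<Rightarrow> ('x, 'a) chart \<Rightarrow> bool" where
  "smooth_transition c c' \<longleftrightarrow> (case (c, c') of ((V, \<phi>), (V', \<phi>')) \<Rightarrow>
     smooth_map_on (\<phi> ` (V \<inter> V')) (\<lambda>u. \<phi>' (inv_into V \<phi> u)))"

text \<open>The dimension is \<open>CARD('a)\<close>, and \<open>charts M\<close> is the maximal atlas.\<close>
definition smooth_manifold :: "('x, 'a::finite) manifold \<Rightarrow> bool" where
  "smooth_manifold M \<longleftrightarrow>
     Hausdorff_space (mtop M) \<and> second_countable (mtop M) \<and>
     (\<forall>c\<in>charts M. is_chart (mtop M) c) \<and>
     (\<Union>c\<in>charts M. fst c) = topspace (mtop M) \<and>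
     (\<forall>c\<in>charts M. \<forall>c'\<in>charts M. smooth_transition c c') \<and>
     (\<forall>c. is_chart (mtop M) c \<and>
          (\<forall>c'\<in>charts M. smooth_transition c c' \<and> smooth_transition c' c) \<longrightarrow> c \<in> charts M)"


section \<open>Velocities\<close>

text \<open>
  Maps defined near the origin are represented by total functions which are only
  constrained on some neighbourhood of the origin.
\<close>
definition smooth_near0 ::
  "('x, 'a::finite) manifold \<Rightarrow> (('n::finite \<Rightarrow> real) \<Rightarrow> 'x) \<Rightarrow> bool" where
  "smooth_near0 M \<gamma> \<longleftrightarrow> (\<exists>U. open U \<and> origin \<in> U \<and>
     continuous_map (top_of_set U) (mtop M) \<gamma> \<and>
     (\<forall>(V, \<phi>)\<in>charts M. smooth_map_on {t\<in>U. \<gamma> t \<in> V} (\<lambda>t. \<phi> (\<gamma> t))))"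

definition same_jet ::
  "('x, 'a::finite) manifold \<Rightarrow> nat \<Rightarrow> (('n::finite \<Rightarrow> real) \<Rightarrow> 'x) \<Rightarrow> (('n \<Rightarrow> real) \<Rightarrow> 'x) \<Rightarrow> bool" where
  "same_jet M r \<gamma> \<gamma>' \<longleftrightarrow> \<gamma> origin = \<gamma>' origin \<and>
     (\<forall>(V, \<phi>)\<in>charts M. \<gamma> origin \<in> V \<longrightarrow>
       (\<forall>A J. length J \<le> r \<longrightarrow> deriv0 J (\<lambda>t. \<phi> (\<gamma> t) A) = deriv0 J (\<lambda>t. \<phi> (\<gamma>' t) A)))"

text \<open>A velocity is an equivalence class of maps.\<close>
type_synonym ('n, 'x) velocity = "(('n \<Rightarrow> real) \<Rightarrow> 'x) set"

definition jet0 ::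
  "('x, 'a::finite) manifold \<Rightarrow> nat \<Rightarrow> (('n::finite \<Rightarrow> real) \<Rightarrow> 'x) \<Rightarrow> ('n, 'x) velocity" where
  "jet0 M r \<gamma> = {\<gamma>'. smooth_near0 M \<gamma>' \<and> same_jet M r \<gamma> \<gamma>'}"

definition velocities :: "('x, 'a::finite) manifold \<Rightarrow> nat \<Rightarrow> ('n::finite, 'x) velocity set" where
  "velocities M r = jet0 M r ` {\<gamma>. smooth_near0 M \<gamma>}"

definition rep :: "'b set \<Rightarrow> 'b" where
  "rep v = (SOME \<gamma>. \<gamma> \<in> v)"

text \<open>
  Immersion at the origin (hence near it): in some (equivalently, every) chart around
  \<open>\<gamma> 0\<close> the differential at the origin is injective.
\<close>
definition immersion_at0 ::
  "('x, 'a::finite) manifold \<Rightarrow> (('n::finite \<Rightarrow> real) \<Rightarrow> 'x) \<Rightarrow> bool" where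
  "immersion_at0 M \<gamma> \<longleftrightarrow> (\<exists>(V, \<phi>)\<in>charts M. \<gamma> origin \<in> V \<and>
     (\<forall>w :: 'n \<Rightarrow> real.
        (\<forall>A. (\<Sum>j\<in>UNIV. w j * deriv0 [j] (\<lambda>t. \<phi> (\<gamma> t) A)) = 0) \<longrightarrow> w = origin))"

definition imm_velocities :: "('x, 'a::finite) manifold \<Rightarrow> nat \<Rightarrow> ('n::finite, 'x) velocity set" where
  "imm_velocities M r = jet0 M r ` {\<gamma>. smooth_near0 M \<gamma> \<and> immersion_at0 M \<gamma>}"

text \<open>The projection of velocities of order \<open>s \<ge> r\<close> to velocities of order \<open>r\<close>.\<close>
definition truncate_vel ::
  "('x, 'a::finite) manifold \<Rightarrow> nat \<Rightarrow> ('n::finite, 'x) velocity \<Rightarrow> ('n, 'x) velocity" where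
  "truncate_vel M r v = jet0 M r (rep v)"


section \<open>The jet group and the quotient\<close>

definition local_diffeo0 :: "(('n::finite \<Rightarrow> real) \<Rightarrow> ('n \<Rightarrow> real)) \<Rightarrow> bool" where
  "local_diffeo0 \<alpha> \<longleftrightarrow> \<alpha> origin = origin \<and>
     (\<exists>U U'. open U \<and> origin \<in> U \<and> open U' \<and> bij_betw \<alpha> U U' \<and>
        smooth_map_on U \<alpha> \<and> smooth_map_on U' (inv_into U \<alpha>))"

type_synonym 'n group_jet = "(('n \<Rightarrow> real) \<Rightarrow> ('n \<Rightarrow> real)) set"

definition diffeo_jet :: "nat \<Rightarrow> (('n::finite \<Rightarrow> real) \<Rightarrow> ('n \<Rightarrow> real)) \<Rightarrow> 'n group_jet" where
  "diffeo_jet r \<alpha> = {\<beta>. local_diffeo0 \<beta> \<and>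
     (\<forall>i J. length J \<le> r \<longrightarrow> deriv0 J (\<lambda>t. \<alpha> t i) = deriv0 J (\<lambda>t. \<beta> t i))}"

definition jet_group :: "nat \<Rightarrow> 'n::finite group_jet set" where
  "jet_group r = diffeo_jet r ` {\<alpha>. local_diffeo0 \<alpha>}"

definition jet_det :: "'n::finite group_jet \<Rightarrow> real" where
  "jet_det a = det (\<chi> i j. deriv0 [j] (\<lambda>t. rep a t i))"

definition jet_act ::
  "('x, 'a::finite) manifold \<Rightarrow> nat \<Rightarrow> ('n::finite, 'x) velocity \<Rightarrow> 'n group_jet \<Rightarrow> ('n, 'x) velocity" where
  "jet_act M r v a = jet0 M r (rep v \<circ> rep a)"

text \<open>The projection onto the quotient by the jet group, whose points are the orbits.\<close>
definition \<rho> ::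
  "('x, 'a::finite) manifold \<Rightarrow> nat \<Rightarrow> ('n::finite, 'x) velocity \<Rightarrow> ('n, 'x) velocity set" where
  "\<rho> M r v = jet_act M r v ` jet_group r"


section \<open>Multi-indices\<close>

text \<open>
  Multi-indices are lists.  Quantities symmetric in their lower indices are made into
  coordinates by indexing them with multisets, so that each coordinate occurs once.
\<close>
definition enum_mset :: "'n multiset \<Rightarrow> 'n list" where
  "enum_mset K = (SOME J. mset J = K)"

text \<open>
  \<open>r\<^sub>1! \<cdots> r\<^sub>n! / k!\<close>: with this factor a sum over all lists \<open>J\<close> counts each coordinate indexed by a
  multiset exactly once.
\<close>
definition index_weight :: "'n::finite list \<Rightarrow> real" where
  "index_weight J = (\<Prod>l\<in>UNIV. fact (count (mset J) l)) / fact (length J)"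

definition multi_indices :: "nat \<Rightarrow> nat \<Rightarrow> 'n list set" where
  "multi_indices k r = {I. k \<le> length I \<and> length I \<le> r}"

definition symmetrize :: "('n list \<Rightarrow> real) \<Rightarrow> 'n list \<Rightarrow> real" where
  "symmetrize f js = (\<Sum>\<pi> | \<pi> permutes {..<length js}. f (permute_list \<pi> js)) / fact (length js)"

text \<open>
  \<open>part_sum \<zeta> I js\<close> is the sum, over the partitions \<open>(I\<^sub>1, \<dots>, I\<^sub>k)\<close> of \<open>I\<close>, of the symmetrization of
  \<open>\<zeta> j\<^sub>1 I\<^sub>1 \<cdots> \<zeta> j\<^sub>k I\<^sub>k\<close> in \<open>js = [j\<^sub>1, \<dots>, j\<^sub>k]\<close>.  Because of the symmetrization the enumeration \<open>Bs\<close>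
  of the blocks does not matter.
\<close>
definition part_sum :: "('n \<Rightarrow> 'n list \<Rightarrow> real) \<Rightarrow> 'n list \<Rightarrow> 'n list \<Rightarrow> real" where
  "part_sum \<zeta> I js =
     (\<Sum>P | partition_on {..<length I} P \<and> card P = length js.
        let Bs = (SOME Bs. distinct Bs \<and> set Bs = P)
        in symmetrize (\<lambda>js'. \<Prod>l<length js. \<zeta> (js' ! l) (nths I (Bs ! l))) js)"


section \<open>Coordinate expressions\<close>

text \<open>
  Given coordinates \<open>c\<close> on a set \<open>S\<close>, of which only those with index in \<open>K\<close> are used, these are the
  image of \<open>S\<close> in the coordinate space and the expression of \<open>f\<close> as a function of the coordinates.
\<close>
definition coord_image :: "'p set \<Rightarrow> 'k set \<Rightarrow> ('p \<Rightarrow> 'k \<Rightarrow> real) \<Rightarrow> ('k \<Rightarrow> real) set" where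
  "coord_image S K c = {u. \<exists>p\<in>S. \<forall>k\<in>K. c p k = u k}"

definition coord_expr ::
  "'p set \<Rightarrow> 'k set \<Rightarrow> ('p \<Rightarrow> 'k \<Rightarrow> real) \<Rightarrow> ('p \<Rightarrow> real) \<Rightarrow> ('k \<Rightarrow> real) \<Rightarrow> real" where
  "coord_expr S K c f u = f (THE p. p \<in> S \<and> (\<forall>k\<in>K. c p k = u k))"


section \<open>Velocities in a chart\<close>

text \<open>\<open>u (A, mset J)\<close> is the coordinate \<open>x\<^sup>A\<^sub>J\<close>.\<close>
type_synonym ('n, 'a) vcoords = "'a \<times> 'n multiset \<Rightarrow> real"

definition vcoord :: "('x, 'a::finite) chart \<Rightarrow> ('n::finite, 'x) velocity \<Rightarrow> ('n, 'a) vcoords" where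
  "vcoord c v = (\<lambda>(A, K). deriv0 (enum_mset K) (\<lambda>t. snd c (rep v t) A))"

definition imm_over :: "('x, 'a::finite) manifold \<Rightarrow> nat \<Rightarrow> ('x, 'a) chart \<Rightarrow> ('n::finite, 'x) velocity set" where
  "imm_over M r c = {v \<in> imm_velocities M r. rep v origin \<in> fst c}"

definition vel_index :: "nat \<Rightarrow> ('a \<times> 'n multiset) set" where
  "vel_index r = {(A, K). size K \<le> r}"

definition vel_domain :: "('x, 'a::finite) manifold \<Rightarrow> nat \<Rightarrow> ('x, 'a) chart \<Rightarrow> ('n::finite, 'a) vcoords set" where
  "vel_domain M r c = coord_image (imm_over M r c) (vel_index r) (vcoord c)"

definition vel_expr ::
  "('x, 'a::finite) manifold \<Rightarrow> nat \<Rightarrow> ('x, 'a) chart \<Rightarrow> (('n::finite, 'x) velocity \<Rightarrow> real)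
     \<Rightarrow> ('n, 'a) vcoords \<Rightarrow> real" where
  "vel_expr M r c f = coord_expr (imm_over M r c) (vel_index r) (vcoord c) f"

definition vpartial ::
  "'a \<Rightarrow> 'n::finite list \<Rightarrow> (('n, 'a) vcoords \<Rightarrow> real) \<Rightarrow> ('n, 'a) vcoords \<Rightarrow> real" where
  "vpartial A J F u = index_weight J * pderiv_at (A, mset J) F u"

text \<open>The operator \<open>d\<^sub>i\<close> on velocities of order \<open>s\<close>.\<close>
definition dtotal ::
  "nat \<Rightarrow> 'n::finite \<Rightarrow> (('n, 'a::finite) vcoords \<Rightarrow> real) \<Rightarrow> ('n, 'a) vcoords \<Rightarrow> real" where
  "dtotal s i F u = (\<Sum>A\<in>UNIV. \<Sum>J | length J < s. u (A, mset (i # J)) * vpartial A J F u)"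

definition lie_euler ::
  "nat \<Rightarrow> nat \<Rightarrow> 'a \<Rightarrow> 'n::finite list \<Rightarrow> (('n, 'a::finite) vcoords \<Rightarrow> real) \<Rightarrow> ('n, 'a) vcoords \<Rightarrow> real" where
  "lie_euler r s A I F u = (\<Sum>J | length I + length J \<le> r.
     (- 1) ^ length J * real ((length I + length J) choose length I) *
     foldr (dtotal s) J (vpartial A (I @ J) F) u)"


section \<open>The quotient in a chart with split coordinates\<close>

text \<open>
  The chart coordinates \<open>x\<^sup>A\<close>, \<open>A :: 'a\<close>, are split by an injection \<open>\<iota> :: 'n \<Rightarrow> 'a\<close>: the coordinates
  \<open>x\<^sup>i\<close> are those with index \<open>\<iota> i\<close>, and the \<open>x\<^sup>\<sigma>\<close> are those with \<open>\<sigma> \<notin> range \<iota>\<close>.  Thus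
  \<open>n = CARD('n) \<ge> 1\<close> and \<open>m = CARD('a) - CARD('n) \<ge> 0\<close>.
\<close>

definition xmat :: "('n::finite \<Rightarrow> 'a) \<Rightarrow> ('n, 'a) vcoords \<Rightarrow> real^'n^'n" where
  "xmat \<iota> u = (\<chi> i j. u (\<iota> i, {#j#}))"

definition zmat :: "('n::finite \<Rightarrow> 'a) \<Rightarrow> 'n \<Rightarrow> 'n \<Rightarrow> ('n, 'a) vcoords \<Rightarrow> real" where
  "zmat \<iota> i j u = matrix_inv (xmat \<iota> u) $ i $ j"

text \<open>
  \<open>zfun \<iota> i I\<close> and \<open>yfun \<iota> \<sigma> I\<close> are functions on velocities of order \<open>|I|\<close>, and \<open>dtotal\<close> is used at
  that order.
\<close>
fun zfun :: "('n::finite \<Rightarrow> 'a::finite) \<Rightarrow> 'n \<Rightarrow> 'n list \<Rightarrow> ('n, 'a) vcoords \<Rightarrow> real" where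
  "zfun \<iota> i [] = undefined"
| "zfun \<iota> i [j] = zmat \<iota> i j"
| "zfun \<iota> i (j # j' # I) =
     (\<lambda>u. \<Sum>p\<in>UNIV. zmat \<iota> p j u * dtotal (length (j # j' # I)) p (zfun \<iota> i (j' # I)) u)"

fun yfun :: "('n::finite \<Rightarrow> 'a::finite) \<Rightarrow> 'a \<Rightarrow> 'n list \<Rightarrow> ('n, 'a) vcoords \<Rightarrow> real" where
  "yfun \<iota> \<sigma> [] = (\<lambda>u. u (\<sigma>, {#}))"
| "yfun \<iota> \<sigma> (i # I) =
     (\<lambda>u. \<Sum>j\<in>UNIV. zmat \<iota> j i u * dtotal (length (i # I)) j (yfun \<iota> \<sigma> I) u)"

definition detx :: "('x, 'a::finite) chart \<Rightarrow> ('n::finite \<Rightarrow> 'a) \<Rightarrow> ('n, 'x) velocity \<Rightarrow> real" where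
  "detx c \<iota> v = det (xmat \<iota> (vcoord c v))"

definition zcoord :: "('x, 'a::finite) chart \<Rightarrow> ('n::finite \<Rightarrow> 'a) \<Rightarrow> ('n, 'x) velocity \<Rightarrow> 'n \<Rightarrow> 'n list \<Rightarrow> real" where
  "zcoord c \<iota> v i I = zfun \<iota> i I (vcoord c v)"

definition W :: "('x, 'a::finite) manifold \<Rightarrow> nat \<Rightarrow> ('x, 'a) chart \<Rightarrow> ('n::finite \<Rightarrow> 'a)
    \<Rightarrow> ('n, 'x) velocity set" where
  "W M r c \<iota> = {v \<in> imm_over M r c. detx c \<iota> v \<noteq> 0}"

text \<open>\<open>w (Inl i)\<close> is the coordinate \<open>x\<^sup>i\<close>, and \<open>w (Inr (\<sigma>, mset J))\<close> with \<open>\<sigma> \<notin> range \<iota>\<close> is \<open>y\<^sup>\<sigma>\<^sub>J\<close>.\<close>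
type_synonym ('n, 'a) qcoords = "'n + 'a \<times> 'n multiset \<Rightarrow> real"

definition qcoord :: "('x, 'a::finite) chart \<Rightarrow> ('n::finite \<Rightarrow> 'a) \<Rightarrow> ('n, 'x) velocity set \<Rightarrow> ('n, 'a) qcoords" where
  "qcoord c \<iota> P = (\<lambda>k. case k of
       Inl i \<Rightarrow> vcoord c (rep P) (\<iota> i, {#})
     | Inr (\<sigma>, K) \<Rightarrow> yfun \<iota> \<sigma> (enum_mset K) (vcoord c (rep P)))"

definition quot_index :: "nat \<Rightarrow> ('n \<Rightarrow> 'a) \<Rightarrow> ('n + 'a \<times> 'n multiset) set" where
  "quot_index r \<iota> = range Inl \<union> {Inr (\<sigma>, K) | \<sigma> K. \<sigma> \<notin> range \<iota> \<and> size K \<le> r}"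

definition quot_domain :: "('x, 'a::finite) manifold \<Rightarrow> nat \<Rightarrow> ('x, 'a) chart \<Rightarrow> ('n::finite \<Rightarrow> 'a)
    \<Rightarrow> ('n, 'a) qcoords set" where
  "quot_domain M r c \<iota> = coord_image (\<rho> M r ` W M r c \<iota>) (quot_index r \<iota>) (qcoord c \<iota>)"

definition quot_expr :: "('x, 'a::finite) manifold \<Rightarrow> nat \<Rightarrow> ('x, 'a) chart \<Rightarrow> ('n::finite \<Rightarrow> 'a)
    \<Rightarrow> (('n, 'x) velocity set \<Rightarrow> real) \<Rightarrow> ('n, 'a) qcoords \<Rightarrow> real" where
  "quot_expr M r c \<iota> f = coord_expr (\<rho> M r ` W M r c \<iota>) (quot_index r \<iota>) (qcoord c \<iota>) f"

definition qpartial ::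
  "'a \<Rightarrow> 'n::finite list \<Rightarrow> (('n, 'a) qcoords \<Rightarrow> real) \<Rightarrow> ('n, 'a) qcoords \<Rightarrow> real" where
  "qpartial \<sigma> J F w = index_weight J * pderiv_at (Inr (\<sigma>, mset J)) F w"

text \<open>The operator \<open>D\<^sub>i\<close> on the quotient of order \<open>s\<close>.\<close>
definition Dtotal ::
  "('n::finite \<Rightarrow> 'a::finite) \<Rightarrow> nat \<Rightarrow> 'n \<Rightarrow> (('n, 'a) qcoords \<Rightarrow> real) \<Rightarrow> ('n, 'a) qcoords \<Rightarrow> real" where
  "Dtotal \<iota> s i F w = pderiv_at (Inl i) F w +
     (\<Sum>\<sigma>\<in>- range \<iota>. \<Sum>J | length J < s. w (Inr (\<sigma>, mset (i # J))) * qpartial \<sigma> J F w)"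

definition quot_lie_euler ::
  "('n::finite \<Rightarrow> 'a::finite) \<Rightarrow> nat \<Rightarrow> nat \<Rightarrow> 'a \<Rightarrow> 'n list \<Rightarrow> (('n, 'a) qcoords \<Rightarrow> real)
     \<Rightarrow> ('n, 'a) qcoords \<Rightarrow> real" where
  "quot_lie_euler \<iota> r s \<sigma> I F w = (\<Sum>J | length I + length J \<le> r.
     (- 1) ^ length J * real ((length I + length J) choose length I) *
     foldr (Dtotal \<iota> s) J (qpartial \<sigma> (I @ J) F) w)"


section \<open>Lagrangians\<close>

definition homogeneous_lagrangian ::
  "('x, 'a::finite) manifold \<Rightarrow> nat \<Rightarrow> (('n::finite, 'x) velocity \<Rightarrow> real) \<Rightarrow> bool" where
  "homogeneous_lagrangian M r \<L> \<longleftrightarrow>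
     (\<forall>c\<in>charts M. smooth_fun_on (vel_domain M r c) (vel_expr M r c \<L>)) \<and>
     (\<forall>v\<in>imm_velocities M r. \<forall>a\<in>jet_group r. \<L> (jet_act M r v a) = jet_det a * \<L> v)"

definition associated_lagrangian ::
  "('x, 'a::finite) manifold \<Rightarrow> nat \<Rightarrow> ('x, 'a) chart \<Rightarrow> ('n::finite \<Rightarrow> 'a)
     \<Rightarrow> (('n, 'x) velocity \<Rightarrow> real) \<Rightarrow> (('n, 'x) velocity set \<Rightarrow> real) \<Rightarrow> bool" where
  "associated_lagrangian M r c \<iota> \<L> L \<longleftrightarrow>
     smooth_fun_on (quot_domain M r c \<iota>) (quot_expr M r c \<iota> L) \<and>
     (\<forall>v\<in>W M r c \<iota>. \<L> v = detx c \<iota> v * L (\<rho> M r v))"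

text \<open>\<open>\<E>\<^sup>I\<^sub>A(\<L>)\<close> on velocities of order \<open>s\<close>, and \<open>E\<^sup>I\<^sub>\<sigma>(L)\<close> on the quotient of order \<open>s\<close>.\<close>

definition \<E> ::
  "('x, 'a::finite) manifold \<Rightarrow> ('x, 'a) chart \<Rightarrow> nat \<Rightarrow> nat \<Rightarrow> (('n::finite, 'x) velocity \<Rightarrow> real)
     \<Rightarrow> 'a \<Rightarrow> 'n list \<Rightarrow> ('n, 'x) velocity \<Rightarrow> real" where
  "\<E> M c r s \<L> A I v = lie_euler r s A I (vel_expr M r c \<L>) (vcoord c v)"

definition E ::
  "('x, 'a::finite) manifold \<Rightarrow> ('x, 'a) chart \<Rightarrow> ('n::finite \<Rightarrow> 'a) \<Rightarrow> nat \<Rightarrow> nat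
     \<Rightarrow> (('n, 'x) velocity set \<Rightarrow> real) \<Rightarrow> 'a \<Rightarrow> 'n list \<Rightarrow> ('n, 'x) velocity set \<Rightarrow> real" where
  "E M c \<iota> r s L \<sigma> I P = quot_lie_euler \<iota> r s \<sigma> I (quot_expr M r c \<iota> L) (qcoord c \<iota> P)"

end

theory Submission imports Defs "HOL-Combinatorics.Multiset_Permutations" begin

text \<open>
  Restrict everything to a curve \<open>\<gamma>\<close>, so that the \<open>d\<^sub>i\<close> become the partial derivatives of functions of \<open>t\<close>.
  Since total derivatives of order \<open>\<le> r\<close> applied to a test function \<open>\<xi>\<close> determine their coefficients, the
  Leibniz rule shows that \<open>\<E>\<^sup>I\<close> is characterised by
  \<open>\<Sum>\<^sub>J P\<^sup>J d\<^sub>J \<xi> = \<Sum>\<^sub>I d\<^sub>I (\<xi> \<E>\<^sup>I)\<close>, where the left-hand side is the first variation of the Lagrangian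
  under \<open>\<gamma>\<^sup>A \<mapsto> \<gamma>\<^sup>A + \<epsilon> \<xi>\<close>; the \<open>E\<^sup>I\<close> are characterised in the same way by the derivations
  \<open>\<nabla>\<^sub>i = z\<^sup>p\<^sub>i d\<^sub>p\<close>, which represent the \<open>D\<^sub>i\<close> along \<open>\<gamma>\<close>.
  For the variation of \<open>det(x) L\<close>, a horizontal component \<open>\<xi>\<^sup>k\<close> acts as the divergence
  \<open>d\<^sub>j (det(x) z\<^sup>j\<^sub>k \<xi>\<^sup>k L)\<close> plus the vertical variation \<open>- y\<^sup>\<sigma>\<^sub>k \<xi>\<^sup>k\<close>, so it remains to turn \<open>det(x) \<nabla>\<^sub>I (\<xi> E\<^sup>I)\<close>
  into divergences of the form \<open>d\<^sub>J (\<dots>)\<close>. By the Piola identity \<open>d\<^sub>j (det(x) z\<^sup>j\<^sub>i) = 0\<close> one has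
  \<open>det(x) \<nabla>\<^sub>i h = d\<^sub>j (det(x) z\<^sup>j\<^sub>i h)\<close>, and iterating this rule produces the sums over partitions of \<open>I\<close>.
\<close>

section \<open>Smooth functions of the coordinates\<close>

text \<open>Passing to germs at the origin makes all derivations total, so the calculus of the
  overview becomes algebra in a commutative ring; values at \<open>origin\<close> are taken only at
  the end. A jet coordinate space has infinitely many coordinates, so smoothness is always carried
  together with dependence on finitely many of them, which the chain rule needs. The main obstacle
  lies outside this calculus. The coordinate expressions of both Lagrangians are definite
  descriptions over velocities and over orbits, so coordinates must be shown to determine these
  objects and to fill open sets. Taylor polynomials do the filling. That the \<open>y\<close>
  coordinates separate orbits rests on the inverse function theorem: two curves with equal
  \<open>x\<close> and \<open>y\<close> coordinates become equal up to order \<open>r\<close> after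
  reparametrising one of them so that the \<open>x\<close> components coincide. The divergence rule
  produces partitions with numbered blocks. Each partition into \<open>k\<close> blocks then occurs
  \<open>fact k\<close> times, which explains both the symmetrization in the statement and the
  factor \<open>1 / fact k\<close> in the intermediate formulas.\<close>

lemma open_fun_box:
  fixes w0 :: "'i \<Rightarrow> real"
  assumes "open \<Omega>" "w0 \<in> \<Omega>"
  obtains I \<delta> where "finite I" "\<delta> > 0" "\<And>w. (\<And>i. i \<in> I \<Longrightarrow> \<bar>w i - w0 i\<bar> < \<delta>) \<Longrightarrow> w \<in> \<Omega>"
proof -
  have "openin (product_topology (\<lambda>i. euclidean) UNIV) \<Omega>"
    using assms(1) by (simp add: open_fun_def)
  from product_topology_open_contains_basis[OF this assms(2)]
  obtain X where X: "w0 \<in> (\<Pi>\<^sub>E i\<in>UNIV. X i)" "\<And>i. open (X i)" "finite {i. X i \<noteq> UNIV}"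
      "(\<Pi>\<^sub>E i\<in>UNIV. X i) \<subseteq> \<Omega>"
    by auto
  have "\<exists>d>0. \<forall>x. \<bar>x - w0 i\<bar> < d \<longrightarrow> x \<in> X i" for i
    using X(1) X(2)[of i] unfolding open_dist by (force simp: dist_real_def PiE_iff)
  then obtain d where d: "\<And>i. d i > 0" "\<And>i x. \<bar>x - w0 i\<bar> < d i \<Longrightarrow> x \<in> X i"
    by metis
  let ?I = "{i. X i \<noteq> UNIV}"
  define \<delta> where "\<delta> = Min (insert 1 (d ` ?I))"
  have le: "\<delta> \<le> d i" if "i \<in> ?I" for i
    unfolding \<delta>_def using X(3) that by (intro Min_le) auto
  have "\<delta> > 0" unfolding \<delta>_def using X(3) d(1) by (subst Min_gr_iff) auto
  moreover have "w \<in> \<Omega>" if "\<And>i. i \<in> ?I \<Longrightarrow> \<bar>w i - w0 i\<bar> < \<delta>" for w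
  proof -
    have "w i \<in> X i" for i
      using that[of i] le[of i] d(2)[of "w i" i] by (cases "i \<in> ?I") force+
    then show ?thesis using X(4) by (auto simp: PiE_iff)
  qed
  ultimately show ?thesis using that X(3) by blast
qed

lemma eventually_fun_upd_in:
  fixes u :: "'i \<Rightarrow> real"
  assumes "open \<Omega>" "u \<in> \<Omega>"
  shows "eventually (\<lambda>t. u(i := t) \<in> \<Omega>) (nhds (u i))"
proof -
  obtain I \<delta> where I: "finite I" "\<delta> > 0" "\<And>w. (\<And>i. i \<in> I \<Longrightarrow> \<bar>w i - u i\<bar> < \<delta>) \<Longrightarrow> w \<in> \<Omega>"
    using open_fun_box[OF assms] by blast
  have "u(i := t) \<in> \<Omega>" if "dist t (u i) < \<delta>" for t
    using that I(2) by (intro I(3)) (auto simp: dist_real_def)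
  then show ?thesis using I(2) unfolding eventually_nhds_metric by blast
qed

lemma open_near_value:
  fixes f :: "'b::topological_space \<Rightarrow> real"
  assumes "open \<Omega>" "continuous_on \<Omega> f"
  shows "open {w\<in>\<Omega>. \<bar>f w - c\<bar> < e}"
proof -
  have "{w\<in>\<Omega>. \<bar>f w - c\<bar> < e} = \<Omega> \<inter> f -` ball c e"
    by (auto simp: dist_real_def abs_minus_commute)
  then show ?thesis using continuous_open_preimage[OF assms(2,1), of "ball c e"] by simp
qed

lemma pderiv_at_cong:
  assumes "open \<Omega>" "u \<in> \<Omega>" "\<And>w. w \<in> \<Omega> \<Longrightarrow> f w = g w"
  shows "pderiv_at i f u = pderiv_at i g u"
  unfolding pderiv_at_def
  using eventually_fun_upd_in[OF assms(1,2), of i]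
  by (intro deriv_cong_ev) (auto elim!: eventually_mono simp: assms(3))

lemma foldr_pderiv_at_cong:
  assumes "open \<Omega>" "\<And>w. w \<in> \<Omega> \<Longrightarrow> f w = g w" "u \<in> \<Omega>"
  shows "foldr pderiv_at ks f u = foldr pderiv_at ks g u"
  using assms(3) by (induction ks arbitrary: u) (auto simp: assms(2) intro: pderiv_at_cong[OF assms(1)])

lemma has_partial_cong:
  assumes "open \<Omega>" "u \<in> \<Omega>" "\<And>w. w \<in> \<Omega> \<Longrightarrow> f w = g w"
  shows "((\<lambda>t. f (u(i := t))) has_real_derivative D) (at (u i)) \<longleftrightarrow>
         ((\<lambda>t. g (u(i := t))) has_real_derivative D) (at (u i))"
  using eventually_fun_upd_in[OF assms(1,2), of i]
  by (intro DERIV_cong_ev) (auto elim!: eventually_mono simp: assms(3))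

lemma smooth_fun_on_continuous: "smooth_fun_on \<Omega> f \<Longrightarrow> continuous_on \<Omega> f"
  unfolding smooth_fun_on_def by (metis foldr.simps(1) id_apply)

lemma smooth_fun_on_has_partial:
  assumes "smooth_fun_on \<Omega> f" "u \<in> \<Omega>"
  shows "((\<lambda>t. f (u(i := t))) has_real_derivative pderiv_at i f u) (at (u i))"
proof -
  have "(\<lambda>t. foldr pderiv_at [] f (u(i := t))) differentiable at (u i)"
    using assms unfolding smooth_fun_on_def by blast
  then show ?thesis unfolding pderiv_at_def
    by (simp add: DERIV_deriv_iff_real_differentiable)
qed

lemma smooth_fun_on_pderiv_at: "smooth_fun_on \<Omega> f \<Longrightarrow> smooth_fun_on \<Omega> (pderiv_at i f)"
  unfolding smooth_fun_on_def
proof safe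
  fix ks assume *: "\<forall>ks. continuous_on \<Omega> (foldr pderiv_at ks f) \<and>
      (\<forall>u\<in>\<Omega>. \<forall>i. (\<lambda>t. foldr pderiv_at ks f (u(i := t))) differentiable at (u i))"
  show "continuous_on \<Omega> (foldr pderiv_at ks (pderiv_at i f))"
    using *[rule_format, of "ks @ [i]"] by simp
  fix u j assume "u \<in> \<Omega>"
  then show "(\<lambda>t. foldr pderiv_at ks (pderiv_at i f) (u(j := t))) differentiable at (u j)"
    using *[rule_format, of "ks @ [i]"] by simp
qed

lemma smooth_fun_on_foldr_pderiv_at: "smooth_fun_on \<Omega> f \<Longrightarrow> smooth_fun_on \<Omega> (foldr pderiv_at ks f)"
  by (induction ks) (auto intro: smooth_fun_on_pderiv_at)

lemma smooth_fun_on_subset: "smooth_fun_on \<Omega> f \<Longrightarrow> \<Omega>' \<subseteq> \<Omega> \<Longrightarrow> smooth_fun_on \<Omega>' f"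
  unfolding smooth_fun_on_def by (meson continuous_on_subset subsetD)

text \<open>A class of continuous functions that is closed under partial differentiation contains
  every iterated partial derivative, by induction on the list of directions. Closure is asked only
  up to equality on \<open>\<Omega>\<close>, because \<open>pderiv_at\<close> is uncontrolled
  elsewhere.\<close>

lemma smooth_fun_on_coinduct:
  assumes "open \<Omega>" "f \<in> S"
    and cont: "\<And>g. g \<in> S \<Longrightarrow> continuous_on \<Omega> g"
    and der: "\<And>g i. g \<in> S \<Longrightarrow>
      \<exists>h\<in>S. \<forall>u\<in>\<Omega>. ((\<lambda>t. g (u(i := t))) has_real_derivative h u) (at (u i))"
  shows "smooth_fun_on \<Omega> f"
proof -
  have ex: "\<exists>h\<in>S. \<forall>u\<in>\<Omega>. foldr pderiv_at ks f u = h u" for ks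
  proof (induction ks)
    case Nil
    then show ?case using assms(2) by auto
  next
    case (Cons k ks)
    then obtain h where h: "h \<in> S" "\<forall>u\<in>\<Omega>. foldr pderiv_at ks f u = h u" by blast
    from der[OF h(1)] obtain h' where h': "h' \<in> S"
      "\<forall>u\<in>\<Omega>. ((\<lambda>t. h (u(k := t))) has_real_derivative h' u) (at (u k))" by blast
    have "foldr pderiv_at (k # ks) f u = h' u" if "u \<in> \<Omega>" for u
    proof -
      have "foldr pderiv_at (k # ks) f u = pderiv_at k h u"
        unfolding foldr.simps o_apply by (rule pderiv_at_cong[OF assms(1) that]) (use h(2) in blast)
      also have "\<dots> = h' u"
        unfolding pderiv_at_def by (rule DERIV_imp_deriv) (use h' that in auto)
      finally show ?thesis .
    qed
    then show ?case using h' by blast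
  qed
  show ?thesis unfolding smooth_fun_on_def
  proof safe
    fix ks
    obtain h where h: "h \<in> S" "\<forall>u\<in>\<Omega>. foldr pderiv_at ks f u = h u" using ex by blast
    show "continuous_on \<Omega> (foldr pderiv_at ks f)"
      using cont[OF h(1)] h(2) by (simp cong: continuous_on_cong)
    fix u i assume u: "u \<in> \<Omega>"
    obtain h' where h': "((\<lambda>t. h (u(i := t))) has_real_derivative h') (at (u i))"
      using der[OF h(1)] u by blast
    then have "((\<lambda>t. foldr pderiv_at ks f (u(i := t))) has_real_derivative h') (at (u i))"
      by (subst has_partial_cong[OF assms(1) u, where g = h]) (use h(2) in auto)
    then show "(\<lambda>t. foldr pderiv_at ks f (u(i := t))) differentiable at (u i)"
      by (auto simp: real_differentiable_def)
  qed
qed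

lemma smooth_fun_on_cong:
  assumes "open \<Omega>" "smooth_fun_on \<Omega> f" "\<And>w. w \<in> \<Omega> \<Longrightarrow> f w = g w"
  shows "smooth_fun_on \<Omega> g"
proof (rule smooth_fun_on_coinduct[OF assms(1), where S = "{g. \<exists>f. smooth_fun_on \<Omega> f \<and> (\<forall>w\<in>\<Omega>. f w = g w)}"])
  fix g i assume "g \<in> {g. \<exists>f. smooth_fun_on \<Omega> f \<and> (\<forall>w\<in>\<Omega>. f w = g w)}"
  then obtain f where f: "smooth_fun_on \<Omega> f" "\<forall>w\<in>\<Omega>. f w = g w" by blast
  show "continuous_on \<Omega> g"
    using smooth_fun_on_continuous[OF f(1)] f(2) by (simp cong: continuous_on_cong)
  have "\<forall>u\<in>\<Omega>. ((\<lambda>t. g (u(i := t))) has_real_derivative pderiv_at i f u) (at (u i))"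
    using smooth_fun_on_has_partial[OF f(1)] has_partial_cong[OF assms(1), of _ f g] f(2) by blast
  then show "\<exists>h\<in>{g. \<exists>f. smooth_fun_on \<Omega> f \<and> (\<forall>w\<in>\<Omega>. f w = g w)}.
      \<forall>u\<in>\<Omega>. ((\<lambda>t. g (u(i := t))) has_real_derivative h u) (at (u i))"
    using smooth_fun_on_pderiv_at[OF f(1)] by blast
qed (use assms in blast)

text \<open>By the Leibniz rule, closure of such an algebra under partial derivatives can be checked
  on the generators alone; choosing the generators well then gives each closure property of smooth
  functions.\<close>

inductive_set fun_alg :: "('b \<Rightarrow> real) set \<Rightarrow> ('b \<Rightarrow> real) set" for B where
  fun_alg_base: "b \<in> B \<Longrightarrow> b \<in> fun_alg B"
| fun_alg_const: "(\<lambda>_. c) \<in> fun_alg B"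
| fun_alg_add: "f \<in> fun_alg B \<Longrightarrow> g \<in> fun_alg B \<Longrightarrow> (\<lambda>u. f u + g u) \<in> fun_alg B"
| fun_alg_mult: "f \<in> fun_alg B \<Longrightarrow> g \<in> fun_alg B \<Longrightarrow> (\<lambda>u. f u * g u) \<in> fun_alg B"

lemma fun_alg_sum:
  assumes "\<And>k. k \<in> K \<Longrightarrow> f k \<in> fun_alg B"
  shows "(\<lambda>u. \<Sum>k\<in>K. f k u) \<in> fun_alg B"
  using assms by (induction K rule: infinite_finite_induct) (auto intro: fun_alg.intros)

lemma smooth_fun_on_alg:
  fixes B :: "(('i \<Rightarrow> real) \<Rightarrow> real) set"
  assumes "open \<Omega>" "f \<in> fun_alg B"
    and cont: "\<And>b. b \<in> B \<Longrightarrow> continuous_on \<Omega> b"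
    and der: "\<And>b i. b \<in> B \<Longrightarrow>
      \<exists>h\<in>fun_alg B. \<forall>u\<in>\<Omega>. ((\<lambda>t. b (u(i := t))) has_real_derivative h u) (at (u i))"
  shows "smooth_fun_on \<Omega> f"
proof (rule smooth_fun_on_coinduct[OF assms(1,2)])
  fix g assume "g \<in> fun_alg B"
  then show "continuous_on \<Omega> g"
    by induction (auto intro: cont continuous_intros)
next
  fix g i assume "g \<in> fun_alg B"
  then show "\<exists>h\<in>fun_alg B. \<forall>u\<in>\<Omega>. ((\<lambda>t. g (u(i := t))) has_real_derivative h u) (at (u i))"
  proof induction
    case (fun_alg_base b)
    then show ?case by (rule der)
  next
    case (fun_alg_const c)
    show ?case by (rule bexI[of _ "\<lambda>_. 0"]) (auto intro: fun_alg.intros)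
  next
    case (fun_alg_add f g)
    then obtain f' g' where *: "f' \<in> fun_alg B" "g' \<in> fun_alg B"
      "\<forall>u\<in>\<Omega>. ((\<lambda>t. f (u(i := t))) has_real_derivative f' u) (at (u i))"
      "\<forall>u\<in>\<Omega>. ((\<lambda>t. g (u(i := t))) has_real_derivative g' u) (at (u i))" by blast
    have "\<forall>u\<in>\<Omega>. ((\<lambda>t. f (u(i := t)) + g (u(i := t))) has_real_derivative f' u + g' u) (at (u i))"
    proof
      fix u assume "u \<in> \<Omega>"
      from DERIV_add[OF *(3)[rule_format, OF this] *(4)[rule_format, OF this]]
      show "((\<lambda>t. f (u(i := t)) + g (u(i := t))) has_real_derivative f' u + g' u) (at (u i))" .
    qed
    moreover have "(\<lambda>u. f' u + g' u) \<in> fun_alg B"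
      by (intro fun_alg.fun_alg_add *)
    ultimately show ?case by (rule bexI[of _ "\<lambda>u. f' u + g' u"])
  next
    case (fun_alg_mult f g)
    then obtain f' g' where *: "f' \<in> fun_alg B" "g' \<in> fun_alg B"
      "\<forall>u\<in>\<Omega>. ((\<lambda>t. f (u(i := t))) has_real_derivative f' u) (at (u i))"
      "\<forall>u\<in>\<Omega>. ((\<lambda>t. g (u(i := t))) has_real_derivative g' u) (at (u i))" by blast
    have "\<forall>u\<in>\<Omega>. ((\<lambda>t. f (u(i := t)) * g (u(i := t))) has_real_derivative f' u * g u + g' u * f u) (at (u i))"
    proof
      fix u assume "u \<in> \<Omega>"
      from DERIV_mult[OF *(3)[rule_format, OF this] *(4)[rule_format, OF this]]
      show "((\<lambda>t. f (u(i := t)) * g (u(i := t))) has_real_derivative f' u * g u + g' u * f u) (at (u i))"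
        by simp
    qed
    moreover have "(\<lambda>u. f' u * g u + g' u * f u) \<in> fun_alg B"
      by (intro fun_alg.fun_alg_add fun_alg.fun_alg_mult) (use * fun_alg_mult in auto)
    ultimately show ?case by (rule bexI[of _ "\<lambda>u. f' u * g u + g' u * f u"])
  qed
qed

lemma smooth_fun_on_alg_smooth:
  assumes "open \<Omega>" "f \<in> fun_alg {g. smooth_fun_on \<Omega> g}"
  shows "smooth_fun_on \<Omega> f"
  using assms
  by (rule smooth_fun_on_alg)
     (auto intro: smooth_fun_on_continuous intro!: bexI[OF _ fun_alg_base] smooth_fun_on_has_partial smooth_fun_on_pderiv_at)

lemma smooth_fun_on_const: "open \<Omega> \<Longrightarrow> smooth_fun_on \<Omega> (\<lambda>_. c)"
  by (erule smooth_fun_on_alg_smooth) (auto intro: fun_alg.intros)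

lemma smooth_fun_on_add:
  "open \<Omega> \<Longrightarrow> smooth_fun_on \<Omega> f \<Longrightarrow> smooth_fun_on \<Omega> g \<Longrightarrow> smooth_fun_on \<Omega> (\<lambda>u. f u + g u)"
  by (erule smooth_fun_on_alg_smooth) (auto intro: fun_alg.intros)

lemma smooth_fun_on_mult:
  "open \<Omega> \<Longrightarrow> smooth_fun_on \<Omega> f \<Longrightarrow> smooth_fun_on \<Omega> g \<Longrightarrow> smooth_fun_on \<Omega> (\<lambda>u. f u * g u)"
  by (erule smooth_fun_on_alg_smooth) (auto intro: fun_alg.intros)

lemma smooth_fun_on_uminus:
  "open \<Omega> \<Longrightarrow> smooth_fun_on \<Omega> f \<Longrightarrow> smooth_fun_on \<Omega> (\<lambda>u. - f u)"
  using smooth_fun_on_mult[OF _ smooth_fun_on_const[of \<Omega> "-1"], of f] by simp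

lemma smooth_fun_on_diff:
  "open \<Omega> \<Longrightarrow> smooth_fun_on \<Omega> f \<Longrightarrow> smooth_fun_on \<Omega> g \<Longrightarrow> smooth_fun_on \<Omega> (\<lambda>u. f u - g u)"
  using smooth_fun_on_add[of \<Omega> f "\<lambda>u. - g u"] smooth_fun_on_uminus[of \<Omega> g] by simp

lemma smooth_fun_on_sum:
  "open \<Omega> \<Longrightarrow> (\<And>k. k \<in> K \<Longrightarrow> smooth_fun_on \<Omega> (f k)) \<Longrightarrow> smooth_fun_on \<Omega> (\<lambda>u. \<Sum>k\<in>K. f k u)"
  by (induction K rule: infinite_finite_induct) (auto intro: smooth_fun_on_const smooth_fun_on_add)

lemma smooth_fun_on_prod:
  "open \<Omega> \<Longrightarrow> (\<And>k. k \<in> K \<Longrightarrow> smooth_fun_on \<Omega> (f k)) \<Longrightarrow> smooth_fun_on \<Omega> (\<lambda>u. \<Prod>k\<in>K. f k u)"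
  by (induction K rule: infinite_finite_induct) (auto intro: smooth_fun_on_const smooth_fun_on_mult)

lemma continuous_on_coord: "continuous_on S (\<lambda>u. u k :: 'b::topological_space)"
  by (rule continuous_on_product_then_coordinatewise) (rule continuous_on_id)

lemma smooth_fun_on_coord: "open \<Omega> \<Longrightarrow> smooth_fun_on \<Omega> (\<lambda>u. u k)"
proof (rule smooth_fun_on_alg[where B = "{\<lambda>u. u k}"])
  fix b :: "('a \<Rightarrow> real) \<Rightarrow> real" and i assume "b \<in> {\<lambda>u. u k}"
  then show "continuous_on \<Omega> b"
    "\<exists>h\<in>fun_alg {\<lambda>u. u k}. \<forall>u\<in>\<Omega>. ((\<lambda>t. b (u(i := t))) has_real_derivative h u) (at (u i))"
    by (auto intro!: continuous_on_coord bexI[OF _ fun_alg_const[of "if i = k then 1 else 0"]])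
qed (auto intro: fun_alg.intros)

text \<open>Adjoining the single generator \<open>1 / f\<close> to the smooth functions suffices,
  since its partial derivatives are \<open>- f' / f^2\<close> and stay in the algebra.\<close>

lemma smooth_fun_on_inverse:
  assumes "open \<Omega>" "smooth_fun_on \<Omega> f" "\<And>u. u \<in> \<Omega> \<Longrightarrow> f u \<noteq> 0"
  shows "smooth_fun_on \<Omega> (\<lambda>u. inverse (f u))"
proof (rule smooth_fun_on_alg[OF assms(1), where B = "{g. smooth_fun_on \<Omega> g} \<union> {\<lambda>u. inverse (f u)}"])
  let ?B = "{g. smooth_fun_on \<Omega> g} \<union> {\<lambda>u. inverse (f u)}"
  fix b i assume "b \<in> ?B"
  then consider "smooth_fun_on \<Omega> b" | "b = (\<lambda>u. inverse (f u))" by blast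
  note b = this
  from b show "continuous_on \<Omega> b"
  proof cases
    case 2
    then show ?thesis using assms smooth_fun_on_continuous by (auto intro!: continuous_intros)
  qed (rule smooth_fun_on_continuous)
  from b show "\<exists>h\<in>fun_alg ?B. \<forall>u\<in>\<Omega>. ((\<lambda>t. b (u(i := t))) has_real_derivative h u) (at (u i))"
  proof cases
    case 1
    then show ?thesis
      by (intro bexI[of _ "pderiv_at i b"])
         (auto intro!: fun_alg_base smooth_fun_on_pderiv_at smooth_fun_on_has_partial)
  next
    case 2
    have "(\<lambda>u. (- 1) * (inverse (f u) * (pderiv_at i f u * inverse (f u)))) \<in> fun_alg ?B"
      by (intro fun_alg_mult fun_alg_const fun_alg_base) (use assms in \<open>auto intro: smooth_fun_on_pderiv_at\<close>)
    moreover have "((\<lambda>t. b (u(i := t))) has_real_derivative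
        (- 1) * (inverse (f u) * (pderiv_at i f u * inverse (f u)))) (at (u i))" if "u \<in> \<Omega>" for u
      unfolding 2
      using DERIV_inverse'[OF smooth_fun_on_has_partial[OF assms(2) that, of i]] assms(3)[OF that] by (simp add: mult.assoc)
    ultimately show ?thesis
      by (intro bexI[of _ "\<lambda>u. (- 1) * (inverse (f u) * (pderiv_at i f u * inverse (f u)))"] ballI)
  qed
qed (auto intro: fun_alg.intros)

section \<open>The chain rule and the symmetry of second derivatives\<close>

lemma mvt_segment:
  fixes f f' :: "real \<Rightarrow> real"
  assumes "\<And>x. min a b \<le> x \<Longrightarrow> x \<le> max a b \<Longrightarrow> (f has_real_derivative f' x) (at x)"
  shows "\<exists>z. min a b \<le> z \<and> z \<le> max a b \<and> f b - f a = (b - a) * f' z"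
proof -
  consider "a = b" | "a < b" | "b < a" by linarith
  then show ?thesis
  proof cases
    case 2
    then obtain z where "a < z" "z < b" "f b - f a = (b - a) * f' z"
      using MVT2[of a b f f'] assms by auto
    then show ?thesis using 2 by (intro exI[of _ z]) auto
  next
    case 3
    then obtain z where "b < z" "z < a" "f a - f b = (a - b) * f' z"
      using MVT2[of b a f f'] assms by auto
    then show ?thesis using 3 by (intro exI[of _ z]) (auto simp: algebra_simps)
  qed auto
qed

text \<open>Continuous partial derivatives give the chain rule by induction on the set of moving
  coordinates: after freezing the coordinate \<open>a\<close>, the remaining difference moves along
  \<open>a\<close> only and is controlled by the mean value theorem.\<close>

lemma has_derivative_along_curve:
  fixes H :: "('i \<Rightarrow> real) \<Rightarrow> real" and c :: "real \<Rightarrow> 'i \<Rightarrow> real"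
  assumes "open \<Omega>" "finite K"
    and "\<And>u k. u \<in> \<Omega> \<Longrightarrow> k \<in> K \<Longrightarrow> ((\<lambda>x. H (u(k := x))) has_real_derivative P k u) (at (u k))"
    and "\<And>k. k \<in> K \<Longrightarrow> continuous_on \<Omega> (P k)"
    and "c t0 \<in> \<Omega>"
    and "\<And>k. k \<in> K \<Longrightarrow> ((\<lambda>t. c t k) has_real_derivative c' k) (at t0)"
    and "\<And>t k. k \<notin> K \<Longrightarrow> c t k = c t0 k"
  shows "((\<lambda>t. H (c t)) has_real_derivative (\<Sum>k\<in>K. P k (c t0) * c' k)) (at t0)"
  using assms(2-)
proof (induction K arbitrary: c rule: finite_induct)
  case empty
  have "(\<lambda>t. H (c t)) = (\<lambda>t. H (c t0))"
    by (intro ext arg_cong[of _ _ H]) (rule empty, simp)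
  then show ?case by simp
next
  case (insert a K)
  define b where "b t = (c t)(a := c t0 a)" for t
  have b0: "b t0 = c t0" by (simp add: b_def)
  have 1: "((\<lambda>t. H (b t)) has_real_derivative (\<Sum>k\<in>K. P k (b t0) * c' k)) (at t0)"
  proof (rule insert.IH)
    show "((\<lambda>t. b t k) has_real_derivative c' k) (at t0)" if "k \<in> K" for k
      using insert.prems(4)[of k] that insert.hyps by (cases "k = a") (auto simp: b_def)
    show "b t k = b t0 k" if "k \<notin> K" for t k
      using insert.prems(5)[of k t] that by (cases "k = a") (simp_all add: b_def)
  qed (use insert.prems(1-3) b0 in auto)
  define g where "g t = H (c t) - H (b t)" for t
  define D where "D = P a (c t0)"
  \<comment> \<open>The difference quotient in the coordinate \<open>a\<close>. Setting it to
    \<open>D\<close> where the increment vanishes makes the factorization \<open>gR\<close> hold for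
    every \<open>t\<close>, so limits of products apply without cases.\<close>
  define R where "R t = (if c t a = c t0 a then D else g t / (c t a - c t0 a))" for t
  have gR: "g t = R t * (c t a - c t0 a)" for t
    by (cases "c t a = c t0 a") (auto simp: R_def g_def b_def fun_upd_idem)
  have "(R \<longlongrightarrow> D) (at t0)"
    unfolding tendsto_iff
  proof safe
    fix e :: real assume e: "e > 0"
    let ?\<Omega> = "{w\<in>\<Omega>. \<bar>P a w - D\<bar> < e}"
    have "open ?\<Omega>" "c t0 \<in> ?\<Omega>"
      using open_near_value[OF assms(1), of "P a"] insert.prems(2,3) e by (auto simp: D_def)
    from open_fun_box[OF this] obtain I \<delta> where I: "finite I" "\<delta> > 0"
      "\<And>w. (\<And>i. i \<in> I \<Longrightarrow> \<bar>w i - c t0 i\<bar> < \<delta>) \<Longrightarrow> w \<in> ?\<Omega>" by blast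
    have "eventually (\<lambda>t. \<bar>c t i - c t0 i\<bar> < \<delta>) (at t0)" for i
    proof (cases "i \<in> insert a K")
      case True
      then have "isCont (\<lambda>t. c t i) t0" using insert.prems(4) DERIV_isCont by blast
      then show ?thesis using I(2) by (simp add: isCont_def tendsto_iff dist_real_def)
    next
      case False
      have "\<bar>c t i - c t0 i\<bar> < \<delta>" for t using insert.prems(5)[OF False, of t] I(2) by simp
      then show ?thesis by simp
    qed
    then have "eventually (\<lambda>t. \<forall>i\<in>I. \<bar>c t i - c t0 i\<bar> < \<delta>) (at t0)"
      using I(1) by (simp add: eventually_ball_finite)
    then show "eventually (\<lambda>t. dist (R t) D < e) (at t0)"
    proof eventually_elim
      case (elim t)
      \<comment> \<open>The whole segment in direction \<open>a\<close> stays in the box around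
        \<open>c t0\<close>, so the mean value point does too, and \<open>P a\<close> is within
        \<open>e\<close> of \<open>D\<close> there.\<close>
      have inW: "(c t)(a := x) \<in> ?\<Omega>" if "min (c t0 a) (c t a) \<le> x" "x \<le> max (c t0 a) (c t a)" for x
      proof (rule I(3))
        fix i assume "i \<in> I"
        then show "\<bar>((c t)(a := x)) i - c t0 i\<bar> < \<delta>" using that elim by (auto split: if_splits)
      qed
      have "\<exists>z. min (c t0 a) (c t a) \<le> z \<and> z \<le> max (c t0 a) (c t a) \<and>
          H ((c t)(a := c t a)) - H ((c t)(a := c t0 a)) = (c t a - c t0 a) * P a ((c t)(a := z))"
      proof (rule mvt_segment)
        fix x assume "min (c t0 a) (c t a) \<le> x" "x \<le> max (c t0 a) (c t a)"
        then have "(c t)(a := x) \<in> \<Omega>" using inW by blast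
        from insert.prems(1)[OF this, of a]
        show "((\<lambda>x. H ((c t)(a := x))) has_real_derivative P a ((c t)(a := x))) (at x)"
          by (simp only: fun_upd_same fun_upd_upd insertI1)
      qed
      then obtain z where "min (c t0 a) (c t a) \<le> z" "z \<le> max (c t0 a) (c t a)"
        "g t = (c t a - c t0 a) * P a ((c t)(a := z))" by (auto simp: g_def b_def)
      then show ?case using inW[of z] e by (auto simp: R_def dist_real_def)
    qed
  qed
  moreover have "((\<lambda>t. (c t a - c t0 a) / (t - t0)) \<longlongrightarrow> c' a) (at t0)"
    using insert.prems(4)[of a] by (simp add: has_field_derivative_iff)
  ultimately have "((\<lambda>t. R t * ((c t a - c t0 a) / (t - t0))) \<longlongrightarrow> D * c' a) (at t0)"
    by (rule tendsto_mult)
  moreover have "g t0 = 0" by (simp add: gR)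
  ultimately have "(g has_real_derivative D * c' a) (at t0)"
    unfolding has_field_derivative_iff by (simp add: gR)
  from DERIV_add[OF 1 this] show ?case
    using insert.hyps by (simp add: g_def D_def b0 algebra_simps)
qed

text \<open>Records that only the coordinates in \<open>K\<close> matter. With finite
  \<open>K\<close> this replaces finite dimension of the coordinate space, and equality on
  \<open>K\<close> is all that is ever known about coordinates of jets.\<close>

definition depends_on :: "'i set \<Rightarrow> (('i \<Rightarrow> real) \<Rightarrow> 'b) \<Rightarrow> bool" where
  "depends_on K H \<longleftrightarrow> (\<forall>u u'. (\<forall>k\<in>K. u k = u' k) \<longrightarrow> H u = H u')"

lemma depends_onD: "depends_on K H \<Longrightarrow> (\<And>k. k \<in> K \<Longrightarrow> u k = u' k) \<Longrightarrow> H u = H u'"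
  unfolding depends_on_def by blast

lemma depends_on_mono: "depends_on K H \<Longrightarrow> K \<subseteq> K' \<Longrightarrow> depends_on K' H"
  unfolding depends_on_def by blast

lemma depends_on_UNIV: "depends_on UNIV H"
  unfolding depends_on_def by (metis UNIV_I ext)

lemma pderiv_at_eq_0:
  assumes "depends_on K H" "k \<notin> K"
  shows "pderiv_at k H u = 0"
proof -
  have "H (u(k := t)) = H u" for t
    by (rule depends_onD[OF assms(1)]) (use assms(2) in auto)
  then show ?thesis by (simp add: pderiv_at_def)
qed

lemma depends_on_pderiv_at:
  assumes "depends_on K H"
  shows "depends_on K (pderiv_at k H)"
  unfolding depends_on_def
proof safe
  fix u u' :: "'a \<Rightarrow> real" assume eq: "\<forall>k\<in>K. u k = u' k"
  show "pderiv_at k H u = pderiv_at k H u'"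
  proof (cases "k \<in> K")
    case True
    have "H (u(k := t)) = H (u'(k := t))" for t
      by (rule depends_onD[OF assms]) (use eq in auto)
    then show ?thesis using True eq by (simp add: pderiv_at_def)
  next
    case False
    then show ?thesis using assms by (simp add: pderiv_at_eq_0)
  qed
qed

lemma smooth_fun_on_chain:
  fixes H :: "('i \<Rightarrow> real) \<Rightarrow> real" and c :: "real \<Rightarrow> 'i \<Rightarrow> real"
  assumes "open \<Omega>" "smooth_fun_on \<Omega> H" "finite K" "depends_on K H" "c t0 \<in> \<Omega>"
    and "\<And>k. k \<in> K \<Longrightarrow> ((\<lambda>t. c t k) has_real_derivative c' k) (at t0)"
  shows "((\<lambda>t. H (c t)) has_real_derivative (\<Sum>k\<in>K. pderiv_at k H (c t0) * c' k)) (at t0)"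
proof -
  \<comment> \<open>The coordinates outside \<open>K\<close> are frozen at \<open>t0\<close>:
    nothing is known about their differentiability, and \<open>H\<close> does not see them.\<close>
  define b where "b t k = (if k \<in> K then c t k else c t0 k)" for t k
  have b0: "b t0 = c t0" by (auto simp: b_def)
  have Hb: "H (b t) = H (c t)" for t
    by (rule depends_onD[OF assms(4)]) (simp add: b_def)
  have "((\<lambda>t. H (b t)) has_real_derivative (\<Sum>k\<in>K. pderiv_at k H (b t0) * c' k)) (at t0)"
  proof (rule has_derivative_along_curve[OF assms(1,3)])
    show "((\<lambda>t. b t k) has_real_derivative c' k) (at t0)" if "k \<in> K" for k
      using assms(6)[OF that] that by (simp add: b_def)
    show "b t k = b t0 k" if "k \<notin> K" for t k
      using that by (simp add: b_def)
    show "((\<lambda>x. H (u(k := x))) has_real_derivative pderiv_at k H u) (at (u k))"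
      if "u \<in> \<Omega>" for u k
      by (rule smooth_fun_on_has_partial[OF assms(2) that])
  qed (use assms b0 in \<open>simp_all add: smooth_fun_on_continuous smooth_fun_on_pderiv_at\<close>)
  then show ?thesis by (simp add: Hb b0)
qed

lemma pderiv_at_compose:
  fixes q :: "('j \<Rightarrow> real) \<Rightarrow> 'i \<Rightarrow> real"
  assumes "open \<Omega>" "smooth_fun_on \<Omega> H" "finite K" "depends_on K H"
    and "\<And>k. k \<in> K \<Longrightarrow> smooth_fun_on U (\<lambda>u. q u k)" "u \<in> U" "q u \<in> \<Omega>"
  shows "((\<lambda>t. H (q (u(j := t)))) has_real_derivative
      (\<Sum>k\<in>K. pderiv_at k H (q u) * pderiv_at j (\<lambda>u. q u k) u)) (at (u j))"
  using smooth_fun_on_chain[OF assms(1-4), where c = "\<lambda>t. q (u(j := t))" and ?t0.0 = "u j"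
      and c' = "\<lambda>k. pderiv_at j (\<lambda>u. q u k) u"] assms(5-) smooth_fun_on_has_partial[OF assms(5,6)]
  by simp

lemma smooth_fun_on_compose:
  fixes q :: "('j \<Rightarrow> real) \<Rightarrow> 'i \<Rightarrow> real"
  assumes "open \<Omega>" "smooth_fun_on \<Omega> H" "finite K" "depends_on K H"
    and "open U" "\<And>k. smooth_fun_on U (\<lambda>u. q u k)" "\<And>u. u \<in> U \<Longrightarrow> q u \<in> \<Omega>"
  shows "smooth_fun_on U (\<lambda>u. H (q u))"
proof -
  \<comment> \<open>By the chain rule, the derivatives of a composite \<open>G (q u)\<close> are
    sums of products of such composites with derivatives of the components of \<open>q\<close>, so
    these generators span an algebra closed under differentiation.\<close>
  define B where "B = {g. smooth_fun_on U g} \<union> {\<lambda>u. G (q u) | G. smooth_fun_on \<Omega> G \<and> depends_on K G}"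
  have qcont: "continuous_on U q"
    by (intro continuous_on_coordinatewise_then_product smooth_fun_on_continuous assms)
  show ?thesis
  proof (rule smooth_fun_on_alg[OF assms(5), where B = B])
    show "(\<lambda>u. H (q u)) \<in> fun_alg B" using assms by (auto simp: B_def intro!: fun_alg_base)
    fix b j assume "b \<in> B"
    then consider "smooth_fun_on U b" | G where "b = (\<lambda>u. G (q u))" "smooth_fun_on \<Omega> G" "depends_on K G"
      unfolding B_def by blast
    note b = this
    from b show "continuous_on U b"
    proof cases
      case 2
      then show ?thesis
        using continuous_on_compose2[OF smooth_fun_on_continuous qcont] assms(7) by blast
    qed (rule smooth_fun_on_continuous)
    from b show "\<exists>h\<in>fun_alg B. \<forall>u\<in>U. ((\<lambda>t. b (u(j := t))) has_real_derivative h u) (at (u j))"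
    proof cases
      case 1
      then show ?thesis
        by (intro bexI[of _ "pderiv_at j b"])
           (auto simp: B_def intro!: fun_alg_base smooth_fun_on_pderiv_at smooth_fun_on_has_partial)
    next
      case 2
      have "(\<lambda>u. \<Sum>k\<in>K. pderiv_at k G (q u) * pderiv_at j (\<lambda>u. q u k) u) \<in> fun_alg B"
        by (intro fun_alg_sum fun_alg_mult fun_alg_base)
           (use assms 2 in \<open>auto simp: B_def intro: smooth_fun_on_pderiv_at depends_on_pderiv_at\<close>)
      moreover have "((\<lambda>t. b (u(j := t))) has_real_derivative
          (\<Sum>k\<in>K. pderiv_at k G (q u) * pderiv_at j (\<lambda>u. q u k) u)) (at (u j))" if "u \<in> U" for u
        unfolding 2(1)
        by (rule pderiv_at_compose[OF assms(1) 2(2) assms(3) 2(3)]) (use assms that in auto)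
      ultimately show ?thesis
        by (intro bexI[of _ "\<lambda>u. \<Sum>k\<in>K. pderiv_at k G (q u) * pderiv_at j (\<lambda>u. q u k) u"] ballI)
    qed
  qed
qed

text \<open>The second difference over a small square is symmetric in the two directions, while two
  applications of the mean value theorem express it by either mixed derivative at a nearby point;
  continuity then identifies the two.\<close>

lemma pderiv_at_commute:
  fixes f :: "('i \<Rightarrow> real) \<Rightarrow> real"
  assumes "open \<Omega>" "smooth_fun_on \<Omega> f" "u \<in> \<Omega>"
  shows "pderiv_at i (pderiv_at j f) u = pderiv_at j (pderiv_at i f) u"
proof (cases "i = j")
  case False
  \<comment> \<open>The mean value theorem is applied first in direction \<open>i\<close> to the
    difference in direction \<open>j\<close>, then in direction \<open>j\<close>. The set
    \<open>V\<close> is where the mixed derivatives are close to their values at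
    \<open>u\<close>.\<close>
  have *: "\<exists>w\<in>V. pderiv_at j (pderiv_at i f) w * h^2 =
      f (u(i := u i + h, j := u j + h)) - f (u(i := u i + h)) - f (u(j := u j + h)) + f u"
    if ij: "i \<noteq> j" and h: "h > 0" and V: "V \<subseteq> \<Omega>"
      and inV: "\<And>x y. \<bar>x - u i\<bar> \<le> h \<Longrightarrow> \<bar>y - u j\<bar> \<le> h \<Longrightarrow> u(i := x, j := y) \<in> V" for i j h V
  proof -
    let ?b = "u j + h"
    have "\<exists>z. u i < z \<and> z < u i + h \<and> (f (u(i := u i + h, j := ?b)) - f (u(i := u i + h, j := u j)))
        - (f (u(i := u i, j := ?b)) - f (u(i := u i, j := u j))) =
        (u i + h - u i) * (pderiv_at i f (u(i := z, j := ?b)) - pderiv_at i f (u(i := z, j := u j)))"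
    proof (rule MVT2)
      show "u i < u i + h" using h by simp
      fix x assume x: "u i \<le> x" "x \<le> u i + h"
      have \<Omega>: "u(i := x, j := y) \<in> \<Omega>" if "y = ?b \<or> y = u j" for y
        using inV[of x y] x that h V by auto
      have d: "((\<lambda>x. f (u(i := x, j := y))) has_real_derivative pderiv_at i f (u(i := x, j := y))) (at x)"
        if "y = ?b \<or> y = u j" for y
        using smooth_fun_on_has_partial[OF assms(2) \<Omega>[OF that], of i] ij by (simp add: fun_upd_twist)
      show "((\<lambda>x. f (u(i := x, j := ?b)) - f (u(i := x, j := u j))) has_real_derivative
          pderiv_at i f (u(i := x, j := ?b)) - pderiv_at i f (u(i := x, j := u j))) (at x)"
        by (intro DERIV_diff d) auto
    qed
    then obtain x where x: "u i < x" "x < u i + h"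
      "f (u(i := u i + h, j := ?b)) - f (u(i := u i + h, j := u j))
        - (f (u(i := u i, j := ?b)) - f (u(i := u i, j := u j))) =
        h * (pderiv_at i f (u(i := x, j := ?b)) - pderiv_at i f (u(i := x, j := u j)))" by auto
    have "\<exists>y. u j < y \<and> y < ?b \<and> pderiv_at i f (u(i := x, j := ?b)) - pderiv_at i f (u(i := x, j := u j)) =
        (?b - u j) * pderiv_at j (pderiv_at i f) (u(i := x, j := y))"
    proof (rule MVT2)
      show "u j < ?b" using h by simp
      fix y assume y: "u j \<le> y" "y \<le> ?b"
      have "u(i := x, j := y) \<in> \<Omega>" using inV[of x y] x y V by auto
      from smooth_fun_on_has_partial[OF smooth_fun_on_pderiv_at[OF assms(2)] this, of i j]
      show "((\<lambda>y. pderiv_at i f (u(i := x, j := y))) has_real_derivative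
          pderiv_at j (pderiv_at i f) (u(i := x, j := y))) (at y)" by simp
    qed
    then obtain y where y: "u j < y" "y < ?b"
      "pderiv_at i f (u(i := x, j := ?b)) - pderiv_at i f (u(i := x, j := u j)) =
        h * pderiv_at j (pderiv_at i f) (u(i := x, j := y))" by auto
    show ?thesis
      by (rule bexI[of _ "u(i := x, j := y)"])
         (use x y inV[of x y] ij in \<open>auto simp: power2_eq_square algebra_simps fun_upd_idem\<close>)
  qed
  have "\<bar>pderiv_at i (pderiv_at j f) u - pderiv_at j (pderiv_at i f) u\<bar> < e" if e: "e > 0" for e
  proof -
    define V where "V = {w\<in>\<Omega>. \<bar>pderiv_at i (pderiv_at j f) w - pderiv_at i (pderiv_at j f) u\<bar> < e / 2} \<inter>
      {w\<in>\<Omega>. \<bar>pderiv_at j (pderiv_at i f) w - pderiv_at j (pderiv_at i f) u\<bar> < e / 2}"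
    have "open V"
      unfolding V_def
      by (intro open_Int open_near_value smooth_fun_on_continuous smooth_fun_on_pderiv_at assms)
    moreover have "u \<in> V" using assms e by (simp add: V_def)
    ultimately obtain I \<delta> where I: "finite I" "\<delta> > 0"
      "\<And>w. (\<And>i. i \<in> I \<Longrightarrow> \<bar>w i - u i\<bar> < \<delta>) \<Longrightarrow> w \<in> V" by (rule open_fun_box) blast
    define h where "h = \<delta> / 2"
    have inV: "u(i := x, j := y) \<in> V" if "\<bar>x - u i\<bar> \<le> h" "\<bar>y - u j\<bar> \<le> h" for x y i j
      by (rule I(3)) (use that I(2) in \<open>auto simp: h_def\<close>)
    have h: "h > 0" using I(2) by (simp add: h_def)
    have VW: "V \<subseteq> \<Omega>" by (auto simp: V_def)
    obtain w where w: "w \<in> V" "pderiv_at j (pderiv_at i f) w * h^2 =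
      f (u(i := u i + h, j := u j + h)) - f (u(i := u i + h)) - f (u(j := u j + h)) + f u"
      using *[OF False h VW] inV by blast
    obtain w' where w': "w' \<in> V" "pderiv_at i (pderiv_at j f) w' * h^2 =
      f (u(j := u j + h, i := u i + h)) - f (u(j := u j + h)) - f (u(i := u i + h)) + f u"
      using *[OF False[symmetric] h VW] inV by blast
    have "pderiv_at j (pderiv_at i f) w * h^2 = pderiv_at i (pderiv_at j f) w' * h^2"
      using w(2) w'(2) False by (simp add: fun_upd_twist)
    then have "pderiv_at j (pderiv_at i f) w = pderiv_at i (pderiv_at j f) w'" using h by simp
    moreover have "\<bar>pderiv_at j (pderiv_at i f) w - pderiv_at j (pderiv_at i f) u\<bar> < e / 2"
      "\<bar>pderiv_at i (pderiv_at j f) w' - pderiv_at i (pderiv_at j f) u\<bar> < e / 2"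
      using w(1) w'(1) by (auto simp: V_def)
    ultimately show ?thesis by linarith
  qed
  then show ?thesis by (metis abs_le_zero_iff less_irrefl not_less right_minus_eq)
qed simp

section \<open>Germs of smooth functions\<close>

text \<open>Deliberately a partial equivalence: being related to itself means being smooth near the
  origin, so the quotient consists exactly of germs of smooth functions.\<close>

definition germ_rel :: "(('k \<Rightarrow> real) \<Rightarrow> real) \<Rightarrow> (('k \<Rightarrow> real) \<Rightarrow> real) \<Rightarrow> bool" where
  "germ_rel f g \<longleftrightarrow> (\<exists>U. open U \<and> origin \<in> U \<and> smooth_fun_on U f \<and> (\<forall>u\<in>U. f u = g u))"

abbreviation near_smooth :: "(('k \<Rightarrow> real) \<Rightarrow> real) \<Rightarrow> bool" where
  "near_smooth f \<equiv> germ_rel f f"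

lemma germ_relI: "open U \<Longrightarrow> origin \<in> U \<Longrightarrow> smooth_fun_on U f \<Longrightarrow> (\<And>u. u \<in> U \<Longrightarrow> f u = g u) \<Longrightarrow> germ_rel f g"
  unfolding germ_rel_def by blast

lemma near_smoothI: "open U \<Longrightarrow> origin \<in> U \<Longrightarrow> smooth_fun_on U f \<Longrightarrow> near_smooth f"
  unfolding germ_rel_def by blast

lemma near_smooth_ext: "near_smooth f \<Longrightarrow> (\<And>u. f u = g u) \<Longrightarrow> germ_rel f g"
  unfolding germ_rel_def by blast

lemma germ_rel_sym: "germ_rel f g \<Longrightarrow> germ_rel g f"
  unfolding germ_rel_def by (metis smooth_fun_on_cong)

lemma germ_rel_trans: "germ_rel f g \<Longrightarrow> germ_rel g h \<Longrightarrow> germ_rel f h"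
  unfolding germ_rel_def
proof safe
  fix U V assume UV: "open U" "origin \<in> U" "smooth_fun_on U f" "\<forall>u\<in>U. f u = g u" "open V" "origin \<in> V" "\<forall>u\<in>V. g u = h u"
  show "\<exists>U. open U \<and> origin \<in> U \<and> smooth_fun_on U f \<and> (\<forall>u\<in>U. f u = h u)"
    by (rule exI[of _ "U \<inter> V"]) (use UV in \<open>auto intro: smooth_fun_on_subset\<close>)
qed

quotient_type 'k germ = "('k \<Rightarrow> real) \<Rightarrow> real" / partial: germ_rel
proof (rule part_equivpI)
  have "near_smooth (\<lambda>_::'k \<Rightarrow> real. 0)"
    by (rule near_smoothI[of UNIV]) (auto intro: smooth_fun_on_const)
  then show "\<exists>f :: ('k \<Rightarrow> real) \<Rightarrow> real. near_smooth f" by blast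
  show "symp (germ_rel :: (('k \<Rightarrow> real) \<Rightarrow> real) \<Rightarrow> _)" by (rule sympI) (rule germ_rel_sym)
  show "transp (germ_rel :: (('k \<Rightarrow> real) \<Rightarrow> real) \<Rightarrow> _)" by (rule transpI) (rule germ_rel_trans)
qed

lemma germ_rel_map2:
  assumes "germ_rel f f'" "germ_rel g g'"
    and "\<And>U. open U \<Longrightarrow> smooth_fun_on U f \<Longrightarrow> smooth_fun_on U g \<Longrightarrow> smooth_fun_on U (\<lambda>u. F (f u) (g u))"
  shows "germ_rel (\<lambda>u. F (f u) (g u)) (\<lambda>u. F (f' u) (g' u))"
proof -
  obtain U V where UV: "open U" "origin \<in> U" "smooth_fun_on U f" "\<forall>u\<in>U. f u = f' u"
     "open V" "origin \<in> V" "smooth_fun_on V g" "\<forall>u\<in>V. g u = g' u"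
    using assms(1,2) unfolding germ_rel_def by blast
  show ?thesis
    by (rule germ_relI[of "U \<inter> V"]) (use UV in \<open>auto intro!: assms(3) intro: smooth_fun_on_subset\<close>)
qed

lemma germ_rel_add: "germ_rel f f' \<Longrightarrow> germ_rel g g' \<Longrightarrow> germ_rel (\<lambda>u. f u + g u) (\<lambda>u. f' u + g' u)"
  by (erule germ_rel_map2[where F = "(+)"], assumption, rule smooth_fun_on_add)

lemma germ_rel_diff: "germ_rel f f' \<Longrightarrow> germ_rel g g' \<Longrightarrow> germ_rel (\<lambda>u. f u - g u) (\<lambda>u. f' u - g' u)"
  by (erule germ_rel_map2[where F = "(-)"], assumption, rule smooth_fun_on_diff)

lemma germ_rel_mult: "germ_rel f f' \<Longrightarrow> germ_rel g g' \<Longrightarrow> germ_rel (\<lambda>u. f u * g u) (\<lambda>u. f' u * g' u)"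
  by (erule germ_rel_map2[where F = "\<lambda>x y. x * y"], assumption, rule smooth_fun_on_mult)

lemma germ_rel_const: "germ_rel (\<lambda>_. c) (\<lambda>_. c)"
  by (rule near_smoothI[of UNIV]) (auto intro: smooth_fun_on_const)

lemma germ_rel_uminus: "germ_rel f f' \<Longrightarrow> germ_rel (\<lambda>u. - f u) (\<lambda>u. - f' u)"
  using germ_rel_diff[OF germ_rel_const[of 0]] by simp

lemma germ_rel_pderiv_at: "germ_rel f f' \<Longrightarrow> germ_rel (pderiv_at k f) (pderiv_at k f')"
  unfolding germ_rel_def by (metis smooth_fun_on_pderiv_at pderiv_at_cong)

lemma near_smooth_coord: "near_smooth (\<lambda>u. u k)"
  by (rule near_smoothI[of UNIV]) (auto intro: smooth_fun_on_coord)

text \<open>Equations between germs hold without mentioning a domain, so everything about total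
  derivatives can be proved for derivations of an abstract commutative real algebra and then
  specialised.\<close>

instantiation germ :: (type) "{comm_ring_1, real_algebra_1}"
begin

lift_definition zero_germ :: "'a germ" is "\<lambda>_. 0" by (rule germ_rel_const)
lift_definition one_germ :: "'a germ" is "\<lambda>_. 1" by (rule germ_rel_const)
lift_definition plus_germ :: "'a germ \<Rightarrow> 'a germ \<Rightarrow> 'a germ" is "\<lambda>f g u. f u + g u" by (rule germ_rel_add)
lift_definition minus_germ :: "'a germ \<Rightarrow> 'a germ \<Rightarrow> 'a germ" is "\<lambda>f g u. f u - g u" by (rule germ_rel_diff)
lift_definition uminus_germ :: "'a germ \<Rightarrow> 'a germ" is "\<lambda>f u. - f u" by (rule germ_rel_uminus)
lift_definition times_germ :: "'a germ \<Rightarrow> 'a germ \<Rightarrow> 'a germ" is "\<lambda>f g u. f u * g u" by (rule germ_rel_mult)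
lift_definition scaleR_germ :: "real \<Rightarrow> 'a germ \<Rightarrow> 'a germ" is "\<lambda>c f u. c * f u"
  by (rule germ_rel_mult[OF germ_rel_const])

instance
proof
  fix a b c :: "'a germ" and x y :: real
  show "a + b + c = a + (b + c)" "a * b * c = a * (b * c)" "(a + b) * c = a * c + b * c" "a * (b + c) = a * b + a * c"
    "x *\<^sub>R (a + b) = x *\<^sub>R a + x *\<^sub>R b" "(x + y) *\<^sub>R a = x *\<^sub>R a + y *\<^sub>R a"
    "x *\<^sub>R y *\<^sub>R a = (x * y) *\<^sub>R a" "x *\<^sub>R a * b = x *\<^sub>R (a * b)" "a * x *\<^sub>R b = x *\<^sub>R (a * b)"
    by (transfer, rule near_smooth_ext, (intro germ_rel_add germ_rel_mult germ_rel_const; assumption), simp add: algebra_simps)+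
  show "a + b = b + a" "a * b = b * a" "a - b = a + - b"
    by (transfer, rule near_smooth_ext, (intro germ_rel_add germ_rel_diff germ_rel_mult; assumption), simp)+
  show "0 + a = a" "1 * a = a" "a * 1 = a" "1 *\<^sub>R a = a" "- a + a = 0"
    by (transfer, rule near_smooth_ext, (intro germ_rel_add germ_rel_mult germ_rel_const germ_rel_uminus; assumption), simp)+
  show "(0 :: 'a germ) \<noteq> 1"
    by transfer (auto simp: germ_rel_def)
qed

end

lift_definition germ_deriv :: "'k \<Rightarrow> 'k germ \<Rightarrow> 'k germ" is pderiv_at by (rule germ_rel_pderiv_at)

lift_definition germ_value :: "'k germ \<Rightarrow> real" is "\<lambda>f. f origin"
  by (auto simp: germ_rel_def)

lemma abs_germ_eqI: "germ_rel f g \<Longrightarrow> abs_germ f = abs_germ g"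
  by (rule Quotient_rel_abs[OF Quotient_germ])

lemma germ_cases: obtains f where "near_smooth f" "a = abs_germ f"
  by (metis Quotient_rep_reflp[OF Quotient_germ] Quotient_abs_rep[OF Quotient_germ])

lemma abs_germ_add: "near_smooth f \<Longrightarrow> near_smooth g \<Longrightarrow> abs_germ (\<lambda>u. f u + g u) = abs_germ f + abs_germ g"
  by (simp add: plus_germ.abs_eq)

lemma abs_germ_diff: "near_smooth f \<Longrightarrow> near_smooth g \<Longrightarrow> abs_germ (\<lambda>u. f u - g u) = abs_germ f - abs_germ g"
  by (simp add: minus_germ.abs_eq)

lemma abs_germ_mult: "near_smooth f \<Longrightarrow> near_smooth g \<Longrightarrow> abs_germ (\<lambda>u. f u * g u) = abs_germ f * abs_germ g"
  by (simp add: times_germ.abs_eq)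

lemma abs_germ_const: "abs_germ (\<lambda>_. c) = of_real c"
proof -
  have "abs_germ (\<lambda>_. c) = c *\<^sub>R abs_germ (\<lambda>_. 1 :: real)"
    by (simp add: scaleR_germ.abs_eq germ_rel_const)
  also have "abs_germ (\<lambda>_. 1 :: real) = 1" by (simp add: one_germ.abs_eq)
  finally show ?thesis by (simp add: scaleR_conv_of_real)
qed

lemma near_smooth_sum: "(\<And>k. k \<in> K \<Longrightarrow> near_smooth (f k)) \<Longrightarrow> near_smooth (\<lambda>u. \<Sum>k\<in>K. f k u)"
  by (induction K rule: infinite_finite_induct) (auto intro: germ_rel_const germ_rel_add)

lemma abs_germ_sum: "(\<And>k. k \<in> K \<Longrightarrow> near_smooth (f k)) \<Longrightarrow> abs_germ (\<lambda>u. \<Sum>k\<in>K. f k u) = (\<Sum>k\<in>K. abs_germ (f k))"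
  by (induction K rule: infinite_finite_induct) (auto simp: abs_germ_const abs_germ_add near_smooth_sum)

lemma near_smooth_prod: "(\<And>k. k \<in> K \<Longrightarrow> near_smooth (f k)) \<Longrightarrow> near_smooth (\<lambda>u. \<Prod>k\<in>K. f k u)"
  by (induction K rule: infinite_finite_induct) (auto intro: germ_rel_const germ_rel_mult)

lemma abs_germ_prod: "(\<And>k. k \<in> K \<Longrightarrow> near_smooth (f k)) \<Longrightarrow> abs_germ (\<lambda>u. \<Prod>k\<in>K. f k u) = (\<Prod>k\<in>K. abs_germ (f k))"
  by (induction K rule: infinite_finite_induct) (auto simp: abs_germ_const abs_germ_mult near_smooth_prod)

lemma germ_deriv_abs: "near_smooth f \<Longrightarrow> germ_deriv k (abs_germ f) = abs_germ (pderiv_at k f)"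
  by (simp add: germ_deriv.abs_eq)

lemma germ_value_abs: "near_smooth f \<Longrightarrow> germ_value (abs_germ f) = f origin"
  by (simp add: germ_value.abs_eq)

lemma near_smooth_foldr: "near_smooth f \<Longrightarrow> near_smooth (foldr pderiv_at ks f)"
  by (induction ks) (auto intro: germ_rel_pderiv_at)

lemma foldr_germ_deriv_abs: "near_smooth f \<Longrightarrow> foldr germ_deriv ks (abs_germ f) = abs_germ (foldr pderiv_at ks f)"
  by (induction ks) (auto simp: germ_deriv_abs near_smooth_foldr)

lemma germ_value_foldr: "near_smooth f \<Longrightarrow> germ_value (foldr germ_deriv ks (abs_germ f)) = deriv0 ks f"
  by (simp add: foldr_germ_deriv_abs germ_value_abs near_smooth_foldr deriv0_def)

lemma germ_value_add [simp]: "germ_value (a + b) = germ_value a + germ_value b"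
  by transfer simp
lemma germ_value_diff [simp]: "germ_value (a - b) = germ_value a - germ_value b"
  by transfer simp
lemma germ_value_mult [simp]: "germ_value (a * b) = germ_value a * germ_value b"
  by transfer simp
lemma germ_value_scaleR [simp]: "germ_value (c *\<^sub>R b) = c * germ_value b"
  by transfer simp
lemma germ_value_0 [simp]: "germ_value 0 = 0"
  by transfer simp
lemma germ_value_1 [simp]: "germ_value 1 = 1"
  by transfer simp
lemma germ_value_sum [simp]: "germ_value (sum f S) = (\<Sum>x\<in>S. germ_value (f x))"
  by (induction S rule: infinite_finite_induct) auto
lemma germ_value_prod [simp]: "germ_value (prod f S) = (\<Prod>x\<in>S. germ_value (f x))"
  by (induction S rule: infinite_finite_induct) auto

lemma germ_deriv_add: "germ_deriv k (a + b) = germ_deriv k a + germ_deriv k b"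
proof transfer
  fix k :: 'a and f g :: "('a \<Rightarrow> real) \<Rightarrow> real" assume "near_smooth f" "near_smooth g"
  then obtain U V where UV: "open U" "origin \<in> U" "smooth_fun_on U f" "open V" "origin \<in> V" "smooth_fun_on V g"
    unfolding germ_rel_def by blast
  then have U: "open (U \<inter> V)" "origin \<in> U \<inter> V" "smooth_fun_on (U \<inter> V) f" "smooth_fun_on (U \<inter> V) g"
    by (auto intro: smooth_fun_on_subset)
  show "germ_rel (pderiv_at k (\<lambda>u. f u + g u)) (\<lambda>u. pderiv_at k f u + pderiv_at k g u)"
  proof (rule germ_relI[OF U(1,2)])
    show "smooth_fun_on (U \<inter> V) (pderiv_at k (\<lambda>u. f u + g u))"
      using U by (intro smooth_fun_on_pderiv_at smooth_fun_on_add)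
    fix u assume u: "u \<in> U \<inter> V"
    show "pderiv_at k (\<lambda>u. f u + g u) u = pderiv_at k f u + pderiv_at k g u"
      unfolding pderiv_at_def[of k "\<lambda>u. f u + g u"]
      by (rule DERIV_imp_deriv DERIV_add smooth_fun_on_has_partial U u)+
  qed
qed

lemma germ_deriv_mult: "germ_deriv k (a * b) = germ_deriv k a * b + a * germ_deriv k b"
proof transfer
  fix k :: 'a and f g :: "('a \<Rightarrow> real) \<Rightarrow> real" assume "near_smooth f" "near_smooth g"
  then obtain U V where UV: "open U" "origin \<in> U" "smooth_fun_on U f" "open V" "origin \<in> V" "smooth_fun_on V g"
    unfolding germ_rel_def by blast
  then have U: "open (U \<inter> V)" "origin \<in> U \<inter> V" "smooth_fun_on (U \<inter> V) f" "smooth_fun_on (U \<inter> V) g"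
    by (auto intro: smooth_fun_on_subset)
  show "germ_rel (pderiv_at k (\<lambda>u. f u * g u)) (\<lambda>u. pderiv_at k f u * g u + f u * pderiv_at k g u)"
  proof (rule germ_relI[OF U(1,2)])
    show "smooth_fun_on (U \<inter> V) (pderiv_at k (\<lambda>u. f u * g u))"
      using U by (intro smooth_fun_on_pderiv_at smooth_fun_on_mult)
    fix u assume u: "u \<in> U \<inter> V"
    from DERIV_mult[OF smooth_fun_on_has_partial[OF U(3) u] smooth_fun_on_has_partial[OF U(4) u], of k]
    show "pderiv_at k (\<lambda>u. f u * g u) u = pderiv_at k f u * g u + f u * pderiv_at k g u"
      unfolding pderiv_at_def[of k "\<lambda>u. f u * g u"]
      by (intro DERIV_imp_deriv) (simp add: mult.commute)
  qed
qed

lemma germ_deriv_const [simp]: "germ_deriv k (of_real c) = 0"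
proof -
  have "germ_deriv k (of_real c) = abs_germ (pderiv_at k (\<lambda>_. c))"
    by (simp add: germ_deriv_abs germ_rel_const flip: abs_germ_const)
  also have "pderiv_at k (\<lambda>_. c) = (\<lambda>_. 0)" by (simp add: pderiv_at_def fun_eq_iff)
  finally show ?thesis by (simp add: abs_germ_const)
qed

lemma germ_deriv_scaleR: "germ_deriv k (c *\<^sub>R a) = c *\<^sub>R germ_deriv k a"
  by (simp add: scaleR_conv_of_real germ_deriv_mult)

lemma germ_deriv_commute: "germ_deriv i (germ_deriv j a) = germ_deriv j (germ_deriv i a)"
proof transfer
  fix i j :: 'a and f :: "('a \<Rightarrow> real) \<Rightarrow> real" assume "near_smooth f"
  then obtain U where "open U" "origin \<in> U" "smooth_fun_on U f" unfolding germ_rel_def by blast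
  then show "germ_rel (pderiv_at i (pderiv_at j f)) (pderiv_at j (pderiv_at i f))"
    by (intro germ_relI[of U]) (auto intro: smooth_fun_on_pderiv_at pderiv_at_commute)
qed

definition germ_var :: "'k \<Rightarrow> 'k germ" where
  "germ_var k = abs_germ (\<lambda>u. u k)"

lemma germ_deriv_var: "germ_deriv i (germ_var j) = (if i = j then 1 else 0)"
proof -
  have "pderiv_at i (\<lambda>u. u j) = (\<lambda>_. if i = j then 1 else 0)"
    by (auto simp: pderiv_at_def fun_eq_iff)
  then show ?thesis unfolding germ_var_def
    by (simp add: germ_deriv_abs near_smooth_coord abs_germ_const)
qed

text \<open>The variable \<open>None\<close> is the parameter \<open>\<epsilon>\<close> of a variation, and \<open>germ_restrict\<close> below sets \<open>\<epsilon> = 0\<close>.\<close>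

definition ext0 :: "('n \<Rightarrow> real) \<Rightarrow> 'n option \<Rightarrow> real" where
  "ext0 t k = (case k of None \<Rightarrow> 0 | Some i \<Rightarrow> t i)"

lemma ext0_upd: "ext0 (t(i := x)) = (ext0 t)(Some i := x)"
  by (auto simp: ext0_def fun_eq_iff split: option.split)

lemma ext0_origin [simp]: "ext0 origin = origin"
  by (auto simp: ext0_def fun_eq_iff split: option.split)

lemma continuous_on_ext0: "continuous_on S ext0"
proof (rule continuous_on_coordinatewise_then_product)
  fix k show "continuous_on S (\<lambda>t. ext0 t k)"
    by (cases k) (auto simp: ext0_def intro: continuous_on_coord)
qed

lemma pderiv_at_ext0: "pderiv_at i (\<lambda>t. f (ext0 t)) = (\<lambda>t. pderiv_at (Some i) f (ext0 t))"
  by (simp add: pderiv_at_def ext0_upd fun_eq_iff) (simp add: ext0_def)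

lemma foldr_pderiv_at_ext0: "foldr pderiv_at ks (\<lambda>t. f (ext0 t)) = (\<lambda>t. foldr pderiv_at (map Some ks) f (ext0 t))"
  by (induction ks) (auto simp: pderiv_at_ext0)

lemma smooth_fun_on_ext0:
  assumes "smooth_fun_on U f"
  shows "smooth_fun_on (ext0 -` U) (\<lambda>t. f (ext0 t))"
  unfolding smooth_fun_on_def foldr_pderiv_at_ext0
proof safe
  fix ks
  show "continuous_on (ext0 -` U) (\<lambda>t. foldr pderiv_at (map Some ks) f (ext0 t))"
    by (rule continuous_on_compose2[OF smooth_fun_on_continuous[OF smooth_fun_on_foldr_pderiv_at[OF assms]] continuous_on_ext0]) auto
  fix t i assume "ext0 t \<in> U"
  from smooth_fun_on_has_partial[OF smooth_fun_on_foldr_pderiv_at[OF assms] this, of "map Some ks" "Some i"]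
  show "(\<lambda>x. foldr pderiv_at (map Some ks) f (ext0 (t(i := x)))) differentiable at (t i)"
    unfolding ext0_upd by (auto simp: real_differentiable_def ext0_def)
qed

lift_definition germ_restrict :: "'n option germ \<Rightarrow> 'n germ" is "\<lambda>f t. f (ext0 t)"
proof -
  fix f g :: "('n option \<Rightarrow> real) \<Rightarrow> real" assume "germ_rel f g"
  then obtain U where U: "open U" "origin \<in> U" "smooth_fun_on U f" "\<forall>u\<in>U. f u = g u"
    unfolding germ_rel_def by blast
  show "germ_rel (\<lambda>t. f (ext0 t)) (\<lambda>t. g (ext0 t))"
    by (rule germ_relI[of "ext0 -` U"])
       (use U in \<open>auto intro: smooth_fun_on_ext0 open_vimage continuous_on_ext0\<close>)
qed

lemma germ_restrict_abs: "near_smooth f \<Longrightarrow> germ_restrict (abs_germ f) = abs_germ (\<lambda>t. f (ext0 t))"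
  by (simp add: germ_restrict.abs_eq)

lemma near_smooth_ext0: "near_smooth f \<Longrightarrow> near_smooth (\<lambda>t. f (ext0 t))"
  using germ_restrict.rsp unfolding rel_fun_def by blast

lemma germ_restrict_add [simp]: "germ_restrict (a + b) = germ_restrict a + germ_restrict b"
proof -
  obtain f g where f: "near_smooth f" "a = abs_germ f" and g: "near_smooth g" "b = abs_germ g"
    by (meson germ_cases)
  have "germ_restrict (a + b) = abs_germ (\<lambda>t. f (ext0 t) + g (ext0 t))"
    using germ_restrict_abs[OF germ_rel_add[OF f(1) g(1)]] f g by (simp add: abs_germ_add)
  then show ?thesis
    using f g by (simp add: germ_restrict_abs abs_germ_add near_smooth_ext0[OF f(1)] near_smooth_ext0[OF g(1)])
qed

lemma germ_restrict_diff [simp]: "germ_restrict (a - b) = germ_restrict a - germ_restrict b"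
proof -
  obtain f g where f: "near_smooth f" "a = abs_germ f" and g: "near_smooth g" "b = abs_germ g"
    by (meson germ_cases)
  have "germ_restrict (a - b) = abs_germ (\<lambda>t. f (ext0 t) - g (ext0 t))"
    using germ_restrict_abs[OF germ_rel_diff[OF f(1) g(1)]] f g by (simp add: abs_germ_diff)
  then show ?thesis
    using f g by (simp add: germ_restrict_abs abs_germ_diff near_smooth_ext0[OF f(1)] near_smooth_ext0[OF g(1)])
qed

lemma germ_restrict_mult [simp]: "germ_restrict (a * b) = germ_restrict a * germ_restrict b"
proof -
  obtain f g where f: "near_smooth f" "a = abs_germ f" and g: "near_smooth g" "b = abs_germ g"
    by (meson germ_cases)
  have "germ_restrict (a * b) = abs_germ (\<lambda>t. f (ext0 t) * g (ext0 t))"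
    using germ_restrict_abs[OF germ_rel_mult[OF f(1) g(1)]] f g by (simp add: abs_germ_mult)
  then show ?thesis
    using f g by (simp add: germ_restrict_abs abs_germ_mult near_smooth_ext0[OF f(1)] near_smooth_ext0[OF g(1)])
qed

lemma germ_restrict_0 [simp]: "germ_restrict 0 = 0"
  by transfer (rule germ_rel_const)
lemma germ_restrict_sum [simp]: "germ_restrict (sum f S) = (\<Sum>x\<in>S. germ_restrict (f x))"
  by (induction S rule: infinite_finite_induct) auto
lemma germ_restrict_deriv [simp]: "germ_restrict (germ_deriv (Some i) a) = germ_deriv i (germ_restrict a)"
  by transfer (simp add: pderiv_at_ext0 near_smooth_ext0 germ_rel_pderiv_at)

section \<open>Commuting derivations and Lie--Euler operators\<close>

definition ins_at :: "nat \<Rightarrow> 'n \<Rightarrow> 'n list \<Rightarrow> 'n list" where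
  "ins_at a i M = take a M @ i # drop a M"

definition rem_at :: "nat \<Rightarrow> 'n list \<Rightarrow> 'n list" where
  "rem_at a M = take a M @ drop (Suc a) M"

lemma finite_lists_length: "finite {I :: 'n::finite list. length I = n}"
  using finite_lists_length_eq[of "UNIV :: 'n set" n] by simp

lemma finite_lists_length_bound: "finite {I :: 'n::finite list. k + length I \<le> n}"
  by (rule finite_subset[OF _ finite_lists_length_le[of "UNIV :: 'n set" n]]) auto

lemma finite_lists_length_atMost: "finite {I :: 'n::finite list. length I \<le> n}"
  using finite_lists_length_bound[of 0 n] by simp

lemma length_ins_at [simp]: "length (ins_at a i M) = Suc (length M)"
  by (simp add: ins_at_def)

lemma length_rem_at [simp]: "a < length M \<Longrightarrow> length (rem_at a M) = length M - 1"
  by (simp add: rem_at_def min_def)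

lemma mset_ins_at [simp]: "mset (ins_at a i M) = add_mset i (mset M)"
  unfolding ins_at_def by (metis append_take_drop_id mset.simps(2) mset_append union_mset_add_mset_right)

lemma rem_at_ins_at [simp]: "a \<le> length M \<Longrightarrow> rem_at a (ins_at a i M) = M"
  by (simp add: rem_at_def ins_at_def)

lemma nth_ins_at [simp]: "a \<le> length M \<Longrightarrow> ins_at a i M ! a = i"
  by (simp add: ins_at_def nth_append)

lemma ins_at_rem_at [simp]: "a < length M \<Longrightarrow> ins_at a (M ! a) (rem_at a M) = M"
  by (simp add: rem_at_def ins_at_def id_take_nth_drop[symmetric] min_def)

text \<open>The position \<open>a\<close> is free because a new derivative may be placed anywhere in
  a word: at the front, at the cut between the two factors of a Leibniz term, or at each position in
  turn when symmetrizing.\<close>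

lemma sum_lists_ins_at:
  assumes "a \<le> n"
  shows "(\<Sum>M | length M = Suc n. G M) = (\<Sum>i\<in>UNIV. \<Sum>M | length M = n. G (ins_at a i M :: 'n::finite list))"
proof -
  have "(\<Sum>i\<in>UNIV. \<Sum>M | length M = n. G (ins_at a i M)) =
      (\<Sum>(i, M)\<in>UNIV \<times> {M. length M = n}. G (ins_at a i M))"
    by (simp add: sum.cartesian_product)
  also have "\<dots> = (\<Sum>M | length M = Suc n. G M)"
    using assms
    by (intro sum.reindex_bij_witness[where i = "\<lambda>M. (M ! a, rem_at a M)" and j = "\<lambda>(i, M). ins_at a i M"]) auto
  finally show ?thesis ..
qed

lemma sum_lists_Suc:
  "(\<Sum>M | length M = Suc n. G M) = (\<Sum>i\<in>UNIV. \<Sum>M | length M = n. G (i # M :: 'n::finite list))"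
  using sum_lists_ins_at[of 0 n G] by (simp add: ins_at_def)

lemma sum_lists_atMost:
  "(\<Sum>I | length I \<le> r. G (I :: 'n::finite list)) = (\<Sum>n\<le>r. \<Sum>I | length I = n. G I)"
proof -
  have "{I :: 'n list. length I \<le> r} = (\<Union>n\<in>{..r}. {I. length I = n})" by auto
  then show ?thesis by (simp only:) (subst sum.UNION_disjoint, auto simp: finite_lists_length)
qed

text \<open>A pair of words is the same as their concatenation together with the place of the cut,
  which reorganises double sums by the total word.\<close>

lemma sum_lists_append:
  "(\<Sum>J | k + length J \<le> r. \<Sum>K | k + length J + length K \<le> r. G J K) =
   (\<Sum>M | k + length M \<le> r. \<Sum>a\<le>length M. G (take a M) (drop a M :: 'n::finite list))"
proof -
  have "(\<Sum>J | k + length J \<le> r. \<Sum>K | k + length J + length K \<le> r. G J K) =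
      (\<Sum>(J, K)\<in>(SIGMA J:{J. k + length J \<le> r}. {K. k + length J + length K \<le> r}). G J K)"
    by (rule sum.Sigma) (auto intro: finite_lists_length_bound)
  also have "\<dots> = (\<Sum>(M, a)\<in>(SIGMA M:{M. k + length M \<le> r}. {..length M}). G (take a M) (drop a M))"
    by (intro sum.reindex_bij_witness[where i = "\<lambda>(M, a). (take a M, drop a M)"
          and j = "\<lambda>(J, K). (J @ K, length J)"]) (auto simp: min_def)
  also have "\<dots> = (\<Sum>M | k + length M \<le> r. \<Sum>a\<le>length M. G (take a M) (drop a M))"
    by (rule sum.Sigma[symmetric]) (auto intro: finite_lists_length_bound)
  finally show ?thesis .
qed

text \<open>Symmetry in the lower indices, for quantities written as functions of words.\<close>

definition mset_inv :: "('n list \<Rightarrow> 'b) \<Rightarrow> bool" where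
  "mset_inv f \<longleftrightarrow> (\<forall>I J. mset I = mset J \<longrightarrow> f I = f J)"

lemma mset_invD: "mset_inv f \<Longrightarrow> mset I = mset J \<Longrightarrow> f I = f J"
  unfolding mset_inv_def by blast

lemma mset_inv_append: "mset_inv f \<Longrightarrow> mset_inv (\<lambda>J. f (I @ J))"
  unfolding mset_inv_def by simp

lemma sum_binomial_Suc:
  fixes g :: "nat \<Rightarrow> 'r::real_vector"
  shows "(\<Sum>a\<le>n. real (n choose a) *\<^sub>R (g (Suc a) + g a)) = (\<Sum>a\<le>Suc n. real (Suc n choose a) *\<^sub>R g a)"
proof -
  have "(\<Sum>a\<le>Suc n. real (Suc n choose a) *\<^sub>R g a) =
      g 0 + (\<Sum>a\<le>n. real (n choose a) *\<^sub>R g (Suc a)) + (\<Sum>a\<le>n. real (n choose Suc a) *\<^sub>R g (Suc a))"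
    by (subst sum.atMost_Suc_shift) (simp add: scaleR_add_left sum.distrib)
  moreover have "g 0 + (\<Sum>a\<le>n. real (n choose Suc a) *\<^sub>R g (Suc a)) = (\<Sum>a\<le>n. real (n choose a) *\<^sub>R g a)"
  proof -
    have "(\<Sum>a\<le>n. real (n choose a) *\<^sub>R g a) = (\<Sum>a\<le>Suc n. real (n choose a) *\<^sub>R g a)" by simp
    also have "\<dots> = g 0 + (\<Sum>a\<le>n. real (n choose Suc a) *\<^sub>R g (Suc a))"
      by (subst sum.atMost_Suc_shift) simp
    finally show ?thesis ..
  qed
  ultimately show ?thesis by (simp add: scaleR_add_right sum.distrib algebra_simps)
qed

text \<open>Serves twice on the same ring: for the partial derivatives along a curve, and for the
  derivations \<open>nab\<close> that represent the \<open>D_i\<close>.\<close>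

locale commuting_derivations =
  fixes d :: "'n::finite \<Rightarrow> 'r::{comm_ring_1, real_algebra_1} \<Rightarrow> 'r"
  assumes d_add: "d i (f + g) = d i f + d i g"
    and d_mult: "d i (f * g) = d i f * g + f * d i g"
    and d_scaleR: "d i (c *\<^sub>R f) = c *\<^sub>R d i f"
    and d_commute: "d i (d j f) = d j (d i f)"
begin

lemma d_0 [simp]: "d i 0 = 0"
  using d_scaleR[of i 0 0] by simp

lemma d_minus: "d i (- f) = - d i f"
  using d_scaleR[of i "-1" f] by simp

lemma d_diff: "d i (f - g) = d i f - d i g"
  using d_add[of i f "- g"] by (simp add: d_minus)

lemma d_sum: "d i (sum f S) = (\<Sum>x\<in>S. d i (f x))"
  by (induction S rule: infinite_finite_induct) (auto simp: d_add)

lemma d_1 [simp]: "d i 1 = 0"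
  using d_mult[of i 1 1] by simp

abbreviation dl :: "'n list \<Rightarrow> 'r \<Rightarrow> 'r" where
  "dl \<equiv> foldr d"

lemma dl_0 [simp]: "dl I 0 = 0"
  by (induction I) auto

lemma dl_add: "dl I (f + g) = dl I f + dl I g"
  by (induction I) (auto simp: d_add)

lemma dl_scaleR: "dl I (c *\<^sub>R f) = c *\<^sub>R dl I f"
  by (induction I) (auto simp: d_scaleR)

lemma dl_diff: "dl I (f - g) = dl I f - dl I g"
  by (induction I) (auto simp: d_diff)

lemma dl_sum: "dl I (sum f S) = (\<Sum>x\<in>S. dl I (f x))"
  by (induction S rule: infinite_finite_induct) (auto simp: dl_add)

lemma d_dl_commute: "d i (dl I f) = dl I (d i f)"
  by (induction I) (auto simp: d_commute[of i])

lemma mset_inv_dl: "mset_inv dl"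
  unfolding mset_inv_def
proof safe
  fix I J :: "'n list" assume "mset I = mset J"
  then show "dl I = dl J"
  proof (induction I arbitrary: J)
    case (Cons i I)
    then have "i \<in> set J" by (metis list.set_intros(1) mset_eq_setD)
    then obtain J1 J2 where J: "J = J1 @ i # J2" by (meson split_list)
    have "dl I = dl (J1 @ J2)" using Cons J by simp
    then show ?case unfolding J by (auto simp: d_dl_commute)
  qed simp
qed

lemma dl_mset_cong: "mset I = mset J \<Longrightarrow> dl I f = dl J f"
  using mset_invD[OF mset_inv_dl] by metis

text \<open>For \<open>s = -1\<close> these are the Lie--Euler expressions; \<open>s = 1\<close> is the inverse transformation.\<close>

definition binom_op :: "nat \<Rightarrow> real \<Rightarrow> ('n list \<Rightarrow> 'r) \<Rightarrow> 'n list \<Rightarrow> 'r" where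
  "binom_op r s f I = (\<Sum>J | length I + length J \<le> r.
     (s ^ length J * real ((length I + length J) choose length I)) *\<^sub>R dl J (f (I @ J)))"

lemma mset_inv_binom_op: "mset_inv f \<Longrightarrow> mset_inv (binom_op r s f)"
  unfolding mset_inv_def binom_op_def
proof safe
  fix I J :: "'n list"
  assume f: "\<forall>I J. mset I = mset J \<longrightarrow> f I = f J" and IJ: "mset I = mset J"
  then have "length I = length J" by (metis size_mset)
  moreover have "f (I @ K) = f (J @ K)" for K using f IJ by simp
  ultimately show "(\<Sum>Ja | length I + length Ja \<le> r.
     (s ^ length Ja * real ((length I + length Ja) choose length I)) *\<^sub>R dl Ja (f (I @ Ja))) =
     (\<Sum>Ja | length J + length Ja \<le> r.
     (s ^ length Ja * real ((length J + length Ja) choose length J)) *\<^sub>R dl Ja (f (J @ Ja)))" by simp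
qed

text \<open>Collecting the terms with total word \<open>M\<close>, the identity for products of
  binomial coefficients turns their sum into \<open>(|I| + |M|) choose |I|\<close> times
  \<open>(- s + s) ^ |M|\<close>. Only the empty word survives, and it is in range because
  \<open>length I \<le> r\<close>.\<close>

lemma binom_op_inverse:
  assumes "length I \<le> r"
  shows "binom_op r (- s) (binom_op r s f) I = f I"
proof -
  let ?i = "length I"
  define c where "c a m = (- s) ^ a * real ((?i + a) choose ?i) * (s ^ (m - a) * real ((?i + m) choose (?i + a)))" for a m
  have c: "c a m = real ((?i + m) choose ?i) * (real (m choose a) * (- s) ^ a * s ^ (m - a))" if "a \<le> m" for a m
  proof -
    have "((?i + m) choose (?i + a)) * ((?i + a) choose ?i) = ((?i + m) choose ?i) * ((?i + m - ?i) choose (?i + a - ?i))"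
      using that by (intro choose_mult) auto
    then have "real ((?i + m) choose (?i + a)) * real ((?i + a) choose ?i) = real ((?i + m) choose ?i) * real (m choose a)"
      by (simp flip: of_nat_mult)
    then show ?thesis unfolding c_def by (simp add: algebra_simps)
  qed
  have sum_c: "(\<Sum>a\<le>m. c a m) = (if m = 0 then 1 else 0)" for m
  proof -
    have "(\<Sum>a\<le>m. c a m) = real ((?i + m) choose ?i) * (\<Sum>a\<le>m. real (m choose a) * (- s) ^ a * s ^ (m - a))"
      by (simp add: c sum_distrib_left)
    also have "(\<Sum>a\<le>m. real (m choose a) * (- s) ^ a * s ^ (m - a)) = (- s + s) ^ m"
      by (rule binomial_ring[symmetric])
    finally show ?thesis by (simp add: power_0_left)
  qed
  have "binom_op r (- s) (binom_op r s f) I =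
      (\<Sum>J | ?i + length J \<le> r. \<Sum>K | ?i + length J + length K \<le> r.
        c (length J) (length J + length K) *\<^sub>R dl (J @ K) (f (I @ J @ K)))"
    unfolding binom_op_def
    by (intro sum.cong refl) (simp add: dl_sum dl_scaleR scaleR_sum_right c_def algebra_simps)
  also have "\<dots> = (\<Sum>M | ?i + length M \<le> r. \<Sum>a\<le>length M. c a (length M) *\<^sub>R dl M (f (I @ M)))"
    by (subst sum_lists_append) (intro sum.cong refl, simp add: min_def)
  also have "\<dots> = (\<Sum>M | ?i + length M \<le> r. (if M = ([] :: 'n list) then f I else 0))"
    by (intro sum.cong refl) (simp add: sum_c flip: scaleR_sum_left)
  also have "\<dots> = f I"
    using assms by (subst sum.delta) (auto simp: finite_lists_length_bound)
  finally show ?thesis .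
qed

text \<open>Symmetry of \<open>f\<close> allows the letters differentiating \<open>\<xi>\<close> to
  be collected as a prefix of the word and the others as a suffix, at the price of a binomial
  coefficient; the induction step is Pascal's rule \<open>sum_binomial_Suc\<close>.\<close>

lemma leibniz_length:
  assumes "mset_inv f"
  shows "(\<Sum>I | length I = n. dl I (\<xi> * f I)) =
    (\<Sum>M | length M = n. \<Sum>a\<le>n. real (n choose a) *\<^sub>R (dl (take a M) \<xi> * dl (drop a M) (f M)))"
  using assms
proof (induction n arbitrary: f)
  case 0
  then show ?case by simp
next
  case (Suc n)
  define A where "A a M = dl (take a M) \<xi> * dl (drop a M) (f M)" for a M
  have "(\<Sum>I | length I = Suc n. dl I (\<xi> * f I)) = (\<Sum>i\<in>UNIV. d i (\<Sum>I | length I = n. dl I (\<xi> * f (i # I))))"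
    by (simp add: sum_lists_Suc d_sum)
  also have "\<dots> = (\<Sum>i\<in>UNIV. d i (\<Sum>M | length M = n. \<Sum>a\<le>n. real (n choose a) *\<^sub>R (dl (take a M) \<xi> * dl (drop a M) (f (i # M)))))"
    using mset_inv_append[OF Suc.prems, of "[_]"] by (subst Suc.IH) auto
  \<comment> \<open>The outer derivative either falls on \<open>\<xi>\<close>, which lengthens the
    prefix by a letter at the front, or on the other factor, which lengthens the suffix by a letter
    inserted at the cut.\<close>
  also have "\<dots> = (\<Sum>i\<in>UNIV. \<Sum>M | length M = n. \<Sum>a\<le>n. real (n choose a) *\<^sub>R (A (Suc a) (i # M) + A a (ins_at a i M)))"
  proof (intro sum.cong refl)
    fix i
    have "d i (real (n choose a) *\<^sub>R (dl (take a M) \<xi> * dl (drop a M) (f (i # M)))) =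
      real (n choose a) *\<^sub>R (A (Suc a) (i # M) + A a (ins_at a i M))" if "length M = n" "a \<le> n" for a M
    proof -
      have "f (ins_at a i M) = f (i # M)" using mset_invD[OF Suc.prems] by simp
      moreover have "take a (ins_at a i M) = take a M" "drop a (ins_at a i M) = i # drop a M"
        using that by (auto simp: ins_at_def)
      ultimately show ?thesis by (simp add: d_scaleR d_mult A_def)
    qed
    then show "d i (\<Sum>M | length M = n. \<Sum>a\<le>n. real (n choose a) *\<^sub>R (dl (take a M) \<xi> * dl (drop a M) (f (i # M)))) =
      (\<Sum>M | length M = n. \<Sum>a\<le>n. real (n choose a) *\<^sub>R (A (Suc a) (i # M) + A a (ins_at a i M)))"
      by (simp add: d_sum)
  qed
  also have "\<dots> = (\<Sum>a\<le>n. real (n choose a) *\<^sub>R ((\<Sum>i\<in>UNIV. \<Sum>M | length M = n. A (Suc a) (i # M)) +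
      (\<Sum>i\<in>UNIV. \<Sum>M | length M = n. A a (ins_at a i M))))"
    by (simp add: sum.swap[of _ "{..n}"] scaleR_sum_right sum.distrib scaleR_add_right)
  also have "\<dots> = (\<Sum>a\<le>n. real (n choose a) *\<^sub>R ((\<Sum>M | length M = Suc n. A (Suc a) M) + (\<Sum>M | length M = Suc n. A a M)))"
    by (intro sum.cong refl) (simp add: sum_lists_Suc[of "A (Suc _)"] sum_lists_ins_at[of _ n "A _"])
  also have "\<dots> = (\<Sum>a\<le>Suc n. real (Suc n choose a) *\<^sub>R (\<Sum>M | length M = Suc n. A a M))"
    by (rule sum_binomial_Suc)
  also have "\<dots> = (\<Sum>M | length M = Suc n. \<Sum>a\<le>Suc n. real (Suc n choose a) *\<^sub>R A a M)"
    by (simp only: scaleR_sum_right sum.swap[of _ "{..Suc n}"])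
  finally show ?case by (simp only: A_def)
qed

text \<open>Integration by parts read backwards. Combined with \<open>binom_op_inverse\<close> it
  characterises the Lie--Euler expressions as the coefficients of the divergence form.\<close>

lemma leibniz_sum:
  assumes "mset_inv f"
  shows "(\<Sum>I | length I \<le> r. dl I (\<xi> * f I)) = (\<Sum>J | length J \<le> r. dl J \<xi> * binom_op r 1 f J)"
proof -
  define G where "G J K = real ((length J + length K) choose length J) *\<^sub>R (dl J \<xi> * dl K (f (J @ K)))" for J K
  have "(\<Sum>I | length I \<le> r. dl I (\<xi> * f I)) =
      (\<Sum>M | length M \<le> r. \<Sum>a\<le>length M. real (length M choose a) *\<^sub>R (dl (take a M) \<xi> * dl (drop a M) (f M)))"
    unfolding sum_lists_atMost leibniz_length[OF assms] by (intro sum.cong refl) auto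
  also have "\<dots> = (\<Sum>M | 0 + length M \<le> r. \<Sum>a\<le>length M. G (take a M) (drop a M))"
    by (intro sum.cong) (auto simp: G_def min_def)
  also have "\<dots> = (\<Sum>J | 0 + length J \<le> r. \<Sum>K | 0 + length J + length K \<le> r. G J K)"
    by (rule sum_lists_append[symmetric])
  also have "\<dots> = (\<Sum>J | length J \<le> r. dl J \<xi> * binom_op r 1 f J)"
    by (simp add: G_def binom_op_def sum_distrib_left)
  finally show ?thesis .
qed

text \<open>A differential operator that kills every function has zero symmetric coefficients.
  Tested on the monomial belonging to \<open>J\<close>, shorter words contribute nothing by
  induction on the length, and words at least as long contribute only if they are permutations of
  \<open>J\<close>.\<close>

lemma test_monomials:
  assumes t: "\<And>i j. d i (t j) = (if i = j then 1 else 0)"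
    and h: "mset_inv h"
    and zero: "\<And>\<xi>. (\<Sum>J | length J \<le> r. dl J \<xi> * h J) = 0"
    and J: "length J \<le> r"
  shows "h J = 0"
  using J
proof (induction "length J" arbitrary: J rule: less_induct)
  case less
  define tp where "tp K = (\<Prod>i\<in>#K. t i)" for K
  have tp_add: "tp (add_mset i K) = t i * tp K" for i K by (simp add: tp_def)
  have d_tp: "d j (tp K) = real (count K j) *\<^sub>R tp (K - {#j#})" for j K
  proof (induction K)
    case empty
    then show ?case by (simp add: tp_def)
  next
    case (add i K)
    show ?case
    proof (cases "j = i")
      case True
      have "real (count K i) *\<^sub>R (t i * tp (K - {#i#})) = real (count K i) *\<^sub>R tp K"
        by (cases "i \<in># K") (auto simp: not_in_iff insert_DiffM simp flip: tp_add)
      then show ?thesis using add True by (simp add: tp_add d_mult t scaleR_add_left)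
    next
      case False
      have "add_mset i K - {#j#} = add_mset i (K - {#j#})" if "j \<in># K"
        using False that by (metis add_mset_remove_trivial diff_union_swap insert_DiffM)
      then show ?thesis using add False
        by (cases "j \<in># K") (auto simp: tp_add d_mult t not_in_iff)
    qed
  qed
  \<comment> \<open>The constant is the product of the factorials of the multiplicities in
    \<open>K\<close>; only its positivity is recorded.\<close>
  have dl_tp: "\<exists>c>0. \<forall>J. size K \<le> length J \<longrightarrow> dl J (tp K) = (if mset J = K then of_real c else 0)" for K
  proof (induction "size K" arbitrary: K)
    case 0
    have "dl J 1 = (if J = [] then 1 else 0)" for J
      by (cases J rule: rev_cases) auto
    then show ?case using 0 by (intro exI[of _ 1]) (auto simp: tp_def)
  next
    case (Suc n)
    then obtain i K' where K': "K = add_mset i K'" "size K' = n"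
      by (metis size_eq_Suc_imp_eq_union size_add_mset nat.inject union_mset_add_mset_right add_0_right union_commute add.right_neutral)
    have "\<exists>c>0. \<forall>J. n \<le> length J \<longrightarrow> dl J (tp (K - {#j#})) = (if mset J = K - {#j#} then of_real c else 0)"
      if "j \<in># K" for j
      using Suc(1)[of "K - {#j#}"] Suc(2) that by (metis size_Suc_Diff1 nat.inject)
    then obtain c where c: "\<And>j. j \<in># K \<Longrightarrow> c j > 0"
      "\<And>j J. j \<in># K \<Longrightarrow> n \<le> length J \<Longrightarrow> dl J (tp (K - {#j#})) = (if mset J = K - {#j#} then of_real (c j) else 0)"
      by metis
    have step: "dl (J @ [j]) (tp K) = (if mset (J @ [j]) = K then of_real (real (count K j) * c j) else 0)" if "n \<le> length J" for J j
    proof (cases "j \<in># K")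
      case True
      have "mset (J @ [j]) = K \<longleftrightarrow> mset J = K - {#j#}"
        using True by auto
      moreover have "dl (J @ [j]) (tp K) = real (count K j) *\<^sub>R dl J (tp (K - {#j#}))"
        by (simp only: d_tp dl_scaleR foldr_append foldr.simps o_apply id_apply)
      ultimately show ?thesis using c(2)[OF True that]
        by (simp add: scaleR_conv_of_real)
    next
      case False
      then have "mset (J @ [j]) \<noteq> K" by auto
      then show ?thesis using False by (simp add: d_tp not_in_iff)
    qed
    define c0 where "c0 = real (count K i) * c i"
    have iK: "i \<in># K" using K' by simp
    obtain J0 where J0: "mset J0 = K'" by (metis ex_mset)
    have "dl J (tp K) = (if mset J = K then of_real c0 else 0)" if "size K \<le> length J" for J
    proof (cases "mset J = K")
      case True
      then have "dl J (tp K) = dl (J0 @ [i]) (tp K)" by (intro dl_mset_cong) (simp add: J0 K')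
      also have "\<dots> = of_real c0" using step[of J0 i] J0 K' by (metis (full_types) c0_def mset_append mset.simps size_mset le_refl union_mset_add_mset_right add.right_neutral)
      finally show ?thesis using True by simp
    next
      case False
      then show ?thesis
        using that step[of "butlast J" "last J"] Suc(2) by (cases J rule: rev_cases) auto
    qed
    moreover have "c0 > 0" using c(1)[OF iK] iK by (simp add: c0_def)
    ultimately show ?case by blast
  qed
  obtain c where c: "c > 0" "\<And>K. length J \<le> length K \<Longrightarrow> dl K (tp (mset J)) = (if mset K = mset J then of_real c else 0)"
    using dl_tp[of "mset J"] by auto
  have "0 = (\<Sum>K | length K \<le> r. dl K (tp (mset J)) * h K)" using zero by simp
  also have "\<dots> = (\<Sum>K | length K \<le> r. if mset K = mset J then of_real c * h J else 0)"
  proof (intro sum.cong refl)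
    fix K :: "'n list" assume K: "K \<in> {K. length K \<le> r}"
    show "dl K (tp (mset J)) * h K = (if mset K = mset J then of_real c * h J else 0)"
    proof (cases "length K < length J")
      case True
      then have "mset K \<noteq> mset J" by (metis size_mset less_irrefl)
      then show ?thesis using less.hyps[of K] True K by simp
    next
      case False
      then show ?thesis using c(2)[of K] mset_invD[OF h, of K J] by auto
    qed
  qed
  \<comment> \<open>All permutations of \<open>J\<close> contribute the same term, so
    \<open>h J\<close> appears with a positive multiplicity that can be divided out.\<close>
  also have "\<dots> = (\<Sum>K\<in>{K. length K \<le> r \<and> mset K = mset J}. of_real c * h J)"
    by (subst sum.inter_filter[symmetric]) (auto simp: finite_lists_length_atMost)
  also have "\<dots> = (real (card {K. length K \<le> r \<and> mset K = mset J}) * c) *\<^sub>R h J"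
    by (simp only: sum_constant scaleR_conv_of_real of_real_mult of_real_of_nat_eq mult.assoc)
  finally have "real (card {K. length K \<le> r \<and> mset K = mset J}) * c = 0 \<or> h J = 0"
    by (simp only: eq_commute[of 0] scaleR_eq_0_iff)
  moreover have "card {K. length K \<le> r \<and> mset K = mset J} > 0"
  proof -
    have "J \<in> {K. length K \<le> r \<and> mset K = mset J}" using less.prems by simp
    moreover have "finite {K. length K \<le> r \<and> mset K = mset J}"
      by (rule finite_subset[OF _ finite_lists_length_atMost[of r]]) auto
    ultimately show ?thesis by (metis card_gt_0_iff empty_iff)
  qed
  ultimately show ?case using c(1) by simp
qed

end

lemma derivation_prod:
  fixes \<delta> :: "'r::comm_ring_1 \<Rightarrow> 'r"
  assumes "\<And>f g. \<delta> (f * g) = \<delta> f * g + f * \<delta> g" "finite S"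
  shows "\<delta> (\<Prod>i\<in>S. f i) = (\<Sum>p\<in>S. \<delta> (f p) * (\<Prod>i\<in>S - {p}. f i))"
  using assms(2)
proof (induction S)
  case empty
  show ?case using assms(1)[of 1 1] by simp
next
  case (insert a S)
  have "(\<Sum>p\<in>S. \<delta> (f p) * (\<Prod>i\<in>insert a S - {p}. f i)) = (\<Sum>p\<in>S. f a * (\<delta> (f p) * (\<Prod>i\<in>S - {p}. f i)))"
  proof (intro sum.cong refl)
    fix p assume "p \<in> S"
    then have "insert a S - {p} = insert a (S - {p})" using insert.hyps by auto
    then show "\<delta> (f p) * (\<Prod>i\<in>insert a S - {p}. f i) = f a * (\<delta> (f p) * (\<Prod>i\<in>S - {p}. f i))"
      using insert.hyps by (simp add: algebra_simps)
  qed
  then show ?case using insert by (simp add: assms(1) sum_distrib_left)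
qed

text \<open>Jacobi's formula over a commutative ring, with a left inverse \<open>z\<close> in place
  of the adjugate. The determinant is differentiated one row at a time, and the differentiated row
  is expanded in the rows of \<open>A\<close>.\<close>

lemma derivation_det:
  fixes \<delta> :: "'r::comm_ring_1 \<Rightarrow> 'r" and A :: "'r^'n^'n"
  assumes add: "\<And>f g. \<delta> (f + g) = \<delta> f + \<delta> g"
    and mult: "\<And>f g. \<delta> (f * g) = \<delta> f * g + f * \<delta> g"
    and inv: "\<And>q k. (\<Sum>p\<in>UNIV. z q p * A $ p $ k) = (if q = k then 1 else 0)"
  shows "\<delta> (det A) = det A * (\<Sum>p\<in>UNIV. \<Sum>q\<in>UNIV. \<delta> (A $ p $ q) * z q p)"
proof -
  have \<delta>1: "\<delta> 1 = 0" using mult[of 1 1] by simp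
  have \<delta>m: "\<delta> (- f) = - \<delta> f" for f
    using add[of f "- f"] add[of 0 0] by (simp add: eq_neg_iff_add_eq_0 add.commute)
  have \<delta>sum: "\<delta> (sum f S) = (\<Sum>x\<in>S. \<delta> (f x))" for f and S :: "'b set"
    using add[of 0 0] by (induction S rule: infinite_finite_induct) (auto simp: add)
  have \<delta>sign: "\<delta> (of_int (sign p) * f) = of_int (sign p) * \<delta> f" for p :: "'n \<Rightarrow> 'n" and f
    by (cases p rule: sign_cases) (auto simp: \<delta>m)
  have row: "(\<Prod>i\<in>UNIV. (\<chi> i. if i = p then (\<chi> k. \<delta> (A $ p $ k)) else A $ i) $ i $ \<pi> i) =
      \<delta> (A $ p $ \<pi> p) * (\<Prod>i\<in>UNIV - {p}. A $ i $ \<pi> i)" for p :: 'n and \<pi>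
    by (subst prod.remove[of _ p]) (auto intro!: arg_cong2[of _ _ _ _ "(*)"] prod.cong)
  have "\<delta> (det A) = (\<Sum>p\<in>UNIV. det (\<chi> i. if i = p then (\<chi> k. \<delta> (A $ p $ k)) else A $ i))"
    unfolding det_def row
    by (simp add: \<delta>sum \<delta>sign derivation_prod[of \<delta>, OF mult] sum_distrib_left sum.swap[of _ "{p. p permutes UNIV}"])
  also have "\<dots> = (\<Sum>p\<in>UNIV. det A * (\<Sum>q\<in>UNIV. \<delta> (A $ p $ q) * z q p))"
  proof (intro sum.cong refl)
    fix p :: 'n
    \<comment> \<open>Coefficients of the differentiated row \<open>p\<close> in terms of the rows
      of \<open>A\<close>. All rows other than \<open>p\<close> would appear twice in the
      determinant, so only \<open>c p\<close> survives.\<close>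
    define c where "c k = (\<Sum>q\<in>UNIV. \<delta> (A $ p $ q) * z q k)" for k
    have "(\<chi> k. \<delta> (A $ p $ k)) = (\<Sum>k\<in>UNIV. c k *s A $ k)"
    proof (rule vec_eq_iff[THEN iffD2, rule_format])
      fix k
      have "(\<Sum>l\<in>UNIV. c l * A $ l $ k) = (\<Sum>q\<in>UNIV. \<delta> (A $ p $ q) * (\<Sum>l\<in>UNIV. z q l * A $ l $ k))"
        unfolding c_def sum_distrib_left sum_distrib_right by (subst sum.swap) (simp add: mult.assoc)
      also have "\<dots> = \<delta> (A $ p $ k)" by (simp add: inv if_distrib cong: if_cong)
      finally show "(\<chi> k. \<delta> (A $ p $ k)) $ k = (\<Sum>k\<in>UNIV. c k *s A $ k) $ k" by simp
    qed
    then have "det (\<chi> i. if i = p then (\<chi> k. \<delta> (A $ p $ k)) else A $ i) =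
        det (\<chi> i. if i = p then (\<Sum>k\<in>UNIV. c k *s A $ k) else A $ i)" by (simp only:)
    also have "\<dots> = (\<Sum>k\<in>UNIV. det (\<chi> i. if i = p then c k *s A $ k else A $ i))"
      by (rule det_linear_row_sum) simp
    also have "\<dots> = (\<Sum>k\<in>UNIV. c k * det (\<chi> i. if i = p then A $ k else A $ i))"
      by (intro sum.cong refl det_row_mul[where a = "\<lambda>_. A $ _"])
    also have "\<dots> = (\<Sum>k\<in>UNIV. if k = p then c k * det A else 0)"
    proof (intro sum.cong refl)
      fix k
      have "det (\<chi> i. if i = p then A $ k else A $ i) = 0" if "k \<noteq> p"
        by (rule det_identical_rows[OF that]) (use that in \<open>simp add: row_def\<close>)
      moreover have "(\<chi> i. if i = p then A $ p else A $ i) = A" by (simp add: vec_eq_iff)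
      ultimately show "c k * det (\<chi> i. if i = p then A $ k else A $ i) = (if k = p then c k * det A else 0)"
        by auto
    qed
    also have "\<dots> = det A * c p" by simp
    finally show "det (\<chi> i. if i = p then (\<chi> k. \<delta> (A $ p $ k)) else A $ i) =
        det A * (\<Sum>q\<in>UNIV. \<delta> (A $ p $ q) * z q p)" by (simp add: c_def)
  qed
  finally show ?thesis by (simp add: sum_distrib_left)
qed

lemma sum_delta_mult:
  fixes f :: "'b::finite \<Rightarrow> 'r::comm_ring_1"
  shows "(\<Sum>k\<in>UNIV. (if k = i then 1 else 0) * f k) = f i" "(\<Sum>k\<in>UNIV. (if i = k then 1 else 0) * f k) = f i"
    "(\<Sum>k\<in>UNIV. f k * (if k = i then 1 else 0)) = f i" "(\<Sum>k\<in>UNIV. f k * (if i = k then 1 else 0)) = f i"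
  by (simp_all add: if_distrib if_distribR cong: if_cong)

section \<open>Change of frame\<close>

text \<open>Here \<open>x\<close> and \<open>z\<close> stand for the functions \<open>x\<^sup>k\<close> and \<open>z\<^sup>j\<^sub>i\<close> along a curve, and \<open>nab i\<close> for \<open>D\<^sub>i\<close>.\<close>

locale adapted_frame = commuting_derivations d
  for d :: "'n::finite \<Rightarrow> 'r::{comm_ring_1, real_algebra_1} \<Rightarrow> 'r" +
  fixes x :: "'n \<Rightarrow> 'r" and z :: "'n \<Rightarrow> 'n \<Rightarrow> 'r"
  assumes x_z: "(\<Sum>j\<in>UNIV. d j (x k) * z j i) = (if k = i then 1 else 0)"
    and z_x: "(\<Sum>i\<in>UNIV. z j i * d k (x i)) = (if j = k then 1 else 0)"
begin

definition nab :: "'n \<Rightarrow> 'r \<Rightarrow> 'r" where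
  "nab i f = (\<Sum>p\<in>UNIV. z p i * d p f)"

definition jac :: 'r where
  "jac = det (\<chi> k j. d j (x k))"

lemma nab_add: "nab i (f + g) = nab i f + nab i g"
  by (simp add: nab_def d_add distrib_left sum.distrib)

lemma nab_mult: "nab i (f * g) = nab i f * g + f * nab i g"
  by (simp add: nab_def d_mult distrib_left sum.distrib sum_distrib_left sum_distrib_right algebra_simps)

lemma nab_scaleR: "nab i (c *\<^sub>R f) = c *\<^sub>R nab i f"
  by (simp add: nab_def d_scaleR scaleR_sum_right)

lemma nab_x: "nab i (x k) = (if k = i then 1 else 0)"
  using x_z[of k i] by (simp add: nab_def mult.commute)

lemma d_nab: "d a f = (\<Sum>p\<in>UNIV. d a (x p) * nab p f)"
proof -
  have "(\<Sum>p\<in>UNIV. d a (x p) * nab p f) = (\<Sum>q\<in>UNIV. (\<Sum>p\<in>UNIV. z q p * d a (x p)) * d q f)"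
    unfolding nab_def sum_distrib_left sum_distrib_right by (subst sum.swap) (simp add: algebra_simps)
  also have "\<dots> = d a f" by (simp only: z_x sum_delta_mult)
  finally show ?thesis ..
qed

lemma nab_sum: "nab i (sum f S) = (\<Sum>s\<in>S. nab i (f s))"
proof -
  have "nab i 0 = 0" by (simp add: nab_def)
  then show ?thesis by (induction S rule: infinite_finite_induct) (auto simp: nab_add)
qed

text \<open>The derivative of an inverse matrix: differentiate \<open>x_z\<close> and multiply by
  \<open>z\<close>. The second factor \<open>z\<close> of the usual formula is absorbed into
  \<open>nab i\<close>.\<close>

lemma derivation_z:
  assumes add: "\<And>f g. \<delta> (f + g) = \<delta> f + \<delta> g"
    and mult: "\<And>f g. \<delta> (f * g) = \<delta> f * g + f * \<delta> g"
    and comm: "\<And>j f. \<delta> (d j f) = d j (\<delta> f)"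
  shows "\<delta> (z j i) = - (\<Sum>p\<in>UNIV. z j p * nab i (\<delta> (x p)))"
proof -
  have \<delta>0: "\<delta> 0 = 0" using add[of 0 0] by simp
  have \<delta>1: "\<delta> 1 = 0" using mult[of 1 1] by simp
  have \<delta>sum: "\<delta> (sum f S) = (\<Sum>x\<in>S. \<delta> (f x))" for f and S :: "'n set"
    by (induction S rule: infinite_finite_induct) (auto simp: add \<delta>0)
  have 1: "(\<Sum>q\<in>UNIV. d q (x p) * \<delta> (z q i)) = - nab i (\<delta> (x p))" for p
  proof -
    have "\<delta> (\<Sum>q\<in>UNIV. d q (x p) * z q i) = 0" unfolding x_z by (simp add: \<delta>0 \<delta>1)
    then have "(\<Sum>q\<in>UNIV. d q (\<delta> (x p)) * z q i) + (\<Sum>q\<in>UNIV. d q (x p) * \<delta> (z q i)) = 0"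
      by (simp add: \<delta>sum mult sum.distrib comm)
    then show ?thesis by (simp add: nab_def eq_neg_iff_add_eq_0 algebra_simps)
  qed
  have "\<delta> (z j i) = (\<Sum>q\<in>UNIV. (\<Sum>p\<in>UNIV. z j p * d q (x p)) * \<delta> (z q i))"
    by (simp only: z_x sum_delta_mult)
  also have "\<dots> = (\<Sum>p\<in>UNIV. z j p * (\<Sum>q\<in>UNIV. d q (x p) * \<delta> (z q i)))"
    unfolding sum_distrib_left sum_distrib_right by (subst sum.swap) (simp add: algebra_simps)
  finally show ?thesis by (simp add: 1 sum_negf)
qed

text \<open>The frame \<open>nab\<close> moves with \<open>x\<close>, and this is its commutator
  with any derivation commuting with the \<open>d j\<close>. With \<open>\<delta> = d a\<close> it
  leads to commutativity of the frame, with the derivative along a variation to the prolongation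
  formula.\<close>

lemma derivation_nab:
  assumes add: "\<And>f g. \<delta> (f + g) = \<delta> f + \<delta> g"
    and mult: "\<And>f g. \<delta> (f * g) = \<delta> f * g + f * \<delta> g"
    and comm: "\<And>j f. \<delta> (d j f) = d j (\<delta> f)"
  shows "\<delta> (nab i f) = nab i (\<delta> f) - (\<Sum>p\<in>UNIV. nab i (\<delta> (x p)) * nab p f)"
proof -
  have \<delta>sum: "\<delta> (sum f S) = (\<Sum>x\<in>S. \<delta> (f x))" for f and S :: "'n set"
    using add[of 0 0] by (induction S rule: infinite_finite_induct) (auto simp: add)
  have "(\<Sum>j\<in>UNIV. \<delta> (z j i) * d j f) = - (\<Sum>j\<in>UNIV. \<Sum>p\<in>UNIV. nab i (\<delta> (x p)) * (z j p * d j f))"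
    unfolding derivation_z[of \<delta>, OF add mult comm]
    by (simp add: sum_distrib_right sum_distrib_left sum_negf algebra_simps)
  also have "\<dots> = - (\<Sum>p\<in>UNIV. nab i (\<delta> (x p)) * nab p f)"
    unfolding nab_def[of _ f] sum_distrib_left by (subst sum.swap) simp
  finally have "(\<Sum>j\<in>UNIV. \<delta> (z j i) * d j f) = - (\<Sum>p\<in>UNIV. nab i (\<delta> (x p)) * nab p f)" .
  then show ?thesis unfolding nab_def[of i f] nab_def[of i "\<delta> f"]
    by (simp add: \<delta>sum mult sum.distrib comm)
qed

lemma d_derivation_nab: "d a (nab i f) = nab i (d a f) - (\<Sum>p\<in>UNIV. nab i (d a (x p)) * nab p f)"
  by (rule derivation_nab) (auto simp: d_add d_mult d_commute[of a])

text \<open>Applying \<open>nab j\<close> to the constant \<open>nab i (x p)\<close> trades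
  derivatives of \<open>d a (x p)\<close> for derivatives of \<open>z a i\<close>. After recombining
  \<open>d a (x p)\<close> with \<open>nab p\<close> by \<open>d_nab\<close>, the commutator terms
  are those produced by \<open>nab j\<close> acting on the coefficients of
  \<open>nab i\<close>.\<close>

lemma nab_commute: "nab i (nab j f) = nab j (nab i f)"
proof -
  have 0: "nab j (if b then 1 else 0) = 0" for b j
    using d_0 d_1 by (simp add: nab_def)
  have 1: "(\<Sum>a\<in>UNIV. z a i * nab j (d a g)) = nab j (nab i g) - (\<Sum>a\<in>UNIV. nab j (z a i) * d a g)" for g
    unfolding nab_def[of i g] by (simp add: nab_sum nab_mult sum.distrib)
  have "nab i (nab j f) = (\<Sum>a\<in>UNIV. z a i * nab j (d a f))
      - (\<Sum>a\<in>UNIV. \<Sum>p\<in>UNIV. z a i * nab j (d a (x p)) * nab p f)"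
    unfolding nab_def[of i "nab j f"] d_derivation_nab
    by (simp add: right_diff_distrib sum_subtractf sum_distrib_left mult.assoc)
  also have "(\<Sum>a\<in>UNIV. \<Sum>p\<in>UNIV. z a i * nab j (d a (x p)) * nab p f) =
      (\<Sum>p\<in>UNIV. (\<Sum>a\<in>UNIV. z a i * nab j (d a (x p))) * nab p f)"
    by (subst sum.swap) (simp add: sum_distrib_right)
  also have "\<dots> = - (\<Sum>p\<in>UNIV. \<Sum>a\<in>UNIV. nab j (z a i) * d a (x p) * nab p f)"
    by (simp add: 1 nab_x 0 sum_negf sum_distrib_right)
  also have "(\<Sum>p\<in>UNIV. \<Sum>a\<in>UNIV. nab j (z a i) * d a (x p) * nab p f) = (\<Sum>a\<in>UNIV. nab j (z a i) * d a f)"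
    by (subst sum.swap) (simp add: d_nab[of _ f] sum_distrib_left mult.assoc)
  finally show ?thesis by (simp add: 1)
qed

sublocale nb: commuting_derivations nab
  by unfold_locales (simp_all add: nab_add nab_mult nab_scaleR nab_commute)

lemma derivation_jac:
  assumes "\<And>f g. \<delta> (f + g) = \<delta> f + \<delta> g" "\<And>f g. \<delta> (f * g) = \<delta> f * g + f * \<delta> g"
    "\<And>j f. \<delta> (d j f) = d j (\<delta> f)"
  shows "\<delta> jac = jac * (\<Sum>p\<in>UNIV. nab p (\<delta> (x p)))"
  unfolding jac_def
  by (subst derivation_det[where z = z]) (auto simp: assms z_x nab_def mult.commute)

text \<open>The derivative of \<open>jac\<close> and that of \<open>z j i\<close> both produce
  second derivatives of \<open>x\<close> contracted with two factors \<open>z\<close>; they cancel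
  because the \<open>d j\<close> commute.\<close>

lemma piola: "(\<Sum>j\<in>UNIV. d j (jac * z j i * h)) = jac * nab i h"
proof -
  have dj: "d j jac = jac * (\<Sum>p\<in>UNIV. nab p (d j (x p)))" for j
    by (rule derivation_jac) (auto simp: d_add d_mult d_commute[of j])
  have dz: "d j (z j i) = - (\<Sum>p\<in>UNIV. z j p * nab i (d j (x p)))" for j
    by (rule derivation_z) (auto simp: d_add d_mult d_commute[of j])
  \<comment> \<open>The roles of the two differentiation indices are exchanged here, which is the
    point where \<open>d_commute\<close> enters the cancellation.\<close>
  have "(\<Sum>j\<in>UNIV. \<Sum>p\<in>UNIV. z j i * nab p (d j (x p))) = (\<Sum>j\<in>UNIV. \<Sum>q\<in>UNIV. \<Sum>p\<in>UNIV. z j i * (z q p * d q (d j (x p))))"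
    unfolding nab_def sum_distrib_left by (rule sum.cong[OF refl], rule sum.swap)
  also have "\<dots> = (\<Sum>j\<in>UNIV. \<Sum>q\<in>UNIV. \<Sum>p\<in>UNIV. z j p * (z q i * d q (d j (x p))))"
    by (subst sum.swap) (simp add: d_commute algebra_simps)
  also have "\<dots> = (\<Sum>j\<in>UNIV. \<Sum>p\<in>UNIV. z j p * nab i (d j (x p)))"
    unfolding nab_def sum_distrib_left by (rule sum.cong[OF refl], rule sum.swap)
  finally have "(\<Sum>j\<in>UNIV. z j i * (\<Sum>p\<in>UNIV. nab p (d j (x p)))) = (\<Sum>j\<in>UNIV. \<Sum>p\<in>UNIV. z j p * nab i (d j (x p)))"
    by (simp add: sum_distrib_left)
  note sym = this
  have "(\<Sum>j\<in>UNIV. d j jac * z j i * h + jac * d j (z j i) * h) =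
      (\<Sum>j\<in>UNIV. jac * h * (z j i * (\<Sum>p\<in>UNIV. nab p (d j (x p))) - (\<Sum>p\<in>UNIV. z j p * nab i (d j (x p)))))"
    unfolding dj dz by (rule sum.cong[OF refl]) (simp add: algebra_simps)
  also have "\<dots> = 0"
    by (simp only: sum_distrib_left[symmetric] sum_subtractf sym) simp
  finally have "(\<Sum>j\<in>UNIV. d j jac * z j i * h + jac * d j (z j i) * h) = 0" .
  then have "(\<Sum>j\<in>UNIV. d j (jac * z j i * h)) = (\<Sum>j\<in>UNIV. jac * z j i * d j h)"
    by (simp add: d_mult distrib_right sum.distrib)
  then show ?thesis by (simp add: nab_def sum_distrib_left mult.assoc)
qed

text \<open>The variation splits into its characteristic
  \<open>\<delta> y - \<Sum> \<delta> (x k) * nab k y\<close>, which is simply differentiated along,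
  and a transport term along \<open>x\<close>. Each further \<open>nab i\<close> preserves this
  form, since the commutator from \<open>derivation_nab\<close> cancels the derivative of the
  coefficients \<open>\<delta> (x k)\<close>.\<close>

lemma prolongation:
  assumes add: "\<And>f g. \<delta> (f + g) = \<delta> f + \<delta> g"
    and mult: "\<And>f g. \<delta> (f * g) = \<delta> f * g + f * \<delta> g"
    and comm: "\<And>j f. \<delta> (d j f) = d j (\<delta> f)"
  shows "\<delta> (nb.dl I y) = nb.dl I (\<delta> y - (\<Sum>k\<in>UNIV. \<delta> (x k) * nab k y)) + (\<Sum>k\<in>UNIV. \<delta> (x k) * nab k (nb.dl I y))"
proof (induction I)
  case (Cons i I)
  let ?f = "nb.dl I y" and ?\<eta> = "\<delta> y - (\<Sum>k\<in>UNIV. \<delta> (x k) * nab k y)"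
  have "\<delta> (nb.dl (i # I) y) = nab i (\<delta> ?f) - (\<Sum>p\<in>UNIV. nab i (\<delta> (x p)) * nab p ?f)"
    using derivation_nab[of \<delta>, OF add mult comm] by simp
  also have "nab i (\<delta> ?f) = nb.dl (i # I) ?\<eta> + (\<Sum>k\<in>UNIV. nab i (\<delta> (x k)) * nab k ?f)
      + (\<Sum>k\<in>UNIV. \<delta> (x k) * nab k (nab i ?f))"
    unfolding Cons by (simp add: nab_add nab_sum nab_mult sum.distrib nab_commute[of i] add.assoc)
  finally show ?case by simp
qed simp

text \<open>Here \<open>a\<close> and \<open>Q\<close> stand for the partial derivatives of the
  non-homogeneous Lagrangian \<open>g\<close> in \<open>x\<close> and in \<open>y_J\<close>; the
  last two hypotheses are its chain rule for \<open>\<delta>\<close> and for \<open>d j\<close>. The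
  transport part of the prolongation adds up to \<open>\<delta> (x k) * nab k g\<close>, and
  together with the variation of \<open>jac\<close> this is a divergence by
  \<open>piola\<close>.\<close>

lemma first_variation:
  assumes add: "\<And>f g. \<delta> (f + g) = \<delta> f + \<delta> g"
    and mult: "\<And>f g. \<delta> (f * g) = \<delta> f * g + f * \<delta> g"
    and comm: "\<And>j f. \<delta> (d j f) = d j (\<delta> f)"
    and \<delta>g: "\<delta> g = (\<Sum>k\<in>UNIV. a k * \<delta> (x k)) + (\<Sum>\<sigma>\<in>S. \<Sum>J\<in>\<J>. Q \<sigma> J * \<delta> (nb.dl J (y \<sigma>)))"
    and dg: "\<And>j. d j g = (\<Sum>k\<in>UNIV. a k * d j (x k)) + (\<Sum>\<sigma>\<in>S. \<Sum>J\<in>\<J>. Q \<sigma> J * d j (nb.dl J (y \<sigma>)))"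
  shows "\<delta> (jac * g) = (\<Sum>j\<in>UNIV. d j (\<Sum>k\<in>UNIV. jac * z j k * (\<delta> (x k) * g)))
    + jac * (\<Sum>\<sigma>\<in>S. \<Sum>J\<in>\<J>. Q \<sigma> J * nb.dl J (\<delta> (y \<sigma>) - (\<Sum>k\<in>UNIV. \<delta> (x k) * nab k (y \<sigma>))))"
proof -
  \<comment> \<open>Contracting the chain rule for \<open>d j\<close> with \<open>z\<close> isolates
    \<open>a i\<close>, which is thereby eliminated from the variation.\<close>
  have nabg: "nab i g = a i + (\<Sum>\<sigma>\<in>S. \<Sum>J\<in>\<J>. Q \<sigma> J * nab i (nb.dl J (y \<sigma>)))" for i
  proof -
    have "nab i g = (\<Sum>k\<in>UNIV. a k * nab i (x k)) + (\<Sum>\<sigma>\<in>S. \<Sum>J\<in>\<J>. Q \<sigma> J * nab i (nb.dl J (y \<sigma>)))"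
      unfolding nab_def dg distrib_left sum.distrib sum_distrib_left
      by (subst sum.swap, subst (2) sum.swap, subst (3) sum.swap) (simp add: algebra_simps)
    then show ?thesis by (simp add: nab_x if_distrib cong: if_cong)
  qed
  let ?\<eta> = "\<lambda>\<sigma>. \<delta> (y \<sigma>) - (\<Sum>k\<in>UNIV. \<delta> (x k) * nab k (y \<sigma>))"
  have "\<delta> g = (\<Sum>k\<in>UNIV. \<delta> (x k) * (a k + (\<Sum>\<sigma>\<in>S. \<Sum>J\<in>\<J>. Q \<sigma> J * nab k (nb.dl J (y \<sigma>)))))
      + (\<Sum>\<sigma>\<in>S. \<Sum>J\<in>\<J>. Q \<sigma> J * nb.dl J (?\<eta> \<sigma>))"
    unfolding \<delta>g prolongation[of \<delta>, OF add mult comm] distrib_left sum.distrib sum_distrib_left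
    by (simp add: sum.swap[of _ UNIV S] sum.swap[of _ UNIV \<J>] algebra_simps)
  then have \<delta>g': "\<delta> g = (\<Sum>k\<in>UNIV. \<delta> (x k) * nab k g) + (\<Sum>\<sigma>\<in>S. \<Sum>J\<in>\<J>. Q \<sigma> J * nb.dl J (?\<eta> \<sigma>))"
    by (simp only: nabg)
  have "(\<Sum>j\<in>UNIV. d j (\<Sum>k\<in>UNIV. jac * z j k * (\<delta> (x k) * g))) = jac * (\<Sum>k\<in>UNIV. nab k (\<delta> (x k) * g))"
    unfolding d_sum by (subst sum.swap) (simp add: piola sum_distrib_left)
  then show ?thesis
    unfolding mult derivation_jac[of \<delta>, OF add mult comm] \<delta>g' nab_mult
    by (simp add: sum.distrib sum_distrib_left sum_distrib_right algebra_simps)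
qed

end

text \<open>A list \<open>fs\<close> assigns a label to each position of \<open>I\<close>; the
  positions with label \<open>l\<close> form a block. Lists of labels using every label thus encode
  partitions with numbered blocks.\<close>

definition sub_word :: "'n list \<Rightarrow> nat list \<Rightarrow> nat \<Rightarrow> 'n list" where
  "sub_word I fs l = map fst (filter (\<lambda>p. snd p = l) (zip I fs))"

lemma sub_word_Cons: "sub_word (i # I) (f # fs) l = (if f = l then i # sub_word I fs l else sub_word I fs l)"
  by (simp add: sub_word_def)

lemma sub_word_eq_Nil: "length fs = length I \<Longrightarrow> sub_word I fs l = [] \<longleftrightarrow> l \<notin> set fs"
  by (auto simp: sub_word_def filter_empty_conv set_zip in_set_conv_nth)

context adapted_frame
begin

text \<open>The functions \<open>z^j_I\<close> inside the ring. Blocks of a partition are nonempty,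
  so the value on the empty word is only a placeholder.\<close>

fun zz :: "'n \<Rightarrow> 'n list \<Rightarrow> 'r" where
  "zz j [] = 0"
| "zz j [i] = z j i"
| "zz j (i # i' # I) = nab i (zz j (i' # I))"

lemma zz_Cons: "I \<noteq> [] \<Longrightarrow> zz j (i # I) = nab i (zz j I)"
  by (cases I) auto

text \<open>
  The recursion is that of sums over partitions of \<open>i # I\<close> into blocks labelled by \<open>B\<close>: the new position either
  forms the block \<open>l\<close> by itself, or joins a block of a partition of \<open>I\<close>, which the Leibniz rule for \<open>nab i\<close> expresses.
\<close>

primrec VB :: "'n list \<Rightarrow> nat set \<Rightarrow> (nat \<Rightarrow> 'n) \<Rightarrow> 'r" where
  "VB [] B j = (if B = {} then 1 else 0)"
| "VB (i # I) B j = nab i (VB I B j) + (\<Sum>l\<in>B. z (j l) i * VB I (B - {l}) j)"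

lemma VB_eq_0: "finite B \<Longrightarrow> length I < card B \<Longrightarrow> VB I B j = 0"
proof (induction I arbitrary: B)
  case (Cons i I)
  have "VB I (B - {l}) j = 0" if "l \<in> B" for l
    using Cons that by (intro Cons.IH) (auto simp: card_Diff_singleton)
  moreover have "VB I B j = 0" using Cons by (intro Cons.IH) auto
  ultimately show ?case by simp
qed auto

text \<open>The labels of the blocks are only names. This yields the symmetry of \<open>V\<close> in
  its second argument and the renumbering after one label has been removed.\<close>

lemma VB_relabel:
  assumes "bij_betw \<sigma> B' B" "\<And>l. l \<in> B' \<Longrightarrow> j' l = j (\<sigma> l)"
  shows "VB I B j = VB I B' j'"
  using assms
proof (induction I arbitrary: B B')
  case Nil
  then show ?case by (auto simp: bij_betw_def)
next
  case (Cons i I)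
  have "(\<Sum>l\<in>B. z (j l) i * VB I (B - {l}) j) = (\<Sum>l\<in>B'. z (j (\<sigma> l)) i * VB I (B - {\<sigma> l}) j)"
    by (rule sum.reindex_bij_betw[OF Cons.prems(1), symmetric])
  also have "\<dots> = (\<Sum>l\<in>B'. z (j' l) i * VB I (B' - {l}) j')"
  proof (intro sum.cong refl)
    fix l assume l: "l \<in> B'"
    have "bij_betw \<sigma> (B' - {l}) (B - {\<sigma> l})"
      using Cons.prems(1) l by (auto simp: bij_betw_def inj_on_def)
    then have "VB I (B - {\<sigma> l}) j = VB I (B' - {l}) j'"
      using Cons.prems(2) by (intro Cons.IH) auto
    then show "z (j (\<sigma> l)) i * VB I (B - {\<sigma> l}) j = z (j' l) i * VB I (B' - {l}) j'"
      using Cons.prems(2) l by simp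
  qed
  moreover have "VB I B j = VB I B' j'" by (rule Cons.IH[OF Cons.prems])
  ultimately show ?case by simp
qed

definition V :: "'n list \<Rightarrow> 'n list \<Rightarrow> 'r" where
  "V I js = VB I {..<length js} (nth js)"

lemma V_Nil: "V [] js = (if js = [] then 1 else 0)"
  by (simp add: V_def lessThan_empty_iff)

lemma V_eq_0: "length I < length js \<Longrightarrow> V I js = 0"
  unfolding V_def by (rule VB_eq_0) auto

lemma V_Cons: "V (i # I) js = nab i (V I js) + (\<Sum>l<length js. z (js ! l) i * V I (rem_at l js))"
proof -
  have "VB I ({..<length js} - {l}) (nth js) = V I (rem_at l js)" if l: "l < length js" for l
    unfolding V_def
  proof (rule VB_relabel)
    show "bij_betw (\<lambda>x. if x < l then x else Suc x) {..<length (rem_at l js)} ({..<length js} - {l})"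
      by (rule bij_betw_byWitness[where f' = "\<lambda>x. if x < l then x else x - 1"]) (use l in auto)
    show "rem_at l js ! x = js ! (if x < l then x else Suc x)" if "x \<in> {..<length (rem_at l js)}" for x
      using l that by (auto simp: rem_at_def nth_append min_def)
  qed
  then show ?thesis by (simp add: V_def)
qed

lemma mset_inv_V: "mset_inv (V I)"
  unfolding mset_inv_def
proof safe
  fix js js' :: "'n list" assume "mset js = mset js'"
  then obtain p where p: "p permutes {..<length js'}" "permute_list p js' = js"
    by (rule mset_eq_permutation)
  have len: "length js = length js'" using p(2) by auto
  have "V I js' = V I js" unfolding V_def
  proof (rule VB_relabel)
    show "bij_betw p {..<length js} {..<length js'}"
      using permutes_imp_bij[OF p(1)] len by simp
    show "js ! l = js' ! p l" if "l \<in> {..<length js}" for l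
      using that p len by (auto simp: permute_list_nth)
  qed
  then show "V I js = V I js'" ..
qed

text \<open>Iterates the rule that \<open>jac * nab i\<close> is a divergence. Each letter of
  \<open>I\<close> either becomes a derivative \<open>d j\<close> outside or differentiates the
  coefficient already accumulated, which is the recursion \<open>V_Cons\<close>. The factor
  \<open>1 / fact k\<close> compensates for the \<open>k\<close> places at which the newest letter
  of a word of length \<open>k\<close> may stand.\<close>

lemma nab_pullback:
  "(- 1) ^ length I *\<^sub>R (jac * nb.dl I h) =
   (\<Sum>js | length js \<le> length I. ((- 1) ^ length js / fact (length js)) *\<^sub>R dl js (jac * V I js * h))"
proof (induction I arbitrary: h)
  case Nil
  then show ?case by (simp add: V_Nil)
next
  case (Cons i I)
  let ?n = "length I"
  let ?c = "\<lambda>k. (- 1) ^ k / fact k :: real"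
  \<comment> \<open>The Leibniz rule followed by \<open>piola\<close>: moving \<open>nab i\<close>
    away from \<open>h\<close> costs one divergence and one derivative of \<open>V\<close>.\<close>
  have p: "jac * V I js * nab i h = (\<Sum>j\<in>UNIV. d j (jac * z j i * V I js * h)) - jac * nab i (V I js) * h" for js
    using piola[of i "V I js * h"] by (simp add: nab_mult algebra_simps)
  have "(- 1) ^ length (i # I) *\<^sub>R (jac * nb.dl (i # I) h) = - ((- 1) ^ ?n *\<^sub>R (jac * nb.dl I (nab i h)))"
    by (simp add: nb.d_dl_commute)
  also have "\<dots> = (\<Sum>js | length js \<le> ?n. ?c (length js) *\<^sub>R dl js (jac * nab i (V I js) * h))
      + - (\<Sum>js | length js \<le> ?n. ?c (length js) *\<^sub>R (\<Sum>j\<in>UNIV. d j (dl js (jac * z j i * V I js * h))))"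
    unfolding Cons.IH p
    by (simp add: dl_diff dl_sum d_dl_commute sum_subtractf scaleR_diff_right)
  finally have main: "(- 1) ^ length (i # I) *\<^sub>R (jac * nb.dl (i # I) h) = (\<Sum>js | length js \<le> ?n. ?c (length js) *\<^sub>R dl js (jac * nab i (V I js) * h))
      + - (\<Sum>js | length js \<le> ?n. ?c (length js) *\<^sub>R (\<Sum>j\<in>UNIV. d j (dl js (jac * z j i * V I js * h))))" .
  \<comment> \<open>The range may be extended by one because \<open>V I js\<close> vanishes when
    \<open>js\<close> is longer than \<open>I\<close>.\<close>
  have eq1: "(\<Sum>js | length js \<le> ?n. ?c (length js) *\<^sub>R dl js (jac * nab i (V I js) * h)) =
      (\<Sum>js | length js \<le> Suc ?n. ?c (length js) *\<^sub>R dl js (jac * nab i (V I js) * h))"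
    by (rule sum.mono_neutral_left) (auto simp: finite_lists_length_atMost V_eq_0 nb.d_0)
  have eq2: "- (\<Sum>js | length js \<le> ?n. ?c (length js) *\<^sub>R (\<Sum>j\<in>UNIV. d j (dl js (jac * z j i * V I js * h)))) =
      (\<Sum>js | length js \<le> Suc ?n. ?c (length js) *\<^sub>R (\<Sum>l<length js. dl js (jac * z (js ! l) i * V I (rem_at l js) * h)))"
  proof -
    \<comment> \<open>\<open>dl\<close> is symmetric in its word, so removing any of the
      \<open>k + 1\<close> letters gives the same sum. The resulting factor \<open>k + 1\<close> is
      what takes \<open>1 / fact (k + 1)\<close> back to \<open>1 / fact k\<close>.\<close>
    have 1: "(\<Sum>js | length js = Suc k. \<Sum>l<Suc k. dl js (jac * z (js ! l) i * V I (rem_at l js) * h)) =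
        real (Suc k) *\<^sub>R (\<Sum>js | length js = k. \<Sum>j\<in>UNIV. d j (dl js (jac * z j i * V I js * h)))" for k
    proof -
      have "(\<Sum>js | length js = Suc k. dl js (jac * z (js ! l) i * V I (rem_at l js) * h)) =
        (\<Sum>js | length js = k. \<Sum>j\<in>UNIV. d j (dl js (jac * z j i * V I js * h)))" if l: "l < Suc k" for l
      proof -
        have "dl (ins_at l j js) g = d j (dl js g)" for j js g
          using dl_mset_cong[of "ins_at l j js" "j # js" g] by simp
        then show ?thesis using l
          by (subst sum_lists_ins_at[of l]) (auto simp: sum.swap[of _ UNIV] intro!: sum.cong)
      qed
      then show ?thesis by (subst sum.swap) (simp add: scaleR_conv_of_real)
    qed
    have c: "?c (Suc k) * real (Suc k) = - ?c k" for k
      by (simp add: divide_simps)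
    have "(\<Sum>js | length js \<le> Suc ?n. ?c (length js) *\<^sub>R (\<Sum>l<length js. dl js (jac * z (js ! l) i * V I (rem_at l js) * h))) =
        (\<Sum>k\<le>Suc ?n. ?c k *\<^sub>R (\<Sum>js | length js = k. \<Sum>l<k. dl js (jac * z (js ! l) i * V I (rem_at l js) * h)))"
      unfolding sum_lists_atMost scaleR_sum_right by (intro sum.cong refl) auto
    also have "\<dots> = (\<Sum>k\<le>?n. - ?c k *\<^sub>R (\<Sum>js | length js = k. \<Sum>j\<in>UNIV. d j (dl js (jac * z j i * V I js * h))))"
      by (subst sum.atMost_Suc_shift) (simp only: 1 scaleR_scaleR c, simp)
    also have "\<dots> = - (\<Sum>js | length js \<le> ?n. ?c (length js) *\<^sub>R (\<Sum>j\<in>UNIV. d j (dl js (jac * z j i * V I js * h))))"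
      unfolding sum_lists_atMost scaleR_sum_right sum_negf[symmetric] by (intro sum.cong refl) auto
    finally show ?thesis ..
  qed
  have "(- 1) ^ length (i # I) *\<^sub>R (jac * nb.dl (i # I) h) =
      (\<Sum>js | length js \<le> Suc ?n. ?c (length js) *\<^sub>R dl js (jac * nab i (V I js) * h)) +
      (\<Sum>js | length js \<le> Suc ?n. ?c (length js) *\<^sub>R (\<Sum>l<length js. dl js (jac * z (js ! l) i * V I (rem_at l js) * h)))"
    unfolding main by (rule arg_cong2[OF eq1 eq2])
  also have "\<dots> = (\<Sum>js | length js \<le> length (i # I). ?c (length js) *\<^sub>R dl js (jac * V (i # I) js * h))"
    by (simp add: V_Cons distrib_left distrib_right dl_add scaleR_add_right sum.distrib sum_distrib_left
        sum_distrib_right dl_sum mult.assoc)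
  finally show ?case .
qed

text \<open>The expressions \<open>E^I\<close> of the relations are
  \<open>nb.binom_op r (- 1) Q I\<close>, and \<open>V I js\<close> divided by
  \<open>fact (length js)\<close> will turn out to be the symmetrized sum over partitions.\<close>

definition pulled_coeff :: "nat \<Rightarrow> ('n list \<Rightarrow> 'r) \<Rightarrow> 'n list \<Rightarrow> 'r" where
  "pulled_coeff r Q js = (\<Sum>I\<in>multi_indices (length js) r.
     ((- 1) ^ length I * (- 1) ^ length js / fact (length js)) *\<^sub>R (jac * V I js * nb.binom_op r (- 1) Q I))"

lemma mset_inv_pulled_coeff: "mset_inv (pulled_coeff r Q)"
  unfolding mset_inv_def
proof safe
  fix js js' :: "'n list" assume eq: "mset js = mset js'"
  then have "length js = length js'" by (metis size_mset)
  then show "pulled_coeff r Q js = pulled_coeff r Q js'"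
    unfolding pulled_coeff_def mset_invD[OF mset_inv_V eq] by simp
qed

text \<open>Three moves: write \<open>Q\<close> through its Lie--Euler expressions, collect the sum
  into divergence form for \<open>nab\<close> by \<open>leibniz_sum\<close>, and pull each
  divergence back by \<open>nab_pullback\<close>. The sign there is handled by inserting its
  square.\<close>

lemma pulled_sum:
  assumes "mset_inv Q"
  shows "jac * (\<Sum>J | length J \<le> r. Q J * nb.dl J \<eta>) = (\<Sum>js | length js \<le> r. dl js (pulled_coeff r Q js * \<eta>))"
proof -
  define e where "e = nb.binom_op r (- 1) Q"
  have e: "mset_inv e" unfolding e_def by (rule nb.mset_inv_binom_op[OF assms])
  have "(\<Sum>J | length J \<le> r. Q J * nb.dl J \<eta>) = (\<Sum>J | length J \<le> r. nb.dl J \<eta> * nb.binom_op r 1 e J)"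
    using nb.binom_op_inverse[of _ r "- 1" Q] by (intro sum.cong refl) (simp add: e_def)
  also have "\<dots> = (\<Sum>I | length I \<le> r. nb.dl I (\<eta> * e I))"
    by (rule nb.leibniz_sum[OF e, symmetric])
  finally have "jac * (\<Sum>J | length J \<le> r. Q J * nb.dl J \<eta>) = (\<Sum>I | length I \<le> r. jac * nb.dl I (\<eta> * e I))"
    by (simp add: sum_distrib_left)
  also have "\<dots> = (\<Sum>I | length I \<le> r. (- 1) ^ length I *\<^sub>R ((- 1) ^ length I *\<^sub>R (jac * nb.dl I (\<eta> * e I))))"
    by (simp flip: power_mult_distrib)
  also have "\<dots> = (\<Sum>I\<in>{I. length I \<le> r}. \<Sum>js\<in>{js\<in>{js. length js \<le> r}. length js \<le> length I}.
      ((- 1) ^ length I * (- 1) ^ length js / fact (length js)) *\<^sub>R dl js (jac * V I js * (\<eta> * e I)))"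
  proof (intro sum.cong refl)
    fix I :: "'n list" assume "I \<in> {I. length I \<le> r}"
    then have "{js \<in> {js. length js \<le> r}. length js \<le> length I} = {js :: 'n list. length js \<le> length I}" by auto
    then show "(- 1) ^ length I *\<^sub>R ((- 1) ^ length I *\<^sub>R (jac * nb.dl I (\<eta> * e I))) =
      (\<Sum>js\<in>{js\<in>{js. length js \<le> r}. length js \<le> length I}.
      ((- 1) ^ length I * (- 1) ^ length js / fact (length js)) *\<^sub>R dl js (jac * V I js * (\<eta> * e I)))"
      unfolding nab_pullback by (simp add: scaleR_sum_right)
  qed
  also have "\<dots> = (\<Sum>js\<in>{js. length js \<le> r}. \<Sum>I\<in>{I\<in>{I. length I \<le> r}. length js \<le> length I}.
      ((- 1) ^ length I * (- 1) ^ length js / fact (length js)) *\<^sub>R dl js (jac * V I js * (\<eta> * e I)))"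
    by (rule sum.swap_restrict) (rule finite_lists_length_atMost)+
  also have "\<dots> = (\<Sum>js | length js \<le> r. dl js (pulled_coeff r Q js * \<eta>))"
  proof (intro sum.cong refl)
    fix js :: "'n list"
    have "{I \<in> {I. length I \<le> r}. length js \<le> length I} = multi_indices (length js) r"
      by (auto simp: multi_indices_def)
    note eq = this
    show "(\<Sum>I\<in>{I\<in>{I. length I \<le> r}. length js \<le> length I}.
      ((- 1) ^ length I * (- 1) ^ length js / fact (length js)) *\<^sub>R dl js (jac * V I js * (\<eta> * e I))) =
      dl js (pulled_coeff r Q js * \<eta>)"
      unfolding eq pulled_coeff_def e_def sum_distrib_right dl_sum
      by (intro sum.cong refl) (simp add: dl_scaleR mult_ac)
  qed
  finally show ?thesis .
qed

text \<open>
  \<open>P\<close> is recovered from the first variation by testing it on monomials in the \<open>t j\<close>, which is why these functions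
  have to exist in the ring.
\<close>

theorem euler_transform:
  assumes P: "mset_inv P" and Q: "\<And>\<sigma>. \<sigma> \<in> S \<Longrightarrow> mset_inv (Q \<sigma>)"
    and t: "\<And>i j. d i (t j) = (if i = j then 1 else 0)" and r: "r \<ge> 1"
    and var: "\<And>\<xi>. (\<Sum>J | length J \<le> r. P J * dl J \<xi>) =
      (\<Sum>j\<in>UNIV. d j (b j * \<xi>)) + jac * (\<Sum>\<sigma>\<in>S. \<Sum>J | length J \<le> r. Q \<sigma> J * nb.dl J (w \<sigma> * \<xi>))"
    and js: "length js \<le> r"
  shows "binom_op r (- 1) P js = (case js of [j] \<Rightarrow> b j | _ \<Rightarrow> 0) + (\<Sum>\<sigma>\<in>S. w \<sigma> * pulled_coeff r (Q \<sigma>) js)"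
proof -
  \<comment> \<open>The extra divergence in \<open>var\<close> is the part of the divergence form
    supported on one-letter words; \<open>r \<ge> 1\<close> puts these words in the range of
    summation.\<close>
  define B where "B js = (case js of [j] \<Rightarrow> b j | _ \<Rightarrow> 0)" for js
  define F where "F js = B js + (\<Sum>\<sigma>\<in>S. w \<sigma> * pulled_coeff r (Q \<sigma>) js)" for js
  have B: "mset_inv B"
    unfolding mset_inv_def
  proof safe
    fix I J :: "'n list" assume eq: "mset I = mset J"
    then have len: "length I = length J" by (metis size_mset)
    show "B I = B J"
    proof (cases "length I = 1")
      case True
      then obtain i j where "I = [i]" "J = [j]" using len by (metis One_nat_def length_0_conv length_Suc_conv)
      then show ?thesis using eq by simp
    next
      case False
      then show ?thesis using len by (auto simp: B_def split: list.split)
    qed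
  qed
  have F: "mset_inv F"
    unfolding mset_inv_def F_def
  proof (intro allI impI)
    fix I J :: "'n list" assume eq: "mset I = mset J"
    show "B I + (\<Sum>\<sigma>\<in>S. w \<sigma> * pulled_coeff r (Q \<sigma>) I) = B J + (\<Sum>\<sigma>\<in>S. w \<sigma> * pulled_coeff r (Q \<sigma>) J)"
      by (simp only: mset_invD[OF B eq] mset_invD[OF mset_inv_pulled_coeff eq])
  qed
  \<comment> \<open>Rewritten by \<open>leibniz_sum\<close>, the right-hand side of
    \<open>var\<close> becomes a differential operator in \<open>\<xi>\<close> with coefficients
    \<open>binom_op r 1 F\<close>, so the difference of the two operators annihilates
    everything.\<close>
  have "(\<Sum>J | length J \<le> r. dl J \<xi> * (P J - binom_op r 1 F J)) = 0" for \<xi>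
  proof -
    have "(\<Sum>js | length js \<le> r. dl js (B js * \<xi>)) = (\<Sum>js\<in>(\<lambda>j. [j]) ` UNIV. dl js (B js * \<xi>))"
    proof (rule sum.mono_neutral_right)
      show "\<forall>js\<in>{js. length js \<le> r} - range (\<lambda>j. [j]). dl js (B js * \<xi>) = 0"
        by (auto simp: B_def split: list.split)
    qed (use r in \<open>auto simp: finite_lists_length_atMost\<close>)
    also have "\<dots> = (\<Sum>j\<in>UNIV. d j (b j * \<xi>))"
      by (subst sum.reindex) (auto simp: B_def inj_on_def)
    finally have 1: "(\<Sum>j\<in>UNIV. d j (b j * \<xi>)) = (\<Sum>js | length js \<le> r. dl js (B js * \<xi>))" ..
    have 2: "jac * (\<Sum>\<sigma>\<in>S. \<Sum>J | length J \<le> r. Q \<sigma> J * nb.dl J (w \<sigma> * \<xi>)) =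
        (\<Sum>js | length js \<le> r. dl js ((\<Sum>\<sigma>\<in>S. w \<sigma> * pulled_coeff r (Q \<sigma>) js) * \<xi>))"
    proof -
      have "jac * (\<Sum>\<sigma>\<in>S. \<Sum>J | length J \<le> r. Q \<sigma> J * nb.dl J (w \<sigma> * \<xi>)) =
          (\<Sum>\<sigma>\<in>S. \<Sum>js | length js \<le> r. dl js (pulled_coeff r (Q \<sigma>) js * (w \<sigma> * \<xi>)))"
        by (subst sum_distrib_left, rule sum.cong[OF refl], rule pulled_sum, rule Q)
      also have "\<dots> = (\<Sum>js | length js \<le> r. \<Sum>\<sigma>\<in>S. dl js (pulled_coeff r (Q \<sigma>) js * (w \<sigma> * \<xi>)))"
        by (rule sum.swap)
      also have "\<dots> = (\<Sum>js | length js \<le> r. dl js ((\<Sum>\<sigma>\<in>S. w \<sigma> * pulled_coeff r (Q \<sigma>) js) * \<xi>))"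
        by (rule sum.cong[OF refl]) (simp add: sum_distrib_left sum_distrib_right dl_sum mult_ac)
      finally show ?thesis .
    qed
    have "(\<Sum>J | length J \<le> r. dl J \<xi> * P J) = (\<Sum>js | length js \<le> r. dl js (\<xi> * F js))"
      using var[of \<xi>] unfolding 1 2 by (simp add: F_def distrib_left dl_add sum.distrib mult.commute[of \<xi>] mult.commute[of "P _"])
    then show ?thesis unfolding leibniz_sum[OF F] by (simp add: right_diff_distrib sum_subtractf)
  qed
  moreover have "mset_inv (\<lambda>J. P J - binom_op r 1 F J)"
    unfolding mset_inv_def
  proof (intro allI impI)
    fix I J :: "'n list" assume eq: "mset I = mset J"
    show "P I - binom_op r 1 F I = P J - binom_op r 1 F J"
      by (simp only: mset_invD[OF P eq] mset_invD[OF mset_inv_binom_op[OF F] eq])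
  qed
  ultimately have PF: "P J = binom_op r 1 F J" if "length J \<le> r" for J
    using test_monomials[OF t, of "\<lambda>J. P J - binom_op r 1 F J" r J] that by simp
  have "binom_op r (- 1) P js = binom_op r (- 1) (binom_op r 1 F) js"
    unfolding binom_op_def[of r "- 1"] using PF by (intro sum.cong refl) auto
  also have "\<dots> = F js" by (rule binom_op_inverse[OF js])
  finally show ?thesis by (simp only: F_def B_def)
qed

text \<open>Labellings obey the recursion of \<open>VB\<close>. If the label of the new position
  occurs again, that block grows by a letter and its factor is \<open>nab i\<close> of the old one;
  if it does not, the block is the single letter and contributes \<open>z\<close>.\<close>

lemma VB_words:
  assumes "finite B"
  shows "VB I B j = (\<Sum>fs | length fs = length I \<and> set fs = B. \<Prod>l\<in>B. zz (j l) (sub_word I fs l))"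
  using assms
proof (induction I arbitrary: B)
  case Nil
  have "{fs. length fs = length ([] :: 'n list) \<and> set fs = B} = (if B = {} then {[]} else {})" by auto
  then show ?case by (simp only:) simp
next
  case (Cons i I)
  let ?W = "\<lambda>B. {fs. length fs = length I \<and> set fs = B}"
  let ?T = "\<lambda>fs. \<Prod>l\<in>B. zz (j l) (sub_word (i # I) fs l)"
  have finW: "finite (?W B)" if "finite B" for B :: "nat set"
    by (rule finite_subset[OF _ finite_lists_length_eq[OF that, of "length I"]]) auto
  \<comment> \<open>The union separates labellings by their first label \<open>l\<close> and by
    whether \<open>l\<close> still occurs in the tail.\<close>
  have eq: "{fs. length fs = length (i # I) \<and> set fs = B} = (\<Union>l\<in>B. (\<lambda>fs. l # fs) ` (?W B \<union> ?W (B - {l})))"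
  proof (intro equalityI subsetI)
    fix fs assume "fs \<in> {fs. length fs = length (i # I) \<and> set fs = B}"
    then obtain l fs' where fs: "fs = l # fs'" "length fs' = length I" "insert l (set fs') = B"
      by (cases fs) auto
    then have "set fs' = B \<or> set fs' = B - {l}" by auto
    then show "fs \<in> (\<Union>l\<in>B. (\<lambda>fs. l # fs) ` (?W B \<union> ?W (B - {l})))" using fs by auto
  next
    fix fs assume "fs \<in> (\<Union>l\<in>B. (\<lambda>fs. l # fs) ` (?W B \<union> ?W (B - {l})))"
    then obtain l fs' where fs: "l \<in> B" "fs = l # fs'" "fs' \<in> ?W B \<union> ?W (B - {l})" by blast
    then have "length fs' = length I" "insert l (set fs') = B" by auto
    then show "fs \<in> {fs. length fs = length (i # I) \<and> set fs = B}" using fs(2) by simp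
  qed
  have "(\<Sum>fs | length fs = length (i # I) \<and> set fs = B. ?T fs) =
      (\<Sum>l\<in>B. \<Sum>fs\<in>(\<lambda>fs. l # fs) ` (?W B \<union> ?W (B - {l})). ?T fs)"
    unfolding eq
  proof (rule sum.UNION_disjoint[OF Cons.prems])
    show "\<forall>l\<in>B. finite ((\<lambda>fs. l # fs) ` (?W B \<union> ?W (B - {l})))"
      using Cons.prems finW by (intro ballI finite_imageI finite_UnI) auto
    show "\<forall>l\<in>B. \<forall>m\<in>B. l \<noteq> m \<longrightarrow> (\<lambda>fs. l # fs) ` (?W B \<union> ?W (B - {l})) \<inter> (\<lambda>fs. m # fs) ` (?W B \<union> ?W (B - {m})) = {}"
      by blast
  qed
  also have "\<dots> = (\<Sum>l\<in>B. \<Sum>fs\<in>?W B \<union> ?W (B - {l}). ?T (l # fs))"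
    by (intro sum.cong refl sum.reindex[unfolded o_def]) (simp add: inj_on_def)
  also have "\<dots> = (\<Sum>l\<in>B. (\<Sum>fs\<in>?W B. ?T (l # fs)) + (\<Sum>fs\<in>?W (B - {l}). ?T (l # fs)))"
  proof (rule sum.cong[OF refl], rule sum.union_disjoint)
    fix l assume "l \<in> B"
    then show "?W B \<inter> ?W (B - {l}) = {}" by blast
  qed (use Cons.prems finW in simp_all)
  also have "\<dots> = (\<Sum>fs\<in>?W B. \<Sum>l\<in>B. ?T (l # fs)) + (\<Sum>l\<in>B. \<Sum>fs\<in>?W (B - {l}). ?T (l # fs))"
    by (simp add: sum.distrib sum.swap[of _ B])
  also have "(\<Sum>fs\<in>?W B. \<Sum>l\<in>B. ?T (l # fs)) = nab i (VB I B j)"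
  proof -
    \<comment> \<open>Summing over the block that receives the new letter is the product rule for
      \<open>nab i\<close>, since every block of the tail is already nonempty.\<close>
    have "(\<Sum>l\<in>B. ?T (l # fs)) = nab i (\<Prod>l\<in>B. zz (j l) (sub_word I fs l))" if fs: "fs \<in> ?W B" for fs
    proof -
      have "?T (l # fs) = nab i (zz (j l) (sub_word I fs l)) * (\<Prod>l\<in>B - {l}. zz (j l) (sub_word I fs l))"
        if l: "l \<in> B" for l
      proof -
        have "sub_word I fs l \<noteq> []" using fs l by (auto simp: sub_word_eq_Nil)
        then show ?thesis using Cons.prems l
          by (subst prod.remove[of _ l]) (auto simp: sub_word_Cons zz_Cons intro!: arg_cong2[of _ _ _ _ "(*)"] prod.cong)
      qed
      then show ?thesis using Cons.prems by (simp add: derivation_prod[of "nab i", OF nab_mult])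
    qed
    then show ?thesis by (simp add: Cons.IH[OF Cons.prems] nab_sum)
  qed
  also have "(\<Sum>l\<in>B. \<Sum>fs\<in>?W (B - {l}). ?T (l # fs)) = (\<Sum>l\<in>B. z (j l) i * VB I (B - {l}) j)"
  proof (intro sum.cong refl)
    fix l assume l: "l \<in> B"
    have "?T (l # fs) = z (j l) i * (\<Prod>l\<in>B - {l}. zz (j l) (sub_word I fs l))" if fs: "fs \<in> ?W (B - {l})" for fs
    proof -
      have "sub_word I fs l = []" using fs by (auto simp: sub_word_eq_Nil)
      then show ?thesis using Cons.prems l
        by (subst prod.remove[of _ l]) (auto simp: sub_word_Cons intro!: arg_cong2[of _ _ _ _ "(*)"] prod.cong)
    qed
    then show "(\<Sum>fs\<in>?W (B - {l}). ?T (l # fs)) = z (j l) i * VB I (B - {l}) j"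
      using Cons.prems by (simp add: Cons.IH sum_distrib_left)
  qed
  finally show ?case by simp
qed

end

lemma sub_word_nths:
  assumes "length fs = length I"
  shows "sub_word I fs l = nths I {x. x < length I \<and> fs ! x = l}"
  using assms
proof (induction I arbitrary: fs)
  case (Cons i I)
  then obtain f fs' where fs: "fs = f # fs'" "length fs' = length I" by (cases fs) auto
  have "{x. Suc x \<in> {x. x < length (i # I) \<and> fs ! x = l}} = {x. x < length I \<and> fs' ! x = l}"
    using fs by auto
  then show ?case using Cons.IH[OF fs(2)] by (simp add: sub_word_Cons nths_Cons fs)
qed (simp add: sub_word_def)

text \<open>For a fixed partition with a fixed enumeration of its blocks, permutations of the labels
  correspond bijectively to the labellings that induce this partition. The average over permutations
  is therefore a sum over labellings divided by \<open>fact (length js)\<close>, independent of the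
  chosen enumeration.\<close>

lemma part_sum_words:
  "part_sum \<zeta> I js =
    (\<Sum>fs | length fs = length I \<and> set fs = {..<length js}. \<Prod>l<length js. \<zeta> (js ! l) (sub_word I fs l)) / fact (length js)"
proof -
  let ?n = "length I" and ?k = "length js"
  define A where "A = {fs. length fs = ?n \<and> set fs = {..<?k}}"
  define T where "T = {P. partition_on {..<?n} P \<and> card P = ?k}"
  define blk where "blk fs l = {x. x < ?n \<and> fs ! x = l}" for fs :: "nat list" and l
  define g where "g fs = (\<Prod>l<?k. \<zeta> (js ! l) (sub_word I fs l))" for fs
  have finA: "finite A"
    unfolding A_def by (rule finite_subset[OF _ finite_lists_length_eq[of "{..<?k}" ?n]]) auto
  have "T \<subseteq> Pow (Pow {..<?n})" unfolding T_def partition_on_def by auto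
  then have finT: "finite T" by (rule finite_subset) simp
  have blk_ne: "blk fs l \<noteq> {}" if "fs \<in> A" "l < ?k" for fs l
  proof -
    have "l \<in> set fs" using that by (auto simp: A_def)
    then show ?thesis using that by (auto simp: blk_def A_def in_set_conv_nth)
  qed
  have inj_blk: "inj_on (blk fs) {..<?k}" if "fs \<in> A" for fs
    using blk_ne[OF that] unfolding inj_on_def blk_def by blast
  have blkT: "blk fs ` {..<?k} \<in> T" if "fs \<in> A" for fs
  proof -
    have "\<Union> (blk fs ` {..<?k}) = {..<?n}"
      using that nth_mem[of _ fs] by (fastforce simp: blk_def A_def)
    moreover have "disjoint (blk fs ` {..<?k})"
      by (auto simp: disjoint_def blk_def)
    moreover have "{} \<notin> blk fs ` {..<?k}" using blk_ne[OF that] by auto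
    ultimately show ?thesis unfolding T_def partition_on_def
      using card_image[OF inj_blk[OF that]] by auto
  qed
  have main: "(\<Sum>fs\<in>{fs\<in>A. blk fs ` {..<?k} = P}. g fs) =
      (\<Sum>\<pi> | \<pi> permutes {..<?k}. \<Prod>l<?k. \<zeta> (permute_list \<pi> js ! l) (nths I (Bs ! l)))"
    if P: "P \<in> T" and Bs: "distinct Bs" "set Bs = P" for P Bs
  proof -
    have len: "length Bs = ?k" using Bs P distinct_card[OF Bs(1)] by (simp add: T_def)
    have part: "partition_on {..<?n} P" using P by (simp add: T_def)
    have Bs_ne: "Bs ! l \<noteq> {}" if "l < ?k" for l
      using part that len Bs(2) unfolding partition_on_def by (metis nth_mem)
    have Bs_sub: "Bs ! l \<subseteq> {..<?n}" if "l < ?k" for l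
      using part that len Bs(2) unfolding partition_on_def by (metis Union_upper nth_mem)
    have Bs_disj: "l = l'" if "x \<in> Bs ! l" "x \<in> Bs ! l'" "l < ?k" "l' < ?k" for x l l'
    proof -
      have "Bs ! l \<in> P" "Bs ! l' \<in> P" using that len Bs(2) by auto
      then have "Bs ! l = Bs ! l'" using part that unfolding partition_on_def disjoint_def by blast
      then show ?thesis using Bs(1) that len by (simp add: nth_eq_iff_index_eq)
    qed
    have Bs_cov: "\<exists>l<?k. x \<in> Bs ! l" if "x < ?n" for x
    proof -
      have "x \<in> \<Union> P" using part that unfolding partition_on_def by auto
      then show ?thesis using Bs(2) len by (metis UnionE in_set_conv_nth)
    qed
    define idx where "idx x = (THE l. l < ?k \<and> x \<in> Bs ! l)" for x
    have idx: "idx x = l" if "x \<in> Bs ! l" "l < ?k" for x l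
      unfolding idx_def by (rule the_equality) (use that Bs_disj in blast)+
    have idx_less: "idx x < ?k" "x \<in> Bs ! idx x" if "x < ?n" for x
      using Bs_cov[OF that] idx by metis+
    \<comment> \<open>The labelling attached to \<open>\<pi>\<close>: the block
      \<open>Bs ! l\<close> receives the label \<open>\<pi> l\<close>.\<close>
    define word where "word \<pi> = map (\<lambda>x. \<pi> (idx x)) [0..<?n]" for \<pi> :: "nat \<Rightarrow> nat"
    have word_nth: "word \<pi> ! x = \<pi> (idx x)" if "x < ?n" for \<pi> x
      using that by (simp add: word_def)
    have word_blk: "blk (word \<pi>) (\<pi> l) = Bs ! l" if \<pi>: "\<pi> permutes {..<?k}" and l: "l < ?k" for \<pi> l
    proof -
      have "\<pi> (idx x) = \<pi> l \<longleftrightarrow> x \<in> Bs ! l" if "x < ?n" for x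
        using permutes_inj[OF \<pi>] idx[OF _ l] idx_less[OF that] by (metis injD)
      then show ?thesis using Bs_sub[OF l] by (auto simp: blk_def word_nth)
    qed
    have word_in: "word \<pi> \<in> {fs\<in>A. blk fs ` {..<?k} = P}" if \<pi>: "\<pi> permutes {..<?k}" for \<pi>
    proof -
      have "set (word \<pi>) = {..<?k}"
      proof (intro equalityI subsetI)
        fix l assume "l \<in> set (word \<pi>)"
        then show "l \<in> {..<?k}" using idx_less permutes_in_image[OF \<pi>] by (auto simp: word_def)
      next
        fix m assume "m \<in> {..<?k}"
        then obtain l where l: "l < ?k" "m = \<pi> l"
          using permutes_image[OF \<pi>] by (metis imageE lessThan_iff)
        obtain x where x: "x \<in> Bs ! l" using Bs_ne[OF l(1)] by blast
        then have "x < ?n" using Bs_sub[OF l(1)] by auto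
        then show "m \<in> set (word \<pi>)" using idx[OF x l(1)] l(2) by (auto simp: word_def intro!: image_eqI[of _ _ x])
      qed
      then have "word \<pi> \<in> A" by (simp add: A_def word_def)
      moreover have "blk (word \<pi>) ` {..<?k} = blk (word \<pi>) ` \<pi> ` {..<?k}"
        using permutes_image[OF \<pi>] by simp
      then have "blk (word \<pi>) ` {..<?k} = (\<lambda>l. Bs ! l) ` {..<?k}"
        using word_blk[OF \<pi>] by (simp add: image_image)
      then have "blk (word \<pi>) ` {..<?k} = P" using Bs(2) len by (auto simp: set_conv_nth)
      ultimately show ?thesis by simp
    qed
    have "bij_betw word {\<pi>. \<pi> permutes {..<?k}} {fs\<in>A. blk fs ` {..<?k} = P}"
      unfolding bij_betw_def
    proof
      show "inj_on word {\<pi>. \<pi> permutes {..<?k}}"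
      proof (rule inj_onI)
        fix \<pi> \<pi>' assume \<pi>: "\<pi> \<in> {\<pi>. \<pi> permutes {..<?k}}" "\<pi>' \<in> {\<pi>. \<pi> permutes {..<?k}}" and eq: "word \<pi> = word \<pi>'"
        show "\<pi> = \<pi>'"
        proof
          fix l show "\<pi> l = \<pi>' l"
          proof (cases "l < ?k")
            case True
            then obtain x where x: "x \<in> Bs ! l" using Bs_ne by blast
            then have "x < ?n" using Bs_sub[OF True] by auto
            then show ?thesis using eq word_nth[of x] idx[OF x True] by metis
          next
            case False
            then show ?thesis using \<pi> permutes_not_in by (metis lessThan_iff mem_Collect_eq)
          qed
        qed
      qed
      show "word ` {\<pi>. \<pi> permutes {..<?k}} = {fs\<in>A. blk fs ` {..<?k} = P}"
      proof (intro equalityI subsetI)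
        fix fs assume "fs \<in> {fs\<in>A. blk fs ` {..<?k} = P}"
        then have fs: "fs \<in> A" "blk fs ` {..<?k} = P" by auto
        have bij1: "bij_betw (\<lambda>l. Bs ! l) {..<?k} P" using bij_betw_nth[OF Bs(1)] len Bs(2) by auto
        have bij2: "bij_betw (blk fs) {..<?k} P" using inj_blk[OF fs(1)] fs(2) by (simp add: bij_betw_def)
        \<comment> \<open>Recovers the permutation from a labelling by comparing the two
          enumerations of the same blocks; the identity outside the range makes it a permutation in
          the sense of \<open>permutes\<close>.\<close>
        define \<pi> where "\<pi> l = (if l < ?k then inv_into {..<?k} (blk fs) (Bs ! l) else l)" for l
        have "bij_betw (inv_into {..<?k} (blk fs) \<circ> (\<lambda>l. Bs ! l)) {..<?k} {..<?k}"
          using bij_betw_trans[OF bij1 bij_betw_inv_into[OF bij2]] .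
        then have "bij_betw \<pi> {..<?k} {..<?k}"
          by (rule iffD1[OF bij_betw_cong, rotated]) (simp add: \<pi>_def)
        then have \<pi>: "\<pi> permutes {..<?k}" by (rule bij_imp_permutes) (simp add: \<pi>_def)
        have blk\<pi>: "blk fs (\<pi> l) = Bs ! l" if "l < ?k" for l
          using that bij_betw_inv_into_right[OF bij2] bij1 by (auto simp: \<pi>_def bij_betw_def)
        have "word \<pi> = fs"
        proof (rule nth_equalityI)
          show "length (word \<pi>) = length fs" using fs(1) by (simp add: A_def word_def)
          fix x assume "x < length (word \<pi>)"
          then have x: "x < ?n" by (simp add: word_def)
          have "x \<in> blk fs (\<pi> (idx x))" using blk\<pi> idx_less[OF x] by simp
          then show "word \<pi> ! x = fs ! x" using x by (simp add: word_nth blk_def)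
        qed
        then show "fs \<in> word ` {\<pi>. \<pi> permutes {..<?k}}" using \<pi> by blast
      qed (use word_in in auto)
    qed
    then have "(\<Sum>fs\<in>{fs\<in>A. blk fs ` {..<?k} = P}. g fs) = (\<Sum>\<pi> | \<pi> permutes {..<?k}. g (word \<pi>))"
      by (rule sum.reindex_bij_betw[symmetric])
    also have "\<dots> = (\<Sum>\<pi> | \<pi> permutes {..<?k}. \<Prod>l<?k. \<zeta> (permute_list \<pi> js ! l) (nths I (Bs ! l)))"
    proof (rule sum.cong[OF refl])
      fix \<pi> assume "\<pi> \<in> {\<pi>. \<pi> permutes {..<?k}}"
      then have \<pi>: "\<pi> permutes {..<?k}" by simp
      have "g (word \<pi>) = (\<Prod>l<?k. \<zeta> (js ! l) (nths I (blk (word \<pi>) l)))"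
        unfolding g_def blk_def by (simp add: sub_word_nths word_def)
      also have "\<dots> = (\<Prod>l<?k. \<zeta> (js ! \<pi> l) (nths I (blk (word \<pi>) (\<pi> l))))"
        by (rule prod.reindex_bij_betw[OF permutes_imp_bij[OF \<pi>], symmetric])
      also have "\<dots> = (\<Prod>l<?k. \<zeta> (permute_list \<pi> js ! l) (nths I (Bs ! l)))"
        by (rule prod.cong[OF refl]) (simp add: word_blk[OF \<pi>] permute_list_nth[OF \<pi>])
      finally show "g (word \<pi>) = (\<Prod>l<?k. \<zeta> (permute_list \<pi> js ! l) (nths I (Bs ! l)))" .
    qed
    finally show ?thesis .
  qed
  have "part_sum \<zeta> I js = (\<Sum>P\<in>T. (\<Sum>fs\<in>{fs\<in>A. blk fs ` {..<?k} = P}. g fs) / fact ?k)"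
    unfolding part_sum_def T_def[symmetric]
  proof (rule sum.cong[OF refl])
    fix P assume P: "P \<in> T"
    have "finite P" using P finite_elements[of "{..<?n}" P] by (auto simp: T_def)
    then have "\<exists>Bs. distinct Bs \<and> set Bs = P" using finite_distinct_list by blast
    then have Bs: "distinct (SOME Bs. distinct Bs \<and> set Bs = P)" "set (SOME Bs. distinct Bs \<and> set Bs = P) = P"
      by (metis (mono_tags, lifting) someI_ex)+
    show "(let Bs = (SOME Bs. distinct Bs \<and> set Bs = P)
        in symmetrize (\<lambda>js'. \<Prod>l<length js. \<zeta> (js' ! l) (nths I (Bs ! l))) js) =
      (\<Sum>fs\<in>{fs\<in>A. blk fs ` {..<?k} = P}. g fs) / fact ?k"
      unfolding main[OF P Bs] by (simp add: Let_def symmetrize_def)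
  qed
  also have "\<dots> = (\<Sum>P\<in>T. (\<Sum>fs\<in>{fs\<in>A. blk fs ` {..<?k} = P}. g fs)) / fact ?k"
    by (simp add: sum_divide_distrib)
  \<comment> \<open>Every labelling using all labels induces exactly one partition with the right
    number of blocks, so the fibres over \<open>T\<close> exhaust \<open>A\<close>.\<close>
  also have "(\<Sum>P\<in>T. (\<Sum>fs\<in>{fs\<in>A. blk fs ` {..<?k} = P}. g fs)) = (\<Sum>fs\<in>A. g fs)"
    using blkT by (intro sum.group finA finT) auto
  finally show ?thesis by (simp add: A_def g_def)
qed

section \<open>Velocities of curves in coordinates\<close>

lemma mset_enum_mset [simp]: "mset (enum_mset K) = K"
  unfolding enum_mset_def by (rule someI_ex) (rule ex_mset)

lemma length_enum_mset [simp]: "length (enum_mset K) = size K"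
  by (metis mset_enum_mset size_mset)

lemma finite_msets: "finite {K :: 'n::finite multiset. size K < s}"
proof -
  have "finite (mset ` {J :: 'n list. length J \<le> s})"
    by (intro finite_imageI finite_lists_length_atMost)
  moreover have "{K :: 'n multiset. size K < s} \<subseteq> mset ` {J. length J \<le> s}"
    by (auto intro!: image_eqI[of _ mset "enum_mset _"])
  ultimately show ?thesis by (rule finite_subset[rotated])
qed

text \<open>The number of words with a given multiset of letters is the multinomial coefficient, and
  \<open>index_weight\<close> is its reciprocal. Hence weighted sums over words count each jet
  coordinate once.\<close>

lemma index_weight_card: "index_weight J * real (card {J' :: 'n::finite list. mset J' = mset J}) = 1"
proof -
  have set: "{J' :: 'n list. mset J' = mset J} = permutations_of_multiset (mset J)"
    by (auto simp: permutations_of_multiset_def)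
  have prod: "(\<Prod>l\<in>UNIV. fact (count (mset J) l)) = (\<Prod>l\<in>set_mset (mset J). fact (count (mset J) l) :: nat)"
  proof (rule prod.mono_neutral_right)
    show "\<forall>l\<in>UNIV - set_mset (mset J). fact (count (mset J) l) = (1 :: nat)"
    proof
      fix l assume "l \<in> UNIV - set_mset (mset J)"
      then have "count (mset J) l = 0" by (simp only: count_eq_zero_iff Diff_iff) simp
      then show "fact (count (mset J) l) = (1 :: nat)" by (simp only: fact_0)
    qed
  qed auto
  have "real (card {J' :: 'n list. mset J' = mset J}) =
      fact (length J) / (\<Prod>l\<in>UNIV. fact (count (mset J) l))"
    using card_permutations_of_multiset[of "mset J"] unfolding set prod[symmetric]
    by (simp add: real_of_nat_div)
  then show ?thesis by (simp add: index_weight_def)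
qed

lemma index_weight_cong: "mset J = mset J' \<Longrightarrow> index_weight J = index_weight J'"
  unfolding index_weight_def by (metis size_mset)

lemma sum_index_weight:
  fixes G :: "'n::finite multiset \<Rightarrow> 'b::real_vector"
  shows "(\<Sum>J | length J < s. index_weight J *\<^sub>R G (mset J)) = (\<Sum>K | size K < s. G K)"
proof -
  have fin: "finite {J :: 'n list. length J < s}"
    by (rule finite_subset[OF _ finite_lists_length_atMost[of s]]) auto
  have "(\<Sum>J | length J < s. index_weight J *\<^sub>R G (mset J)) =
      (\<Sum>K | size K < s. \<Sum>J\<in>{J\<in>{J. length J < s}. mset J = K}. index_weight J *\<^sub>R G (mset J))"
    by (rule sum.group[symmetric]) (auto simp: fin finite_msets)
  also have "\<dots> = (\<Sum>K | size K < s. G K)"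
  proof (rule sum.cong[OF refl])
    fix K :: "'n multiset" assume K: "K \<in> {K. size K < s}"
    have set: "{J\<in>{J. length J < s}. mset J = K} = {J. mset J = mset (enum_mset K)}"
      using K by (auto simp flip: size_mset)
    have "(\<Sum>J\<in>{J\<in>{J. length J < s}. mset J = K}. index_weight J *\<^sub>R G (mset J)) =
        (\<Sum>J | mset J = mset (enum_mset K). index_weight (enum_mset K) *\<^sub>R G K)"
      unfolding set
    proof (rule sum.cong[OF refl])
      fix J :: "'n list" assume "J \<in> {J. mset J = mset (enum_mset K)}"
      then have J: "mset J = mset (enum_mset K)" by simp
      show "index_weight J *\<^sub>R G (mset J) = index_weight (enum_mset K) *\<^sub>R G K"
        unfolding index_weight_cong[OF J] unfolding J by simp
    qed
    also have "\<dots> = (index_weight (enum_mset K) * real (card {J. mset J = mset (enum_mset K)})) *\<^sub>R G K"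
      by (simp add: sum_constant_scaleR mult.commute)
    also have "\<dots> = G K" unfolding index_weight_card by simp
    finally show "(\<Sum>J\<in>{J\<in>{J. length J < s}. mset J = K}. index_weight J *\<^sub>R G (mset J)) = G K" .
  qed
  finally show ?thesis .
qed

lemma foldr_pderiv_at_mset:
  assumes "open \<Omega>" "smooth_fun_on \<Omega> f" "mset ks = mset ks'" "u \<in> \<Omega>"
  shows "foldr pderiv_at ks f u = foldr pderiv_at ks' f u"
  using assms(3,4)
proof (induction ks arbitrary: ks' u)
  case (Cons k ks)
  then have "k \<in> set ks'" by (metis list.set_intros(1) mset_eq_setD)
  then obtain k1 k2 where k: "ks' = k1 @ k # k2" by (meson split_list)
  have move: "foldr pderiv_at k1 (pderiv_at k g) w = pderiv_at k (foldr pderiv_at k1 g) w"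
    if "smooth_fun_on \<Omega> g" "w \<in> \<Omega>" for g w
    using that
  proof (induction k1 arbitrary: w)
    case (Cons a k1)
    have "foldr pderiv_at (a # k1) (pderiv_at k g) w = pderiv_at a (pderiv_at k (foldr pderiv_at k1 g)) w"
      using pderiv_at_cong[OF assms(1) Cons.prems(2) Cons.IH[OF Cons.prems(1)]] by simp
    also have "\<dots> = pderiv_at k (foldr pderiv_at (a # k1) g) w"
      using pderiv_at_commute[OF assms(1) smooth_fun_on_foldr_pderiv_at[OF Cons.prems(1)] Cons.prems(2)] by simp
    finally show ?case .
  qed simp
  have "foldr pderiv_at (k # ks) f u = pderiv_at k (foldr pderiv_at (k1 @ k2) f) u"
  proof -
    have "foldr pderiv_at ks f w = foldr pderiv_at (k1 @ k2) f w" if "w \<in> \<Omega>" for w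
      using Cons.prems k that by (intro Cons.IH) auto
    then show ?thesis unfolding foldr.simps o_apply by (intro pderiv_at_cong[OF assms(1) Cons.prems(2)])
  qed
  also have "\<dots> = foldr pderiv_at ks' f u"
    using move[OF smooth_fun_on_foldr_pderiv_at[OF assms(2)] Cons.prems(2), of k2] by (simp add: k)
  finally show ?case .
qed simp

lemma open_preimage_smooth:
  fixes q :: "('j \<Rightarrow> real) \<Rightarrow> 'i \<Rightarrow> real"
  assumes "open U" "\<And>k. smooth_fun_on U (\<lambda>u. q u k)" "open \<Omega>"
  shows "open {u\<in>U. q u \<in> \<Omega>}"
proof -
  have "continuous_on U q"
    by (intro continuous_on_coordinatewise_then_product smooth_fun_on_continuous assms)
  then have "open (U \<inter> q -` \<Omega>)" using assms by (intro continuous_open_preimage)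
  moreover have "U \<inter> q -` \<Omega> = {u\<in>U. q u \<in> \<Omega>}" by auto
  ultimately show ?thesis by simp
qed

lemma near_smooth_compose:
  fixes q :: "('k \<Rightarrow> real) \<Rightarrow> 'i \<Rightarrow> real"
  assumes "open \<Omega>" "smooth_fun_on \<Omega> H" "finite K" "depends_on K H"
    and "open U" "origin \<in> U" "\<And>k. smooth_fun_on U (\<lambda>u. q u k)" "q origin \<in> \<Omega>"
  shows "near_smooth (\<lambda>u. H (q u))"
proof (rule near_smoothI)
  let ?U = "{u\<in>U. q u \<in> \<Omega>}"
  show U: "open ?U" by (rule open_preimage_smooth[OF assms(5,7,1)])
  show "origin \<in> ?U" using assms by simp
  show "smooth_fun_on ?U (\<lambda>u. H (q u))"
    by (rule smooth_fun_on_compose[OF assms(1-4) U]) (auto intro: smooth_fun_on_subset[OF assms(7)])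
qed

text \<open>The bridge between analysis and algebra: the identification of the operators
  \<open>d_i\<close> and \<open>D_i\<close> with derivations of germs, and the comparison of jets of
  composites, reduce to this form of the chain rule.\<close>

lemma germ_chain:
  fixes q :: "('k \<Rightarrow> real) \<Rightarrow> 'i \<Rightarrow> real"
  assumes "open \<Omega>" "smooth_fun_on \<Omega> H" "finite K" "depends_on K H"
    and "open U" "origin \<in> U" "\<And>k. smooth_fun_on U (\<lambda>u. q u k)" "q origin \<in> \<Omega>"
  shows "germ_deriv j (abs_germ (\<lambda>u. H (q u))) =
    (\<Sum>k\<in>K. abs_germ (\<lambda>u. pderiv_at k H (q u)) * germ_deriv j (abs_germ (\<lambda>u. q u k)))"
proof -
  let ?U = "{u\<in>U. q u \<in> \<Omega>}"
  have U: "open ?U" by (rule open_preimage_smooth[OF assms(5,7,1)])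
  have q: "near_smooth (\<lambda>u. q u k)" for k by (rule near_smoothI[OF assms(5,6,7)])
  have dH: "near_smooth (\<lambda>u. pderiv_at k H (q u))" for k
    by (rule near_smooth_compose[OF assms(1) smooth_fun_on_pderiv_at[OF assms(2)] assms(3)
          depends_on_pderiv_at[OF assms(4)] assms(5-8)])
  have H: "near_smooth (\<lambda>u. H (q u))" by (rule near_smooth_compose[OF assms])
  have "germ_rel (pderiv_at j (\<lambda>u. H (q u))) (\<lambda>u. \<Sum>k\<in>K. pderiv_at k H (q u) * pderiv_at j (\<lambda>u. q u k) u)"
  proof (rule germ_relI[OF U])
    show "origin \<in> ?U" using assms by simp
    show "smooth_fun_on ?U (pderiv_at j (\<lambda>u. H (q u)))"
      by (rule smooth_fun_on_pderiv_at, rule smooth_fun_on_compose[OF assms(1-4) U])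
         (auto intro: smooth_fun_on_subset[OF assms(7)])
    fix u assume "u \<in> ?U"
    then show "pderiv_at j (\<lambda>u. H (q u)) u = (\<Sum>k\<in>K. pderiv_at k H (q u) * pderiv_at j (\<lambda>u. q u k) u)"
      unfolding pderiv_at_def[of j "\<lambda>u. H (q u)"]
      by (intro DERIV_imp_deriv pderiv_at_compose[OF assms(1-4,7)]) auto
  qed
  then have "germ_deriv j (abs_germ (\<lambda>u. H (q u))) =
      abs_germ (\<lambda>u. \<Sum>k\<in>K. pderiv_at k H (q u) * pderiv_at j (\<lambda>u. q u k) u)"
    by (simp add: germ_deriv_abs[OF H] abs_germ_eqI)
  also have "\<dots> = (\<Sum>k\<in>K. abs_germ (\<lambda>u. pderiv_at k H (q u) * pderiv_at j (\<lambda>u. q u k) u))"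
    by (intro abs_germ_sum germ_rel_mult dH germ_rel_pderiv_at q)
  also have "\<dots> = (\<Sum>k\<in>K. abs_germ (\<lambda>u. pderiv_at k H (q u)) * germ_deriv j (abs_germ (\<lambda>u. q u k)))"
    by (simp add: abs_germ_mult[OF dH germ_rel_pderiv_at[OF q]] germ_deriv_abs[OF q])
  finally show ?thesis .
qed

lemma finite_vel_index: "finite (vel_index r :: ('a::finite \<times> 'n::finite multiset) set)"
proof -
  have "vel_index r = (UNIV :: 'a set) \<times> {K :: 'n multiset. size K < Suc r}"
    by (auto simp: vel_index_def)
  then show ?thesis by (simp add: finite_msets)
qed

abbreviation vel_order :: "nat \<Rightarrow> (('n, 'a) vcoords \<Rightarrow> real) \<Rightarrow> bool" where
  "vel_order r H \<equiv> depends_on (vel_index r) H"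

lemma vel_index_mono: "r \<le> r' \<Longrightarrow> vel_index r \<subseteq> vel_index r'"
  by (auto simp: vel_index_def)

lemma vel_order_mono: "vel_order r H \<Longrightarrow> r \<le> r' \<Longrightarrow> vel_order r' H"
  by (rule depends_on_mono[OF _ vel_index_mono])

lemma depends_on_sum: "(\<And>x. x \<in> S \<Longrightarrow> depends_on K (f x)) \<Longrightarrow> depends_on K (\<lambda>u. \<Sum>x\<in>S. f x u)"
  unfolding depends_on_def by (intro allI impI sum.cong) auto

lemma depends_on_mult: "depends_on K f \<Longrightarrow> depends_on K g \<Longrightarrow> depends_on K (\<lambda>u. f u * g u :: real)"
  unfolding depends_on_def by metis

lemma depends_on_coord: "k \<in> K \<Longrightarrow> depends_on K (\<lambda>u. u k)"
  unfolding depends_on_def by blast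

lemma depends_on_const: "depends_on K (\<lambda>u. c)"
  unfolding depends_on_def by blast

lemma vel_order_vpartial: "vel_order r H \<Longrightarrow> vel_order r (vpartial A J H)"
  unfolding vpartial_def by (intro depends_on_mult depends_on_const depends_on_pderiv_at)

lemma vpartial_eq_0: "vel_order r H \<Longrightarrow> r < length J \<Longrightarrow> vpartial A J H u = 0"
  by (simp add: vpartial_def pderiv_at_eq_0 vel_index_def)

text \<open>The order is governed by \<open>r\<close>, whatever \<open>s\<close> is: partial
  derivatives along coordinates of order above \<open>r\<close> vanish.\<close>

lemma vel_order_dtotal:
  assumes "vel_order r H"
  shows "vel_order (Suc r) (dtotal s i H)"
  unfolding dtotal_def
proof (intro depends_on_sum)
  fix A J
  show "vel_order (Suc r) (\<lambda>u. u (A, mset (i # J)) * vpartial A J H u)"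
  proof (cases "length J \<le> r")
    case True
    then show ?thesis
      by (intro depends_on_mult depends_on_coord vel_order_mono[OF vel_order_vpartial[OF assms]])
         (auto simp: vel_index_def)
  next
    case False
    then show ?thesis using vpartial_eq_0[OF assms] by (simp add: depends_on_const)
  qed
qed

lemma smooth_fun_on_vpartial:
  assumes "open \<Omega>" "smooth_fun_on \<Omega> H"
  shows "smooth_fun_on \<Omega> (vpartial A J H)"
  unfolding vpartial_def
  by (intro smooth_fun_on_mult smooth_fun_on_const smooth_fun_on_pderiv_at assms)

lemma smooth_fun_on_dtotal:
  assumes "open \<Omega>" "smooth_fun_on \<Omega> H"
  shows "smooth_fun_on \<Omega> (dtotal s i H)"
  unfolding dtotal_def
  by (intro smooth_fun_on_sum smooth_fun_on_mult smooth_fun_on_coord smooth_fun_on_vpartial assms)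

text \<open>
  With \<open>e = Some\<close> the curve carries the extra variable \<open>None\<close>, along which no derivative enters the velocity.
\<close>

definition jet_of :: "('n \<Rightarrow> 'k) \<Rightarrow> (('k \<Rightarrow> real) \<Rightarrow> 'a \<Rightarrow> real) \<Rightarrow> ('k \<Rightarrow> real) \<Rightarrow> ('n, 'a) vcoords" where
  "jet_of e \<Gamma> \<tau> = (\<lambda>(A, K). foldr pderiv_at (map e (enum_mset K)) (\<lambda>\<tau>. \<Gamma> \<tau> A) \<tau>)"

locale curve =
  fixes e :: "'n::finite \<Rightarrow> 'k" and \<Gamma> :: "('k \<Rightarrow> real) \<Rightarrow> 'a::finite \<Rightarrow> real" and U :: "('k \<Rightarrow> real) set"
  assumes open_U: "open U" and origin_U: "origin \<in> U"
    and smooth_\<Gamma>: "\<And>A. smooth_fun_on U (\<lambda>\<tau>. \<Gamma> \<tau> A)"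
begin

abbreviation jet :: "('k \<Rightarrow> real) \<Rightarrow> ('n, 'a) vcoords" where
  "jet \<equiv> jet_of e \<Gamma>"

abbreviation d :: "'n \<Rightarrow> 'k germ \<Rightarrow> 'k germ" where
  "d i \<equiv> germ_deriv (e i)"

definition cmp :: "(('n, 'a) vcoords \<Rightarrow> real) \<Rightarrow> 'k germ" where
  "cmp H = abs_germ (\<lambda>\<tau>. H (jet \<tau>))"

lemma jet_mset: "\<tau> \<in> U \<Longrightarrow> jet \<tau> (A, mset J) = foldr pderiv_at (map e J) (\<lambda>\<tau>. \<Gamma> \<tau> A) \<tau>"
  unfolding jet_of_def by (simp, rule foldr_pderiv_at_mset[OF open_U smooth_\<Gamma>]) auto

lemma smooth_jet: "smooth_fun_on U (\<lambda>\<tau>. jet \<tau> k)"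
  by (cases k) (simp add: jet_of_def smooth_fun_on_foldr_pderiv_at smooth_\<Gamma>)

lemma near_smooth_\<Gamma>: "near_smooth (\<lambda>\<tau>. \<Gamma> \<tau> A)"
  by (rule near_smoothI[OF open_U origin_U smooth_\<Gamma>])

lemma cmp_coord: "cmp (\<lambda>u. u (A, mset J)) = foldr d J (abs_germ (\<lambda>\<tau>. \<Gamma> \<tau> A))"
proof -
  have "cmp (\<lambda>u. u (A, mset J)) = abs_germ (foldr pderiv_at (map e J) (\<lambda>\<tau>. \<Gamma> \<tau> A))"
    unfolding cmp_def
    by (rule abs_germ_eqI, rule germ_relI[OF open_U origin_U smooth_jet]) (rule jet_mset)
  also have "\<dots> = foldr germ_deriv (map e J) (abs_germ (\<lambda>\<tau>. \<Gamma> \<tau> A))"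
    by (rule foldr_germ_deriv_abs[OF near_smooth_\<Gamma>, symmetric])
  finally show ?thesis by (simp add: foldr_map o_def)
qed

sublocale commuting_derivations d
  by unfold_locales (rule germ_deriv_add germ_deriv_mult germ_deriv_scaleR germ_deriv_commute)+

context
  fixes \<Omega> :: "('n, 'a) vcoords set"
  assumes \<Omega>: "open \<Omega>" "jet origin \<in> \<Omega>"
begin

lemma near_smooth_cmp: "smooth_fun_on \<Omega> H \<Longrightarrow> vel_order r H \<Longrightarrow> near_smooth (\<lambda>\<tau>. H (jet \<tau>))"
  by (rule near_smooth_compose[OF \<Omega>(1) _ finite_vel_index _ open_U origin_U smooth_jet \<Omega>(2)])

lemma cmp_cong:
  assumes "smooth_fun_on \<Omega> H" "vel_order r H" "\<And>u. u \<in> \<Omega> \<Longrightarrow> H u = H' u"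
  shows "cmp H = cmp H'"
proof -
  let ?U = "{u\<in>U. jet u \<in> \<Omega>}"
  have U: "open ?U" by (rule open_preimage_smooth[OF open_U smooth_jet \<Omega>(1)])
  show ?thesis unfolding cmp_def
    by (rule abs_germ_eqI, rule germ_relI[OF U])
       (use assms \<Omega> origin_U in \<open>auto intro!: smooth_fun_on_compose[OF \<Omega>(1) assms(1) finite_vel_index assms(2) U]
          smooth_fun_on_subset[OF smooth_jet]\<close>)
qed

lemma cmp_value: "smooth_fun_on \<Omega> H \<Longrightarrow> vel_order r H \<Longrightarrow> germ_value (cmp H) = H (jet origin)"
  unfolding cmp_def by (rule germ_value_abs) (rule near_smooth_cmp)

lemma cmp_mult: "smooth_fun_on \<Omega> H \<Longrightarrow> vel_order r H \<Longrightarrow> smooth_fun_on \<Omega> H' \<Longrightarrow> vel_order r' H' \<Longrightarrow>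
    cmp (\<lambda>u. H u * H' u) = cmp H * cmp H'"
  unfolding cmp_def by (intro abs_germ_mult near_smooth_cmp)

lemma cmp_sum: "(\<And>x. x \<in> S \<Longrightarrow> smooth_fun_on \<Omega> (H x)) \<Longrightarrow> (\<And>x. x \<in> S \<Longrightarrow> vel_order r (H x)) \<Longrightarrow>
    cmp (\<lambda>u. \<Sum>x\<in>S. H x u) = (\<Sum>x\<in>S. cmp (H x))"
  unfolding cmp_def by (intro abs_germ_sum near_smooth_cmp)

lemma cmp_const: "cmp (\<lambda>u. c) = of_real c"
  unfolding cmp_def by (rule abs_germ_const)

lemma cmp_vpartial:
  assumes "smooth_fun_on \<Omega> H" "vel_order r H"
  shows "cmp (vpartial A J H) = index_weight J *\<^sub>R cmp (pderiv_at (A, mset J) H)"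
proof -
  have "cmp (vpartial A J H) = cmp (\<lambda>u. index_weight J) * cmp (pderiv_at (A, mset J) H)"
    unfolding vpartial_def
    by (rule cmp_mult[OF smooth_fun_on_const depends_on_const[of "vel_index 0"] smooth_fun_on_pderiv_at depends_on_pderiv_at])
       (rule \<Omega> assms)+
  then show ?thesis by (simp add: cmp_const scaleR_conv_of_real)
qed

text \<open>The direction \<open>k\<close> need not be one of the \<open>e i\<close>. For
  \<open>k = e i\<close> the formula gives the total derivative, and for the extra variable
  \<open>None\<close> of a varied curve it gives the first variation.\<close>

lemma germ_deriv_cmp:
  assumes "smooth_fun_on \<Omega> H" "vel_order r H" "r < s"
  shows "germ_deriv k (cmp H) = (\<Sum>A\<in>UNIV. \<Sum>J | length J < s. cmp (vpartial A J H) * foldr d J (germ_deriv k (abs_germ (\<lambda>\<tau>. \<Gamma> \<tau> A))))"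
proof -
  let ?I = "UNIV \<times> {K. size K < s}"
  have sub: "vel_index r \<subseteq> ?I" using assms(3) by (auto simp: vel_index_def)
  have dl_k: "germ_deriv k (foldr d J g) = foldr d J (germ_deriv k g)" for J g
    by (induction J) (simp_all add: germ_deriv_commute[where i = k])
  have "germ_deriv k (cmp H) = (\<Sum>\<kappa>\<in>?I. cmp (pderiv_at \<kappa> H) * germ_deriv k (cmp (\<lambda>u. u \<kappa>)))"
    unfolding cmp_def
    by (rule germ_chain[OF \<Omega>(1) assms(1) _ depends_on_mono[OF assms(2) sub] open_U origin_U smooth_jet \<Omega>(2)])
       (simp add: finite_msets)
  also have "\<dots> = (\<Sum>A\<in>UNIV. \<Sum>K | size K < s. cmp (pderiv_at (A, K) H) * germ_deriv k (cmp (\<lambda>u. u (A, K))))"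
    by (simp add: sum.cartesian_product)
  also have "\<dots> = (\<Sum>A\<in>UNIV. \<Sum>J | length J < s. index_weight J *\<^sub>R (cmp (pderiv_at (A, mset J) H) * germ_deriv k (cmp (\<lambda>u. u (A, mset J)))))"
    by (simp only: sum_index_weight[where G = "\<lambda>K. cmp (pderiv_at (_, K) H) * germ_deriv k (cmp (\<lambda>u. u (_, K)))"])
  also have "\<dots> = (\<Sum>A\<in>UNIV. \<Sum>J | length J < s. cmp (vpartial A J H) * foldr d J (germ_deriv k (abs_germ (\<lambda>\<tau>. \<Gamma> \<tau> A))))"
    by (simp only: cmp_coord dl_k cmp_vpartial[OF assms(1,2)] mult_scaleR_left)
  finally show ?thesis .
qed

text \<open>Along a curve the coordinate with index \<open>i # J\<close> is the derivative
  \<open>d i\<close> of the one with index \<open>J\<close>. The condition \<open>r < s\<close>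
  ensures that the words of length at most \<open>s - 1\<close> in \<open>dtotal\<close> reach every
  coordinate that \<open>H\<close> uses.\<close>

lemma d_cmp:
  assumes "smooth_fun_on \<Omega> H" "vel_order r H" "r < s"
  shows "d i (cmp H) = cmp (dtotal s i H)"
proof -
  have [simp]: "smooth_fun_on \<Omega> (vpartial A J H)" "vel_order r (vpartial A J H)" for A J
    using smooth_fun_on_vpartial[OF \<Omega>(1) assms(1)] vel_order_vpartial[OF assms(2)] by auto
  have o: "vel_order (Suc s) (vpartial A J H)" for A J
    using vel_order_mono[OF vel_order_vpartial[OF assms(2)], of "Suc s"] assms(3) by simp
  have c: "vel_order (Suc s) (\<lambda>u. u (A, mset (i # J)))" if "length J < s" for A J
    using that by (intro depends_on_coord) (auto simp: vel_index_def)
  have "cmp (dtotal s i H) = (\<Sum>A\<in>UNIV. \<Sum>J | length J < s. cmp (\<lambda>u. u (A, mset (i # J))) * cmp (vpartial A J H))"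
    unfolding dtotal_def
    by (subst cmp_sum[where r = "Suc s"], (intro smooth_fun_on_sum smooth_fun_on_mult smooth_fun_on_coord depends_on_sum depends_on_mult c o \<Omega>; simp)+)
       (intro sum.cong refl, subst cmp_sum[where r = "Suc s"],
        (intro smooth_fun_on_mult smooth_fun_on_coord depends_on_mult c o \<Omega>; simp)+,
        intro sum.cong refl cmp_mult[where r = "Suc s" and r' = "Suc s"] c o smooth_fun_on_coord \<Omega>, auto)
  also have "\<dots> = (\<Sum>A\<in>UNIV. \<Sum>J | length J < s. cmp (vpartial A J H) * foldr d J (d i (abs_germ (\<lambda>\<tau>. \<Gamma> \<tau> A))))"
    by (simp only: cmp_coord foldr.simps o_apply d_dl_commute mult.commute)
  also have "\<dots> = d i (cmp H)" by (rule germ_deriv_cmp[OF assms, symmetric])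
  finally show ?thesis ..
qed

text \<open>Each total derivative raises the order by one, and \<open>r + length J \<le> s\<close>
  keeps every intermediate function within the reach of \<open>dtotal s\<close>. This is the source
  of the bound \<open>2 * r \<le> s\<close>.\<close>

lemma foldr_dtotal:
  assumes "smooth_fun_on \<Omega> H" "vel_order r H" "r + length J \<le> s"
  shows "smooth_fun_on \<Omega> (foldr (dtotal s) J H) \<and> vel_order (r + length J) (foldr (dtotal s) J H) \<and>
    foldr d J (cmp H) = cmp (foldr (dtotal s) J H)"
  using assms(3)
proof (induction J)
  case Nil
  then show ?case using assms by simp
next
  case (Cons i J)
  then have IH: "smooth_fun_on \<Omega> (foldr (dtotal s) J H)" "vel_order (r + length J) (foldr (dtotal s) J H)"
    "foldr d J (cmp H) = cmp (foldr (dtotal s) J H)" by auto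
  show ?case
    using smooth_fun_on_dtotal[OF \<Omega>(1) IH(1)] vel_order_dtotal[OF IH(2)] d_cmp[OF IH(1,2), of s i] IH(3) Cons.prems
    by simp
qed

end

end

section \<open>The functions z and y, and the coordinates of the quotient\<close>

lemma smooth_fun_on_det:
  assumes "open \<Omega>" "\<And>i j. smooth_fun_on \<Omega> (\<lambda>u. M u $ i $ j)"
  shows "smooth_fun_on \<Omega> (\<lambda>u. det (M u :: real^'n^'n))"
  unfolding det_def
  by (intro smooth_fun_on_sum smooth_fun_on_mult smooth_fun_on_prod smooth_fun_on_const assms)

lemma smooth_fun_on_det_xmat: "open \<Omega> \<Longrightarrow> smooth_fun_on \<Omega> (\<lambda>u. det (xmat \<iota> u))"
  by (rule smooth_fun_on_det) (simp_all add: xmat_def smooth_fun_on_coord)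

lemma depends_on_comp: "depends_on K g \<Longrightarrow> depends_on K (\<lambda>u. f (g u))"
  unfolding depends_on_def by metis

lemma vel_order_xmat: "depends_on (vel_index 1) (xmat \<iota>)"
  by (auto simp: depends_on_def xmat_def vel_index_def vec_eq_iff)

definition reg_coords :: "('n::finite \<Rightarrow> 'a) \<Rightarrow> ('n, 'a) vcoords set" where
  "reg_coords \<iota> = {u. det (xmat \<iota> u) \<noteq> 0}"

lemma open_reg_coords: "open (reg_coords \<iota>)"
  unfolding reg_coords_def
  by (rule open_Collect_neq) (auto intro: smooth_fun_on_continuous smooth_fun_on_det_xmat)

lemma matrix_inv_det:
  fixes A :: "real^'n^'n"
  assumes "det A \<noteq> 0"
  shows "A ** matrix_inv A = mat 1" "matrix_inv A ** A = mat 1"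
proof -
  have "\<exists>A'. A ** A' = mat 1 \<and> A' ** A = mat 1"
    using assms by (simp flip: invertible_det_nz add: invertible_def)
  then show "A ** matrix_inv A = mat 1" "matrix_inv A ** A = mat 1"
    unfolding matrix_inv_def by (metis (mono_tags, lifting) someI_ex)+
qed

text \<open>\<open>matrix_inv\<close> is introduced by choice and says nothing about dependence on
  \<open>u\<close>. Cramer's rule writes its entries as polynomials divided by the determinant, from
  which smoothness can be read off.\<close>

lemma zmat_cramer:
  assumes "u \<in> reg_coords \<iota>"
  shows "zmat \<iota> i j u = det (\<chi> k l. if l = i then (if k = j then 1 else 0) else xmat \<iota> u $ k $ l) * inverse (det (xmat \<iota> u))"
proof -
  let ?A = "xmat \<iota> u"
  have det: "det ?A \<noteq> 0" using assms by (simp add: reg_coords_def)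
  have "?A *v column j (matrix_inv ?A) = axis j 1"
    using matrix_inv_det(1)[OF det] by (metis matrix_vector_mul_assoc matrix_vector_mult_basis matrix_vector_mul_lid)
  then have "column j (matrix_inv ?A) = (\<chi> k. det (\<chi> i l. if l = k then axis j 1 $ i else ?A $ i $ l) / det ?A)"
    using cramer[OF det] by blast
  then have "column j (matrix_inv ?A) $ i = det (\<chi> k l. if l = i then axis j 1 $ k else ?A $ k $ l) / det ?A" by simp
  moreover have "axis j 1 $ k = (if k = j then 1 else 0 :: real)" for k by (simp add: axis_def)
  ultimately show ?thesis by (simp add: zmat_def column_def divide_inverse cong: if_cong)
qed

lemma smooth_fun_on_zmat: "smooth_fun_on (reg_coords \<iota>) (zmat \<iota> i j)"
proof (rule smooth_fun_on_cong[OF open_reg_coords _ zmat_cramer[symmetric]])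
  show "smooth_fun_on (reg_coords \<iota>) (\<lambda>u. det (\<chi> k l. if l = i then (if k = j then 1 else 0) else xmat \<iota> u $ k $ l) * inverse (det (xmat \<iota> u)))"
  proof (intro smooth_fun_on_mult smooth_fun_on_inverse smooth_fun_on_det_xmat open_reg_coords smooth_fun_on_det)
    fix k l
    show "smooth_fun_on (reg_coords \<iota>) (\<lambda>u. (\<chi> k l. if l = i then (if k = j then 1 else 0) else xmat \<iota> u $ k $ l) $ k $ l)"
      by (cases "l = i") (simp_all add: smooth_fun_on_const smooth_fun_on_coord open_reg_coords xmat_def)
  qed (simp add: reg_coords_def)
qed

lemma vel_order_zmat: "vel_order 1 (zmat \<iota> i j)"
  unfolding zmat_def by (intro depends_on_comp[OF vel_order_xmat])

lemma zfun_props: "I \<noteq> [] \<Longrightarrow> smooth_fun_on (reg_coords \<iota>) (zfun \<iota> i I) \<and> vel_order (length I) (zfun \<iota> i I)"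
proof (induction \<iota> i I rule: zfun.induct)
  case (2 \<iota> i j)
  then show ?case using vel_order_zmat[of \<iota> i j] by (simp add: smooth_fun_on_zmat)
next
  case (3 \<iota> i j j' I)
  let ?l = "length (j # j' # I)"
  have IH: "smooth_fun_on (reg_coords \<iota>) (zfun \<iota> i (j' # I))" "vel_order (length (j' # I)) (zfun \<iota> i (j' # I))"
    using 3 by auto
  have "smooth_fun_on (reg_coords \<iota>) (zfun \<iota> i (j # j' # I))"
    by (simp only: zfun.simps) (intro smooth_fun_on_sum smooth_fun_on_mult smooth_fun_on_zmat smooth_fun_on_dtotal open_reg_coords IH)
  moreover have "vel_order ?l (zfun \<iota> i (j # j' # I))"
    using vel_order_dtotal[OF IH(2)] vel_order_mono[OF vel_order_zmat, of ?l]
    by (simp only: zfun.simps) (intro depends_on_sum depends_on_mult, auto)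
  ultimately show ?case by blast
qed simp

lemma yfun_props: "smooth_fun_on (reg_coords \<iota>) (yfun \<iota> \<sigma> I) \<and> vel_order (length I) (yfun \<iota> \<sigma> I)"
proof (induction I)
  case Nil
  have "vel_order 0 (\<lambda>u. u (\<sigma>, {#}) :: real)" by (rule depends_on_coord) (simp add: vel_index_def)
  then show ?case by (simp add: smooth_fun_on_coord open_reg_coords)
next
  case (Cons i I)
  let ?l = "length (i # I)"
  have "smooth_fun_on (reg_coords \<iota>) (yfun \<iota> \<sigma> (i # I))"
    by (simp only: yfun.simps) (intro smooth_fun_on_sum smooth_fun_on_mult smooth_fun_on_zmat smooth_fun_on_dtotal open_reg_coords conjunct1[OF Cons])
  moreover have "vel_order ?l (yfun \<iota> \<sigma> (i # I))"
    using vel_order_dtotal[OF conjunct2[OF Cons]] vel_order_mono[OF vel_order_zmat, of ?l]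
    by (simp only: yfun.simps) (intro depends_on_sum depends_on_mult, auto)
  ultimately show ?case by blast
qed

text \<open>The projection to the quotient in coordinates. It is controlled only on
  \<open>reg_coords\<close>, where the matrix of the \<open>x^i_j\<close> is invertible.\<close>

definition qmap :: "('n::finite \<Rightarrow> 'a::finite) \<Rightarrow> ('n, 'a) vcoords \<Rightarrow> ('n, 'a) qcoords" where
  "qmap \<iota> u = (\<lambda>k. case k of Inl i \<Rightarrow> u (\<iota> i, {#}) | Inr (\<sigma>, K) \<Rightarrow> yfun \<iota> \<sigma> (enum_mset K) u)"

lemma smooth_fun_on_qmap: "smooth_fun_on (reg_coords \<iota>) (\<lambda>u. qmap \<iota> u k)"
proof (cases k)
  case (Inl i)
  then show ?thesis by (simp add: qmap_def smooth_fun_on_coord open_reg_coords)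
next
  case (Inr p)
  then show ?thesis by (cases p) (simp add: qmap_def conjunct1[OF yfun_props])
qed

lemma finite_quot_index: "finite (quot_index r \<iota> :: ('n::finite + 'a::finite \<times> 'n multiset) set)"
proof -
  have "quot_index r \<iota> \<subseteq> range Inl \<union> Inr ` (UNIV \<times> {K :: 'n multiset. size K < Suc r})"
    by (auto simp: quot_index_def)
  moreover have "finite (range Inl \<union> Inr ` ((UNIV :: 'a set) \<times> {K :: 'n multiset. size K < Suc r}) :: ('n + 'a \<times> 'n multiset) set)"
    by (simp add: finite_msets)
  ultimately show ?thesis by (rule finite_subset)
qed

lemma quot_index_mono: "r \<le> r' \<Longrightarrow> quot_index r \<iota> \<subseteq> quot_index r' \<iota>"
  by (auto simp: quot_index_def)

abbreviation quot_order :: "('n \<Rightarrow> 'a) \<Rightarrow> nat \<Rightarrow> (('n, 'a) qcoords \<Rightarrow> real) \<Rightarrow> bool" where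
  "quot_order \<iota> r H \<equiv> depends_on (quot_index r \<iota>) H"

lemma quot_order_mono: "quot_order \<iota> r H \<Longrightarrow> r \<le> r' \<Longrightarrow> quot_order \<iota> r' H"
  by (rule depends_on_mono[OF _ quot_index_mono])

lemma quot_order_qpartial: "quot_order \<iota> r H \<Longrightarrow> quot_order \<iota> r (qpartial \<sigma> J H)"
  unfolding qpartial_def by (intro depends_on_mult depends_on_const depends_on_pderiv_at)

lemma qpartial_eq_0: "quot_order \<iota> r H \<Longrightarrow> r < length J \<Longrightarrow> qpartial \<sigma> J H u = 0"
  unfolding qpartial_def by (subst pderiv_at_eq_0[of "quot_index r \<iota>"]) (auto simp: quot_index_def)

lemma smooth_fun_on_qpartial: "open \<Omega> \<Longrightarrow> smooth_fun_on \<Omega> H \<Longrightarrow> smooth_fun_on \<Omega> (qpartial \<sigma> J H)"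
  unfolding qpartial_def
  by (intro smooth_fun_on_mult smooth_fun_on_const smooth_fun_on_pderiv_at)

lemma depends_on_add: "depends_on K f \<Longrightarrow> depends_on K g \<Longrightarrow> depends_on K (\<lambda>u. f u + g u :: real)"
  unfolding depends_on_def by metis

lemma quot_order_Dtotal:
  assumes "quot_order \<iota> r H"
  shows "quot_order \<iota> (Suc r) (Dtotal \<iota> s i H)"
  unfolding Dtotal_def
proof (intro depends_on_add depends_on_sum)
  show "quot_order \<iota> (Suc r) (pderiv_at (Inl i) H)"
    by (rule quot_order_mono[OF depends_on_pderiv_at[OF assms]]) simp
  fix \<sigma> J assume \<sigma>: "\<sigma> \<in> - range \<iota>"
  show "quot_order \<iota> (Suc r) (\<lambda>w. w (Inr (\<sigma>, mset (i # J))) * qpartial \<sigma> J H w)"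
  proof (cases "length J \<le> r")
    case True
    then show ?thesis using \<sigma>
      by (intro depends_on_mult depends_on_coord quot_order_mono[OF quot_order_qpartial[OF assms]])
         (auto simp: quot_index_def)
  next
    case False
    then show ?thesis using qpartial_eq_0[OF assms] by (simp add: depends_on_const)
  qed
qed

text \<open>The words \<open>i # J\<close> in \<open>Dtotal s\<close> have length at most
  \<open>s\<close>, so order \<open>s\<close> is never exceeded. This shows that
  \<open>quot_lie_euler\<close> at level \<open>s\<close> sees only the coordinates of order at most
  \<open>s\<close>.\<close>

lemma quot_order_Dtotal_le:
  fixes \<iota> :: "'n::finite \<Rightarrow> 'a::finite"
  assumes "quot_order \<iota> s H"
  shows "quot_order \<iota> s (Dtotal \<iota> s i H)"
  unfolding Dtotal_def
proof (intro depends_on_add depends_on_sum depends_on_pderiv_at[OF assms])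
  fix \<sigma> :: 'a and J :: "'n list" assume "\<sigma> \<in> - range \<iota>" "J \<in> {J. length J < s}"
  then show "quot_order \<iota> s (\<lambda>w. w (Inr (\<sigma>, mset (i # J))) * qpartial \<sigma> J H w)"
    by (intro depends_on_mult depends_on_coord quot_order_qpartial[OF assms]) (auto simp: quot_index_def)
qed

lemma smooth_fun_on_Dtotal: "open \<Omega> \<Longrightarrow> smooth_fun_on \<Omega> H \<Longrightarrow> smooth_fun_on \<Omega> (Dtotal \<iota> s i H)"
  unfolding Dtotal_def
  by (intro smooth_fun_on_add smooth_fun_on_sum smooth_fun_on_mult smooth_fun_on_coord smooth_fun_on_qpartial smooth_fun_on_pderiv_at)

section \<open>Curves whose x components form a local coordinate system\<close>

locale regular_curve = curve e \<Gamma> U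
  for e :: "'n::finite \<Rightarrow> 'k" and \<Gamma> :: "('k \<Rightarrow> real) \<Rightarrow> 'a::finite \<Rightarrow> real" and U +
  fixes \<iota> :: "'n \<Rightarrow> 'a"
  assumes inj_\<iota>: "inj \<iota>" and regular: "jet origin \<in> reg_coords \<iota>"
begin

definition comp :: "'a \<Rightarrow> 'k germ" where
  "comp A = abs_germ (\<lambda>\<tau>. \<Gamma> \<tau> A)"

lemmas reg = open_reg_coords regular
lemmas cmp_reg_cong = cmp_cong[OF reg]
lemmas cmp_reg_mult = cmp_mult[OF reg]
lemmas cmp_reg_sum = cmp_sum[OF reg]

lemma d_comp: "d j (comp A) = cmp (\<lambda>u. u (A, {#j#}))"
  using cmp_coord[of A "[j]"] by (simp add: comp_def)

lemma cmp_delta: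
  assumes "smooth_fun_on (reg_coords \<iota>) H" "vel_order r H" "\<And>u. u \<in> reg_coords \<iota> \<Longrightarrow> H u = (if b then 1 else 0)"
  shows "cmp H = (if b then 1 else 0)"
  using cmp_reg_cong[OF assms] cmp_const[OF reg, of "if b then 1 else 0"] by auto

lemma order1_coord: "vel_order 1 (\<lambda>u. u (A, {#j#}))"
  by (rule depends_on_coord) (simp add: vel_index_def)

text \<open>Along the curve the matrix \<open>xmat\<close> becomes the matrix of the derivatives of
  the \<open>x^k\<close>, so the two axioms are the two equations for its inverse, carried over to
  germs.\<close>

sublocale adapted_frame d "\<lambda>k. comp (\<iota> k)" "\<lambda>p i. cmp (zmat \<iota> p i)"
proof unfold_locales
  fix k i
  have "(\<Sum>j\<in>UNIV. d j (comp (\<iota> k)) * cmp (zmat \<iota> j i)) = cmp (\<lambda>u. \<Sum>j\<in>UNIV. u (\<iota> k, {#j#}) * zmat \<iota> j i u)"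
    unfolding d_comp
    by (subst cmp_reg_sum[where r = 1],
        (intro smooth_fun_on_mult smooth_fun_on_coord smooth_fun_on_zmat open_reg_coords depends_on_mult order1_coord vel_order_zmat)+)
       (simp only: cmp_reg_mult[OF smooth_fun_on_coord[OF open_reg_coords] order1_coord smooth_fun_on_zmat vel_order_zmat])
  also have "\<dots> = (if k = i then 1 else 0)"
  proof (rule cmp_delta[where r = 1])
    fix u assume u: "u \<in> reg_coords \<iota>"
    have "(xmat \<iota> u ** matrix_inv (xmat \<iota> u)) $ k $ i = (\<Sum>j\<in>UNIV. u (\<iota> k, {#j#}) * zmat \<iota> j i u)"
      by (simp add: matrix_matrix_mult_def zmat_def) (simp add: xmat_def)
    then show "(\<Sum>j\<in>UNIV. u (\<iota> k, {#j#}) * zmat \<iota> j i u) = (if k = i then 1 else 0)"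
      using u by (simp add: reg_coords_def matrix_inv_det mat_def)
  qed (intro smooth_fun_on_sum smooth_fun_on_mult smooth_fun_on_coord smooth_fun_on_zmat open_reg_coords
        depends_on_sum depends_on_mult order1_coord vel_order_zmat)+
  finally show "(\<Sum>j\<in>UNIV. d j (comp (\<iota> k)) * cmp (zmat \<iota> j i)) = (if k = i then 1 else 0)" .
next
  fix j k
  have "(\<Sum>i\<in>UNIV. cmp (zmat \<iota> j i) * d k (comp (\<iota> i))) = cmp (\<lambda>u. \<Sum>i\<in>UNIV. zmat \<iota> j i u * u (\<iota> i, {#k#}))"
    unfolding d_comp
    by (subst cmp_reg_sum[where r = 1],
        (intro smooth_fun_on_mult smooth_fun_on_coord smooth_fun_on_zmat open_reg_coords depends_on_mult order1_coord vel_order_zmat)+)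
       (simp only: cmp_reg_mult[OF smooth_fun_on_zmat vel_order_zmat smooth_fun_on_coord[OF open_reg_coords] order1_coord])
  also have "\<dots> = (if j = k then 1 else 0)"
  proof (rule cmp_delta[where r = 1])
    fix u assume u: "u \<in> reg_coords \<iota>"
    have "(matrix_inv (xmat \<iota> u) ** xmat \<iota> u) $ j $ k = (\<Sum>i\<in>UNIV. zmat \<iota> j i u * u (\<iota> i, {#k#}))"
      by (simp add: matrix_matrix_mult_def zmat_def) (simp add: xmat_def)
    then show "(\<Sum>i\<in>UNIV. zmat \<iota> j i u * u (\<iota> i, {#k#})) = (if j = k then 1 else 0)"
      using u by (simp add: reg_coords_def matrix_inv_det mat_def)
  qed (intro smooth_fun_on_sum smooth_fun_on_mult smooth_fun_on_coord smooth_fun_on_zmat open_reg_coords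
        depends_on_sum depends_on_mult order1_coord vel_order_zmat)+
  finally show "(\<Sum>i\<in>UNIV. cmp (zmat \<iota> j i) * d k (comp (\<iota> i))) = (if j = k then 1 else 0)" .
qed

lemma nab_cmp:
  assumes "smooth_fun_on (reg_coords \<iota>) H" "vel_order r H" "r < s"
  shows "nab i (cmp H) = cmp (\<lambda>u. \<Sum>p\<in>UNIV. zmat \<iota> p i u * dtotal s p H u)"
proof -
  have sm: "smooth_fun_on (reg_coords \<iota>) (dtotal s p H)" for p
    by (rule smooth_fun_on_dtotal[OF open_reg_coords assms(1)])
  have o: "vel_order (Suc r) (dtotal s p H)" "vel_order (Suc r) (zmat \<iota> p i)" for p
    by (rule vel_order_dtotal[OF assms(2)], rule vel_order_mono[OF vel_order_zmat], simp)
  have "cmp (\<lambda>u. \<Sum>p\<in>UNIV. zmat \<iota> p i u * dtotal s p H u) = (\<Sum>p\<in>UNIV. cmp (\<lambda>u. zmat \<iota> p i u * dtotal s p H u))"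
    by (rule cmp_reg_sum[where r = "Suc r"])
       (intro smooth_fun_on_mult smooth_fun_on_zmat sm o depends_on_mult open_reg_coords)+
  also have "\<dots> = (\<Sum>p\<in>UNIV. cmp (zmat \<iota> p i) * d p (cmp H))"
    by (intro sum.cong refl)
       (simp add: cmp_reg_mult[OF smooth_fun_on_zmat o(2) sm o(1)] d_cmp[OF reg assms])
  finally show ?thesis by (simp add: nab_def)
qed

text \<open>Both sides satisfy the same recursion, because \<open>nab_cmp\<close> identifies one
  step of \<open>zfun\<close>, taken at the order of the word, with one application of
  \<open>nab\<close>.\<close>

lemma cmp_zfun: "I \<noteq> [] \<Longrightarrow> cmp (zfun \<iota> j I) = zz j I"
proof (induction j I rule: zz.induct)
  case (3 j i i' I)
  then have "zz j (i # i' # I) = nab i (cmp (zfun \<iota> j (i' # I)))" by simp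
  also have "\<dots> = cmp (zfun \<iota> j (i # i' # I))"
    using zfun_props[of "i' # I" \<iota> j] by (subst nab_cmp[where s = "length (i # i' # I)"]) auto
  finally show ?case ..
qed auto

lemma cmp_yfun: "cmp (yfun \<iota> \<sigma> I) = nb.dl I (comp \<sigma>)"
proof (induction I)
  case Nil
  show ?case using cmp_coord[of \<sigma> "[]"] by (simp add: comp_def)
next
  case (Cons i I)
  have "nb.dl (i # I) (comp \<sigma>) = nab i (cmp (yfun \<iota> \<sigma> I))" using Cons by simp
  also have "\<dots> = cmp (yfun \<iota> \<sigma> (i # I))"
    using yfun_props[of \<iota> \<sigma> I] by (subst nab_cmp[where s = "length (i # I)"]) auto
  finally show ?case ..
qed

lemma jac_cmp: "jac = cmp (\<lambda>u. det (xmat \<iota> u))"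
proof -
  have ns: "near_smooth (\<lambda>\<tau>. jet \<tau> (A, {#j#}))" for A j
    by (rule near_smoothI[OF open_U origin_U smooth_jet])
  have "cmp (\<lambda>u. det (xmat \<iota> u)) = (\<Sum>p | p permutes UNIV. abs_germ (\<lambda>\<tau>. of_int (sign p) * (\<Prod>i\<in>UNIV. jet \<tau> (\<iota> i, {#p i#}))))"
    unfolding cmp_def det_def xmat_def
    by (simp, intro abs_germ_sum germ_rel_mult germ_rel_const near_smooth_prod ns)
  also have "\<dots> = (\<Sum>p | p permutes UNIV. of_int (sign p) * (\<Prod>i\<in>UNIV. d (p i) (comp (\<iota> i))))"
    unfolding d_comp cmp_def
    by (intro sum.cong refl) (simp add: abs_germ_mult germ_rel_const near_smooth_prod ns abs_germ_prod abs_germ_const)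
  finally show ?thesis by (simp add: jac_def det_def)
qed

definition U0 :: "('k \<Rightarrow> real) set" where
  "U0 = {\<tau>\<in>U. jet \<tau> \<in> reg_coords \<iota>}"

lemma U0: "open U0" "origin \<in> U0"
  unfolding U0_def using open_preimage_smooth[OF open_U smooth_jet open_reg_coords] origin_U regular by auto

lemma smooth_qjet: "smooth_fun_on U0 (\<lambda>\<tau>. qmap \<iota> (jet \<tau>) k)"
proof -
  obtain r where "vel_order r (\<lambda>u. qmap \<iota> u k)"
  proof (cases k)
    case (Inl i)
    then have "vel_order 0 (\<lambda>u. qmap \<iota> u k)"
      by (simp add: qmap_def) (rule depends_on_coord, simp add: vel_index_def)
    then show ?thesis using that by blast
  next
    case (Inr p)
    then show ?thesis using yfun_props that by (cases p) (auto simp: qmap_def)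
  qed
  then show ?thesis
  proof (rule smooth_fun_on_compose[OF open_reg_coords smooth_fun_on_qmap finite_vel_index _ U0(1), where q = jet])
    show "smooth_fun_on U0 (\<lambda>u. jet u k)" for k
      by (rule smooth_fun_on_subset[OF smooth_jet]) (simp add: U0_def)
    show "jet u \<in> reg_coords \<iota>" if "u \<in> U0" for u
      using that by (simp add: U0_def)
  qed
qed

definition cmq :: "(('n, 'a) qcoords \<Rightarrow> real) \<Rightarrow> 'k germ" where
  "cmq H = abs_germ (\<lambda>\<tau>. H (qmap \<iota> (jet \<tau>)))"

context
  fixes \<Omega> :: "('n, 'a) qcoords set"
  assumes \<Omega>: "open \<Omega>" "qmap \<iota> (jet origin) \<in> \<Omega>"
begin

lemma near_smooth_cmq: "smooth_fun_on \<Omega> H \<Longrightarrow> quot_order \<iota> r H \<Longrightarrow> near_smooth (\<lambda>\<tau>. H (qmap \<iota> (jet \<tau>)))"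
  by (rule near_smooth_compose[OF \<Omega>(1) _ finite_quot_index _ U0 smooth_qjet \<Omega>(2)])

lemma cmq_value: "smooth_fun_on \<Omega> H \<Longrightarrow> quot_order \<iota> r H \<Longrightarrow> germ_value (cmq H) = H (qmap \<iota> (jet origin))"
  unfolding cmq_def by (rule germ_value_abs) (rule near_smooth_cmq)

lemma cmq_mult: "smooth_fun_on \<Omega> H \<Longrightarrow> quot_order \<iota> r H \<Longrightarrow> smooth_fun_on \<Omega> H' \<Longrightarrow> quot_order \<iota> r' H' \<Longrightarrow>
    cmq (\<lambda>u. H u * H' u) = cmq H * cmq H'"
  unfolding cmq_def by (intro abs_germ_mult near_smooth_cmq)

lemma cmq_add: "smooth_fun_on \<Omega> H \<Longrightarrow> quot_order \<iota> r H \<Longrightarrow> smooth_fun_on \<Omega> H' \<Longrightarrow> quot_order \<iota> r' H' \<Longrightarrow>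
    cmq (\<lambda>u. H u + H' u) = cmq H + cmq H'"
  unfolding cmq_def by (intro abs_germ_add near_smooth_cmq)

lemma cmq_sum: "(\<And>x. x \<in> S \<Longrightarrow> smooth_fun_on \<Omega> (H x)) \<Longrightarrow> (\<And>x. x \<in> S \<Longrightarrow> quot_order \<iota> r (H x)) \<Longrightarrow>
    cmq (\<lambda>u. \<Sum>x\<in>S. H x u) = (\<Sum>x\<in>S. cmq (H x))"
  unfolding cmq_def by (intro abs_germ_sum near_smooth_cmq)

lemma cmq_const: "cmq (\<lambda>u. c) = of_real c"
  unfolding cmq_def by (rule abs_germ_const)

lemma cmq_qpartial:
  assumes "smooth_fun_on \<Omega> H" "quot_order \<iota> r H"
  shows "cmq (qpartial \<sigma> J H) = index_weight J *\<^sub>R cmq (pderiv_at (Inr (\<sigma>, mset J)) H)"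
proof -
  have "cmq (qpartial \<sigma> J H) = cmq (\<lambda>u. index_weight J) * cmq (pderiv_at (Inr (\<sigma>, mset J)) H)"
    unfolding qpartial_def
    by (rule cmq_mult[OF smooth_fun_on_const depends_on_const[of "quot_index 0 \<iota>"] smooth_fun_on_pderiv_at depends_on_pderiv_at])
       (rule \<Omega> assms)+
  then show ?thesis by (simp add: cmq_const scaleR_conv_of_real)
qed

lemma cmq_Inl: "cmq (\<lambda>w. w (Inl i)) = comp (\<iota> i)"
  using cmp_coord[of "\<iota> i" "[]"] by (simp add: cmq_def qmap_def cmp_def comp_def)

lemma cmq_Inr: "cmq (\<lambda>w. w (Inr (\<sigma>, mset J))) = nb.dl J (comp \<sigma>)"
proof -
  have "cmq (\<lambda>w. w (Inr (\<sigma>, mset J))) = nb.dl (enum_mset (mset J)) (comp \<sigma>)"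
    by (simp add: cmq_def qmap_def flip: cmp_yfun) (simp add: cmp_def)
  also have "\<dots> = nb.dl J (comp \<sigma>)" by (rule nb.dl_mset_cong) simp
  finally show ?thesis .
qed

lemma germ_deriv_cmq:
  assumes "smooth_fun_on \<Omega> H" "quot_order \<iota> r H" "r < s"
  shows "germ_deriv k (cmq H) = (\<Sum>i\<in>UNIV. cmq (pderiv_at (Inl i) H) * germ_deriv k (comp (\<iota> i))) +
    (\<Sum>\<sigma>\<in>- range \<iota>. \<Sum>J | length J < s. cmq (qpartial \<sigma> J H) * germ_deriv k (nb.dl J (comp \<sigma>)))"
proof -
  let ?T = "\<lambda>\<kappa>. cmq (pderiv_at \<kappa> H) * germ_deriv k (cmq (\<lambda>u. u \<kappa>))"
  let ?B = "(- range \<iota>) \<times> {K :: 'n multiset. size K < s}"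
  have sub: "quot_index r \<iota> \<subseteq> range Inl \<union> Inr ` ?B" using assms(3) by (auto simp: quot_index_def)
  have fin: "finite ?B" by (simp add: finite_msets)
  have "germ_deriv k (cmq H) = (\<Sum>\<kappa>\<in>range Inl \<union> Inr ` ?B. ?T \<kappa>)"
    unfolding cmq_def
    by (rule germ_chain[OF \<Omega>(1) assms(1) _ depends_on_mono[OF assms(2) sub] U0 smooth_qjet \<Omega>(2)])
       (simp add: fin)
  also have "\<dots> = (\<Sum>\<kappa>\<in>range Inl. ?T \<kappa>) + (\<Sum>\<kappa>\<in>Inr ` ?B. ?T \<kappa>)"
    by (rule sum.union_disjoint) (auto simp: fin)
  also have "(\<Sum>\<kappa>\<in>range Inl. ?T \<kappa>) = (\<Sum>i\<in>UNIV. cmq (pderiv_at (Inl i) H) * germ_deriv k (comp (\<iota> i)))"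
    by (subst sum.reindex) (auto simp: cmq_Inl)
  also have "(\<Sum>\<kappa>\<in>Inr ` ?B. ?T \<kappa>) = (\<Sum>(\<sigma>, K)\<in>?B. ?T (Inr (\<sigma>, K)))"
    by (subst sum.reindex) (auto intro!: sum.cong)
  also have "\<dots> = (\<Sum>\<sigma>\<in>- range \<iota>. \<Sum>K | size K < s. ?T (Inr (\<sigma>, K)))"
    by (simp add: sum.cartesian_product)
  also have "\<dots> = (\<Sum>\<sigma>\<in>- range \<iota>. \<Sum>J | length J < s. index_weight J *\<^sub>R ?T (Inr (\<sigma>, mset J)))"
    by (simp only: sum_index_weight[where G = "\<lambda>K. ?T (Inr (_, K))"])
  also have "\<dots> = (\<Sum>\<sigma>\<in>- range \<iota>. \<Sum>J | length J < s. cmq (qpartial \<sigma> J H) * germ_deriv k (nb.dl J (comp \<sigma>)))"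
    by (simp only: cmq_Inr cmq_qpartial[OF assms(1,2)] mult_scaleR_left)
  finally show ?thesis .
qed

text \<open>By the chain rule it is enough to know \<open>nab i\<close> on the coordinates: it is
  the unit vector on the \<open>x^k\<close>, and it adds the letter \<open>i\<close> to the index of
  each \<open>y^\<sigma>_J\<close>. These are exactly the coefficients of
  \<open>D_i\<close>.\<close>

lemma nab_cmq:
  assumes "smooth_fun_on \<Omega> H" "quot_order \<iota> r H" "r < s"
  shows "nab i (cmq H) = cmq (Dtotal \<iota> s i H)"
proof -
  have p: "smooth_fun_on \<Omega> (qpartial \<sigma> J H)" "quot_order \<iota> s (qpartial \<sigma> J H)" for \<sigma> J
    using smooth_fun_on_qpartial[OF \<Omega>(1) assms(1)] quot_order_mono[OF quot_order_qpartial[OF assms(2)], of s] assms(3) by auto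
  have c: "quot_order \<iota> s (\<lambda>w. w (Inr (\<sigma>, mset (i # J))))" if "length J < s" "\<sigma> \<in> - range \<iota>" for \<sigma> J
    using that by (intro depends_on_coord) (auto simp: quot_index_def)
  have 1: "nab i (cmq H) = (\<Sum>k\<in>UNIV. cmq (pderiv_at (Inl k) H) * nab i (comp (\<iota> k))) +
    (\<Sum>\<sigma>\<in>- range \<iota>. \<Sum>J | length J < s. cmq (qpartial \<sigma> J H) * nab i (nb.dl J (comp \<sigma>)))"
    unfolding nab_def germ_deriv_cmq[OF assms] distrib_left sum.distrib sum_distrib_left
    by (subst sum.swap, subst (2) sum.swap, subst (3) sum.swap) (simp add: algebra_simps)
  let ?t = "\<lambda>\<sigma> J w. w (Inr (\<sigma>, mset (i # J))) * qpartial \<sigma> J H w"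
  have tS: "smooth_fun_on \<Omega> (?t \<sigma> J)" for \<sigma> J
    by (intro smooth_fun_on_mult smooth_fun_on_coord p \<Omega>)
  have tO: "quot_order \<iota> s (?t \<sigma> J)" if "length J < s" "\<sigma> \<in> - range \<iota>" for \<sigma> J
    by (intro depends_on_mult c p that)
  have sS: "smooth_fun_on \<Omega> (\<lambda>w. \<Sum>J | length J < s. ?t \<sigma> J w)" for \<sigma>
    by (intro smooth_fun_on_sum tS \<Omega>)
  have sO: "quot_order \<iota> s (\<lambda>w. \<Sum>J | length J < s. ?t \<sigma> J w)" if "\<sigma> \<in> - range \<iota>" for \<sigma>
    by (intro depends_on_sum tO that) simp
  have in1: "cmq (\<lambda>w. \<Sum>J | length J < s. ?t \<sigma> J w) = (\<Sum>J | length J < s. cmq (?t \<sigma> J))"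
    if "\<sigma> \<in> - range \<iota>" for \<sigma>
    by (rule cmq_sum[OF tS tO]) (use that in simp_all)
  have in2: "cmq (\<lambda>w. \<Sum>\<sigma>\<in>- range \<iota>. \<Sum>J | length J < s. ?t \<sigma> J w) =
      (\<Sum>\<sigma>\<in>- range \<iota>. cmq (\<lambda>w. \<Sum>J | length J < s. ?t \<sigma> J w))"
    by (rule cmq_sum[OF sS sO])
  have "cmq (Dtotal \<iota> s i H) = cmq (pderiv_at (Inl i) H) + cmq (\<lambda>w. \<Sum>\<sigma>\<in>- range \<iota>. \<Sum>J | length J < s. ?t \<sigma> J w)"
    unfolding Dtotal_def
    by (rule cmq_add[OF smooth_fun_on_pderiv_at[OF assms(1)] depends_on_pderiv_at[OF assms(2)]
          smooth_fun_on_sum[OF \<Omega>(1) sS] depends_on_sum[OF sO]])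
  then have 2: "cmq (Dtotal \<iota> s i H) = cmq (pderiv_at (Inl i) H) +
      (\<Sum>\<sigma>\<in>- range \<iota>. \<Sum>J | length J < s. cmq (?t \<sigma> J))"
    by (simp only: in2) (simp only: in1 cong: sum.cong)
  have 3: "cmq (\<lambda>w. w (Inr (\<sigma>, mset (i # J))) * qpartial \<sigma> J H w) = cmq (qpartial \<sigma> J H) * nab i (nb.dl J (comp \<sigma>))"
    if "length J < s" "\<sigma> \<in> - range \<iota>" for \<sigma> J
    using cmq_mult[OF smooth_fun_on_coord[OF \<Omega>(1)] c[OF that] p] cmq_Inr[of \<sigma> "i # J"] by (simp add: mult.commute)
  show ?thesis unfolding 1 2
    by (rule arg_cong2[of _ _ _ _ "(+)"], simp add: nab_x if_distrib cong: if_cong, intro sum.cong refl 3[symmetric], simp_all)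
qed

lemma foldr_Dtotal:
  assumes "smooth_fun_on \<Omega> H" "quot_order \<iota> r H" "r + length J \<le> s"
  shows "smooth_fun_on \<Omega> (foldr (Dtotal \<iota> s) J H) \<and> quot_order \<iota> (r + length J) (foldr (Dtotal \<iota> s) J H) \<and>
    nb.dl J (cmq H) = cmq (foldr (Dtotal \<iota> s) J H)"
  using assms(3)
proof (induction J)
  case Nil
  then show ?case using assms by simp
next
  case (Cons i J)
  then have IH: "smooth_fun_on \<Omega> (foldr (Dtotal \<iota> s) J H)" "quot_order \<iota> (r + length J) (foldr (Dtotal \<iota> s) J H)"
    "nb.dl J (cmq H) = cmq (foldr (Dtotal \<iota> s) J H)" by auto
  show ?case
    using smooth_fun_on_Dtotal[OF \<Omega>(1) IH(1)] quot_order_Dtotal[OF IH(2)] nab_cmq[OF IH(1,2), of s i] IH(3) Cons.prems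
    by simp
qed

end

end

section \<open>First variation of a homogeneous Lagrangian\<close>

lemma germ_deriv_0 [simp]: "germ_deriv k 0 = 0"
  using germ_deriv_const[of k 0] by simp

definition drop_eps :: "('n option \<Rightarrow> real) \<Rightarrow> 'n \<Rightarrow> real" where
  "drop_eps \<tau> = (\<lambda>i. \<tau> (Some i))"

lemma drop_eps_ext0 [simp]: "drop_eps (ext0 t) = t"
  by (simp add: drop_eps_def ext0_def)

lemma ext0_None [simp]: "ext0 t None = 0"
  by (simp add: ext0_def)

lemma drop_eps_origin [simp]: "drop_eps origin = origin"
  by (simp add: drop_eps_def)

lemma open_drop_eps: "open U \<Longrightarrow> open (drop_eps -` U)"
proof (rule open_vimage)
  show "continuous_on UNIV (drop_eps :: ('n option \<Rightarrow> real) \<Rightarrow> _)"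
    unfolding drop_eps_def by (intro continuous_on_coordinatewise_then_product continuous_on_coord)
qed

lemma smooth_fun_on_drop_eps:
  fixes f :: "('n::finite \<Rightarrow> real) \<Rightarrow> real"
  assumes "open U" "smooth_fun_on U f"
  shows "smooth_fun_on (drop_eps -` U) (\<lambda>\<tau>. f (drop_eps \<tau>))"
  by (rule smooth_fun_on_compose[OF assms finite depends_on_UNIV open_drop_eps[OF assms(1)]])
     (use smooth_fun_on_coord[OF open_drop_eps[OF assms(1)]] in \<open>simp_all add: drop_eps_def\<close>)

lemma germ_deriv_None_drop_eps:
  fixes f :: "('n::finite \<Rightarrow> real) \<Rightarrow> real"
  assumes "open U" "origin \<in> U" "smooth_fun_on U f"
  shows "germ_deriv None (abs_germ (\<lambda>\<tau>. f (drop_eps \<tau>))) = 0"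
proof -
  have "near_smooth (\<lambda>\<tau>. f (drop_eps \<tau>))"
    by (rule near_smoothI[OF open_drop_eps[OF assms(1)] _ smooth_fun_on_drop_eps[OF assms(1,3)]]) (simp add: assms)
  moreover have "pderiv_at None (\<lambda>\<tau>. f (drop_eps \<tau>)) = (\<lambda>_. 0)"
    by (simp add: pderiv_at_def drop_eps_def fun_eq_iff)
  ultimately show ?thesis by (simp add: germ_deriv_abs abs_germ_const)
qed

text \<open>Only the component \<open>A\<close> is varied, so that the variation isolates the
  partial derivatives with respect to the \<open>x^A_J\<close>. The variable \<open>None\<close> is
  the parameter.\<close>

definition perturb :: "(('n \<Rightarrow> real) \<Rightarrow> 'a \<Rightarrow> real) \<Rightarrow> 'a \<Rightarrow> (('n \<Rightarrow> real) \<Rightarrow> real) \<Rightarrow> ('n option \<Rightarrow> real) \<Rightarrow> 'a \<Rightarrow> real" where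
  "perturb \<gamma> A \<xi> \<tau> B = \<gamma> (drop_eps \<tau>) B + (if B = A then \<tau> None * \<xi> (drop_eps \<tau>) else 0)"

lemma perturb_ext0: "perturb \<gamma> A \<xi> (ext0 t) B = \<gamma> t B"
  by (simp add: perturb_def)

lemma jet_of_perturb: "jet_of Some (perturb \<gamma> A \<xi>) (ext0 t) = jet_of (\<lambda>i. i) \<gamma> t"
proof -
  have "foldr pderiv_at (map Some ks) (\<lambda>\<tau>. perturb \<gamma> A \<xi> \<tau> B) (ext0 t) = foldr pderiv_at ks (\<lambda>t. \<gamma> t B) t" for ks B
    using fun_cong[OF foldr_pderiv_at_ext0[of ks "\<lambda>\<tau>. perturb \<gamma> A \<xi> \<tau> B"], of t] by (simp add: perturb_ext0)
  then show ?thesis by (auto simp: jet_of_def)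
qed

text \<open>\<open>F\<close> and \<open>G\<close> are the coordinate expressions of the homogeneous
  and the non-homogeneous Lagrangian, and \<open>FG\<close> is the factorization through the
  quotient on an open set. No reference to the manifold remains.\<close>

locale lagrangian_curve =
  fixes \<gamma> :: "('n::finite \<Rightarrow> real) \<Rightarrow> 'a::finite \<Rightarrow> real" and U and \<iota> :: "'n \<Rightarrow> 'a" and r :: nat
    and F :: "('n, 'a) vcoords \<Rightarrow> real" and G :: "('n, 'a) qcoords \<Rightarrow> real"
    and \<Omega>v :: "('n, 'a) vcoords set" and \<Omega>q :: "('n, 'a) qcoords set"
  assumes open_U: "open U" and origin_U: "origin \<in> U" and smooth_\<gamma>: "\<And>A. smooth_fun_on U (\<lambda>t. \<gamma> t A)"
    and inj_\<iota>: "inj \<iota>" and open_v: "open \<Omega>v" and open_q: "open \<Omega>q"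
    and F: "smooth_fun_on \<Omega>v F" "vel_order r F" and G: "smooth_fun_on \<Omega>q G" "quot_order \<iota> r G"
    and \<Omega>v_reg: "\<Omega>v \<subseteq> reg_coords \<iota>" and \<Omega>v_q: "\<And>u. u \<in> \<Omega>v \<Longrightarrow> qmap \<iota> u \<in> \<Omega>q"
    and FG: "\<And>u. u \<in> \<Omega>v \<Longrightarrow> F u = det (xmat \<iota> u) * G (qmap \<iota> u)"
    and jet_v: "jet_of (\<lambda>i. i) \<gamma> origin \<in> \<Omega>v"
begin

sublocale c0: regular_curve "\<lambda>i :: 'n. i" \<gamma> U \<iota>
  by unfold_locales (use open_U origin_U smooth_\<gamma> inj_\<iota> jet_v \<Omega>v_reg in auto)

text \<open>Both expressions for the Lagrangian are differentiated in the parameter along the varied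
  curve, and the parameter is then set to zero. For a transversal \<open>A\<close> every
  \<open>\<zeta> k\<close> vanishes and the divergence disappears; for \<open>A = \<iota> p\<close>
  only \<open>\<zeta> p\<close> is nonzero.\<close>

lemma variation:
  fixes A :: 'a
  assumes "open V" "origin \<in> V" "smooth_fun_on V \<xi>"
  defines "\<zeta> \<equiv> \<lambda>k. if \<iota> k = A then abs_germ \<xi> else 0"
  shows "(\<Sum>J | length J \<le> r. c0.cmp (vpartial A J F) * c0.dl J (abs_germ \<xi>)) =
    (\<Sum>j\<in>UNIV. c0.d j (\<Sum>k\<in>UNIV. c0.jac * c0.cmp (zmat \<iota> j k) * (\<zeta> k * c0.cmq G))) +
    c0.jac * (\<Sum>\<sigma>\<in>- range \<iota>. \<Sum>J | length J \<le> r. c0.cmq (qpartial \<sigma> J G) *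
      c0.nb.dl J ((if \<sigma> = A then abs_germ \<xi> else 0) - (\<Sum>k\<in>UNIV. \<zeta> k * c0.nab k (c0.comp \<sigma>))))"
proof -
  define \<Gamma> where "\<Gamma> = perturb \<gamma> A \<xi>"
  define U1 where "U1 = drop_eps -` (U \<inter> V)"
  have U1: "open U1" "origin \<in> U1"
    unfolding U1_def using assms open_U origin_U by (auto intro: open_drop_eps)
  have sm: "smooth_fun_on U1 (\<lambda>\<tau>. f (drop_eps \<tau>))" if "smooth_fun_on (U \<inter> V) f" for f
    unfolding U1_def using that assms open_U by (intro smooth_fun_on_drop_eps) auto
  have sm\<gamma>: "smooth_fun_on U1 (\<lambda>\<tau>. \<gamma> (drop_eps \<tau>) B)" for B
    by (rule sm, rule smooth_fun_on_subset[OF smooth_\<gamma>]) auto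
  have sm\<xi>: "smooth_fun_on U1 (\<lambda>\<tau>. \<xi> (drop_eps \<tau>))"
    by (rule sm, rule smooth_fun_on_subset[OF assms(3)]) auto
  have sm\<Gamma>: "smooth_fun_on U1 (\<lambda>\<tau>. \<Gamma> \<tau> B)" for B
    unfolding \<Gamma>_def perturb_def
    by (cases "B = A") (simp_all add: smooth_fun_on_add smooth_fun_on_mult smooth_fun_on_coord sm\<gamma> sm\<xi> U1 smooth_fun_on_const)
  have jet0: "jet_of Some \<Gamma> origin = jet_of (\<lambda>i. i) \<gamma> origin"
    using jet_of_perturb[of \<gamma> A \<xi> origin] by (simp add: \<Gamma>_def)
  interpret c1: regular_curve "Some :: 'n \<Rightarrow> 'n option" \<Gamma> U1 \<iota>
    by unfold_locales (use U1 sm\<Gamma> inj_\<iota> jet_v \<Omega>v_reg jet0 in auto)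
  have v1: "c1.jet origin \<in> \<Omega>v" and q1: "qmap \<iota> (c1.jet origin) \<in> \<Omega>q"
    using jet0 jet_v \<Omega>v_q by auto
  have q0: "qmap \<iota> (c0.jet origin) \<in> \<Omega>q" using jet_v \<Omega>v_q by auto
  let ?\<delta> = "germ_deriv (None :: 'n option)"
  let ?\<xi> = "abs_germ (\<lambda>\<tau>. \<xi> (drop_eps \<tau>))"
  have ns\<xi>: "near_smooth (\<lambda>\<tau>. \<xi> (drop_eps \<tau>))" by (rule near_smoothI[OF U1 sm\<xi>])
  \<comment> \<open>The varied component is \<open>\<gamma> + \<epsilon> \<xi>\<close> with both
    functions independent of the parameter, so its derivative in the parameter is exactly
    \<open>\<xi>\<close>.\<close>
  have \<delta>comp: "?\<delta> (c1.comp B) = (if B = A then ?\<xi> else 0)" for B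
  proof -
    have ns\<gamma>: "near_smooth (\<lambda>\<tau>. \<gamma> (drop_eps \<tau>) B)" by (rule near_smoothI[OF U1 sm\<gamma>])
    have "c1.comp B = abs_germ (\<lambda>\<tau>. \<gamma> (drop_eps \<tau>) B) + (if B = A then germ_var None * ?\<xi> else 0)"
      unfolding c1.comp_def unfolding \<Gamma>_def perturb_def
      using abs_germ_add[OF ns\<gamma> germ_rel_mult[OF near_smooth_coord ns\<xi>]] abs_germ_mult[OF near_smooth_coord ns\<xi>]
      by (auto simp: germ_var_def)
    then show ?thesis
      using germ_deriv_None_drop_eps[OF open_U origin_U smooth_\<gamma>] germ_deriv_None_drop_eps[OF assms(1-3)]
      by (simp add: germ_deriv_add germ_deriv_mult germ_deriv_var)
  qed
  have "c1.cmp F = c1.cmp (\<lambda>u. det (xmat \<iota> u) * G (qmap \<iota> u))"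
    by (rule c1.cmp_cong[OF open_v v1 F FG])
  also have "\<dots> = c1.jac * c1.cmq G"
    unfolding c1.jac_cmp unfolding c1.cmp_def c1.cmq_def
    by (rule abs_germ_mult[OF c1.near_smooth_cmp[OF c1.reg smooth_fun_on_det_xmat depends_on_comp[OF vel_order_xmat]]
          c1.near_smooth_cmq[OF open_q q1 G]]) (rule open_reg_coords)
  finally have cmpF: "c1.cmp F = c1.jac * c1.cmq G" .
  \<comment> \<open>The velocity side of the variation: \<open>germ_deriv_cmp\<close> in the
    direction of the parameter, where only the component \<open>A\<close> contributes.\<close>
  have lhs: "?\<delta> (c1.cmp F) = (\<Sum>J | length J \<le> r. c1.cmp (vpartial A J F) * c1.dl J ?\<xi>)"
  proof -
    have "?\<delta> (c1.cmp F) = (\<Sum>B\<in>UNIV. \<Sum>J | length J < Suc r. c1.cmp (vpartial B J F) * c1.dl J (if B = A then ?\<xi> else 0))"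
      using c1.germ_deriv_cmp[OF open_v v1 F, of "Suc r" None] by (simp add: \<delta>comp flip: c1.comp_def)
    also have "\<dots> = (\<Sum>B\<in>UNIV. if B = A then \<Sum>J | length J \<le> r. c1.cmp (vpartial A J F) * c1.dl J ?\<xi> else 0)"
      by (intro sum.cong refl) (auto simp: less_Suc_eq_le)
    finally show ?thesis by simp
  qed
  \<comment> \<open>The quotient side. \<open>germ_deriv_cmq\<close> supplies the chain rule both
    for the parameter and for the directions of the curve, with the same coefficients.\<close>
  have "?\<delta> (c1.jac * c1.cmq G) = (\<Sum>j\<in>UNIV. c1.d j (\<Sum>k\<in>UNIV. c1.jac * c1.cmp (zmat \<iota> j k) * (?\<delta> (c1.comp (\<iota> k)) * c1.cmq G)))
    + c1.jac * (\<Sum>\<sigma>\<in>- range \<iota>. \<Sum>J\<in>{J. length J < Suc r}. c1.cmq (qpartial \<sigma> J G) *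
      c1.nb.dl J (?\<delta> (c1.comp \<sigma>) - (\<Sum>k\<in>UNIV. ?\<delta> (c1.comp (\<iota> k)) * c1.nab k (c1.comp \<sigma>))))"
    by (rule c1.first_variation[where a = "\<lambda>k. c1.cmq (pderiv_at (Inl k) G)"])
       (rule germ_deriv_add germ_deriv_mult germ_deriv_commute c1.germ_deriv_cmq[OF open_q q1 G lessI])+
  then have main: "(\<Sum>J | length J \<le> r. c1.cmp (vpartial A J F) * c1.dl J ?\<xi>) =
    (\<Sum>j\<in>UNIV. c1.d j (\<Sum>k\<in>UNIV. c1.jac * c1.cmp (zmat \<iota> j k) * ((if \<iota> k = A then ?\<xi> else 0) * c1.cmq G)))
    + c1.jac * (\<Sum>\<sigma>\<in>- range \<iota>. \<Sum>J | length J \<le> r. c1.cmq (qpartial \<sigma> J G) *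
      c1.nb.dl J ((if \<sigma> = A then ?\<xi> else 0) - (\<Sum>k\<in>UNIV. (if \<iota> k = A then ?\<xi> else 0) * c1.nab k (c1.comp \<sigma>))))"
    unfolding lhs[symmetric] cmpF \<delta>comp less_Suc_eq_le .
  \<comment> \<open>Setting the parameter to zero is compatible with products, sums and the
    derivatives along the curve, so the equation for the varied curve descends term by term to the
    original one.\<close>
  have jets: "c1.jet (ext0 t) = c0.jet t" and comps: "\<Gamma> (ext0 t) B = \<gamma> t B" for t B
    unfolding \<Gamma>_def by (rule jet_of_perturb perturb_ext0)+
  have r_cmp: "germ_restrict (c1.cmp H) = c0.cmp H" if "near_smooth (\<lambda>\<tau>. H (c1.jet \<tau>))" for H
    by (simp only: c1.cmp_def c0.cmp_def germ_restrict_abs[OF that] jets)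
  have r_cmq: "germ_restrict (c1.cmq H) = c0.cmq H" if "near_smooth (\<lambda>\<tau>. H (qmap \<iota> (c1.jet \<tau>)))" for H
    by (simp only: c1.cmq_def c0.cmq_def germ_restrict_abs[OF that] jets)
  have r_P: "germ_restrict (c1.cmp (vpartial A J F)) = c0.cmp (vpartial A J F)" for J
    by (rule r_cmp, rule c1.near_smooth_cmp[OF open_v v1 smooth_fun_on_vpartial[OF open_v F(1)] vel_order_vpartial[OF F(2)]])
  have r_Q: "germ_restrict (c1.cmq (qpartial \<sigma> J G)) = c0.cmq (qpartial \<sigma> J G)" for \<sigma> J
    by (rule r_cmq, rule c1.near_smooth_cmq[OF open_q q1 smooth_fun_on_qpartial[OF open_q G(1)] quot_order_qpartial[OF G(2)]])
  have r_G: "germ_restrict (c1.cmq G) = c0.cmq G"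
    by (rule r_cmq, rule c1.near_smooth_cmq[OF open_q q1 G])
  have r_z: "germ_restrict (c1.cmp (zmat \<iota> p i)) = c0.cmp (zmat \<iota> p i)" for p i
    by (rule r_cmp, rule c1.near_smooth_cmp[OF c1.reg smooth_fun_on_zmat vel_order_zmat])
  have r_jac: "germ_restrict c1.jac = c0.jac"
    unfolding c0.jac_cmp c1.jac_cmp
    by (rule r_cmp, rule c1.near_smooth_cmp[OF c1.reg smooth_fun_on_det_xmat[OF open_reg_coords] depends_on_comp[OF vel_order_xmat]])
  have r_\<xi>: "germ_restrict ?\<xi> = abs_germ \<xi>"
    by (simp add: germ_restrict_abs[OF ns\<xi>])
  have r_comp: "germ_restrict (c1.comp B) = c0.comp B" for B
    by (simp only: c1.comp_def c0.comp_def germ_restrict_abs[OF c1.near_smooth_\<Gamma>] comps)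
  have r_dl: "germ_restrict (c1.dl J f) = c0.dl J (germ_restrict f)" for J f
    by (induction J) auto
  have r_nab: "germ_restrict (c1.nab i f) = c0.nab i (germ_restrict f)" for i f
    by (simp add: c1.nab_def c0.nab_def r_z)
  have r_nabl: "germ_restrict (c1.nb.dl J f) = c0.nb.dl J (germ_restrict f)" for J f
    by (induction J) (auto simp: r_nab)
  have r_if: "germ_restrict (if b then f else 0) = (if b then germ_restrict f else 0)" for b f
    by simp
  from arg_cong[OF main, of germ_restrict] show ?thesis
    by (simp add: \<zeta>_def r_P r_Q r_G r_z r_jac r_\<xi> r_comp r_dl r_nab r_nabl r_if cong: if_cong)
qed

lemma mset_inv_vpartial: "mset_inv (\<lambda>J. c0.cmp (vpartial A J F))"
  unfolding mset_inv_def
proof (intro allI impI)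
  fix I J :: "'n list" assume eq: "mset I = mset J"
  show "c0.cmp (vpartial A I F) = c0.cmp (vpartial A J F)"
    unfolding vpartial_def index_weight_cong[OF eq] eq ..
qed

lemma mset_inv_qpartial: "mset_inv (\<lambda>J. c0.cmq (qpartial \<sigma> J G))"
  unfolding mset_inv_def
proof (intro allI impI)
  fix I J :: "'n list" assume eq: "mset I = mset J"
  show "c0.cmq (qpartial \<sigma> I G) = c0.cmq (qpartial \<sigma> J G)"
    unfolding qpartial_def index_weight_cong[OF eq] eq ..
qed

abbreviation "u0 \<equiv> c0.jet origin"

lemma value_lie_euler:
  assumes "2 * r \<le> s"
  shows "germ_value (c0.binom_op r (- 1) (\<lambda>J. c0.cmp (vpartial A J F)) I) = lie_euler r s A I F u0"
proof -
  have "germ_value (c0.dl J (c0.cmp (vpartial A (I @ J) F))) = foldr (dtotal s) J (vpartial A (I @ J) F) u0"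
    if "length I + length J \<le> r" for J
  proof -
    \<comment> \<open>A partial derivative of \<open>F\<close> still has order \<open>r\<close>, and
      at most \<open>r\<close> total derivatives act on it.\<close>
    have "r + length J \<le> s" using that assms by linarith
    from c0.foldr_dtotal[OF open_v jet_v smooth_fun_on_vpartial[OF open_v F(1)] vel_order_vpartial[OF F(2)] this]
    show ?thesis using c0.cmp_value[OF open_v jet_v] by auto
  qed
  then show ?thesis by (simp add: c0.binom_op_def lie_euler_def)
qed

lemma value_quot_lie_euler:
  assumes "2 * r \<le> s"
  shows "germ_value (c0.nb.binom_op r (- 1) (\<lambda>J. c0.cmq (qpartial \<sigma> J G)) I) = quot_lie_euler \<iota> r s \<sigma> I G (qmap \<iota> u0)"
proof -
  have q0: "qmap \<iota> u0 \<in> \<Omega>q" using jet_v \<Omega>v_q by auto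
  have "germ_value (c0.nb.dl J (c0.cmq (qpartial \<sigma> (I @ J) G))) = foldr (Dtotal \<iota> s) J (qpartial \<sigma> (I @ J) G) (qmap \<iota> u0)"
    if "length I + length J \<le> r" for J
  proof -
    have "r + length J \<le> s" using that assms by linarith
    from c0.foldr_Dtotal[OF open_q q0 smooth_fun_on_qpartial[OF open_q G(1)] quot_order_qpartial[OF G(2)] this]
    show ?thesis using c0.cmq_value[OF open_q q0] by auto
  qed
  then show ?thesis by (simp add: c0.nb.binom_op_def quot_lie_euler_def)
qed

text \<open>The factor \<open>fact (length js)\<close> counts the numberings of the blocks and
  cancels the denominator in \<open>pulled_coeff\<close>.\<close>

lemma value_V: "germ_value (c0.V I js) = fact (length js) * part_sum (\<lambda>j I. zfun \<iota> j I u0) I js"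
proof -
  have "germ_value (c0.V I js) = (\<Sum>fs | length fs = length I \<and> set fs = {..<length js}.
      \<Prod>l<length js. germ_value (c0.zz (js ! l) (sub_word I fs l)))"
    unfolding c0.V_def by (subst c0.VB_words) auto
  also have "\<dots> = (\<Sum>fs | length fs = length I \<and> set fs = {..<length js}.
      \<Prod>l<length js. zfun \<iota> (js ! l) (sub_word I fs l) u0)"
  proof (intro sum.cong prod.cong refl)
    fix fs l assume "fs \<in> {fs. length fs = length I \<and> set fs = {..<length js}}" "l \<in> {..<length js}"
    then have ne: "sub_word I fs l \<noteq> []" by (auto simp: sub_word_eq_Nil)
    show "germ_value (c0.zz (js ! l) (sub_word I fs l)) = zfun \<iota> (js ! l) (sub_word I fs l) u0"
      unfolding c0.cmp_zfun[OF ne, symmetric]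
      by (rule c0.cmp_value[OF c0.reg conjunct1[OF zfun_props[OF ne]] conjunct2[OF zfun_props[OF ne]]])
  qed
  finally show ?thesis by (simp add: part_sum_words)
qed

theorem lie_euler_transform:
  assumes r: "r \<ge> 1" and s: "2 * r \<le> s" and js: "length js \<le> r"
  shows "lie_euler r s A js F u0 =
    (case js of [j] \<Rightarrow> det (xmat \<iota> u0) * (\<Sum>k\<in>UNIV. if \<iota> k = A then zmat \<iota> j k u0 else 0) * G (qmap \<iota> u0) | _ \<Rightarrow> 0) +
    (\<Sum>\<sigma>\<in>- range \<iota>. ((if \<sigma> = A then 1 else 0) - (\<Sum>k\<in>UNIV. if \<iota> k = A then yfun \<iota> \<sigma> [k] u0 else 0)) *
      ((- 1) ^ length js * det (xmat \<iota> u0) * (\<Sum>I\<in>multi_indices (length js) r.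
        (- 1) ^ length I * part_sum (\<lambda>j I. zfun \<iota> j I u0) I js * quot_lie_euler \<iota> r s \<sigma> I G (qmap \<iota> u0))))"
proof -
  have q0: "qmap \<iota> u0 \<in> \<Omega>q" using jet_v \<Omega>v_q by auto
  let ?i = "\<lambda>b. if b then 1 else 0 :: 'n germ"
  \<comment> \<open>Germs are free to be any test function, so \<open>variation\<close> can be read
    as an identity linear in \<open>\<xi>\<close>: \<open>b\<close> collects the coefficient under
    the divergence, and \<open>w\<close> the coefficient of the vertical variation. Their values are
    \<open>det(x) z^j_p L\<close> and \<open>- y^\<sigma>_p\<close> for
    \<open>A = \<iota> p\<close>, and zero and a Kronecker delta for transversal
    \<open>A\<close>.\<close>
  define b where "b j = (\<Sum>k\<in>UNIV. c0.jac * c0.cmp (zmat \<iota> j k) * (?i (\<iota> k = A) * c0.cmq G))" for j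
  define w where "w \<sigma> = ?i (\<sigma> = A) - (\<Sum>k\<in>UNIV. ?i (\<iota> k = A) * c0.nab k (c0.comp \<sigma>))" for \<sigma>
  have var: "(\<Sum>J | length J \<le> r. c0.cmp (vpartial A J F) * c0.dl J \<xi>) =
    (\<Sum>j\<in>UNIV. c0.d j (b j * \<xi>)) + c0.jac * (\<Sum>\<sigma>\<in>- range \<iota>. \<Sum>J | length J \<le> r. c0.cmq (qpartial \<sigma> J G) * c0.nb.dl J (w \<sigma> * \<xi>))" for \<xi>
  proof -
    obtain f where f: "near_smooth f" "\<xi> = abs_germ f" by (rule germ_cases)
    then obtain V where V: "open V" "origin \<in> V" "smooth_fun_on V f" unfolding germ_rel_def by blast
    have i: "(if b then \<xi> else 0) = ?i b * \<xi>" for b by simp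
    have "b j * \<xi> = (\<Sum>k\<in>UNIV. c0.jac * c0.cmp (zmat \<iota> j k) * (?i (\<iota> k = A) * \<xi> * c0.cmq G))" for j
      unfolding b_def sum_distrib_right by (rule sum.cong[OF refl]) (simp only: mult_ac)
    moreover have "w \<sigma> * \<xi> = ?i (\<sigma> = A) * \<xi> - (\<Sum>k\<in>UNIV. ?i (\<iota> k = A) * \<xi> * c0.nab k (c0.comp \<sigma>))" for \<sigma>
      unfolding w_def left_diff_distrib sum_distrib_right
      by (rule arg_cong2[of _ _ _ _ "(-)", OF refl], rule sum.cong[OF refl]) (simp only: mult_ac)
    ultimately show ?thesis using variation[OF V, of A] unfolding f(2)[symmetric] i by (simp only:)
  qed
  have "c0.binom_op r (- 1) (\<lambda>J. c0.cmp (vpartial A J F)) js = (case js of [j] \<Rightarrow> b j | _ \<Rightarrow> 0) +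
      (\<Sum>\<sigma>\<in>- range \<iota>. w \<sigma> * c0.pulled_coeff r (\<lambda>J. c0.cmq (qpartial \<sigma> J G)) js)"
    by (rule c0.euler_transform[OF mset_inv_vpartial mset_inv_qpartial _ r var js, where t = germ_var])
       (simp add: germ_deriv_var)
  from arg_cong[OF this, of germ_value]
  have main: "lie_euler r s A js F u0 = germ_value (case js of [j] \<Rightarrow> b j | _ \<Rightarrow> 0) +
      (\<Sum>\<sigma>\<in>- range \<iota>. germ_value (w \<sigma>) * germ_value (c0.pulled_coeff r (\<lambda>J. c0.cmq (qpartial \<sigma> J G)) js))"
    by (simp add: value_lie_euler[OF s])
  have v_jac: "germ_value c0.jac = det (xmat \<iota> u0)"
    unfolding c0.jac_cmp
    by (rule c0.cmp_value[OF c0.reg smooth_fun_on_det_xmat[OF open_reg_coords] depends_on_comp[OF vel_order_xmat]])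
  have v_z: "germ_value (c0.cmp (zmat \<iota> j k)) = zmat \<iota> j k u0" for j k
    by (rule c0.cmp_value[OF c0.reg smooth_fun_on_zmat vel_order_zmat])
  have v_G: "germ_value (c0.cmq G) = G (qmap \<iota> u0)"
    by (rule c0.cmq_value[OF open_q q0 G])
  have v_y: "germ_value (c0.nab k (c0.comp \<sigma>)) = yfun \<iota> \<sigma> [k] u0" for k \<sigma>
    using c0.cmp_value[OF c0.reg conjunct1[OF yfun_props] conjunct2[OF yfun_props], of \<sigma> "[k]"]
    by (simp only: c0.cmp_yfun) simp
  have v_i: "germ_value (?i b) = (if b then 1 else 0)" for b by simp
  have v_b: "germ_value (b j) = det (xmat \<iota> u0) * (\<Sum>k\<in>UNIV. if \<iota> k = A then zmat \<iota> j k u0 else 0) * G (qmap \<iota> u0)" for j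
    unfolding b_def sum_distrib_left sum_distrib_right germ_value_sum
    by (rule sum.cong[OF refl]) (simp add: v_jac v_z v_G)
  have v_w: "germ_value (w \<sigma>) = (if \<sigma> = A then 1 else 0) - (\<Sum>k\<in>UNIV. if \<iota> k = A then yfun \<iota> \<sigma> [k] u0 else 0)" for \<sigma>
  proof -
    have "germ_value (w \<sigma>) = (if \<sigma> = A then 1 else 0) - (\<Sum>k\<in>UNIV. germ_value (?i (\<iota> k = A) * c0.nab k (c0.comp \<sigma>)))"
      unfolding w_def germ_value_diff germ_value_sum v_i ..
    also have "(\<Sum>k\<in>UNIV. germ_value (?i (\<iota> k = A) * c0.nab k (c0.comp \<sigma>))) = (\<Sum>k\<in>UNIV. if \<iota> k = A then yfun \<iota> \<sigma> [k] u0 else 0)"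
      by (rule sum.cong[OF refl]) (simp only: germ_value_mult v_i v_y, simp)
    finally show ?thesis .
  qed
  have v_pc: "germ_value (c0.pulled_coeff r (\<lambda>J. c0.cmq (qpartial \<sigma> J G)) js) =
     (- 1) ^ length js * det (xmat \<iota> u0) * (\<Sum>I\<in>multi_indices (length js) r.
        (- 1) ^ length I * part_sum (\<lambda>j I. zfun \<iota> j I u0) I js * quot_lie_euler \<iota> r s \<sigma> I G (qmap \<iota> u0))" for \<sigma>
    unfolding c0.pulled_coeff_def germ_value_sum sum_distrib_left
    by (rule sum.cong[OF refl]) (simp add: v_jac value_V value_quot_lie_euler[OF s])
  have "germ_value (case js of [j] \<Rightarrow> b j | _ \<Rightarrow> 0) = (case js of [j] \<Rightarrow> germ_value (b j) | _ \<Rightarrow> 0)"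
    by (simp split: list.split)
  then show ?thesis unfolding main v_w v_pc v_b by simp
qed

end

section \<open>Invariance under reparametrisation\<close>

definition germ_jet_eq :: "nat \<Rightarrow> 'k germ \<Rightarrow> 'k germ \<Rightarrow> bool" where
  "germ_jet_eq r a b \<longleftrightarrow> (\<forall>J. length J \<le> r \<longrightarrow> germ_value (foldr germ_deriv J a) = germ_value (foldr germ_deriv J b))"

lemma germ_jet_eq_0: "germ_jet_eq 0 a b \<longleftrightarrow> germ_value a = germ_value b"
  by (simp add: germ_jet_eq_def)

lemma germ_jet_eq_Suc:
  "germ_jet_eq (Suc r) a b \<longleftrightarrow> germ_value a = germ_value b \<and> (\<forall>i. germ_jet_eq r (germ_deriv i a) (germ_deriv i b))"
proof
  assume *: "germ_jet_eq (Suc r) a b"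
  have "germ_value (foldr germ_deriv J (germ_deriv i a)) = germ_value (foldr germ_deriv J (germ_deriv i b))"
    if "length J \<le> r" for J i
    using *[unfolded germ_jet_eq_def, rule_format, of "J @ [i]"] that by simp
  then show "germ_value a = germ_value b \<and> (\<forall>i. germ_jet_eq r (germ_deriv i a) (germ_deriv i b))"
    using *[unfolded germ_jet_eq_def, rule_format, of "[]"] by (simp add: germ_jet_eq_def)
next
  assume *: "germ_value a = germ_value b \<and> (\<forall>i. germ_jet_eq r (germ_deriv i a) (germ_deriv i b))"
  show "germ_jet_eq (Suc r) a b"
    unfolding germ_jet_eq_def
  proof (intro allI impI)
    fix J :: "'a list" assume "length J \<le> Suc r"
    then show "germ_value (foldr germ_deriv J a) = germ_value (foldr germ_deriv J b)"
      using * by (cases J rule: rev_cases) (auto simp: germ_jet_eq_def)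
  qed
qed

lemma germ_jet_eq_mono: "germ_jet_eq r a b \<Longrightarrow> r' \<le> r \<Longrightarrow> germ_jet_eq r' a b"
  unfolding germ_jet_eq_def by auto

lemma germ_jet_eq_refl: "germ_jet_eq r a a"
  by (simp add: germ_jet_eq_def)

lemma germ_jet_eq_add: "germ_jet_eq r a b \<Longrightarrow> germ_jet_eq r a' b' \<Longrightarrow> germ_jet_eq r (a + a') (b + b')"
  by (induction r arbitrary: a b a' b') (auto simp: germ_jet_eq_0 germ_jet_eq_Suc germ_deriv_add)

lemma germ_jet_eq_sum: "(\<And>x. x \<in> S \<Longrightarrow> germ_jet_eq r (f x) (g x)) \<Longrightarrow> germ_jet_eq r (sum f S) (sum g S)"
  by (induction S rule: infinite_finite_induct) (auto intro: germ_jet_eq_refl germ_jet_eq_add)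

lemma germ_jet_eq_mult: "germ_jet_eq r a b \<Longrightarrow> germ_jet_eq r a' b' \<Longrightarrow> germ_jet_eq r (a * a') (b * b')"
proof (induction r arbitrary: a b a' b')
  case (Suc r)
  then have "germ_jet_eq r a b" "germ_jet_eq r a' b'" by (auto elim: germ_jet_eq_mono)
  then show ?case using Suc by (auto simp: germ_jet_eq_Suc germ_deriv_mult intro!: germ_jet_eq_add)
qed (simp add: germ_jet_eq_0)

text \<open>Jets of composites are compared by induction on the order through one application of the
  chain rule at a time, which avoids an explicit formula for higher derivatives of a
  composite.\<close>

lemma germ_jet_eq_compose:
  fixes H :: "('i::finite \<Rightarrow> real) \<Rightarrow> real" and q q' :: "('k \<Rightarrow> real) \<Rightarrow> 'i \<Rightarrow> real"
  assumes \<Omega>: "open \<Omega>" "q origin \<in> \<Omega>" and U: "open U" "origin \<in> U"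
    and q: "\<And>k. smooth_fun_on U (\<lambda>t. q t k)" "\<And>k. smooth_fun_on U (\<lambda>t. q' t k)"
    and eq: "\<And>k. germ_jet_eq r (abs_germ (\<lambda>t. q t k)) (abs_germ (\<lambda>t. q' t k))"
    and H: "smooth_fun_on \<Omega> H" "smooth_fun_on \<Omega> H'"
    and HH: "\<And>J. length J \<le> r \<Longrightarrow> foldr pderiv_at J H (q origin) = foldr pderiv_at J H' (q origin)"
  shows "germ_jet_eq r (abs_germ (\<lambda>t. H (q t))) (abs_germ (\<lambda>t. H' (q' t)))"
proof -
  have ns: "near_smooth (\<lambda>t. q t k)" "near_smooth (\<lambda>t. q' t k)" for k
    by (rule near_smoothI[OF U q(1)], rule near_smoothI[OF U q(2)])
  have q0: "q' origin = q origin"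
    using eq[unfolded germ_jet_eq_def, rule_format, of "[]"] by (simp add: germ_value_abs ns fun_eq_iff)
  have \<Omega>': "q' origin \<in> \<Omega>" using \<Omega> q0 by simp
  note fin = finite[of UNIV] depends_on_UNIV
  have v: "germ_value (abs_germ (\<lambda>t. f (q t))) = f (q origin)" if "smooth_fun_on \<Omega> f" for f
    by (rule germ_value_abs, rule near_smooth_compose[OF \<Omega>(1) that fin U q(1) \<Omega>(2)])
  have v': "germ_value (abs_germ (\<lambda>t. f (q' t))) = f (q' origin)" if "smooth_fun_on \<Omega> f" for f
    by (rule germ_value_abs, rule near_smooth_compose[OF \<Omega>(1) that fin U q(2) \<Omega>'])
  show ?thesis using eq H HH
  proof (induction r arbitrary: H H')
    case 0
    then show ?case using 0(4)[of "[]"] q0 unfolding germ_jet_eq_0 v[OF 0(2)] v'[OF 0(3)] by simp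
  next
    case (Suc r)
    have "germ_jet_eq r (germ_deriv j (abs_germ (\<lambda>t. H (q t)))) (germ_deriv j (abs_germ (\<lambda>t. H' (q' t))))" for j
      unfolding germ_chain[OF \<Omega>(1) Suc.prems(2) fin U q(1) \<Omega>(2)] germ_chain[OF \<Omega>(1) Suc.prems(3) fin U q(2) \<Omega>']
    proof (intro germ_jet_eq_sum germ_jet_eq_mult)
      fix k :: 'i
      show "germ_jet_eq r (germ_deriv j (abs_germ (\<lambda>t. q t k))) (germ_deriv j (abs_germ (\<lambda>t. q' t k)))"
        using Suc.prems(1) by (simp add: germ_jet_eq_Suc)
      show "germ_jet_eq r (abs_germ (\<lambda>t. pderiv_at k H (q t))) (abs_germ (\<lambda>t. pderiv_at k H' (q' t)))"
      proof (rule Suc.IH)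
        show "germ_jet_eq r (abs_germ (\<lambda>t. q t k)) (abs_germ (\<lambda>t. q' t k))" for k
          using Suc.prems(1) by (rule germ_jet_eq_mono) simp
        show "foldr pderiv_at J (pderiv_at k H) (q origin) = foldr pderiv_at J (pderiv_at k H') (q origin)"
          if "length J \<le> r" for J
          using Suc.prems(4)[of "J @ [k]"] that by simp
      qed (intro smooth_fun_on_pderiv_at Suc.prems)+
    qed
    then show ?case
      using Suc.prems(4)[of "[]"] q0 unfolding germ_jet_eq_Suc v[OF Suc.prems(2)] v'[OF Suc.prems(3)] by simp
  qed
qed

text \<open>Each \<open>d j\<close> is a combination of the \<open>nab p\<close> with coefficients
  \<open>d j (x p)\<close>, common to both germs. Agreement of the \<open>nab\<close> derivatives up
  to order \<open>r\<close> therefore passes to the ordinary ones.\<close>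

lemma nab_jets:
  fixes x :: "'n::finite \<Rightarrow> 'n germ"
  assumes fr: "adapted_frame germ_deriv x z"
    and "\<And>I. length I \<le> r \<Longrightarrow> germ_value (foldr (adapted_frame.nab germ_deriv z) I a) = germ_value (foldr (adapted_frame.nab germ_deriv z) I b)"
  shows "germ_jet_eq r a b"
  using assms(2)
proof (induction r arbitrary: a b)
  case 0
  then show ?case using 0[of "[]"] by (simp add: germ_jet_eq_0)
next
  case (Suc r)
  have "germ_jet_eq r (germ_deriv j a) (germ_deriv j b)" for j
    unfolding adapted_frame.d_nab[OF fr, of j a] adapted_frame.d_nab[OF fr, of j b]
  proof (intro germ_jet_eq_sum germ_jet_eq_mult germ_jet_eq_refl Suc.IH)
    fix p and I :: "'n list" assume "length I \<le> r"
    then show "germ_value (foldr (adapted_frame.nab germ_deriv z) I (adapted_frame.nab germ_deriv z p a)) =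
        germ_value (foldr (adapted_frame.nab germ_deriv z) I (adapted_frame.nab germ_deriv z p b))"
      using Suc.prems[of "I @ [p]"] by simp
  qed
  then show ?case using Suc.prems[of "[]"] by (simp add: germ_jet_eq_Suc)
qed

text \<open>Written through a representative because composition respects \<open>germ_rel\<close>
  only for a smooth \<open>\<beta>\<close> fixing the origin, which is assumed in
  \<open>germ_reparam\<close>.\<close>

definition germ_pull :: "(('n \<Rightarrow> real) \<Rightarrow> 'n::finite \<Rightarrow> real) \<Rightarrow> 'n germ \<Rightarrow> 'n germ" where
  "germ_pull \<beta> a = abs_germ (\<lambda>t. rep_germ a (\<beta> t))"

locale germ_reparam =
  fixes \<beta> :: "('n::finite \<Rightarrow> real) \<Rightarrow> 'n \<Rightarrow> real" and V
  assumes V: "open V" "origin \<in> V" and smooth_\<beta>: "\<And>k. smooth_fun_on V (\<lambda>t. \<beta> t k)" and \<beta>0: "\<beta> origin = origin"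
begin

lemma pull_rel:
  assumes "germ_rel f g"
  shows "germ_rel (\<lambda>t. f (\<beta> t)) (\<lambda>t. g (\<beta> t))"
proof -
  obtain U where U: "open U" "origin \<in> U" "smooth_fun_on U f" "\<And>u. u \<in> U \<Longrightarrow> f u = g u"
    using assms unfolding germ_rel_def by blast
  let ?U = "{t\<in>V. \<beta> t \<in> U}"
  have o: "open ?U" by (rule open_preimage_smooth[OF V(1) smooth_\<beta> U(1)])
  show ?thesis
    by (rule germ_relI[OF o])
       (use V \<beta>0 U in \<open>auto intro!: smooth_fun_on_compose[OF U(1,3) finite depends_on_UNIV o] smooth_fun_on_subset[OF smooth_\<beta>]\<close>)
qed

lemma germ_pull_abs: "near_smooth f \<Longrightarrow> germ_pull \<beta> (abs_germ f) = abs_germ (\<lambda>t. f (\<beta> t))"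
proof -
  assume f: "near_smooth f"
  have "germ_rel (rep_germ (abs_germ f)) f"
    by (rule Quotient_rep_abs[OF Quotient_germ]) (rule f)
  from abs_germ_eqI[OF pull_rel[OF this]] show ?thesis by (simp add: germ_pull_def)
qed

lemma germ_pull_add: "germ_pull \<beta> (a + b) = germ_pull \<beta> a + germ_pull \<beta> b"
proof -
  obtain f g where f: "near_smooth f" "a = abs_germ f" and g: "near_smooth g" "b = abs_germ g"
    by (meson germ_cases)
  show ?thesis
    unfolding f(2) g(2) abs_germ_add[OF f(1) g(1), symmetric] germ_pull_abs[OF f(1)] germ_pull_abs[OF g(1)]
      germ_pull_abs[OF germ_rel_add[OF f(1) g(1)]]
    by (rule abs_germ_add[OF pull_rel[OF f(1)] pull_rel[OF g(1)]])
qed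

lemma germ_pull_mult: "germ_pull \<beta> (a * b) = germ_pull \<beta> a * germ_pull \<beta> b"
proof -
  obtain f g where f: "near_smooth f" "a = abs_germ f" and g: "near_smooth g" "b = abs_germ g"
    by (meson germ_cases)
  show ?thesis
    unfolding f(2) g(2) abs_germ_mult[OF f(1) g(1), symmetric] germ_pull_abs[OF f(1)] germ_pull_abs[OF g(1)]
      germ_pull_abs[OF germ_rel_mult[OF f(1) g(1)]]
    by (rule abs_germ_mult[OF pull_rel[OF f(1)] pull_rel[OF g(1)]])
qed

lemma germ_pull_0: "germ_pull \<beta> 0 = 0"
  using germ_pull_add[of 0 0] by simp

lemma germ_pull_sum: "germ_pull \<beta> (sum f S) = (\<Sum>x\<in>S. germ_pull \<beta> (f x))"
  by (induction S rule: infinite_finite_induct) (auto simp: germ_pull_0 germ_pull_add)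

lemma germ_value_pull: "germ_value (germ_pull \<beta> a) = germ_value a"
proof -
  obtain f where f: "near_smooth f" "a = abs_germ f" by (rule germ_cases)
  show ?thesis unfolding f(2) germ_pull_abs[OF f(1)] germ_value_abs[OF f(1)] germ_value_abs[OF pull_rel[OF f(1)]]
    by (simp add: \<beta>0)
qed

lemma germ_deriv_pull:
  "germ_deriv j (germ_pull \<beta> a) = (\<Sum>k\<in>UNIV. germ_pull \<beta> (germ_deriv k a) * germ_deriv j (abs_germ (\<lambda>t. \<beta> t k)))"
proof -
  obtain f where f: "near_smooth f" "a = abs_germ f" by (rule germ_cases)
  obtain U where U: "open U" "origin \<in> U" "smooth_fun_on U f"
    using f(1) unfolding germ_rel_def by blast
  have \<beta>U: "\<beta> origin \<in> U" using U \<beta>0 by simp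
  show ?thesis
    unfolding f(2) germ_pull_abs[OF f(1)] germ_chain[OF U(1,3) finite depends_on_UNIV V smooth_\<beta> \<beta>U]
      germ_deriv_abs[OF f(1)] germ_pull_abs[OF germ_rel_pderiv_at[OF f(1)]] ..
qed

text \<open>\<open>nab i\<close> is differentiation with respect to the functions \<open>x\<close>
  and hence natural under reparametrisation: the derivatives of a pulled back germ have the
  derivatives of the pulled back \<open>x\<close> as coefficients, and contraction with
  \<open>z'\<close> removes them. This is the source of the invariance of the \<open>y\<close>
  coordinates.\<close>

lemma nab_pull:
  assumes "adapted_frame germ_deriv x z" "adapted_frame germ_deriv x' z'"
    and x': "\<And>k. x' k = germ_pull \<beta> (x k)"
  shows "adapted_frame.nab germ_deriv z' i (germ_pull \<beta> a) = germ_pull \<beta> (adapted_frame.nab germ_deriv z i a)"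
proof -
  interpret f: adapted_frame germ_deriv x z by fact
  interpret f': adapted_frame germ_deriv x' z' by fact
  have "germ_deriv j (germ_pull \<beta> a) = (\<Sum>p\<in>UNIV. germ_deriv j (x' p) * germ_pull \<beta> (f.nab p a))" for j
  proof -
    have "germ_deriv j (germ_pull \<beta> a) =
        (\<Sum>k\<in>UNIV. \<Sum>p\<in>UNIV. germ_pull \<beta> (germ_deriv k (x p)) * germ_pull \<beta> (f.nab p a) * germ_deriv j (abs_germ (\<lambda>t. \<beta> t k)))"
      unfolding germ_deriv_pull by (subst f.d_nab) (simp add: germ_pull_sum germ_pull_mult sum_distrib_right)
    also have "\<dots> = (\<Sum>p\<in>UNIV. germ_deriv j (x' p) * germ_pull \<beta> (f.nab p a))"
      unfolding x' germ_deriv_pull sum_distrib_right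
      by (subst sum.swap) (intro sum.cong refl, simp only: mult_ac)
    finally show ?thesis .
  qed
  then have "f'.nab i (germ_pull \<beta> a) = (\<Sum>p\<in>UNIV. f'.nab i (x' p) * germ_pull \<beta> (f.nab p a))"
    unfolding f'.nab_def by (simp add: sum_distrib_left sum_distrib_right mult_ac) (rule sum.swap)
  then show ?thesis by (simp add: f'.nab_x if_distrib if_distribR cong: if_cong)
qed

lemma nab_list_pull:
  assumes "adapted_frame germ_deriv x z" "adapted_frame germ_deriv x' z'"
    and x': "\<And>k. x' k = germ_pull \<beta> (x k)"
  shows "foldr (adapted_frame.nab germ_deriv z') I (germ_pull \<beta> a) = germ_pull \<beta> (foldr (adapted_frame.nab germ_deriv z) I a)"
  by (induction I) (simp_all add: nab_pull[OF assms])

end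

lemma adapted_frame_unique:
  assumes "adapted_frame d x z" "adapted_frame d x z'"
  shows "z = z'"
proof (intro ext)
  fix j i
  interpret f: adapted_frame d x z by fact
  interpret f': adapted_frame d x z' by fact
  have "z j i = (\<Sum>k\<in>UNIV. z j k * (\<Sum>l\<in>UNIV. d l (x k) * z' l i))"
    by (simp only: f'.x_z sum_delta_mult)
  also have "\<dots> = (\<Sum>l\<in>UNIV. (\<Sum>k\<in>UNIV. z j k * d l (x k)) * z' l i)"
    unfolding sum_distrib_left sum_distrib_right by (subst sum.swap) (simp add: mult_ac)
  also have "\<dots> = z' j i" by (simp only: f.z_x sum_delta_mult)
  finally show "z j i = z' j i" .
qed

section \<open>Local diffeomorphisms\<close>

text \<open>Changing one coordinate at a time, the mean value theorem and the continuity of the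
  partial derivatives bound each error by \<open>e\<close> times the increment.\<close>

lemma first_order_expansion:
  fixes f :: "('n::finite \<Rightarrow> real) \<Rightarrow> real"
  assumes "open \<Omega>" "smooth_fun_on \<Omega> f" "u \<in> \<Omega>" "e > 0"
  shows "\<exists>\<delta>>0. \<forall>h. (\<forall>k. \<bar>h k\<bar> < \<delta>) \<longrightarrow>
    \<bar>f (\<lambda>i. u i + h i) - f u - (\<Sum>k\<in>UNIV. pderiv_at k f u * h k)\<bar> \<le> e * (\<Sum>k\<in>UNIV. \<bar>h k\<bar>)"
proof -
  define N where "N = (\<Inter>k. {w\<in>\<Omega>. \<bar>pderiv_at k f w - pderiv_at k f u\<bar> < e})"
  have "open N" unfolding N_def
    by (intro open_INT finite ballI open_near_value smooth_fun_on_continuous smooth_fun_on_pderiv_at assms)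
  moreover have "u \<in> N" using assms by (simp add: N_def)
  ultimately obtain I \<delta> where I: "finite I" "\<delta> > 0" "\<And>w. (\<And>i. i \<in> I \<Longrightarrow> \<bar>w i - u i\<bar> < \<delta>) \<Longrightarrow> w \<in> N"
    by (rule open_fun_box) blast
  have step: "\<bar>f (\<lambda>i. u i + (if i \<in> K then h i else 0)) - f u - (\<Sum>k\<in>K. pderiv_at k f u * h k)\<bar> \<le> e * (\<Sum>k\<in>K. \<bar>h k\<bar>)"
    if h: "\<And>k. \<bar>h k\<bar> < \<delta>" and K: "finite K" for h K
    using K
  proof (induction K rule: finite_induct)
    case (insert a K)
    define w where "w = (\<lambda>i. u i + (if i \<in> K then h i else 0))"
    have wN: "w(a := z) \<in> N" if "min (u a) (u a + h a) \<le> z" "z \<le> max (u a) (u a + h a)" for z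
    proof (rule I(3))
      fix i show "\<bar>(w(a := z)) i - u i\<bar> < \<delta>" using that h[of i] I(2) by (auto simp: w_def)
    qed
    have "\<exists>z. min (u a) (u a + h a) \<le> z \<and> z \<le> max (u a) (u a + h a) \<and>
        f (w(a := u a + h a)) - f (w(a := u a)) = (u a + h a - u a) * pderiv_at a f (w(a := z))"
    proof (rule mvt_segment)
      fix x assume "min (u a) (u a + h a) \<le> x" "x \<le> max (u a) (u a + h a)"
      then have "w(a := x) \<in> \<Omega>" using wN by (auto simp: N_def)
      from smooth_fun_on_has_partial[OF assms(2) this, of a]
      show "((\<lambda>x. f (w(a := x))) has_real_derivative pderiv_at a f (w(a := x))) (at x)"
        by (simp only: fun_upd_same fun_upd_upd)
    qed
    then obtain z where z: "w(a := z) \<in> N"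
      "f (w(a := u a + h a)) - f (w(a := u a)) = h a * pderiv_at a f (w(a := z))" using wN by auto
    have wa: "w(a := u a) = w" using insert.hyps by (simp add: w_def fun_eq_iff)
    have wh: "w(a := u a + h a) = (\<lambda>i. u i + (if i \<in> insert a K then h i else 0))"
      using insert.hyps by (auto simp: w_def fun_eq_iff)
    have "\<bar>pderiv_at a f (w(a := z)) - pderiv_at a f u\<bar> \<le> e" using z(1) by (auto simp: N_def intro: less_imp_le)
    then have 1: "\<bar>h a * (pderiv_at a f (w(a := z)) - pderiv_at a f u)\<bar> \<le> e * \<bar>h a\<bar>"
      unfolding abs_mult by (subst mult.commute) (rule mult_right_mono, auto)
    have "f (w(a := u a + h a)) - f u - (\<Sum>k\<in>insert a K. pderiv_at k f u * h k) =
        (f w - f u - (\<Sum>k\<in>K. pderiv_at k f u * h k)) + h a * (pderiv_at a f (w(a := z)) - pderiv_at a f u)"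
      using z(2) insert.hyps unfolding wa by (simp add: algebra_simps)
    then have "\<bar>f (w(a := u a + h a)) - f u - (\<Sum>k\<in>insert a K. pderiv_at k f u * h k)\<bar> \<le>
        e * (\<Sum>k\<in>K. \<bar>h k\<bar>) + e * \<bar>h a\<bar>"
      using insert.IH 1 unfolding w_def[symmetric] by linarith
    then show ?case unfolding wh using insert.hyps by (simp add: algebra_simps)
  qed simp
  show ?thesis
    using I(2) step[of _ UNIV] by (intro exI[of _ \<delta>]) simp
qed

text \<open>The inverse function theorem concerns derivatives on normed spaces, so smoothness in
  coordinates is first turned into differentiability on \<open>real^'n\<close>.\<close>

lemma has_derivative_vec_nth_comp:
  fixes f :: "('n::finite \<Rightarrow> real) \<Rightarrow> real"
  assumes "open \<Omega>" "smooth_fun_on \<Omega> f" "vec_nth y \<in> \<Omega>"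
  shows "((\<lambda>y :: real^'n. f (vec_nth y)) has_derivative (\<lambda>h. \<Sum>k\<in>UNIV. pderiv_at k f (vec_nth y) * h $ k)) (at y)"
  unfolding has_derivative_at_alt
proof (intro conjI allI impI)
  show "bounded_linear (\<lambda>h :: real^'n. \<Sum>k\<in>UNIV. pderiv_at k f (vec_nth y) * h $ k)"
    by (intro bounded_linear_sum bounded_linear_const_mult bounded_linear_vec_nth)
  fix e :: real assume e: "e > 0"
  let ?n = "real CARD('n)"
  have n: "?n > 0" by simp
  obtain \<delta> where \<delta>: "\<delta> > 0" "\<And>h. (\<And>k. \<bar>h k\<bar> < \<delta>) \<Longrightarrow>
      \<bar>f (\<lambda>i. y $ i + h i) - f (vec_nth y) - (\<Sum>k\<in>UNIV. pderiv_at k f (vec_nth y) * h k)\<bar> \<le> (e / ?n) * (\<Sum>k\<in>UNIV. \<bar>h k\<bar>)"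
    using first_order_expansion[OF assms, of "e / ?n"] e n by (auto simp: divide_pos_pos)
  show "\<exists>d>0. \<forall>x. norm (x - y) < d \<longrightarrow> norm (f (vec_nth x) - f (vec_nth y) -
      (\<Sum>k\<in>UNIV. pderiv_at k f (vec_nth y) * (x - y) $ k)) \<le> e * norm (x - y)"
  proof (intro exI[of _ \<delta>] conjI \<delta>(1) allI impI)
    fix x :: "real^'n" assume x: "norm (x - y) < \<delta>"
    have k: "\<bar>(x - y) $ k\<bar> \<le> norm (x - y)" for k by (rule component_le_norm_cart)
    have "\<bar>f (\<lambda>i. y $ i + (x - y) $ i) - f (vec_nth y) - (\<Sum>k\<in>UNIV. pderiv_at k f (vec_nth y) * (x - y) $ k)\<bar>
        \<le> (e / ?n) * (\<Sum>k\<in>UNIV. \<bar>(x - y) $ k\<bar>)"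
      by (rule \<delta>(2)) (use x k in \<open>meson le_less_trans\<close>)
    also have "\<dots> \<le> (e / ?n) * (?n * norm (x - y))"
      using sum_bounded_above[of UNIV "\<lambda>k. \<bar>(x - y) $ k\<bar>" "norm (x - y)"] k e n
      by (intro mult_left_mono) (auto intro: less_imp_le)
    finally show "norm (f (vec_nth x) - f (vec_nth y) -
      (\<Sum>k\<in>UNIV. pderiv_at k f (vec_nth y) * (x - y) $ k)) \<le> e * norm (x - y)"
      using n by simp
  qed
qed

lemma enum_mset_single [simp]: "enum_mset {#j#} = [j]"
  using mset_enum_mset[of "{#j#}"] by (metis mset_single_iff)

text \<open>The Jacobian matrix, expressed through \<open>xmat\<close> with the identity splitting
  so that the results on \<open>reg_coords\<close> and \<open>zmat\<close> apply to it.\<close>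

abbreviation Jac :: "(('n::finite \<Rightarrow> real) \<Rightarrow> 'n \<Rightarrow> real) \<Rightarrow> ('n \<Rightarrow> real) \<Rightarrow> real^'n^'n" where
  "Jac \<kappa> u \<equiv> xmat (\<lambda>i. i) (jet_of (\<lambda>i. i) \<kappa> u)"

lemma xmat_jet_of: "xmat \<iota> (jet_of (\<lambda>i. i) \<gamma> u) $ i $ j = pderiv_at j (\<lambda>u. \<gamma> u (\<iota> i)) u"
  by (simp add: xmat_def jet_of_def)

lemma smooth_fun_on_jet_of: "(\<And>A. smooth_fun_on U (\<lambda>t. \<gamma> t A)) \<Longrightarrow> smooth_fun_on U (\<lambda>u. jet_of e \<gamma> u k)"
  by (cases k) (simp add: jet_of_def smooth_fun_on_foldr_pderiv_at)

lemma continuous_vec_nth_fun: "continuous_on S (vec_nth :: real^'n \<Rightarrow> _)"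
  by (intro continuous_on_coordinatewise_then_product continuous_intros)

lemma continuous_vec_lambda_fun: "continuous_on S (vec_lambda :: _ \<Rightarrow> real^'n::finite)"
  using continuous_on_vec_lambda[of S "\<lambda>i u. u i"] by (simp add: continuous_on_coord)

text \<open>The inverse function theorem on \<open>real^'n\<close> provides an inverse with one
  derivative; full smoothness is added by coinduction, since a function composed with the inverse
  again has derivatives of this kind.\<close>

lemma local_inverse:
  fixes \<kappa> :: "('n::finite \<Rightarrow> real) \<Rightarrow> 'n \<Rightarrow> real"
  assumes U: "open U" "p \<in> U" and sm: "\<And>i. smooth_fun_on U (\<lambda>u. \<kappa> u i)"
    and det: "det (Jac \<kappa> p) \<noteq> 0"
  obtains U1 V1 \<psi> where "open U1" "p \<in> U1" "U1 \<subseteq> U" "open V1" "\<kappa> p \<in> V1"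
    "\<And>u. u \<in> U1 \<Longrightarrow> \<kappa> u \<in> V1 \<and> \<psi> (\<kappa> u) = u" "\<And>w. w \<in> V1 \<Longrightarrow> \<psi> w \<in> U1 \<and> \<kappa> (\<psi> w) = w"
    "\<And>i. smooth_fun_on V1 (\<lambda>w. \<psi> w i)"
proof -
  define U0 where "U0 = {u\<in>U. jet_of (\<lambda>i. i) \<kappa> u \<in> reg_coords (\<lambda>i. i)}"
  have U0: "open U0" unfolding U0_def
    by (rule open_preimage_smooth[OF U(1) smooth_fun_on_jet_of[OF sm] open_reg_coords])
  have pU0: "p \<in> U0" using U det by (simp add: U0_def reg_coords_def)
  have sm0: "smooth_fun_on U0 (\<lambda>u. \<kappa> u i)" for i
    by (rule smooth_fun_on_subset[OF sm]) (auto simp: U0_def)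
  define Y where "Y = (vec_nth :: real^'n \<Rightarrow> _) -` U0"
  have Y: "open Y" unfolding Y_def by (rule open_vimage[OF U0]) (rule continuous_vec_nth_fun)
  define f where "f y = (\<chi> i. \<kappa> (vec_nth y) i)" for y :: "real^'n"
  define f' where "f' y = Blinfun ((*v) (Jac \<kappa> (vec_nth y)))" for y :: "real^'n"
  have f'_apply: "blinfun_apply (f' y) h = Jac \<kappa> (vec_nth y) *v h" for y h
    unfolding f'_def by (subst bounded_linear_Blinfun_apply) (auto intro: matrix_vector_mul_bounded_linear)
  have der: "(f has_derivative blinfun_apply (f' y)) (at y)" if "y \<in> Y" for y
  proof -
    have c: "((\<lambda>y. f y \<bullet> b) has_derivative (\<lambda>h. blinfun_apply (f' y) h \<bullet> b)) (at y)" if b: "b \<in> Basis" for b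
    proof -
      obtain i where i: "b = axis i 1" using b by (auto simp: Basis_vec_def)
      have "((\<lambda>y :: real^'n. \<kappa> (vec_nth y) i) has_derivative (\<lambda>h. \<Sum>k\<in>UNIV. pderiv_at k (\<lambda>u. \<kappa> u i) (vec_nth y) * h $ k)) (at y)"
        by (rule has_derivative_vec_nth_comp[OF U0 sm0]) (use \<open>y \<in> Y\<close> in \<open>simp add: Y_def\<close>)
      then show ?thesis
        by (simp add: i f_def inner_axis f'_apply matrix_vector_mult_def xmat_jet_of)
    qed
    show ?thesis
      unfolding has_derivative_componentwise_within[of f] using c by blast
  qed
  have contf': "continuous_on Y f'"
  proof (rule continuous_on_blinfun_componentwise)
    fix b :: "real^'n" assume "b \<in> Basis"
    have "continuous_on Y (\<lambda>y. \<chi> i. \<Sum>k\<in>UNIV. pderiv_at k (\<lambda>u. \<kappa> u i) (vec_nth y) * b $ k)"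
    proof (intro continuous_on_vec_lambda continuous_on_sum continuous_on_mult continuous_on_const)
      fix i k :: 'n
      show "continuous_on Y (\<lambda>y. pderiv_at k (\<lambda>u. \<kappa> u i) (vec_nth y))"
        by (rule continuous_on_compose2[OF smooth_fun_on_continuous[OF smooth_fun_on_pderiv_at[OF sm0]] continuous_vec_nth_fun])
           (auto simp: Y_def)
    qed
    then show "continuous_on Y (\<lambda>y. blinfun_apply (f' y) b)"
      by (simp add: f'_apply matrix_vector_mult_def xmat_jet_of)
  qed
  define p' where "p' = (\<chi> i. p i)"
  have p': "vec_nth p' = p" by (simp add: p'_def fun_eq_iff)
  then have p'Y: "p' \<in> Y" using pU0 by (simp add: Y_def)
  have inv: "Blinfun ((*v) (matrix_inv (Jac \<kappa> p))) o\<^sub>L f' p' = id_blinfun"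
  proof (rule blinfun_eqI)
    fix h
    have "blinfun_apply (Blinfun ((*v) (matrix_inv (Jac \<kappa> p)))) x = matrix_inv (Jac \<kappa> p) *v x" for x
      by (subst bounded_linear_Blinfun_apply) (auto intro: matrix_vector_mul_bounded_linear)
    then show "blinfun_apply (Blinfun ((*v) (matrix_inv (Jac \<kappa> p))) o\<^sub>L f' p') h = blinfun_apply id_blinfun h"
      by (simp add: f'_apply p' matrix_vector_mul_assoc matrix_inv_det[OF det])
  qed
  obtain Y' Z g g' where Y': "open Y'" "Y' \<subseteq> Y" "p' \<in> Y'" and Z: "open Z" "f p' \<in> Z" and hom: "homeomorphism Y' Z f g"
    and g: "\<And>z. z \<in> Z \<Longrightarrow> (g has_derivative (g' z)) (at z)"
      "\<And>z. z \<in> Z \<Longrightarrow> g' z = Hilbert_Choice.inv (blinfun_apply (f' (g z)))"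
      "\<And>z. z \<in> Z \<Longrightarrow> bij (blinfun_apply (f' (g z)))"
    by (rule inverse_function_theorem[OF Y _ contf' p'Y inv]) (erule der, rule that)
  define U1 where "U1 = (vec_lambda :: _ \<Rightarrow> real^'n) -` Y'"
  define V1 where "V1 = (vec_lambda :: _ \<Rightarrow> real^'n) -` Z"
  define \<psi> where "\<psi> w = vec_nth (g (vec_lambda w))" for w
  have U1: "open U1" "open V1" unfolding U1_def V1_def
    by (rule open_vimage[OF Y'(1) continuous_vec_lambda_fun], rule open_vimage[OF Z(1) continuous_vec_lambda_fun])
  have nth_lambda: "vec_nth (vec_lambda u :: real^'n) = u" for u by (simp add: fun_eq_iff)
  have U10: "U1 \<subseteq> U0"
  proof
    fix x assume "x \<in> U1"
    then have "(vec_lambda x :: real^'n) \<in> Y" using Y'(2) by (auto simp: U1_def)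
    then show "x \<in> U0" by (simp add: Y_def nth_lambda)
  qed
  have f_lambda: "f (vec_lambda u) = vec_lambda (\<kappa> u)" for u
    by (simp add: f_def nth_lambda)
  have \<kappa>\<psi>: "\<kappa> u \<in> V1 \<and> \<psi> (\<kappa> u) = u" if "u \<in> U1" for u
  proof -
    have "vec_lambda u \<in> Y'" using that by (simp add: U1_def)
    then have "f (vec_lambda u) \<in> Z" "g (f (vec_lambda u)) = vec_lambda u"
      using hom by (auto simp: homeomorphism_def)
    then show ?thesis by (simp add: V1_def \<psi>_def f_lambda fun_eq_iff)
  qed
  have \<psi>\<kappa>: "\<psi> w \<in> U1 \<and> \<kappa> (\<psi> w) = w" if "w \<in> V1" for w
  proof -
    have "vec_lambda w \<in> Z" using that by (simp add: V1_def)
    then have *: "g (vec_lambda w) \<in> Y'" "f (g (vec_lambda w)) = vec_lambda w"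
      using hom by (auto simp: homeomorphism_def)
    have "vec_lambda (\<kappa> (\<psi> w)) = (vec_lambda w :: real^'n)"
      using *(2) f_lambda[of "\<psi> w"] by (simp add: \<psi>_def)
    then have "\<kappa> (\<psi> w) = w" by (metis vec_lambda_inverse UNIV_I)
    then show ?thesis using *(1) by (simp add: U1_def \<psi>_def)
  qed
  have \<psi>cont: "continuous_on V1 \<psi>"
  proof -
    have "continuous_on Z g" using hom by (auto simp: homeomorphism_def)
    then have "continuous_on V1 (\<lambda>w. g (vec_lambda w))"
      by (rule continuous_on_compose2[OF _ continuous_vec_lambda_fun]) (auto simp: V1_def)
    then show ?thesis unfolding \<psi>_def
      by (rule continuous_on_compose2[OF continuous_vec_nth_fun[of UNIV]]) auto
  qed
  \<comment> \<open>Entries of the inverse Jacobian matrix as functions on the source. They are the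
    partial derivatives of \<open>\<psi>\<close>, read at the point \<open>\<psi> w\<close>, and
    they are smooth by \<open>smooth_fun_on_zmat\<close>.\<close>
  define mi where "mi i k u = zmat (\<lambda>i. i) i k (jet_of (\<lambda>i. i) \<kappa> u)" for i k u
  have mi: "smooth_fun_on U1 (mi i k)" for i k
    unfolding mi_def
    by (rule smooth_fun_on_compose[OF open_reg_coords smooth_fun_on_zmat finite_vel_index vel_order_zmat U1(1)])
       (use U10 in \<open>auto simp: U0_def intro!: smooth_fun_on_jet_of smooth_fun_on_subset[OF sm]\<close>)
  have \<psi>der: "((\<lambda>t. \<psi> (w(k := t)) i) has_real_derivative mi i k (\<psi> w)) (at (w k))" if w: "w \<in> V1" for w k i
  proof -
    let ?z = "vec_lambda w :: real^'n"
    have z: "?z \<in> Z" using w by (simp add: V1_def)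
    have line: "vec_lambda (w(k := t)) = ?z + (t - w k) *\<^sub>R axis k 1" for t
      by (simp add: vec_eq_iff axis_def)
    have "((\<lambda>t. ?z + (t - w k) *\<^sub>R axis k 1) has_derivative (\<lambda>s. s *\<^sub>R axis k 1)) (at (w k))"
      by (auto intro!: derivative_eq_intros)
    moreover have "(g has_derivative g' ?z) (at (?z + (w k - w k) *\<^sub>R axis k 1))" using g(1)[OF z] by simp
    ultimately have "((\<lambda>t. g (?z + (t - w k) *\<^sub>R axis k 1)) has_derivative (\<lambda>s. g' ?z (s *\<^sub>R axis k 1))) (at (w k))"
      by (rule has_derivative_compose)
    then have "((\<lambda>t. \<psi> (w(k := t)) i) has_derivative (\<lambda>s. g' ?z (s *\<^sub>R axis k 1) $ i)) (at (w k))"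
      unfolding \<psi>_def line by (rule bounded_linear.has_derivative[OF bounded_linear_vec_nth])
    moreover have "g' ?z (s *\<^sub>R axis k 1) $ i = mi i k (\<psi> w) * s" for s
    proof -
      have lin: "linear (g' ?z)" using has_derivative_linear[OF g(1)[OF z]] .
      let ?J = "Jac \<kappa> (\<psi> w)"
      have J: "det ?J \<noteq> 0" using \<psi>\<kappa>[OF w] U10 by (auto simp: U0_def reg_coords_def)
      have "?J *v g' ?z (axis k 1) = axis k 1"
        using g(2,3)[OF z] f'_apply[of "g ?z"] by (metis \<psi>_def bij_inv_eq_iff)
      then have "g' ?z (axis k 1) = matrix_inv ?J *v axis k 1"
        using matrix_inv_det(2)[OF J] by (metis matrix_vector_mul_assoc matrix_vector_mul_lid)
      then have "g' ?z (axis k 1) $ i = mi i k (\<psi> w)"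
        by (simp add: mi_def zmat_def matrix_vector_mult_basis column_def)
      then show ?thesis using linear_scale[OF lin, of s "axis k 1"] by simp
    qed
    ultimately show ?thesis unfolding has_field_derivative_def by (simp add: fun_eq_iff)
  qed
  \<comment> \<open>The class of functions \<open>h (\<psi> w)\<close> is closed under
    differentiation: the derivative in direction \<open>k\<close> is the composite of
    \<open>\<psi>\<close> with a sum of products of derivatives of \<open>h\<close> and entries
    \<open>mi\<close>.\<close>
  have \<psi>sm: "smooth_fun_on V1 (\<lambda>w. h (\<psi> w))" if "smooth_fun_on U1 h" for h
  proof (rule smooth_fun_on_coinduct[OF U1(2), where S = "{\<lambda>w. h (\<psi> w) | h. smooth_fun_on U1 h}"])
    show "(\<lambda>w. h (\<psi> w)) \<in> {\<lambda>w. h (\<psi> w) | h. smooth_fun_on U1 h}" using that by blast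
  next
    fix F k assume "F \<in> {\<lambda>w. h (\<psi> w) | h. smooth_fun_on U1 h}"
    then obtain h where h: "F = (\<lambda>w. h (\<psi> w))" "smooth_fun_on U1 h" by blast
    show "continuous_on V1 F" unfolding h(1)
      by (rule continuous_on_compose2[OF smooth_fun_on_continuous[OF h(2)] \<psi>cont]) (use \<psi>\<kappa> in auto)
    let ?h' = "\<lambda>u. \<Sum>i\<in>UNIV. pderiv_at i h u * mi i k u"
    have h': "smooth_fun_on U1 ?h'"
      by (intro smooth_fun_on_sum smooth_fun_on_mult smooth_fun_on_pderiv_at mi U1 h)
    have "(\<lambda>w. ?h' (\<psi> w)) \<in> {\<lambda>w. h (\<psi> w) | h. smooth_fun_on U1 h}"
      by (intro CollectI exI[of _ ?h'] conjI refl h')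
    moreover have "((\<lambda>t. F (w(k := t))) has_real_derivative ?h' (\<psi> w)) (at (w k))" if w: "w \<in> V1" for w
      using smooth_fun_on_chain[OF U1(1) h(2) finite depends_on_UNIV, where c = "\<lambda>t. \<psi> (w(k := t))" and ?t0.0 = "w k"] \<psi>\<kappa>[OF w] \<psi>der[OF w]
      by (simp add: h(1))
    ultimately show "\<exists>h\<in>{\<lambda>w. h (\<psi> w) | h. smooth_fun_on U1 h}.
        \<forall>u\<in>V1. ((\<lambda>t. F (u(k := t))) has_real_derivative h u) (at (u k))"
      by (intro bexI[of _ "\<lambda>w. ?h' (\<psi> w)"] ballI)
  qed
  show ?thesis
  proof (rule that[of U1 V1 \<psi>])
    show "p \<in> U1" using Y'(3) by (simp add: U1_def p'_def)
    then show "\<kappa> p \<in> V1" using \<kappa>\<psi> by blast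
    show "U1 \<subseteq> U" using U10 by (auto simp: U0_def)
    show "smooth_fun_on V1 (\<lambda>w. \<psi> w i)" for i
      by (rule \<psi>sm[of "\<lambda>u. u i"]) (rule smooth_fun_on_coord[OF U1(1)])
  qed (use U1 \<kappa>\<psi> \<psi>\<kappa> in auto)
qed

lemma local_diffeo0I:
  assumes "open U" "origin \<in> U" "open U'" "\<alpha> origin = origin"
    and "\<And>u. u \<in> U \<Longrightarrow> \<alpha> u \<in> U' \<and> \<alpha>' (\<alpha> u) = u" "\<And>w. w \<in> U' \<Longrightarrow> \<alpha>' w \<in> U \<and> \<alpha> (\<alpha>' w) = w"
    and "\<And>i. smooth_fun_on U (\<lambda>u. \<alpha> u i)" "\<And>i. smooth_fun_on U' (\<lambda>w. \<alpha>' w i)"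
  shows "local_diffeo0 \<alpha>"
  unfolding local_diffeo0_def
proof (intro conjI exI)
  have inj: "inj_on \<alpha> U" using assms(5) by (metis inj_onI)
  have img: "\<alpha> ` U = U'" using assms(5,6) by (metis image_eqI image_subsetI subsetI subset_antisym)
  show "bij_betw \<alpha> U U'" using inj img by (simp add: bij_betw_def)
  show "smooth_map_on U \<alpha>" using assms(7) by (simp add: smooth_map_on_def)
  show "smooth_map_on U' (inv_into U \<alpha>)"
    unfolding smooth_map_on_def
  proof
    fix i
    have "\<alpha>' w = inv_into U \<alpha> w" if "w \<in> U'" for w
      using assms(6)[OF that] inv_into_f_f[OF inj] by metis
    then show "smooth_fun_on U' (\<lambda>w. inv_into U \<alpha> w i)"
      by (intro smooth_fun_on_cong[OF assms(3) assms(8)]) simp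
  qed
qed (use assms in auto)

lemma local_diffeo0E:
  assumes "local_diffeo0 \<alpha>"
  obtains U U' \<alpha>' where "open U" "origin \<in> U" "open U'" "\<alpha> origin = origin"
    "\<And>u. u \<in> U \<Longrightarrow> \<alpha> u \<in> U' \<and> \<alpha>' (\<alpha> u) = u" "\<And>w. w \<in> U' \<Longrightarrow> \<alpha>' w \<in> U \<and> \<alpha> (\<alpha>' w) = w"
    "\<And>i. smooth_fun_on U (\<lambda>u. \<alpha> u i)" "\<And>i. smooth_fun_on U' (\<lambda>w. \<alpha>' w i)"
proof -
  obtain U U' where U: "open U" "origin \<in> U" "open U'" "\<alpha> origin = origin" "bij_betw \<alpha> U U'"
    "smooth_map_on U \<alpha>" "smooth_map_on U' (inv_into U \<alpha>)"
    using assms unfolding local_diffeo0_def by blast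
  show ?thesis
  proof (rule that[of U U' "inv_into U \<alpha>"])
    show "\<alpha> u \<in> U' \<and> inv_into U \<alpha> (\<alpha> u) = u" if "u \<in> U" for u
      using U(5) that by (auto simp: bij_betw_def)
    show "inv_into U \<alpha> w \<in> U \<and> \<alpha> (inv_into U \<alpha> w) = w" if "w \<in> U'" for w
      using U(5) that by (auto simp: bij_betw_def inv_into_into f_inv_into_f)
  qed (use U in \<open>auto simp: smooth_map_on_def\<close>)
qed

lemma local_diffeo0_compose:
  assumes "local_diffeo0 \<alpha>" "local_diffeo0 \<beta>"
  shows "local_diffeo0 (\<alpha> \<circ> \<beta>)"
proof -
  obtain U U' \<alpha>' where a: "open U" "origin \<in> U" "open U'" "\<alpha> origin = origin"
    "\<And>u. u \<in> U \<Longrightarrow> \<alpha> u \<in> U' \<and> \<alpha>' (\<alpha> u) = u" "\<And>w. w \<in> U' \<Longrightarrow> \<alpha>' w \<in> U \<and> \<alpha> (\<alpha>' w) = w"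
    "\<And>i. smooth_fun_on U (\<lambda>u. \<alpha> u i)" "\<And>i. smooth_fun_on U' (\<lambda>w. \<alpha>' w i)"
    by (rule local_diffeo0E[OF assms(1)]) (rule that)
  obtain V V' \<beta>' where b: "open V" "origin \<in> V" "open V'" "\<beta> origin = origin"
    "\<And>u. u \<in> V \<Longrightarrow> \<beta> u \<in> V' \<and> \<beta>' (\<beta> u) = u" "\<And>w. w \<in> V' \<Longrightarrow> \<beta>' w \<in> V \<and> \<beta> (\<beta>' w) = w"
    "\<And>i. smooth_fun_on V (\<lambda>u. \<beta> u i)" "\<And>i. smooth_fun_on V' (\<lambda>w. \<beta>' w i)"
    by (rule local_diffeo0E[OF assms(2)]) (rule that)
  let ?A = "{u\<in>V. \<beta> u \<in> U}" and ?B = "{w\<in>U'. \<alpha>' w \<in> V'}"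
  have o: "open ?A" "open ?B"
    by (rule open_preimage_smooth[OF b(1,7) a(1)], rule open_preimage_smooth[OF a(3,8) b(3)])
  show ?thesis
  proof (rule local_diffeo0I[OF o(1) _ o(2), where \<alpha>' = "\<beta>' \<circ> \<alpha>'"])
    show "smooth_fun_on ?A (\<lambda>u. (\<alpha> \<circ> \<beta>) u i)" for i
      unfolding o_def
      by (rule smooth_fun_on_compose[OF a(1,7) finite depends_on_UNIV o(1)]) (auto intro: smooth_fun_on_subset[OF b(7)])
    show "smooth_fun_on ?B (\<lambda>u. (\<beta>' \<circ> \<alpha>') u i)" for i
      unfolding o_def
      by (rule smooth_fun_on_compose[OF b(3,8) finite depends_on_UNIV o(2)]) (auto intro: smooth_fun_on_subset[OF a(8)])
  qed (use a b in auto)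
qed

lemma local_diffeo0_id: "local_diffeo0 (\<lambda>t. t)"
  by (rule local_diffeo0I[of UNIV UNIV _ "\<lambda>t. t"]) (auto intro: smooth_fun_on_coord)

lemma xmat_compose:
  fixes \<beta> :: "('n::finite \<Rightarrow> real) \<Rightarrow> 'n \<Rightarrow> real"
  assumes "open U" "\<And>A. smooth_fun_on U (\<lambda>t. \<gamma> t A)" "open V" "p \<in> V" "\<And>i. smooth_fun_on V (\<lambda>t. \<beta> t i)" "\<beta> p \<in> U"
  shows "xmat \<iota> (jet_of (\<lambda>i. i) (\<lambda>t. \<gamma> (\<beta> t)) p) = xmat \<iota> (jet_of (\<lambda>i. i) \<gamma> (\<beta> p)) ** Jac \<beta> p"
proof -
  have "pderiv_at j (\<lambda>u. \<gamma> (\<beta> u) A) p = (\<Sum>k\<in>UNIV. pderiv_at k (\<lambda>u. \<gamma> u A) (\<beta> p) * pderiv_at j (\<lambda>u. \<beta> u k) p)" for j A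
    unfolding pderiv_at_def[of j "\<lambda>u. \<gamma> (\<beta> u) A"]
    by (rule DERIV_imp_deriv) (rule pderiv_at_compose[OF assms(1,2) finite depends_on_UNIV assms(5,4,6)])
  then show ?thesis by (simp add: vec_eq_iff matrix_matrix_mult_def xmat_jet_of)
qed

lemma local_diffeo0_regular:
  assumes "local_diffeo0 \<beta>"
  shows "det (Jac \<beta> origin) \<noteq> 0"
proof -
  obtain V V' \<beta>' where b: "open V" "origin \<in> V" "open V'" "\<beta> origin = origin"
    "\<And>u. u \<in> V \<Longrightarrow> \<beta> u \<in> V' \<and> \<beta>' (\<beta> u) = u" "\<And>w. w \<in> V' \<Longrightarrow> \<beta>' w \<in> V \<and> \<beta> (\<beta>' w) = w"
    "\<And>i. smooth_fun_on V (\<lambda>u. \<beta> u i)" "\<And>i. smooth_fun_on V' (\<lambda>w. \<beta>' w i)"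
    by (rule local_diffeo0E[OF assms]) (rule that)
  have "Jac (\<lambda>t. \<beta>' (\<beta> t)) origin = Jac \<beta>' (\<beta> origin) ** Jac \<beta> origin"
    by (rule xmat_compose[OF b(3,8,1,2,7)]) (use b(2) b(5)[of origin] in simp)
  moreover have "Jac (\<lambda>t. \<beta>' (\<beta> t)) origin = mat 1"
  proof -
    have "pderiv_at j (\<lambda>u. \<beta>' (\<beta> u) i) origin = pderiv_at j (\<lambda>u. u i) origin" for i j
      by (rule pderiv_at_cong[OF b(1,2)]) (use b in auto)
    moreover have "pderiv_at j (\<lambda>u. u i) origin = (if i = j then 1 else 0)" for i j :: 'a
      by (simp add: pderiv_at_def)
    ultimately show ?thesis by (simp add: vec_eq_iff xmat_jet_of mat_def)
  qed
  ultimately have "det (Jac \<beta>' (\<beta> origin)) * det (Jac \<beta> origin) = 1"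
    by (metis det_mul det_I)
  then show ?thesis by auto
qed

section \<open>Velocities in a chart of the manifold\<close>

definition monom_fun :: "'n multiset \<Rightarrow> ('n \<Rightarrow> real) \<Rightarrow> real" where
  "monom_fun K t = (\<Prod>i\<in>#K. t i)"

lemma smooth_fun_on_monom: "smooth_fun_on UNIV (monom_fun K)"
proof (induction K)
  case empty
  then show ?case by (simp add: monom_fun_def[abs_def] smooth_fun_on_const)
next
  case (add i K)
  have "smooth_fun_on UNIV (\<lambda>t. t i * monom_fun K t)"
    by (intro smooth_fun_on_mult smooth_fun_on_coord add) auto
  then show ?case by (simp add: monom_fun_def[abs_def])
qed

lemma near_smooth_monom: "near_smooth (monom_fun K)"
  by (rule near_smoothI[OF _ _ smooth_fun_on_monom]) auto

lemma germ_deriv_monom: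
  "germ_deriv j (abs_germ (monom_fun K)) = real (count K j) *\<^sub>R abs_germ (monom_fun (K - {#j#}))"
proof (induction K)
  case empty
  have one: "abs_germ (monom_fun {#}) = of_real 1"
    using abs_germ_const[of 1] by (simp add: monom_fun_def[abs_def])
  show ?case unfolding one germ_deriv_const by simp
next
  case (add i K)
  have tp_add: "abs_germ (monom_fun (add_mset i K)) = germ_var i * abs_germ (monom_fun K)" for i K
    using abs_germ_mult[OF near_smooth_coord[of i] near_smooth_monom[of K]]
    by (simp add: germ_var_def monom_fun_def[abs_def])
  show ?case
  proof (cases "j = i")
    case True
    have "real (count K i) *\<^sub>R (germ_var i * abs_germ (monom_fun (K - {#i#}))) = real (count K i) *\<^sub>R abs_germ (monom_fun K)"
      by (cases "i \<in># K") (auto simp: not_in_iff insert_DiffM simp flip: tp_add)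
    then show ?thesis using add True by (simp add: tp_add germ_deriv_mult germ_deriv_var scaleR_add_left)
  next
    case False
    have "add_mset i K - {#j#} = add_mset i (K - {#j#})" if "j \<in># K"
      using False that by (metis add_mset_remove_trivial diff_union_swap insert_DiffM)
    then show ?thesis using add False
      by (cases "j \<in># K") (auto simp: tp_add germ_deriv_mult germ_deriv_var not_in_iff)
  qed
qed

lemma deriv0_monom:
  "deriv0 J (monom_fun K) = (if mset J = K then (\<Prod>l\<in>UNIV. fact (count K l)) else 0 :: real)" for K :: "'n::finite multiset"
  unfolding germ_value_foldr[OF near_smooth_monom, symmetric]
proof (induction J arbitrary: K rule: rev_induct)
  case Nil
  have "monom_fun K origin = (if K = {#} then 1 else 0)"
    by (cases K) (auto simp: monom_fun_def)
  then show ?case by (auto simp: germ_value_abs[OF near_smooth_monom])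
next
  case (snoc j J)
  have scale: "germ_value (foldr germ_deriv J (c *\<^sub>R a)) = c * germ_value (foldr germ_deriv J a)" for c a
  proof -
    have "foldr germ_deriv J (c *\<^sub>R a) = c *\<^sub>R foldr germ_deriv J a"
      by (induction J) (auto simp: germ_deriv_scaleR)
    then show ?thesis by simp
  qed
  show ?case
  proof (cases "j \<in># K")
    case True
    have "real (count K j) * (\<Prod>l\<in>UNIV. fact (count (K - {#j#}) l)) = (\<Prod>l\<in>UNIV. fact (count K l))"
    proof -
      obtain c where c: "count K j = Suc c" using True by (metis count_eq_zero_iff not0_implies_Suc)
      have "(\<Prod>l\<in>UNIV - {j}. fact (count (K - {#j#}) l)) = (\<Prod>l\<in>UNIV - {j}. fact (count K l) :: real)"
        by (rule prod.cong) auto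
      then show ?thesis by (simp add: prod.remove[of UNIV j] c)
    qed
    moreover have "mset J = K - {#j#} \<longleftrightarrow> mset (J @ [j]) = K" using True by auto
    ultimately show ?thesis by (simp add: germ_deriv_monom scale snoc.IH)
  next
    case False
    then have "mset (J @ [j]) \<noteq> K" by auto
    then show ?thesis using False scale[of 0 0] by (simp add: germ_deriv_monom not_in_iff)
  qed
qed

lemma deriv0_sum:
  assumes "\<And>x. x \<in> S \<Longrightarrow> near_smooth (f x)"
  shows "deriv0 J (\<lambda>t. \<Sum>x\<in>S. c x * f x t) = (\<Sum>x\<in>S. c x * deriv0 J (f x))"
proof -
  have n: "near_smooth (\<lambda>t. c x * f x t)" if "x \<in> S" for x
    by (rule germ_rel_mult[OF germ_rel_const assms[OF that]])
  have lin: "foldr germ_deriv J (\<Sum>x\<in>S. c x *\<^sub>R a x) = (\<Sum>x\<in>S. c x *\<^sub>R foldr germ_deriv J (a x))" for a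
  proof (induction J)
    case (Cons j J)
    have "germ_deriv j (\<Sum>x\<in>T. c x *\<^sub>R b x) = (\<Sum>x\<in>T. c x *\<^sub>R germ_deriv j (b x))" for b T
      by (induction T rule: infinite_finite_induct) (auto simp: germ_deriv_add germ_deriv_scaleR)
    then show ?case using Cons by simp
  qed simp
  have "abs_germ (\<lambda>t. \<Sum>x\<in>S. c x * f x t) = (\<Sum>x\<in>S. c x *\<^sub>R abs_germ (f x))"
    by (simp add: abs_germ_sum n abs_germ_mult germ_rel_const assms abs_germ_const scaleR_conv_of_real)
  then have "deriv0 J (\<lambda>t. \<Sum>x\<in>S. c x * f x t) = germ_value (\<Sum>x\<in>S. c x *\<^sub>R foldr germ_deriv J (abs_germ (f x)))"
    by (simp add: germ_value_foldr[symmetric] near_smooth_sum n lin)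
  then show ?thesis by (simp add: germ_value_foldr assms)
qed

text \<open>One monomial for each multiset, divided by the factorials of the multiplicities, so that
  the derivatives at the origin up to order \<open>r\<close> are exactly the prescribed
  numbers.\<close>

definition taylor_poly :: "nat \<Rightarrow> ('n::finite multiset \<Rightarrow> real) \<Rightarrow> ('n \<Rightarrow> real) \<Rightarrow> real" where
  "taylor_poly r u t = (\<Sum>K | size K < Suc r. (u K / (\<Prod>l\<in>UNIV. fact (count K l))) * monom_fun K t)"

lemma smooth_fun_on_taylor_poly: "smooth_fun_on UNIV (taylor_poly r u)"
  unfolding taylor_poly_def[abs_def]
  by (intro smooth_fun_on_sum smooth_fun_on_mult smooth_fun_on_const smooth_fun_on_monom) auto

lemma deriv0_taylor_poly:
  assumes "length J \<le> r"
  shows "deriv0 J (taylor_poly r u) = u (mset J)"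
proof -
  have "deriv0 J (taylor_poly r u) = (\<Sum>K | size K < Suc r. (u K / (\<Prod>l\<in>UNIV. fact (count K l))) * deriv0 J (monom_fun K))"
    unfolding taylor_poly_def[abs_def] by (rule deriv0_sum) (rule near_smooth_monom)
  also have "\<dots> = (\<Sum>K | size K < Suc r. if K = mset J then u (mset J) else 0)"
    by (rule sum.cong[OF refl]) (auto simp: deriv0_monom)
  also have "\<dots> = u (mset J)" using assms by (simp add: finite_msets)
  finally show ?thesis .
qed

section \<open>Velocities, their representatives and charts\<close>

lemma same_jet_sym: "same_jet M r \<gamma> \<gamma>' \<Longrightarrow> same_jet M r \<gamma>' \<gamma>"
  unfolding same_jet_def by (auto split: prod.splits)

lemma same_jet_trans: "same_jet M r \<gamma> \<gamma>' \<Longrightarrow> same_jet M r \<gamma>' \<gamma>'' \<Longrightarrow> same_jet M r \<gamma> \<gamma>''"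
  unfolding same_jet_def by (fastforce split: prod.splits)

lemma same_jet_refl: "same_jet M r \<gamma> \<gamma>"
  unfolding same_jet_def by auto

lemma same_jet_mono: "same_jet M s \<gamma> \<gamma>' \<Longrightarrow> r \<le> s \<Longrightarrow> same_jet M r \<gamma> \<gamma>'"
  unfolding same_jet_def by (fastforce split: prod.splits)

lemma jet0_eqI: "same_jet M r \<gamma> \<gamma>' \<Longrightarrow> jet0 M r \<gamma> = jet0 M r \<gamma>'"
  unfolding jet0_def using same_jet_sym same_jet_trans by blast

lemma rep_in: "x \<in> v \<Longrightarrow> rep v \<in> v"
  unfolding rep_def by (rule someI)

lemma rep_jet0:
  assumes "smooth_near0 M \<gamma>"
  shows "smooth_near0 M (rep (jet0 M r \<gamma>))" "same_jet M r \<gamma> (rep (jet0 M r \<gamma>))"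
  using rep_in[of \<gamma> "jet0 M r \<gamma>"] assms same_jet_refl by (auto simp: jet0_def)

lemma rep_diffeo_jet:
  assumes "local_diffeo0 \<alpha>"
  shows "local_diffeo0 (rep (diffeo_jet r \<alpha>))"
    "length J \<le> r \<Longrightarrow> deriv0 J (\<lambda>t. rep (diffeo_jet r \<alpha>) t i) = deriv0 J (\<lambda>t. \<alpha> t i)"
  using rep_in[of \<alpha> "diffeo_jet r \<alpha>"] assms by (auto simp: diffeo_jet_def)

locale split_chart =
  fixes M :: "('x, 'a::finite) manifold" and V :: "'x set" and \<phi> :: "'x \<Rightarrow> 'a \<Rightarrow> real" and \<iota> :: "'n::finite \<Rightarrow> 'a"
  assumes manifold: "smooth_manifold M" and chart: "(V, \<phi>) \<in> charts M" and inj_\<iota>: "inj \<iota>"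
begin

lemma charts_props:
  assumes "(V', \<phi>') \<in> charts M"
  shows "openin (mtop M) V'" "open (\<phi>' ` V')" "homeomorphic_map (subtopology (mtop M) V') (top_of_set (\<phi>' ` V')) \<phi>'"
  using manifold assms unfolding smooth_manifold_def is_chart_def by auto

lemmas V_props = charts_props[OF chart]

lemma inj_\<phi>: "inj_on \<phi> V"
proof -
  have "topspace (subtopology (mtop M) V) = V"
    using openin_subset[OF V_props(1)] by auto
  then show ?thesis using homeomorphic_imp_injective_map[OF V_props(3)] by simp
qed

lemma transition:
  assumes "(V', \<phi>') \<in> charts M"
  shows "open (\<phi> ` (V \<inter> V'))" "smooth_fun_on (\<phi> ` (V \<inter> V')) (\<lambda>u. \<phi>' (inv_into V \<phi> u) A)"
proof -
  have "openin (subtopology (mtop M) V) (V \<inter> V')"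
    using charts_props(1)[OF assms] by (auto simp: openin_subtopology)
  then have "openin (top_of_set (\<phi> ` V)) (\<phi> ` (V \<inter> V'))"
    using homeomorphic_imp_open_map[OF V_props(3)] by (simp add: open_map_def)
  then show "open (\<phi> ` (V \<inter> V'))" using V_props(2) by (meson openin_open_trans)
  have "smooth_transition (V, \<phi>) (V', \<phi>')"
    using manifold chart assms unfolding smooth_manifold_def by blast
  then show "smooth_fun_on (\<phi> ` (V \<inter> V')) (\<lambda>u. \<phi>' (inv_into V \<phi> u) A)"
    by (simp add: smooth_transition_def smooth_map_on_def)
qed

lemma open_curve_preimage:
  assumes "open U" "continuous_map (top_of_set U) (mtop M) \<gamma>" "openin (mtop M) V'"
  shows "open {t\<in>U. \<gamma> t \<in> V'}"
  using openin_continuous_map_preimage[OF assms(2,3)] assms(1) by (simp add: openin_open_eq)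

lemma near0_chartE:
  fixes \<gamma> :: "('n \<Rightarrow> real) \<Rightarrow> 'x"
  assumes "smooth_near0 M \<gamma>" "\<gamma> origin \<in> V"
  obtains U where "open U" "origin \<in> U" "\<And>t. t \<in> U \<Longrightarrow> \<gamma> t \<in> V" "\<And>A. smooth_fun_on U (\<lambda>t. \<phi> (\<gamma> t) A)"
proof -
  obtain U where U: "open U" "origin \<in> U" "continuous_map (top_of_set U) (mtop M) \<gamma>"
    "\<forall>(V, \<phi>)\<in>charts M. smooth_map_on {t\<in>U. \<gamma> t \<in> V} (\<lambda>t. \<phi> (\<gamma> t))"
    using assms(1) unfolding smooth_near0_def by blast
  show ?thesis
  proof (rule that[of "{t\<in>U. \<gamma> t \<in> V}"])
    show "open {t\<in>U. \<gamma> t \<in> V}" by (rule open_curve_preimage[OF U(1,3) V_props(1)])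
    show "smooth_fun_on {t\<in>U. \<gamma> t \<in> V} (\<lambda>t. \<phi> (\<gamma> t) A)" for A
      using U(4) chart by (auto simp: smooth_map_on_def)
  qed (use U assms in auto)
qed

text \<open>Continuity is recovered through the inverse of the chart, and smoothness in every other
  chart through the transition maps, so a single chart suffices.\<close>

lemma near0_chartI:
  fixes \<gamma> :: "('n \<Rightarrow> real) \<Rightarrow> 'x"
  assumes U: "open U" "origin \<in> U" "\<And>t. t \<in> U \<Longrightarrow> \<gamma> t \<in> V" and sm: "\<And>A. smooth_fun_on U (\<lambda>t. \<phi> (\<gamma> t) A)"
  shows "smooth_near0 M \<gamma>"
  unfolding smooth_near0_def
proof (intro exI[of _ U] conjI U(1,2) ballI)
  have "continuous_on U (\<lambda>t. \<phi> (\<gamma> t))"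
    by (intro continuous_on_coordinatewise_then_product smooth_fun_on_continuous sm)
  then have c1: "continuous_map (top_of_set U) (top_of_set (\<phi> ` V)) (\<lambda>t. \<phi> (\<gamma> t))"
    using U(3) by (auto simp: continuous_map_in_subtopology)
  obtain g where g: "homeomorphic_maps (subtopology (mtop M) V) (top_of_set (\<phi> ` V)) \<phi> g"
    using V_props(3) by (auto simp: homeomorphic_map_maps)
  have top: "topspace (subtopology (mtop M) V) = V" using openin_subset[OF V_props(1)] by auto
  have "continuous_map (top_of_set (\<phi> ` V)) (subtopology (mtop M) V) g"
    using g by (simp add: homeomorphic_maps_def)
  then have "continuous_map (top_of_set (\<phi> ` V)) (mtop M) g" by (rule continuous_map_into_fulltopology)
  from continuous_map_compose[OF c1 this] have "continuous_map (top_of_set U) (mtop M) (g \<circ> (\<lambda>t. \<phi> (\<gamma> t)))" .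
  moreover have "(g \<circ> (\<lambda>t. \<phi> (\<gamma> t))) t = \<gamma> t" if "t \<in> topspace (top_of_set U)" for t
    using g top U(3)[of t] that by (auto simp: homeomorphic_maps_def)
  ultimately show cont: "continuous_map (top_of_set U) (mtop M) \<gamma>" by (rule continuous_map_eq)
  fix c' assume "c' \<in> charts M"
  then obtain V' \<phi>' where c': "c' = (V', \<phi>')" "(V', \<phi>') \<in> charts M" by (cases c') auto
  have o: "open {t\<in>U. \<gamma> t \<in> V'}" by (rule open_curve_preimage[OF U(1) cont charts_props(1)[OF c'(2)]])
  have "smooth_fun_on {t\<in>U. \<gamma> t \<in> V'} (\<lambda>t. \<phi>' (\<gamma> t) A)" for A
  proof (rule smooth_fun_on_cong[OF o])
    show "smooth_fun_on {t\<in>U. \<gamma> t \<in> V'} (\<lambda>t. \<phi>' (inv_into V \<phi> (\<phi> (\<gamma> t))) A)"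
      by (rule smooth_fun_on_compose[OF transition[OF c'(2)] finite depends_on_UNIV o])
         (use U in \<open>auto intro: smooth_fun_on_subset[OF sm]\<close>)
    show "\<phi>' (inv_into V \<phi> (\<phi> (\<gamma> t))) A = \<phi>' (\<gamma> t) A" if "t \<in> {t\<in>U. \<gamma> t \<in> V'}" for t
      using that U(3) inj_\<phi> by simp
  qed
  then show "case c' of (V, \<phi>) \<Rightarrow> smooth_map_on {t\<in>U. \<gamma> t \<in> V} (\<lambda>t. \<phi> (\<gamma> t))"
    by (simp add: c' smooth_map_on_def)
qed

text \<open>The transition maps of the atlas carry equality of jets from one chart to all others, by
  \<open>germ_jet_eq_compose\<close> with the same outer function on both sides.\<close>

lemma same_jetI:
  fixes \<gamma> \<gamma>' :: "('n \<Rightarrow> real) \<Rightarrow> 'x"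
  assumes \<gamma>: "smooth_near0 M \<gamma>" "\<gamma> origin \<in> V" and \<gamma>': "smooth_near0 M \<gamma>'" "\<gamma>' origin \<in> V"
    and eq: "\<And>A. germ_jet_eq r (abs_germ (\<lambda>t. \<phi> (\<gamma> t) A)) (abs_germ (\<lambda>t. \<phi> (\<gamma>' t) A))"
  shows "same_jet M r \<gamma> \<gamma>'"
proof -
  obtain U where U: "open U" "origin \<in> U" "\<And>t. t \<in> U \<Longrightarrow> \<gamma> t \<in> V" "\<And>A. smooth_fun_on U (\<lambda>t. \<phi> (\<gamma> t) A)"
    by (rule near0_chartE[OF \<gamma>]) (rule that)
  obtain U' where U': "open U'" "origin \<in> U'" "\<And>t. t \<in> U' \<Longrightarrow> \<gamma>' t \<in> V" "\<And>A. smooth_fun_on U' (\<lambda>t. \<phi> (\<gamma>' t) A)"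
    by (rule near0_chartE[OF \<gamma>']) (rule that)
  have ns: "near_smooth (\<lambda>t. \<phi> (\<gamma> t) A)" "near_smooth (\<lambda>t. \<phi> (\<gamma>' t) A)" for A
    by (rule near_smoothI[OF U(1,2,4)], rule near_smoothI[OF U'(1,2,4)])
  have "\<phi> (\<gamma> origin) = \<phi> (\<gamma>' origin)"
    using eq[unfolded germ_jet_eq_def, rule_format, of "[]"] by (simp add: germ_value_abs ns fun_eq_iff)
  then have base: "\<gamma> origin = \<gamma>' origin" using inj_\<phi> \<gamma>(2) \<gamma>'(2) by (auto dest: inj_onD)
  have "deriv0 J (\<lambda>t. \<phi>' (\<gamma> t) A) = deriv0 J (\<lambda>t. \<phi>' (\<gamma>' t) A)"
    if c': "(V', \<phi>') \<in> charts M" "\<gamma> origin \<in> V'" and J: "length J \<le> r" for V' \<phi>' A J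
  proof -
    let ?T = "\<lambda>u. \<phi>' (inv_into V \<phi> u) A"
    let ?q = "\<lambda>\<gamma> t. \<phi> (\<gamma> t)"
    have o: "open (U \<inter> U')" "origin \<in> U \<inter> U'" using U U' by auto
    have sm: "smooth_fun_on (U \<inter> U') (\<lambda>t. \<phi> (\<gamma> t) k)" "smooth_fun_on (U \<inter> U') (\<lambda>t. \<phi> (\<gamma>' t) k)" for k
      by (rule smooth_fun_on_subset[OF U(4)], simp, rule smooth_fun_on_subset[OF U'(4)], simp)
    have mem: "\<phi> (\<gamma> origin) \<in> \<phi> ` (V \<inter> V')" "\<phi> (\<gamma>' origin) \<in> \<phi> ` (V \<inter> V')" using \<gamma>(2) c'(2) base by auto
    have je: "germ_jet_eq r (abs_germ (\<lambda>t. ?T (\<phi> (\<gamma> t)))) (abs_germ (\<lambda>t. ?T (\<phi> (\<gamma>' t))))"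
      by (rule germ_jet_eq_compose[OF transition(1)[OF c'(1)] mem(1) o sm eq transition(2)[OF c'(1)] transition(2)[OF c'(1)] refl])
    have rel: "germ_rel (\<lambda>t. ?T (\<phi> (\<gamma> t))) (\<lambda>t. \<phi>' (\<gamma> t) A)" "germ_rel (\<lambda>t. ?T (\<phi> (\<gamma>' t))) (\<lambda>t. \<phi>' (\<gamma>' t) A)"
    proof -
      have "germ_rel (\<lambda>t. ?T (\<phi> (\<gamma> t))) (\<lambda>t. \<phi>' (\<gamma> t) A)" if
        g: "open N" "origin \<in> N" "\<And>t. t \<in> N \<Longrightarrow> \<gamma> t \<in> V" "\<And>A. smooth_fun_on N (\<lambda>t. \<phi> (\<gamma> t) A)" "\<phi> (\<gamma> origin) \<in> \<phi> ` (V \<inter> V')" for \<gamma> N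
      proof -
        have oN: "open {t\<in>N. \<phi> (\<gamma> t) \<in> \<phi> ` (V \<inter> V')}"
          by (rule open_preimage_smooth[OF g(1,4) transition(1)[OF c'(1)]])
        show ?thesis
          by (rule germ_relI[OF oN])
             (use g inj_\<phi> in \<open>auto intro!: smooth_fun_on_compose[OF transition[OF c'(1)] finite depends_on_UNIV oN] smooth_fun_on_subset[OF g(4)]\<close>)
      qed
      from this[OF U mem(1)] this[OF U' mem(2)] show
        "germ_rel (\<lambda>t. ?T (\<phi> (\<gamma> t))) (\<lambda>t. \<phi>' (\<gamma> t) A)" "germ_rel (\<lambda>t. ?T (\<phi> (\<gamma>' t))) (\<lambda>t. \<phi>' (\<gamma>' t) A)" by blast+
    qed
    have nsr: "near_smooth (\<lambda>t. \<phi>' (\<gamma> t) A)" "near_smooth (\<lambda>t. \<phi>' (\<gamma>' t) A)"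
      using rel germ_rel_sym germ_rel_trans by blast+
    show ?thesis
      using je[unfolded germ_jet_eq_def, rule_format, OF J]
      unfolding abs_germ_eqI[OF rel(1)] abs_germ_eqI[OF rel(2)] germ_value_foldr[OF nsr(1)] germ_value_foldr[OF nsr(2)] .
  qed
  then show ?thesis using base unfolding same_jet_def by auto
qed

end

lemma enum_mset_empty [simp]: "enum_mset {#} = []"
  by (metis mset_enum_mset mset_zero_iff)

lemma vel_order_qmap:
  assumes "k \<in> quot_index r \<iota>"
  shows "depends_on (vel_index r) (\<lambda>u. qmap \<iota> u k)"
proof (cases k)
  case (Inl i)
  then show ?thesis by (simp add: qmap_def) (rule depends_on_coord, simp add: vel_index_def)
next
  case (Inr p)
  then obtain \<sigma> K where p: "k = Inr (\<sigma>, K)" by (cases p) auto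
  then have "size K \<le> r" using assms by (auto simp: quot_index_def)
  then have "vel_order r (yfun \<iota> \<sigma> (enum_mset K))"
    by (intro vel_order_mono[OF conjunct2[OF yfun_props]]) simp
  then show ?thesis by (simp add: p qmap_def)
qed

lemma reg_coords_cong: "(\<And>k. k \<in> vel_index 1 \<Longrightarrow> u k = u' k) \<Longrightarrow> u \<in> reg_coords \<iota> \<longleftrightarrow> u' \<in> reg_coords \<iota>"
  using depends_onD[OF vel_order_xmat, of u u' \<iota>] by (simp add: reg_coords_def)

text \<open>The coordinates of an orbit of order \<open>s\<close> come from an arbitrary
  representative and are controlled only on \<open>quot_index s\<close>; this is enough for the
  Lie--Euler expressions.\<close>

lemma quot_lie_euler_cong:
  assumes "quot_order \<iota> s G" "\<And>k. k \<in> quot_index s \<iota> \<Longrightarrow> w k = w' k"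
  shows "quot_lie_euler \<iota> r s \<sigma> I G w = quot_lie_euler \<iota> r s \<sigma> I G w'"
proof -
  have "quot_order \<iota> s (foldr (Dtotal \<iota> s) J H)" if "quot_order \<iota> s H" for J H
    using that by (induction J) (auto intro: quot_order_Dtotal_le)
  from this[OF quot_order_qpartial[OF assms(1)]]
  have "foldr (Dtotal \<iota> s) J (qpartial \<sigma> I' G) w = foldr (Dtotal \<iota> s) J (qpartial \<sigma> I' G) w'" for J I'
    by (rule depends_onD) (rule assms(2))
  then show ?thesis by (simp add: quot_lie_euler_def)
qed

lemma depends_on_coord_expr: "depends_on K (coord_expr S K c f)"
proof -
  have "coord_expr S K c f u = coord_expr S K c f u'" if "\<forall>k\<in>K. u k = u' k" for u u'
  proof -
    have "(\<lambda>p. p \<in> S \<and> (\<forall>k\<in>K. c p k = u k)) = (\<lambda>p. p \<in> S \<and> (\<forall>k\<in>K. c p k = u' k))"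
      using that by auto
    then show ?thesis by (simp add: coord_expr_def)
  qed
  then show ?thesis by (auto simp: depends_on_def)
qed

context split_chart
begin

abbreviation jt :: "(('n \<Rightarrow> real) \<Rightarrow> 'x) \<Rightarrow> ('n, 'a) vcoords" where
  "jt \<gamma> \<equiv> jet_of (\<lambda>i. i) (\<lambda>t. \<phi> (\<gamma> t)) origin"

text \<open>Regular relative to the chart and the splitting: these are the maps whose velocities of
  order at least one lie in \<open>W\<close>.\<close>

definition regular :: "(('n \<Rightarrow> real) \<Rightarrow> 'x) \<Rightarrow> bool" where
  "regular \<gamma> \<longleftrightarrow> smooth_near0 M \<gamma> \<and> \<gamma> origin \<in> V \<and> jt \<gamma> \<in> reg_coords \<iota>"

lemma vcoord_eq: "vcoord (V, \<phi>) v = jt (rep v)"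
  by (simp add: vcoord_def jet_of_def deriv0_def)

lemma jt_apply: "jt \<gamma> (A, K) = deriv0 (enum_mset K) (\<lambda>t. \<phi> (\<gamma> t) A)"
  by (simp add: jet_of_def deriv0_def)

lemma regularE:
  assumes "regular \<gamma>"
  obtains U where "regular_curve (\<lambda>i. i) (\<lambda>t. \<phi> (\<gamma> t)) U \<iota>" "\<And>t. t \<in> U \<Longrightarrow> \<gamma> t \<in> V"
proof -
  have \<gamma>: "smooth_near0 M \<gamma>" "\<gamma> origin \<in> V" "jt \<gamma> \<in> reg_coords \<iota>" using assms by (auto simp: regular_def)
  obtain U where U: "open U" "origin \<in> U" "\<And>t. t \<in> U \<Longrightarrow> \<gamma> t \<in> V" "\<And>A. smooth_fun_on U (\<lambda>t. \<phi> (\<gamma> t) A)"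
    by (rule near0_chartE[OF \<gamma>(1,2)]) (rule that)
  have "regular_curve (\<lambda>i. i) (\<lambda>t. \<phi> (\<gamma> t)) U \<iota>"
    by unfold_locales (use U \<gamma> inj_\<iota> in auto)
  then show ?thesis using that U(3) by blast
qed

lemma jt_mset:
  assumes "smooth_near0 M \<gamma>" "\<gamma> origin \<in> V"
  shows "jt \<gamma> (A, mset J) = deriv0 J (\<lambda>t. \<phi> (\<gamma> t) A)"
proof -
  obtain U where U: "open U" "origin \<in> U" "\<And>t. t \<in> U \<Longrightarrow> \<gamma> t \<in> V" "\<And>A. smooth_fun_on U (\<lambda>t. \<phi> (\<gamma> t) A)"
    by (rule near0_chartE[OF assms]) (rule that)
  interpret curve "\<lambda>i :: 'n. i" "\<lambda>t. \<phi> (\<gamma> t)" U by unfold_locales (use U in auto)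
  show ?thesis using jet_mset[OF U(2)] by (simp add: deriv0_def)
qed

lemma jt_cong:
  assumes "same_jet M r \<gamma> \<gamma>'" "\<gamma> origin \<in> V" "k \<in> vel_index r"
  shows "jt \<gamma> k = jt \<gamma>' k"
  using assms chart unfolding same_jet_def by (cases k) (auto simp: jt_apply vel_index_def)

lemma same_jet_of_jt:
  assumes \<gamma>: "smooth_near0 M \<gamma>" "\<gamma> origin \<in> V" and \<gamma>': "smooth_near0 M \<gamma>'" "\<gamma>' origin \<in> V"
    and eq: "\<And>k. k \<in> vel_index r \<Longrightarrow> jt \<gamma> k = jt \<gamma>' k"
  shows "same_jet M r \<gamma> \<gamma>'"
proof (rule same_jetI[OF \<gamma> \<gamma>'])
  fix A
  obtain U where U: "open U" "origin \<in> U" "\<And>t. t \<in> U \<Longrightarrow> \<gamma> t \<in> V" "\<And>A. smooth_fun_on U (\<lambda>t. \<phi> (\<gamma> t) A)"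
    by (rule near0_chartE[OF \<gamma>]) (rule that)
  obtain U' where U': "open U'" "origin \<in> U'" "\<And>t. t \<in> U' \<Longrightarrow> \<gamma>' t \<in> V" "\<And>A. smooth_fun_on U' (\<lambda>t. \<phi> (\<gamma>' t) A)"
    by (rule near0_chartE[OF \<gamma>']) (rule that)
  have ns: "near_smooth (\<lambda>t. \<phi> (\<gamma> t) A)" "near_smooth (\<lambda>t. \<phi> (\<gamma>' t) A)"
    by (rule near_smoothI[OF U(1,2,4)], rule near_smoothI[OF U'(1,2,4)])
  have "deriv0 J (\<lambda>t. \<phi> (\<gamma> t) A) = deriv0 J (\<lambda>t. \<phi> (\<gamma>' t) A)" if "length J \<le> r" for J
    using eq[of "(A, mset J)"] that by (simp add: jt_mset \<gamma> \<gamma>' vel_index_def)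
  then show "germ_jet_eq r (abs_germ (\<lambda>t. \<phi> (\<gamma> t) A)) (abs_germ (\<lambda>t. \<phi> (\<gamma>' t) A))"
    unfolding germ_jet_eq_def germ_value_foldr[OF ns(1)] germ_value_foldr[OF ns(2)] by blast
qed

lemma regular_cong:
  assumes "same_jet M r \<gamma> \<gamma>'" "1 \<le> r" "regular \<gamma>" "smooth_near0 M \<gamma>'"
  shows "regular \<gamma>'"
proof -
  have "jt \<gamma> k = jt \<gamma>' k" if "k \<in> vel_index 1" for k
    using jt_cong[OF same_jet_mono[OF assms(1,2)] _ that] assms(3) by (simp add: regular_def)
  then have "jt \<gamma>' \<in> reg_coords \<iota>" using assms(3) reg_coords_cong[of "jt \<gamma>" "jt \<gamma>'" \<iota>] by (simp add: regular_def)
  then show ?thesis using assms by (auto simp: regular_def same_jet_def)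
qed

lemma W_D:
  assumes "v \<in> W M r (V, \<phi>) \<iota>"
  shows "regular (rep v)" "jet0 M r (rep v) = v"
proof -
  obtain \<gamma> where \<gamma>: "v = jet0 M r \<gamma>" "smooth_near0 M \<gamma>"
    using assms by (auto simp: W_def imm_over_def imm_velocities_def)
  show "jet0 M r (rep v) = v" using rep_jet0(2)[OF \<gamma>(2), of r] \<gamma>(1) jet0_eqI by metis
  show "regular (rep v)"
    using assms rep_jet0(1)[OF \<gamma>(2), of r] \<gamma>(1)
    by (auto simp: regular_def W_def imm_over_def detx_def vcoord_eq reg_coords_def)
qed

lemma regular_rep: "regular \<gamma> \<Longrightarrow> 1 \<le> r \<Longrightarrow> regular (rep (jet0 M r \<gamma>))"
  using rep_jet0[of M \<gamma> r] regular_cong by (auto simp: regular_def)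

lemma W_I:
  assumes "regular \<gamma>" "1 \<le> r"
  shows "jet0 M r \<gamma> \<in> W M r (V, \<phi>) \<iota>"
proof -
  have \<gamma>: "smooth_near0 M \<gamma>" "\<gamma> origin \<in> V" "det (xmat \<iota> (jt \<gamma>)) \<noteq> 0"
    using assms by (auto simp: regular_def reg_coords_def)
  have "immersion_at0 M \<gamma>"
    unfolding immersion_at0_def
  proof (intro bexI[OF _ chart] case_prodI conjI allI impI \<gamma>(2))
    fix w :: "'n \<Rightarrow> real" assume w: "\<forall>A. (\<Sum>j\<in>UNIV. w j * deriv0 [j] (\<lambda>t. \<phi> (\<gamma> t) A)) = 0"
    \<comment> \<open>The \<open>x^i\<close> rows of the differential already have trivial kernel,
      so the full differential is injective.\<close>
    have "xmat \<iota> (jt \<gamma>) *v (\<chi> j. w j) = 0"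
      using w by (simp add: vec_eq_iff matrix_vector_mult_def xmat_jet_of deriv0_def mult.commute)
    then have "matrix_inv (xmat \<iota> (jt \<gamma>)) *v (xmat \<iota> (jt \<gamma>) *v (\<chi> j. w j)) = 0" by simp
    then have "(\<chi> j. w j) = 0" by (simp add: matrix_vector_mul_assoc matrix_inv_det[OF \<gamma>(3)])
    then show "w = origin" by (simp add: vec_eq_iff fun_eq_iff)
  qed
  then have "jet0 M r \<gamma> \<in> imm_velocities M r" using \<gamma> by (auto simp: imm_velocities_def)
  then show ?thesis
    using regular_rep[OF assms] by (auto simp: W_def imm_over_def detx_def vcoord_eq regular_def reg_coords_def)
qed

lemma curve_of_coords:
  assumes g: "\<And>A. smooth_fun_on UNIV (\<lambda>t. g t A)" "g origin \<in> \<phi> ` V"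
  obtains \<gamma> :: "('n \<Rightarrow> real) \<Rightarrow> 'x" and U where "smooth_near0 M \<gamma>" "\<gamma> origin \<in> V" "open U" "origin \<in> U"
    "\<And>t. t \<in> U \<Longrightarrow> \<phi> (\<gamma> t) = g t" "\<And>J A. deriv0 J (\<lambda>t. \<phi> (\<gamma> t) A) = deriv0 J (\<lambda>t. g t A)"
proof -
  define U where "U = {t\<in>UNIV. g t \<in> \<phi> ` V}"
  have U: "open U" unfolding U_def by (rule open_preimage_smooth[OF open_UNIV g(1) V_props(2)])
  have U0: "origin \<in> U" using g by (simp add: U_def)
  define \<gamma> where "\<gamma> t = inv_into V \<phi> (g t)" for t
  have \<gamma>: "\<gamma> t \<in> V" "\<phi> (\<gamma> t) = g t" if "t \<in> U" for t
    using that unfolding U_def \<gamma>_def by (auto simp: inv_into_into f_inv_into_f)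
  have sm: "smooth_fun_on U (\<lambda>t. \<phi> (\<gamma> t) A)" for A
    by (rule smooth_fun_on_cong[OF U smooth_fun_on_subset[OF g(1)[of A]]]) (auto simp: \<gamma>)
  have "deriv0 J (\<lambda>t. \<phi> (\<gamma> t) A) = deriv0 J (\<lambda>t. g t A)" for J A
    unfolding deriv0_def by (rule foldr_pderiv_at_cong[OF U _ U0]) (simp add: \<gamma>)
  then show ?thesis
    using that[of \<gamma> U] near0_chartI[OF U U0 \<gamma>(1) sm] \<gamma> U U0 by blast
qed

definition \<Omega>v :: "('n, 'a) vcoords set" where
  "\<Omega>v = {u. (\<lambda>A. u (A, {#})) \<in> \<phi> ` V} \<inter> reg_coords \<iota>"

text \<open>The chart coordinates of the base point, recovered from the \<open>x^i\<close> and the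
  \<open>y^\<sigma>\<close> of order zero. A point of the quotient space of coordinates is
  restricted by nothing else, which is why \<open>\<Omega>q\<close> is defined through it.\<close>

definition base :: "('n, 'a) qcoords \<Rightarrow> 'a \<Rightarrow> real" where
  "base w A = (if A \<in> range \<iota> then w (Inl (inv \<iota> A)) else w (Inr (A, {#})))"

definition \<Omega>q :: "('n, 'a) qcoords set" where
  "\<Omega>q = {w. base w \<in> \<phi> ` V}"

lemma open_\<Omega>v: "open \<Omega>v"
proof -
  have "open ((\<lambda>u A. u (A, {#})) -` (\<phi> ` V) :: ('n, 'a) vcoords set)"
    by (rule open_vimage[OF V_props(2)]) (intro continuous_on_coordinatewise_then_product continuous_on_coord)
  then show ?thesis unfolding \<Omega>v_def using open_reg_coords by (auto simp: vimage_def)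
qed

lemma open_\<Omega>q: "open \<Omega>q"
proof -
  have "continuous_on UNIV base"
  proof (rule continuous_on_coordinatewise_then_product)
    show "continuous_on UNIV (\<lambda>w. base w A)" for A
      by (cases "A \<in> range \<iota>") (simp_all add: base_def continuous_on_coord)
  qed
  from open_vimage[OF V_props(2) this] show ?thesis by (simp add: \<Omega>q_def vimage_def)
qed

lemma base_qmap: "base (qmap \<iota> u) = (\<lambda>A. u (A, {#}))"
  using inj_\<iota> by (auto simp: base_def qmap_def fun_eq_iff)

lemma jt_\<Omega>v:
  assumes "regular \<gamma>"
  shows "jt \<gamma> \<in> \<Omega>v"
proof -
  have "(\<lambda>A. jt \<gamma> (A, {#})) = \<phi> (\<gamma> origin)" by (simp add: jt_apply deriv0_def)
  then show ?thesis using assms by (auto simp: \<Omega>v_def regular_def)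
qed

lemma realize_vel:
  assumes "u \<in> \<Omega>v" "1 \<le> r"
  shows "\<exists>\<gamma>. regular \<gamma> \<and> (\<forall>k\<in>vel_index r. jt \<gamma> k = u k)"
proof -
  define g where "g t A = taylor_poly r (\<lambda>K. u (A, K)) t" for t A
  have "g origin = (\<lambda>A. u (A, {#}))"
    using deriv0_taylor_poly[of "[] :: 'n list" r] by (simp add: g_def deriv0_def fun_eq_iff)
  then have g0: "g origin \<in> \<phi> ` V" using assms by (simp add: \<Omega>v_def)
  have gsm: "smooth_fun_on UNIV (\<lambda>t. g t A)" for A
    by (simp add: g_def smooth_fun_on_taylor_poly)
  obtain \<gamma> U where \<gamma>: "smooth_near0 M \<gamma>" "\<gamma> origin \<in> V" "open U" "origin \<in> U"
    "\<And>t. t \<in> U \<Longrightarrow> \<phi> (\<gamma> t) = g t" "\<And>J A. deriv0 J (\<lambda>t. \<phi> (\<gamma> t) A) = deriv0 J (\<lambda>t. g t A)"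
    by (rule curve_of_coords[OF gsm g0]) (rule that)
  have eq: "jt \<gamma> k = u k" if "k \<in> vel_index r" for k
    using that \<gamma>(6) by (cases k) (auto simp: jt_apply g_def deriv0_taylor_poly vel_index_def)
  have "jt \<gamma> k = u k" if "k \<in> vel_index 1" for k
    using eq that vel_index_mono[OF assms(2)] by blast
  then have "jt \<gamma> \<in> reg_coords \<iota>"
    using reg_coords_cong[of "jt \<gamma>" u \<iota>] assms by (simp add: \<Omega>v_def)
  then show ?thesis using \<gamma> eq by (auto simp: regular_def)
qed

text \<open>With \<open>x^i(t) = w^i + t^i\<close> the frame is trivial, \<open>nab\<close> equals
  the ordinary derivatives, and the \<open>y^\<sigma>_J\<close> become plain Taylor coefficients,
  which can be prescribed freely.\<close>

lemma realize_quot: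
  assumes "w \<in> \<Omega>q" "1 \<le> r"
  shows "\<exists>\<gamma>. regular \<gamma> \<and> (\<forall>k\<in>quot_index r \<iota>. qmap \<iota> (jt \<gamma>) k = w k)"
proof -
  define g where "g t A = (if A \<in> range \<iota> then w (Inl (inv \<iota> A)) + t (inv \<iota> A)
      else taylor_poly r (\<lambda>K. w (Inr (A, K))) t)" for t A
  have g\<iota>: "g t (\<iota> i) = w (Inl i) + t i" for t i using inj_\<iota> by (simp add: g_def)
  have gs: "g t \<sigma> = taylor_poly r (\<lambda>K. w (Inr (\<sigma>, K))) t" if "\<sigma> \<notin> range \<iota>" for t \<sigma> using that by (simp add: g_def)
  have "g origin = base w"
    using deriv0_taylor_poly[of "[] :: 'n list" r] by (auto simp: g_def base_def deriv0_def fun_eq_iff)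
  then have g0: "g origin \<in> \<phi> ` V" using assms by (simp add: \<Omega>q_def)
  have gsm: "smooth_fun_on UNIV (\<lambda>t. g t A)" for A
    by (cases "A \<in> range \<iota>")
       (auto simp: g_def intro!: smooth_fun_on_taylor_poly smooth_fun_on_add smooth_fun_on_const smooth_fun_on_coord)
  obtain \<gamma> U where \<gamma>: "smooth_near0 M \<gamma>" "\<gamma> origin \<in> V" "open U" "origin \<in> U"
    "\<And>t. t \<in> U \<Longrightarrow> \<phi> (\<gamma> t) = g t" "\<And>J A. deriv0 J (\<lambda>t. \<phi> (\<gamma> t) A) = deriv0 J (\<lambda>t. g t A)"
    by (rule curve_of_coords[OF gsm g0]) (rule that)
  have dx: "pderiv_at j (\<lambda>t. w (Inl i) + t i) = (\<lambda>_. if i = j then 1 else 0)" for i j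
  proof
    fix t
    have "((\<lambda>x. w (Inl i) + (t(j := x)) i) has_real_derivative (if i = j then 1 else 0)) (at (t j))"
      by (cases "i = j") (auto intro!: derivative_eq_intros)
    then show "pderiv_at j (\<lambda>t. w (Inl i) + t i) t = (if i = j then 1 else 0)"
      unfolding pderiv_at_def by (rule DERIV_imp_deriv)
  qed
  have "xmat \<iota> (jt \<gamma>) $ i $ j = mat 1 $ i $ j" for i j
    using \<gamma>(6)[of "[j]" "\<iota> i"] by (simp add: xmat_def jt_apply g\<iota> deriv0_def dx mat_def)
  then have "xmat \<iota> (jt \<gamma>) = mat 1" by (simp add: vec_eq_iff)
  then have reg: "regular \<gamma>" using \<gamma> by (simp add: regular_def reg_coords_def)
  obtain N where N: "regular_curve (\<lambda>i. i) (\<lambda>t. \<phi> (\<gamma> t)) N \<iota>" by (rule regularE[OF reg])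
  interpret c: regular_curve "\<lambda>i :: 'n. i" "\<lambda>t. \<phi> (\<gamma> t)" N \<iota> by (rule N)
  have compg: "c.comp A = abs_germ (\<lambda>t. g t A)" for A
    unfolding c.comp_def
    by (rule abs_germ_eqI[symmetric], rule germ_relI[OF \<gamma>(3,4) smooth_fun_on_subset[OF gsm]]) (auto simp: \<gamma>)
  have "germ_deriv j (c.comp (\<iota> i)) = (if i = j then 1 else 0)" for i j
  proof -
    have "near_smooth (\<lambda>t. w (Inl i) + t i)" by (intro germ_rel_add germ_rel_const near_smooth_coord)
    then show ?thesis unfolding compg g\<iota> by (simp add: germ_deriv_abs dx abs_germ_const)
  qed
  then have zk: "c.cmp (zmat \<iota> k i) = (if k = i then 1 else 0)" for k i
    using c.x_z[of k i] by (simp add: sum_delta_mult)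
  have "c.nab i f = germ_deriv i f" for i f
    unfolding c.nab_def unfolding zk sum_delta_mult ..
  then have nab: "c.nab = germ_deriv" by (intro ext)
  have "qmap \<iota> (jt \<gamma>) k = w k" if k: "k \<in> quot_index r \<iota>" for k
  proof (cases k)
    case (Inl i)
    then show ?thesis using \<gamma>(6)[of "[]" "\<iota> i"] by (simp add: qmap_def jt_apply g\<iota> deriv0_def)
  next
    case (Inr p)
    then obtain \<sigma> K where p: "k = Inr (\<sigma>, K)" by (cases p) auto
    have \<sigma>: "\<sigma> \<notin> range \<iota>" "size K \<le> r" using k p by (auto simp: quot_index_def)
    have ns: "near_smooth (\<lambda>t. g t \<sigma>)" by (rule near_smoothI[OF open_UNIV UNIV_I gsm])
    have "yfun \<iota> \<sigma> (enum_mset K) (jt \<gamma>) = germ_value (c.nb.dl (enum_mset K) (c.comp \<sigma>))"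
      using c.cmp_value[OF c.reg conjunct1[OF yfun_props] conjunct2[OF yfun_props]] by (simp only: c.cmp_yfun)
    also have "\<dots> = deriv0 (enum_mset K) (\<lambda>t. g t \<sigma>)"
      unfolding nab compg by (rule germ_value_foldr[OF ns])
    also have "\<dots> = w (Inr (\<sigma>, K))"
      using \<sigma> by (simp add: gs deriv0_taylor_poly)
    finally show ?thesis by (simp add: p qmap_def)
  qed
  then show ?thesis using reg by blast
qed

section \<open>The orbits of the jet group in coordinates\<close>

lemma near0_reparam:
  fixes \<gamma> :: "('n \<Rightarrow> real) \<Rightarrow> 'x"
  assumes "smooth_near0 M \<gamma>" "\<gamma> origin \<in> V" "local_diffeo0 \<beta>"
  shows "smooth_near0 M (\<gamma> \<circ> \<beta>)" "(\<gamma> \<circ> \<beta>) origin \<in> V"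
proof -
  obtain U where U: "open U" "origin \<in> U" "\<And>t. t \<in> U \<Longrightarrow> \<gamma> t \<in> V" "\<And>A. smooth_fun_on U (\<lambda>t. \<phi> (\<gamma> t) A)"
    by (rule near0_chartE[OF assms(1,2)]) (rule that)
  obtain N N' \<beta>' where b: "open N" "origin \<in> N" "open N'" "\<beta> origin = origin"
    "\<And>u. u \<in> N \<Longrightarrow> \<beta> u \<in> N' \<and> \<beta>' (\<beta> u) = u" "\<And>w. w \<in> N' \<Longrightarrow> \<beta>' w \<in> N \<and> \<beta> (\<beta>' w) = w"
    "\<And>i. smooth_fun_on N (\<lambda>u. \<beta> u i)" "\<And>i. smooth_fun_on N' (\<lambda>w. \<beta>' w i)"
    by (rule local_diffeo0E[OF assms(3)]) (rule that)
  let ?U = "{t\<in>N. \<beta> t \<in> U}"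
  have o: "open ?U" by (rule open_preimage_smooth[OF b(1,7) U(1)])
  show "smooth_near0 M (\<gamma> \<circ> \<beta>)"
  proof (rule near0_chartI[OF o])
    show "smooth_fun_on ?U (\<lambda>t. \<phi> ((\<gamma> \<circ> \<beta>) t) A)" for A
      unfolding o_def
      by (rule smooth_fun_on_compose[OF U(1,4) finite depends_on_UNIV o]) (auto intro: smooth_fun_on_subset[OF b(7)])
  qed (use b U in auto)
  show "(\<gamma> \<circ> \<beta>) origin \<in> V" using assms b by simp
qed

text \<open>The components of the reparametrised curve are pull-backs of the original ones, and
  \<open>nab\<close> commutes with pull-back. Since \<open>\<beta>\<close> fixes the origin, the
  values there do not change.\<close>

lemma regular_reparam:
  assumes "regular \<gamma>" "local_diffeo0 \<beta>"
  shows "regular (\<gamma> \<circ> \<beta>)" "qmap \<iota> (jt (\<gamma> \<circ> \<beta>)) = qmap \<iota> (jt \<gamma>)"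
proof -
  have \<gamma>: "smooth_near0 M \<gamma>" "\<gamma> origin \<in> V" using assms by (auto simp: regular_def)
  obtain U where U: "regular_curve (\<lambda>i. i) (\<lambda>t. \<phi> (\<gamma> t)) U \<iota>" by (rule regularE[OF assms(1)])
  interpret c0: regular_curve "\<lambda>i :: 'n. i" "\<lambda>t. \<phi> (\<gamma> t)" U \<iota> by (rule U)
  obtain N N' \<beta>' where b: "open N" "origin \<in> N" "open N'" "\<beta> origin = origin"
    "\<And>u. u \<in> N \<Longrightarrow> \<beta> u \<in> N' \<and> \<beta>' (\<beta> u) = u" "\<And>w. w \<in> N' \<Longrightarrow> \<beta>' w \<in> N \<and> \<beta> (\<beta>' w) = w"
    "\<And>i. smooth_fun_on N (\<lambda>u. \<beta> u i)" "\<And>i. smooth_fun_on N' (\<lambda>w. \<beta>' w i)"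
    by (rule local_diffeo0E[OF assms(2)]) (rule that)
  have "xmat \<iota> (jt (\<gamma> \<circ> \<beta>)) = xmat \<iota> (jt \<gamma>) ** Jac \<beta> origin"
    using xmat_compose[OF c0.open_U c0.smooth_\<Gamma> b(1,2,7), where \<iota> = \<iota>] c0.origin_U b(4) by (simp add: o_def)
  then have "det (xmat \<iota> (jt (\<gamma> \<circ> \<beta>))) \<noteq> 0"
    using local_diffeo0_regular[OF assms(2)] c0.regular by (simp add: det_mul reg_coords_def)
  then show reg: "regular (\<gamma> \<circ> \<beta>)" using near0_reparam[OF \<gamma> assms(2)] by (simp add: regular_def reg_coords_def)
  obtain U' where U': "regular_curve (\<lambda>i. i) (\<lambda>t. \<phi> ((\<gamma> \<circ> \<beta>) t)) U' \<iota>" by (rule regularE[OF reg])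
  interpret c1: regular_curve "\<lambda>i :: 'n. i" "\<lambda>t. \<phi> ((\<gamma> \<circ> \<beta>) t)" U' \<iota> by (rule U')
  interpret r: germ_reparam \<beta> N by unfold_locales (use b in auto)
  have pull: "c1.comp A = germ_pull \<beta> (c0.comp A)" for A
    unfolding c0.comp_def c1.comp_def using r.germ_pull_abs[OF c0.near_smooth_\<Gamma>] by simp
  have "yfun \<iota> \<sigma> I (jt (\<gamma> \<circ> \<beta>)) = yfun \<iota> \<sigma> I (jt \<gamma>)" for \<sigma> I
  proof -
    have "yfun \<iota> \<sigma> I (jt (\<gamma> \<circ> \<beta>)) = germ_value (c1.nb.dl I (c1.comp \<sigma>))"
      using c1.cmp_value[OF c1.reg conjunct1[OF yfun_props] conjunct2[OF yfun_props]] by (simp only: c1.cmp_yfun)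
    also have "c1.nb.dl I (c1.comp \<sigma>) = germ_pull \<beta> (c0.nb.dl I (c0.comp \<sigma>))"
      unfolding pull[of \<sigma>] by (rule r.nab_list_pull[OF c0.adapted_frame_axioms c1.adapted_frame_axioms pull])
    also have "germ_value \<dots> = yfun \<iota> \<sigma> I (jt \<gamma>)"
      unfolding r.germ_value_pull
      using c0.cmp_value[OF c0.reg conjunct1[OF yfun_props] conjunct2[OF yfun_props]] by (simp only: c0.cmp_yfun)
    finally show ?thesis .
  qed
  then show "qmap \<iota> (jt (\<gamma> \<circ> \<beta>)) = qmap \<iota> (jt \<gamma>)"
    by (auto simp: qmap_def fun_eq_iff jt_apply deriv0_def b(4) split: sum.split)
qed

text \<open>Composition of jets does not depend on representatives. This is needed because the
  action composes representatives picked by \<open>rep\<close>.\<close>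

lemma same_jet_comp:
  fixes \<gamma> \<gamma>' :: "('n \<Rightarrow> real) \<Rightarrow> 'x"
  assumes \<gamma>: "smooth_near0 M \<gamma>" "\<gamma> origin \<in> V" and \<gamma>': "smooth_near0 M \<gamma>'" and sj: "same_jet M r \<gamma> \<gamma>'"
    and \<beta>: "local_diffeo0 \<beta>" "local_diffeo0 \<beta>'"
    and eq: "\<And>i J. length J \<le> r \<Longrightarrow> deriv0 J (\<lambda>t. \<beta> t i) = deriv0 J (\<lambda>t. \<beta>' t i)"
  shows "same_jet M r (\<gamma> \<circ> \<beta>) (\<gamma>' \<circ> \<beta>')"
proof -
  have \<gamma>'0: "\<gamma>' origin \<in> V" using sj \<gamma>(2) by (simp add: same_jet_def)
  obtain U where U: "open U" "origin \<in> U" "\<And>t. t \<in> U \<Longrightarrow> \<gamma> t \<in> V" "\<And>A. smooth_fun_on U (\<lambda>t. \<phi> (\<gamma> t) A)"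
    by (rule near0_chartE[OF \<gamma>]) (rule that)
  obtain U' where U': "open U'" "origin \<in> U'" "\<And>t. t \<in> U' \<Longrightarrow> \<gamma>' t \<in> V" "\<And>A. smooth_fun_on U' (\<lambda>t. \<phi> (\<gamma>' t) A)"
    by (rule near0_chartE[OF \<gamma>' \<gamma>'0]) (rule that)
  obtain N where b: "open N" "origin \<in> N" "\<beta> origin = origin" "\<And>i. smooth_fun_on N (\<lambda>u. \<beta> u i)"
    by (rule local_diffeo0E[OF \<beta>(1)]) (rule that)
  obtain N' where b': "open N'" "origin \<in> N'" "\<beta>' origin = origin" "\<And>i. smooth_fun_on N' (\<lambda>u. \<beta>' u i)"
    by (rule local_diffeo0E[OF \<beta>(2)]) (rule that)
  have ns: "near_smooth (\<lambda>t. \<beta> t k)" "near_smooth (\<lambda>t. \<beta>' t k)" for k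
    by (rule near_smoothI[OF b(1,2,4)], rule near_smoothI[OF b'(1,2,4)])
  show ?thesis
  proof (rule same_jetI[OF near0_reparam[OF \<gamma> \<beta>(1)] near0_reparam[OF \<gamma>' \<gamma>'0 \<beta>(2)]])
    fix A
    have "germ_jet_eq r (abs_germ (\<lambda>t. (\<lambda>u. \<phi> (\<gamma> u) A) (\<beta> t))) (abs_germ (\<lambda>t. (\<lambda>u. \<phi> (\<gamma>' u) A) (\<beta>' t)))"
    proof (rule germ_jet_eq_compose[where \<Omega> = "U \<inter> U'" and U = "N \<inter> N'" and q = \<beta> and q' = \<beta>'
          and H = "\<lambda>u. \<phi> (\<gamma> u) A" and H' = "\<lambda>u. \<phi> (\<gamma>' u) A"])
      show "germ_jet_eq r (abs_germ (\<lambda>t. \<beta> t k)) (abs_germ (\<lambda>t. \<beta>' t k))" for k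
        unfolding germ_jet_eq_def germ_value_foldr[OF ns(1)] germ_value_foldr[OF ns(2)] using eq by blast
      show "foldr pderiv_at J (\<lambda>u. \<phi> (\<gamma> u) A) (\<beta> origin) = foldr pderiv_at J (\<lambda>u. \<phi> (\<gamma>' u) A) (\<beta> origin)"
        if "length J \<le> r" for J
        using sj that chart \<gamma>(2) unfolding same_jet_def b(3) deriv0_def by blast
      show "smooth_fun_on (N \<inter> N') (\<lambda>t. \<beta> t k)" "smooth_fun_on (N \<inter> N') (\<lambda>t. \<beta>' t k)" for k
        by (rule smooth_fun_on_subset[OF b(4)], simp, rule smooth_fun_on_subset[OF b'(4)], simp)
      show "smooth_fun_on (U \<inter> U') (\<lambda>u. \<phi> (\<gamma> u) A)" "smooth_fun_on (U \<inter> U') (\<lambda>u. \<phi> (\<gamma>' u) A)"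
        by (rule smooth_fun_on_subset[OF U(4)], simp, rule smooth_fun_on_subset[OF U'(4)], simp)
    qed (use U(1,2) U'(1,2) b(1-3) b'(1-3) in auto)
    then show "germ_jet_eq r (abs_germ (\<lambda>t. \<phi> ((\<gamma> \<circ> \<beta>) t) A)) (abs_germ (\<lambda>t. \<phi> ((\<gamma>' \<circ> \<beta>') t) A))" by simp
  qed
qed

text \<open>Reparametrising by \<open>\<alpha>\<close> makes the \<open>x\<close> components
  coincide as germs. The two curves then have the same frame, and equal \<open>y\<close> coordinates
  mean equal iterated \<open>nab\<close> derivatives, hence equal jets.\<close>

lemma reparam_exists:
  assumes reg: "regular \<gamma>" "regular \<gamma>'" and eq: "\<And>k. k \<in> quot_index r \<iota> \<Longrightarrow> qmap \<iota> (jt \<gamma>) k = qmap \<iota> (jt \<gamma>') k"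
  shows "\<exists>\<alpha>. local_diffeo0 \<alpha> \<and> same_jet M r (\<gamma> \<circ> \<alpha>) \<gamma>'"
proof -
  define x where "x t i = \<phi> (\<gamma> t) (\<iota> i)" for t i
  define x' where "x' t i = \<phi> (\<gamma>' t) (\<iota> i)" for t i
  obtain U where U: "regular_curve (\<lambda>i. i) (\<lambda>t. \<phi> (\<gamma> t)) U \<iota>" by (rule regularE[OF reg(1)])
  interpret c0: regular_curve "\<lambda>i :: 'n. i" "\<lambda>t. \<phi> (\<gamma> t)" U \<iota> by (rule U)
  obtain U' where U': "regular_curve (\<lambda>i. i) (\<lambda>t. \<phi> (\<gamma>' t)) U' \<iota>" by (rule regularE[OF reg(2)])
  interpret c2: regular_curve "\<lambda>i :: 'n. i" "\<lambda>t. \<phi> (\<gamma>' t)" U' \<iota> by (rule U')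
  have smx: "smooth_fun_on U (\<lambda>t. x t i)" "smooth_fun_on U' (\<lambda>t. x' t i)" for i
    unfolding x_def x'_def by (rule c0.smooth_\<Gamma>, rule c2.smooth_\<Gamma>)
  have "Jac x origin = xmat \<iota> (jt \<gamma>)" "Jac x' origin = xmat \<iota> (jt \<gamma>')"
    by (simp_all add: vec_eq_iff xmat_jet_of x_def x'_def)
  then have det: "det (Jac x origin) \<noteq> 0" "det (Jac x' origin) \<noteq> 0"
    using c0.regular c2.regular by (simp_all add: reg_coords_def)
  have "x origin i = x' origin i" for i
    using eq[of "Inl i"] by (simp add: quot_index_def qmap_def jt_apply deriv0_def x_def x'_def)
  then have x0: "x' origin = x origin" by (simp add: fun_eq_iff)
  obtain U1 V1 \<psi> where A: "open U1" "origin \<in> U1" "U1 \<subseteq> U" "open V1" "x origin \<in> V1"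
    "\<And>u. u \<in> U1 \<Longrightarrow> x u \<in> V1 \<and> \<psi> (x u) = u" "\<And>w. w \<in> V1 \<Longrightarrow> \<psi> w \<in> U1 \<and> x (\<psi> w) = w"
    "\<And>i. smooth_fun_on V1 (\<lambda>w. \<psi> w i)"
    by (rule local_inverse[OF c0.open_U c0.origin_U smx(1) det(1)]) (rule that)
  obtain U2 V2 \<psi>' where B: "open U2" "origin \<in> U2" "U2 \<subseteq> U'" "open V2" "x' origin \<in> V2"
    "\<And>u. u \<in> U2 \<Longrightarrow> x' u \<in> V2 \<and> \<psi>' (x' u) = u" "\<And>w. w \<in> V2 \<Longrightarrow> \<psi>' w \<in> U2 \<and> x' (\<psi>' w) = w"
    "\<And>i. smooth_fun_on V2 (\<lambda>w. \<psi>' w i)"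
    by (rule local_inverse[OF c2.open_U c2.origin_U smx(2) det(2)]) (rule that)
  have smx1: "smooth_fun_on U1 (\<lambda>t. x t i)" "smooth_fun_on U2 (\<lambda>t. x' t i)" for i
    by (rule smooth_fun_on_subset[OF smx(1) A(3)], rule smooth_fun_on_subset[OF smx(2) B(3)])
  let ?D = "{t\<in>U2. x' t \<in> V1}" and ?R = "{t\<in>U1. x t \<in> V2}"
  have o: "open ?D" "open ?R"
    by (rule open_preimage_smooth[OF B(1) smx1(2) A(4)], rule open_preimage_smooth[OF A(1) smx1(1) B(4)])
  \<comment> \<open>The local inverse \<open>\<psi>\<close> of \<open>x\<close> after
    \<open>x'\<close>. The origin is fixed because the order zero coordinates \<open>x^i\<close> of
    the two curves agree.\<close>
  define \<alpha> where "\<alpha> t = \<psi> (x' t)" for t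
  have D0: "origin \<in> ?D" using B(2) A(5) x0 by simp
  have \<alpha>: "local_diffeo0 \<alpha>"
  proof (rule local_diffeo0I[OF o(1) D0 o(2), where \<alpha>' = "\<lambda>t. \<psi>' (x t)"])
    show "\<alpha> origin = origin" using A(2,6) x0 by (simp add: \<alpha>_def)
    show "\<alpha> u \<in> ?R \<and> \<psi>' (x (\<alpha> u)) = u" if "u \<in> ?D" for u
      using that A(7)[of "x' u"] B(6)[of u] by (simp add: \<alpha>_def)
    show "\<psi>' (x w) \<in> ?D \<and> \<alpha> (\<psi>' (x w)) = w" if "w \<in> ?R" for w
      using that B(7)[of "x w"] A(6)[of w] by (simp add: \<alpha>_def)
    show "smooth_fun_on ?D (\<lambda>u. \<alpha> u i)" for i
      unfolding \<alpha>_def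
      by (rule smooth_fun_on_compose[OF A(4,8) finite depends_on_UNIV o(1)]) (auto intro: smooth_fun_on_subset[OF smx1(2)])
    show "smooth_fun_on ?R (\<lambda>u. \<psi>' (x u) i)" for i
      by (rule smooth_fun_on_compose[OF B(4,8) finite depends_on_UNIV o(2)]) (auto intro: smooth_fun_on_subset[OF smx1(1)])
  qed
  note r = regular_reparam[OF reg(1) \<alpha>]
  obtain U3 where U3: "regular_curve (\<lambda>i. i) (\<lambda>t. \<phi> ((\<gamma> \<circ> \<alpha>) t)) U3 \<iota>" by (rule regularE[OF r(1)])
  interpret c1: regular_curve "\<lambda>i :: 'n. i" "\<lambda>t. \<phi> ((\<gamma> \<circ> \<alpha>) t)" U3 \<iota> by (rule U3)
  have comp\<iota>: "c1.comp (\<iota> i) = c2.comp (\<iota> i)" for i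
    unfolding c1.comp_def c2.comp_def
  proof (rule abs_germ_eqI[symmetric], rule germ_relI[OF o(1) D0])
    show "smooth_fun_on ?D (\<lambda>t. \<phi> (\<gamma>' t) (\<iota> i))"
      using smooth_fun_on_subset[OF smx1(2)[of i], of ?D] by (auto simp: x'_def)
    show "\<phi> (\<gamma>' t) (\<iota> i) = \<phi> ((\<gamma> \<circ> \<alpha>) t) (\<iota> i)" if "t \<in> ?D" for t
      using that A(7)[of "x' t"] by (auto simp: \<alpha>_def x_def x'_def fun_eq_iff)
  qed
  have fr: "adapted_frame germ_deriv (\<lambda>i. c2.comp (\<iota> i)) (\<lambda>p i. c1.cmp (zmat \<iota> p i))"
    using c1.adapted_frame_axioms by (simp only: comp\<iota>)
  \<comment> \<open>A frame is determined by the functions \<open>x\<close> alone, so the iterated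
    derivatives of both curves are taken with respect to the same \<open>nab\<close>.\<close>
  have zz: "(\<lambda>p i. c1.cmp (zmat \<iota> p i)) = (\<lambda>p i. c2.cmp (zmat \<iota> p i))"
    by (rule adapted_frame_unique[OF fr c2.adapted_frame_axioms])
  have je: "germ_jet_eq r (c1.comp A) (c2.comp A)" for A
  proof (cases "A \<in> range \<iota>")
    case True
    then obtain i where "A = \<iota> i" by blast
    then show ?thesis by (simp only: comp\<iota> germ_jet_eq_refl)
  next
    case False
    show ?thesis
    proof (rule nab_jets[OF c2.adapted_frame_axioms])
      fix I :: "'n list" assume I: "length I \<le> r"
      have 1: "germ_value (c1.nb.dl I (c1.comp A)) = qmap \<iota> (jt (\<gamma> \<circ> \<alpha>)) (Inr (A, mset I))"
      proof -
        have "germ_value (c1.nb.dl (enum_mset (mset I)) (c1.comp A)) = yfun \<iota> A (enum_mset (mset I)) (jt (\<gamma> \<circ> \<alpha>))"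
          using c1.cmp_value[OF c1.reg conjunct1[OF yfun_props] conjunct2[OF yfun_props]] by (simp only: c1.cmp_yfun)
        moreover have "c1.nb.dl I (c1.comp A) = c1.nb.dl (enum_mset (mset I)) (c1.comp A)"
          by (rule c1.nb.dl_mset_cong) simp
        ultimately show ?thesis by (simp add: qmap_def)
      qed
      have 2: "germ_value (c2.nb.dl I (c2.comp A)) = qmap \<iota> (jt \<gamma>') (Inr (A, mset I))"
      proof -
        have "germ_value (c2.nb.dl (enum_mset (mset I)) (c2.comp A)) = yfun \<iota> A (enum_mset (mset I)) (jt \<gamma>')"
          using c2.cmp_value[OF c2.reg conjunct1[OF yfun_props] conjunct2[OF yfun_props]] by (simp only: c2.cmp_yfun)
        moreover have "c2.nb.dl I (c2.comp A) = c2.nb.dl (enum_mset (mset I)) (c2.comp A)"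
          by (rule c2.nb.dl_mset_cong) simp
        ultimately show ?thesis by (simp add: qmap_def)
      qed
      have "Inr (A, mset I) \<in> quot_index r \<iota>" using False I by (auto simp: quot_index_def)
      then show "germ_value (c2.nb.dl I (c1.comp A)) = germ_value (c2.nb.dl I (c2.comp A))"
        using 1 2 eq r(2) unfolding zz by simp
    qed
  qed
  have "same_jet M r (\<gamma> \<circ> \<alpha>) \<gamma>'"
  proof (rule same_jetI)
    show "germ_jet_eq r (abs_germ (\<lambda>t. \<phi> ((\<gamma> \<circ> \<alpha>) t) A)) (abs_germ (\<lambda>t. \<phi> (\<gamma>' t) A))" for A
      using je[of A] unfolding c1.comp_def c2.comp_def .
  qed (use r(1) reg(2) in \<open>simp_all only: regular_def\<close>)
  then show ?thesis using \<alpha> by blast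
qed

text \<open>Any reparametrisation of \<open>rep v'\<close> is, up to order \<open>r\<close>, one of
  \<open>rep v\<close> by the composed local diffeomorphism. The two comparisons below replace first
  the curve and then the diffeomorphism by chosen representatives.\<close>

lemma \<rho>_subset:
  assumes reg: "regular (rep v)" "regular (rep v')"
    and eq: "\<And>k. k \<in> quot_index r \<iota> \<Longrightarrow> qmap \<iota> (jt (rep v)) k = qmap \<iota> (jt (rep v')) k"
  shows "\<rho> M r v' \<subseteq> \<rho> M r v"
proof
  fix P assume "P \<in> \<rho> M r v'"
  then obtain b where b: "b \<in> jet_group r" "P = jet0 M r (rep v' \<circ> rep b)"
    by (auto simp: \<rho>_def jet_act_def)
  then obtain \<beta>0 where "local_diffeo0 \<beta>0" "b = diffeo_jet r \<beta>0" by (auto simp: jet_group_def)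
  then have \<beta>: "local_diffeo0 (rep b)" using rep_diffeo_jet(1) by blast
  obtain \<alpha> where \<alpha>: "local_diffeo0 \<alpha>" "same_jet M r (rep v \<circ> \<alpha>) (rep v')"
    using reparam_exists[OF reg eq] by blast
  let ?\<delta> = "\<alpha> \<circ> rep b"
  have \<delta>: "local_diffeo0 ?\<delta>" by (rule local_diffeo0_compose[OF \<alpha>(1) \<beta>])
  have g: "smooth_near0 M (rep v)" "rep v origin \<in> V" "smooth_near0 M (rep v')"
    using reg by (auto simp: regular_def)
  have 1: "same_jet M r (rep v \<circ> \<alpha> \<circ> rep b) (rep v' \<circ> rep b)"
    by (rule same_jet_comp[OF near0_reparam[OF g(1,2) \<alpha>(1)] g(3) \<alpha>(2) \<beta> \<beta>]) simp
  have 2: "same_jet M r (rep v \<circ> ?\<delta>) (rep v \<circ> rep (diffeo_jet r ?\<delta>))"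
    by (rule same_jet_comp[OF g(1,2,1) same_jet_refl \<delta> rep_diffeo_jet(1)[OF \<delta>]])
       (simp add: rep_diffeo_jet(2)[OF \<delta>])
  have "P = jet0 M r (rep v \<circ> rep (diffeo_jet r ?\<delta>))"
    unfolding b(2) using jet0_eqI[OF 1] jet0_eqI[OF 2] by (simp add: o_assoc)
  then show "P \<in> \<rho> M r v" unfolding \<rho>_def jet_act_def jet_group_def using \<delta> by blast
qed

lemma \<rho>_eqI:
  assumes "regular (rep v)" "regular (rep v')"
    and "\<And>k. k \<in> quot_index r \<iota> \<Longrightarrow> qmap \<iota> (jt (rep v)) k = qmap \<iota> (jt (rep v')) k"
  shows "\<rho> M r v = \<rho> M r v'"
  using \<rho>_subset[OF assms] \<rho>_subset[OF assms(2,1)] assms(3) by (metis subset_antisym)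

text \<open>Two choices are hidden in \<open>qcoord\<close>: a velocity of the orbit and a curve of
  that velocity. The first is harmless by invariance of the \<open>y\<close> coordinates, the second
  up to order \<open>r\<close>, which explains the restriction on \<open>k\<close>.\<close>

lemma qcoord_\<rho>:
  assumes "regular (rep v)" "k \<in> quot_index r \<iota>"
  shows "qcoord (V, \<phi>) \<iota> (\<rho> M r v) k = qmap \<iota> (jt (rep v)) k"
proof -
  have "diffeo_jet r (\<lambda>t. t) \<in> jet_group r" using local_diffeo0_id by (auto simp: jet_group_def)
  then have "\<rho> M r v \<noteq> {}" by (auto simp: \<rho>_def)
  then have "rep (\<rho> M r v) \<in> \<rho> M r v" by (metis all_not_in_conv rep_in)
  then obtain b where b: "b \<in> jet_group r" "rep (\<rho> M r v) = jet0 M r (rep v \<circ> rep b)"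
    by (auto simp: \<rho>_def jet_act_def)
  then obtain \<beta>0 where "local_diffeo0 \<beta>0" "b = diffeo_jet r \<beta>0" by (auto simp: jet_group_def)
  then have \<beta>: "local_diffeo0 (rep b)" using rep_diffeo_jet(1) by blast
  note r = regular_reparam[OF assms(1) \<beta>]
  have sj: "same_jet M r (rep v \<circ> rep b) (rep (rep (\<rho> M r v)))"
    unfolding b(2) using r(1) by (intro rep_jet0(2)) (simp add: regular_def)
  have "qcoord (V, \<phi>) \<iota> (\<rho> M r v) k = qmap \<iota> (jt (rep (rep (\<rho> M r v)))) k"
    unfolding qcoord_def qmap_def vcoord_eq ..
  also have "\<dots> = qmap \<iota> (jt (rep v \<circ> rep b)) k"
    by (rule depends_onD[OF vel_order_qmap[OF assms(2)], symmetric])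
       (rule jt_cong[OF sj], use r(1) in \<open>simp_all add: regular_def\<close>)
  finally show ?thesis unfolding r(2) .
qed

section \<open>The coordinate expressions of the Lagrangians and the relations along a
  representative\<close>

lemma vel_expr_eq:
  assumes "1 \<le> r" "regular \<gamma>" "\<And>k. k \<in> vel_index r \<Longrightarrow> jt \<gamma> k = u k"
  shows "vel_expr M r (V, \<phi>) f u = f (jet0 M r \<gamma>)"
proof -
  let ?v = "jet0 M r \<gamma>"
  have vW: "?v \<in> W M r (V, \<phi>) \<iota>" by (rule W_I[OF assms(2,1)])
  have sj: "same_jet M r \<gamma> (rep ?v)" using assms(2) by (intro rep_jet0(2)) (simp add: regular_def)
  have vu: "vcoord (V, \<phi>) ?v k = u k" if "k \<in> vel_index r" for k
    using jt_cong[OF sj _ that] assms(2,3) that by (simp add: vcoord_eq regular_def)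
  have "(THE p. p \<in> imm_over M r (V, \<phi>) \<and> (\<forall>k\<in>vel_index r. vcoord (V, \<phi>) p k = u k)) = ?v"
  proof (rule the_equality)
    show "?v \<in> imm_over M r (V, \<phi>) \<and> (\<forall>k\<in>vel_index r. vcoord (V, \<phi>) ?v k = u k)"
      using vW vu by (simp add: W_def)
    fix p assume p: "p \<in> imm_over M r (V, \<phi>) \<and> (\<forall>k\<in>vel_index r. vcoord (V, \<phi>) p k = u k)"
    have eq: "jt (rep p) k = jt (rep ?v) k" if "k \<in> vel_index r" for k
      using p vu[OF that] that by (simp add: vcoord_eq)
    \<comment> \<open>Uniqueness is required among all immersed velocities over the chart. A
      competitor with the same coordinates up to order \<open>r \<ge> 1\<close> has the same matrix
      of first derivatives and is therefore regular as well.\<close>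
    have "jt (rep p) \<in> reg_coords \<iota> \<longleftrightarrow> jt (rep ?v) \<in> reg_coords \<iota>"
      by (rule reg_coords_cong) (use eq vel_index_mono[OF assms(1)] in blast)
    then have pW: "p \<in> W M r (V, \<phi>) \<iota>"
      using p W_D(1)[OF vW] by (simp add: W_def detx_def vcoord_eq regular_def reg_coords_def)
    have "same_jet M r (rep p) (rep ?v)"
      by (rule same_jet_of_jt) (use W_D(1)[OF pW] W_D(1)[OF vW] eq in \<open>auto simp: regular_def\<close>)
    then show "p = ?v" using W_D(2)[OF pW] W_D(2)[OF vW] jet0_eqI by metis
  qed
  then show ?thesis by (simp add: vel_expr_def coord_expr_def)
qed

lemma quot_expr_eq:
  assumes "v \<in> W M r (V, \<phi>) \<iota>" "\<And>k. k \<in> quot_index r \<iota> \<Longrightarrow> qmap \<iota> (jt (rep v)) k = w k"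
  shows "quot_expr M r (V, \<phi>) \<iota> f w = f (\<rho> M r v)"
proof -
  have "(THE P. P \<in> \<rho> M r ` W M r (V, \<phi>) \<iota> \<and> (\<forall>k\<in>quot_index r \<iota>. qcoord (V, \<phi>) \<iota> P k = w k)) = \<rho> M r v"
  proof (rule the_equality)
    show "\<rho> M r v \<in> \<rho> M r ` W M r (V, \<phi>) \<iota> \<and> (\<forall>k\<in>quot_index r \<iota>. qcoord (V, \<phi>) \<iota> (\<rho> M r v) k = w k)"
      using assms qcoord_\<rho>[OF W_D(1)[OF assms(1)]] by auto
    fix P assume P: "P \<in> \<rho> M r ` W M r (V, \<phi>) \<iota> \<and> (\<forall>k\<in>quot_index r \<iota>. qcoord (V, \<phi>) \<iota> P k = w k)"
    then obtain v' where v': "v' \<in> W M r (V, \<phi>) \<iota>" "P = \<rho> M r v'" by blast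
    show "P = \<rho> M r v" unfolding v'(2)
    proof (rule \<rho>_eqI[OF W_D(1)[OF v'(1)] W_D(1)[OF assms(1)]])
      fix k assume k: "k \<in> quot_index r \<iota>"
      then show "qmap \<iota> (jt (rep v')) k = qmap \<iota> (jt (rep v)) k"
        using P assms(2)[OF k] qcoord_\<rho>[OF W_D(1)[OF v'(1)] k] v'(2) by auto
    qed
  qed
  then show ?thesis by (simp add: quot_expr_def coord_expr_def)
qed

lemma jt_rep_jet0:
  assumes "regular \<gamma>" "k \<in> vel_index r"
  shows "jt (rep (jet0 M r \<gamma>)) k = jt \<gamma> k"
proof -
  have "same_jet M r \<gamma> (rep (jet0 M r \<gamma>))" using assms by (intro rep_jet0(2)) (simp add: regular_def)
  then show ?thesis using jt_cong assms by (metis regular_def)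
qed

lemma qmap_jt_rep_jet0:
  assumes "regular \<gamma>" "k \<in> quot_index r \<iota>"
  shows "qmap \<iota> (jt (rep (jet0 M r \<gamma>))) k = qmap \<iota> (jt \<gamma>) k"
  by (rule depends_onD[OF vel_order_qmap[OF assms(2)]]) (rule jt_rep_jet0[OF assms(1)])

lemma \<Omega>v_subset: "1 \<le> r \<Longrightarrow> \<Omega>v \<subseteq> vel_domain M r (V, \<phi>)"
proof
  fix u assume r: "1 \<le> r" and u: "u \<in> \<Omega>v"
  obtain \<gamma> where \<gamma>: "regular \<gamma>" "\<forall>k\<in>vel_index r. jt \<gamma> k = u k" using realize_vel[OF u r] by blast
  have "jet0 M r \<gamma> \<in> imm_over M r (V, \<phi>)" using W_I[OF \<gamma>(1) r] by (simp add: W_def)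
  moreover have "vcoord (V, \<phi>) (jet0 M r \<gamma>) k = u k" if "k \<in> vel_index r" for k
    using jt_rep_jet0[OF \<gamma>(1) that] \<gamma>(2) that by (simp add: vcoord_eq)
  ultimately show "u \<in> vel_domain M r (V, \<phi>)" unfolding vel_domain_def coord_image_def by blast
qed

lemma \<Omega>q_subset: "1 \<le> r \<Longrightarrow> \<Omega>q \<subseteq> quot_domain M r (V, \<phi>) \<iota>"
proof
  fix w assume r: "1 \<le> r" and w: "w \<in> \<Omega>q"
  obtain \<gamma> where \<gamma>: "regular \<gamma>" "\<forall>k\<in>quot_index r \<iota>. qmap \<iota> (jt \<gamma>) k = w k" using realize_quot[OF w r] by blast
  have "qcoord (V, \<phi>) \<iota> (\<rho> M r (jet0 M r \<gamma>)) k = w k" if "k \<in> quot_index r \<iota>" for k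
    using qcoord_\<rho>[OF regular_rep[OF \<gamma>(1) r] that] qmap_jt_rep_jet0[OF \<gamma>(1) that] \<gamma>(2) that by simp
  then show "w \<in> quot_domain M r (V, \<phi>) \<iota>"
    using W_I[OF \<gamma>(1) r] unfolding quot_domain_def coord_image_def by blast
qed

text \<open>The transformation formula is applied to a representative of \<open>v\<close>. The
  domains are shrunk to the explicit open sets \<open>\<Omega>v\<close> and
  \<open>\<Omega>q\<close>, on which smoothness is inherited and every point comes from a regular
  curve.\<close>

theorem lie_euler_relations:
  assumes r: "r \<ge> 1" and s: "s \<ge> 2 * r"
    and hom: "homogeneous_lagrangian M r \<L>" and ass: "associated_lagrangian M r (V, \<phi>) \<iota> \<L> L"
    and v: "v \<in> W M s (V, \<phi>) \<iota>" and js: "length js \<le> r"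
  shows "\<E> M (V, \<phi>) r s \<L> A js v =
    (case js of [j] \<Rightarrow> detx (V, \<phi>) \<iota> v * (\<Sum>k\<in>UNIV. if \<iota> k = A then zcoord (V, \<phi>) \<iota> v j [k] else 0) * L (\<rho> M r (truncate_vel M r v)) | _ \<Rightarrow> 0) +
    (\<Sum>\<sigma>\<in>- range \<iota>. ((if \<sigma> = A then 1 else 0) -
        (\<Sum>k\<in>UNIV. if \<iota> k = A then qcoord (V, \<phi>) \<iota> (\<rho> M s v) (Inr (\<sigma>, {#k#})) else 0)) *
      ((- 1) ^ length js * detx (V, \<phi>) \<iota> v * (\<Sum>I\<in>multi_indices (length js) r.
        (- 1) ^ length I * part_sum (zcoord (V, \<phi>) \<iota> v) I js * E M (V, \<phi>) \<iota> r s L \<sigma> I (\<rho> M s v))))"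
proof -
  define F where "F = vel_expr M r (V, \<phi>) \<L>"
  define G where "G = quot_expr M r (V, \<phi>) \<iota> L"
  let ?\<gamma> = "rep v"
  have reg: "regular ?\<gamma>" by (rule W_D(1)[OF v])
  obtain U where U: "regular_curve (\<lambda>i. i) (\<lambda>t. \<phi> (?\<gamma> t)) U \<iota>" by (rule regularE[OF reg])
  interpret c: regular_curve "\<lambda>i :: 'n. i" "\<lambda>t. \<phi> (?\<gamma> t)" U \<iota> by (rule U)
  have LW: "\<L> v' = detx (V, \<phi>) \<iota> v' * L (\<rho> M r v')" if "v' \<in> W M r (V, \<phi>) \<iota>" for v'
    using ass that by (simp add: associated_lagrangian_def)
  have Gv: "G w = L (\<rho> M r (jet0 M r \<gamma>))"
    if \<gamma>: "regular \<gamma>" and w: "\<And>k. k \<in> quot_index r \<iota> \<Longrightarrow> qmap \<iota> (jt \<gamma>) k = w k" for \<gamma> w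
    unfolding G_def using qmap_jt_rep_jet0[OF \<gamma>] w by (intro quot_expr_eq W_I[OF \<gamma> r]) simp
  interpret l: lagrangian_curve "\<lambda>t. \<phi> (?\<gamma> t)" U \<iota> r F G \<Omega>v \<Omega>q
  proof unfold_locales
    show "smooth_fun_on \<Omega>v F"
      using hom chart unfolding F_def homogeneous_lagrangian_def
      by (intro smooth_fun_on_subset[OF _ \<Omega>v_subset[OF r]]) blast
    show "smooth_fun_on \<Omega>q G"
      using ass unfolding G_def associated_lagrangian_def
      by (intro smooth_fun_on_subset[OF _ \<Omega>q_subset[OF r]]) blast
    show "vel_order r F" unfolding F_def vel_expr_def by (rule depends_on_coord_expr)
    show "quot_order \<iota> r G" unfolding G_def quot_expr_def by (rule depends_on_coord_expr)
    show "\<Omega>v \<subseteq> reg_coords \<iota>" by (simp add: \<Omega>v_def)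
    show "jt ?\<gamma> \<in> \<Omega>v" by (rule jt_\<Omega>v[OF reg])
    fix u assume u: "u \<in> \<Omega>v"
    show "qmap \<iota> u \<in> \<Omega>q" using u by (simp add: \<Omega>q_def base_qmap \<Omega>v_def)
    \<comment> \<open>The factorization is given for velocities; to obtain it for an arbitrary point
      \<open>u\<close> of \<open>\<Omega>v\<close>, a curve with these coordinates is
      chosen.\<close>
    obtain \<gamma> where \<gamma>: "regular \<gamma>" "\<And>k. k \<in> vel_index r \<Longrightarrow> jt \<gamma> k = u k" using realize_vel[OF u r] by blast
    have "F u = detx (V, \<phi>) \<iota> (jet0 M r \<gamma>) * L (\<rho> M r (jet0 M r \<gamma>))"
      unfolding F_def using vel_expr_eq[OF r \<gamma>] LW[OF W_I[OF \<gamma>(1) r]] by simp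
    also have "L (\<rho> M r (jet0 M r \<gamma>)) = G (qmap \<iota> u)"
    proof (rule Gv[OF \<gamma>(1), symmetric])
      fix k assume "k \<in> quot_index r \<iota>"
      then show "qmap \<iota> (jt \<gamma>) k = qmap \<iota> u k" by (rule depends_onD[OF vel_order_qmap \<gamma>(2)])
    qed
    also have "detx (V, \<phi>) \<iota> (jet0 M r \<gamma>) = det (xmat \<iota> u)"
    proof -
      have "xmat \<iota> (jt (rep (jet0 M r \<gamma>))) = xmat \<iota> u"
        by (rule depends_onD[OF vel_order_xmat])
           (use jt_rep_jet0[OF \<gamma>(1), of _ r] \<gamma>(2) vel_index_mono[OF r] in force)
      then show ?thesis by (simp add: detx_def vcoord_eq)
    qed
    finally show "F u = det (xmat \<iota> u) * G (qmap \<iota> u)" .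
  qed (use open_\<Omega>v open_\<Omega>q c.open_U c.origin_U c.smooth_\<Gamma> inj_\<iota> in auto)
  have u0: "vcoord (V, \<phi>) v = jt ?\<gamma>" by (rule vcoord_eq)
  \<comment> \<open>\<open>G\<close> has order \<open>r\<close>, but its total derivatives reach
    order up to \<open>2 * r \<le> s\<close>. The coordinates of the orbit of order \<open>s\<close>
    agree with those of the curve in this range.\<close>
  have E: "E M (V, \<phi>) \<iota> r s L \<sigma> I (\<rho> M s v) = quot_lie_euler \<iota> r s \<sigma> I G (qmap \<iota> (jt ?\<gamma>))" for \<sigma> I
    unfolding E_def G_def[symmetric]
    by (rule quot_lie_euler_cong[OF quot_order_mono[OF l.G(2)]]) (use s qcoord_\<rho>[OF reg] in auto)
  \<comment> \<open>The truncated velocity is the jet of order \<open>r\<close> of the same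
    representative, so \<open>G\<close> at its coordinates is the value of \<open>L\<close> on the
    truncated orbit.\<close>
  have LG: "L (\<rho> M r (truncate_vel M r v)) = G (qmap \<iota> (jt ?\<gamma>))"
    unfolding truncate_vel_def by (rule Gv[OF reg, symmetric]) simp
  have y: "qcoord (V, \<phi>) \<iota> (\<rho> M s v) (Inr (\<sigma>, {#k#})) = yfun \<iota> \<sigma> [k] (jt ?\<gamma>)" if "\<sigma> \<in> - range \<iota>" for \<sigma> k
  proof -
    have "Inr (\<sigma>, {#k#}) \<in> quot_index s \<iota>" using that r s by (auto simp: quot_index_def)
    then show ?thesis by (simp add: qcoord_\<rho>[OF reg] qmap_def del: yfun.simps)
  qed
  have z: "zcoord (V, \<phi>) \<iota> v = (\<lambda>j I. zfun \<iota> j I (jt ?\<gamma>))" by (simp add: zcoord_def[abs_def] u0)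
  have d: "detx (V, \<phi>) \<iota> v = det (xmat \<iota> (jt ?\<gamma>))" by (simp add: detx_def u0)
  have "\<E> M (V, \<phi>) r s \<L> A js v = lie_euler r s A js F (jt ?\<gamma>)" by (simp add: \<E>_def F_def u0)
  also note l.lie_euler_transform[OF r s js, of A]
  also have "(\<Sum>\<sigma>\<in>- range \<iota>. ((if \<sigma> = A then 1 else 0) - (\<Sum>k\<in>UNIV. if \<iota> k = A then yfun \<iota> \<sigma> [k] (jt ?\<gamma>) else 0)) * X \<sigma>) =
      (\<Sum>\<sigma>\<in>- range \<iota>. ((if \<sigma> = A then 1 else 0) -
        (\<Sum>k\<in>UNIV. if \<iota> k = A then qcoord (V, \<phi>) \<iota> (\<rho> M s v) (Inr (\<sigma>, {#k#})) else 0)) * X \<sigma>)" for X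
    by (rule sum.cong[OF refl]) (simp only: y)
  finally show ?thesis unfolding E LG z d zfun.simps(2) .
qed

end

section \<open>The transformation of the Lie--Euler operators\<close>

lemma part_sum_Nil: "part_sum \<zeta> I [] = (if I = [] then 1 else 0)"
proof -
  have "{fs :: nat list. length fs = length I \<and> set fs = {}} = (if I = [] then {[]} else {})" by auto
  then show ?thesis by (simp add: part_sum_words)
qed

text \<open>With one label there is exactly one labelling, and its block is the whole word.\<close>

lemma part_sum_single:
  assumes "I \<noteq> []"
  shows "part_sum \<zeta> I [j] = \<zeta> j I"
proof -
  have "length fs = length I \<and> set fs = {..<Suc 0} \<longleftrightarrow> fs = replicate (length I) 0" for fs :: "nat list"
    using assms by (auto simp: lessThan_Suc intro: replicate_eqI)
  then have "{fs. length fs = length I \<and> set fs = {..<Suc 0}} = {replicate (length I) (0 :: nat)}" by blast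
  moreover have "sub_word I (replicate (length I) 0) 0 = I"
    unfolding sub_word_def by (induction I) simp_all
  ultimately show ?thesis by (simp add: part_sum_words)
qed

text \<open>A nonempty word has no partition into zero blocks, so only the empty multi-index
  remains.\<close>

lemma sum_multi_indices_Nil:
  "(\<Sum>I\<in>multi_indices 0 r. f I * part_sum \<zeta> I [] * g I) = f [] * g ([] :: 'n::finite list)"
proof -
  have "(\<Sum>I\<in>multi_indices 0 r. f I * part_sum \<zeta> I [] * g I) = (\<Sum>I\<in>{[] :: 'n list}. f I * part_sum \<zeta> I [] * g I)"
    by (rule sum.mono_neutral_right) (auto simp: multi_indices_def part_sum_Nil finite_lists_length_le[of UNIV, simplified])
  then show ?thesis by (simp add: part_sum_Nil)
qed

lemma sum_multi_indices_single:
  "(\<Sum>I\<in>multi_indices 1 r. f I * part_sum \<zeta> I [j] * g I) = (\<Sum>I\<in>multi_indices 1 r. f I * \<zeta> j I * (g (I :: 'n::finite list) :: real))"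
proof (rule sum.cong[OF refl])
  fix I :: "'n list" assume "I \<in> multi_indices 1 r"
  then have "I \<noteq> []" by (auto simp: multi_indices_def)
  then show "f I * part_sum \<zeta> I [j] * g I = f I * \<zeta> j I * g I" using part_sum_single by metis
qed

text \<open>All five relations are readings of \<open>lie_euler_relations\<close>: the index
  \<open>A\<close> is transversal or of the form \<open>\<iota> p\<close>, and the length of the
  word decides whether the divergence term contributes.\<close>

theorem theorem3p8:
  fixes M :: "('x, 'a::finite) manifold"
    and c :: "('x, 'a) chart"
    and \<iota> :: "'n::finite \<Rightarrow> 'a"
    and r s :: nat
    and \<L> :: "('n, 'x) velocity \<Rightarrow> real"
    and L :: "('n, 'x) velocity set \<Rightarrow> real"
    and v :: "('n, 'x) velocity"
  assumes "smooth_manifold M"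
    and "c \<in> charts M"
    and "inj \<iota>"
    and "r \<ge> 1"
    and "homogeneous_lagrangian M r \<L>"
    and "associated_lagrangian M r c \<iota> \<L> L"
    and "s \<ge> 2 * r"
    and "v \<in> W M s c \<iota>"
  shows
    "(\<forall>\<sigma>. \<sigma> \<notin> range \<iota> \<longrightarrow>
        \<E> M c r s \<L> \<sigma> [] v = detx c \<iota> v * E M c \<iota> r s L \<sigma> [] (\<rho> M s v))
   \<and> (\<forall>\<sigma> js. \<sigma> \<notin> range \<iota> \<and> js \<in> multi_indices 1 r \<longrightarrow>
        \<E> M c r s \<L> \<sigma> js v =
          (- 1) ^ length js * detx c \<iota> v *
          (\<Sum>I\<in>multi_indices (length js) r.
             (- 1) ^ length I * part_sum (zcoord c \<iota> v) I js * E M c \<iota> r s L \<sigma> I (\<rho> M s v)))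
   \<and> (\<forall>p. \<E> M c r s \<L> (\<iota> p) [] v =
          - detx c \<iota> v *
          (\<Sum>\<sigma>\<in>- range \<iota>. qcoord c \<iota> (\<rho> M s v) (Inr (\<sigma>, {#p#})) * E M c \<iota> r s L \<sigma> [] (\<rho> M s v)))
   \<and> (\<forall>p j. \<E> M c r s \<L> (\<iota> p) [j] v =
          detx c \<iota> v *
          (zcoord c \<iota> v j [p] * L (\<rho> M r (truncate_vel M r v)) +
           (\<Sum>\<sigma>\<in>- range \<iota>. qcoord c \<iota> (\<rho> M s v) (Inr (\<sigma>, {#p#})) *
             (\<Sum>I\<in>multi_indices 1 r.
                (- 1) ^ length I * zcoord c \<iota> v j I * E M c \<iota> r s L \<sigma> I (\<rho> M s v)))))
   \<and> (\<forall>p js. js \<in> multi_indices 2 r \<longrightarrow>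
        \<E> M c r s \<L> (\<iota> p) js v =
          (- 1) ^ (length js + 1) * detx c \<iota> v *
          (\<Sum>\<sigma>\<in>- range \<iota>. qcoord c \<iota> (\<rho> M s v) (Inr (\<sigma>, {#p#})) *
             (\<Sum>I\<in>multi_indices (length js) r.
                (- 1) ^ length I * part_sum (zcoord c \<iota> v) I js * E M c \<iota> r s L \<sigma> I (\<rho> M s v))))"
proof -
  obtain V \<phi> where c: "c = (V, \<phi>)" by (cases c)
  interpret split_chart M V \<phi> \<iota> using assms(1-3) by unfold_locales (auto simp: c)
  define \<Phi> where "\<Phi> \<sigma> js = (- 1) ^ length js * detx c \<iota> v * (\<Sum>I\<in>multi_indices (length js) r.
    (- 1) ^ length I * part_sum (zcoord c \<iota> v) I js * E M c \<iota> r s L \<sigma> I (\<rho> M s v))" for \<sigma> js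
  note relations = lie_euler_relations[OF assms(4,7,5), folded c, OF assms(6,8), folded \<Phi>_def]
  have transversal: "\<E> M c r s \<L> \<sigma> js v = \<Phi> \<sigma> js" if \<sigma>: "\<sigma> \<notin> range \<iota>" and js: "length js \<le> r" for \<sigma> js
  proof -
    have ne: "\<iota> k \<noteq> \<sigma>" for k using \<sigma> by auto
    have "(\<Sum>\<sigma>'\<in>- range \<iota>. (if \<sigma>' = \<sigma> then 1 else 0) * \<Phi> \<sigma>' js) = \<Phi> \<sigma> js"
      using \<sigma> by (simp add: if_distrib[of "\<lambda>x. x * _"] sum.delta cong: if_cong)
    then show ?thesis unfolding relations[OF js] by (simp add: ne split: list.split)
  qed
  have horizontal: "\<E> M c r s \<L> (\<iota> p) js v =
      (case js of [j] \<Rightarrow> detx c \<iota> v * zcoord c \<iota> v j [p] * L (\<rho> M r (truncate_vel M r v)) | _ \<Rightarrow> 0) -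
      (\<Sum>\<sigma>\<in>- range \<iota>. qcoord c \<iota> (\<rho> M s v) (Inr (\<sigma>, {#p#})) * \<Phi> \<sigma> js)" if js: "length js \<le> r" for p js
  proof -
    have eq: "\<iota> k = \<iota> p \<longleftrightarrow> k = p" for k using assms(3) by (auto dest: injD)
    \<comment> \<open>The sum runs over transversal indices only, so the Kronecker delta vanishes
      and the horizontal expression is minus the combination of the transversal ones with
      coefficients \<open>y^\<sigma>_p\<close>.\<close>
    have "(\<Sum>\<sigma>\<in>- range \<iota>. ((if \<sigma> = \<iota> p then 1 else 0) - qcoord c \<iota> (\<rho> M s v) (Inr (\<sigma>, {#p#}))) * \<Phi> \<sigma> js) =
        - (\<Sum>\<sigma>\<in>- range \<iota>. qcoord c \<iota> (\<rho> M s v) (Inr (\<sigma>, {#p#})) * \<Phi> \<sigma> js)"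
      unfolding sum_negf[symmetric] by (rule sum.cong) auto
    then show ?thesis unfolding relations[OF js] by (simp add: eq split: list.split)
  qed
  have \<Phi>_Nil: "\<Phi> \<sigma> [] = detx c \<iota> v * E M c \<iota> r s L \<sigma> [] (\<rho> M s v)" for \<sigma>
    unfolding \<Phi>_def list.size sum_multi_indices_Nil by simp
  \<comment> \<open>For one letter the sign \<open>(- 1) ^ 1\<close> cancels the minus sign of the
    horizontal formula, which is why the fourth relation carries a plus.\<close>
  have \<Phi>_single: "\<Phi> \<sigma> [j] = - (detx c \<iota> v * (\<Sum>I\<in>multi_indices 1 r.
      (- 1) ^ length I * zcoord c \<iota> v j I * E M c \<iota> r s L \<sigma> I (\<rho> M s v)))" for \<sigma> j
    using sum_multi_indices_single[where f = "\<lambda>I. (- 1) ^ length I" and g = "\<lambda>I. E M c \<iota> r s L \<sigma> I (\<rho> M s v)"]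
    by (simp add: \<Phi>_def)
  have pull: "(\<Sum>\<sigma>\<in>- range \<iota>. Y \<sigma> * (d * Z \<sigma>)) = d * (\<Sum>\<sigma>\<in>- range \<iota>. Y \<sigma> * Z \<sigma>)"
    for d :: real and Y Z
    by (simp add: sum_distrib_left mult.left_commute)
  show ?thesis
  proof (intro conjI allI impI)
    fix \<sigma> assume "\<sigma> \<notin> range \<iota>"
    then show "\<E> M c r s \<L> \<sigma> [] v = detx c \<iota> v * E M c \<iota> r s L \<sigma> [] (\<rho> M s v)"
      using transversal[of \<sigma> "[]"] by (simp add: \<Phi>_Nil)
  next
    fix \<sigma> and js :: "'n list" assume "\<sigma> \<notin> range \<iota> \<and> js \<in> multi_indices 1 r"
    then show "\<E> M c r s \<L> \<sigma> js v = (- 1) ^ length js * detx c \<iota> v * (\<Sum>I\<in>multi_indices (length js) r.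
        (- 1) ^ length I * part_sum (zcoord c \<iota> v) I js * E M c \<iota> r s L \<sigma> I (\<rho> M s v))"
      using transversal[of \<sigma> js] by (simp add: \<Phi>_def multi_indices_def)
  next
    fix p
    show "\<E> M c r s \<L> (\<iota> p) [] v = - detx c \<iota> v *
        (\<Sum>\<sigma>\<in>- range \<iota>. qcoord c \<iota> (\<rho> M s v) (Inr (\<sigma>, {#p#})) * E M c \<iota> r s L \<sigma> [] (\<rho> M s v))"
      using horizontal[of "[]" p] by (simp add: \<Phi>_Nil pull)
  next
    fix p j
    show "\<E> M c r s \<L> (\<iota> p) [j] v = detx c \<iota> v * (zcoord c \<iota> v j [p] * L (\<rho> M r (truncate_vel M r v)) +
        (\<Sum>\<sigma>\<in>- range \<iota>. qcoord c \<iota> (\<rho> M s v) (Inr (\<sigma>, {#p#})) * (\<Sum>I\<in>multi_indices 1 r.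
          (- 1) ^ length I * zcoord c \<iota> v j I * E M c \<iota> r s L \<sigma> I (\<rho> M s v))))"
      using horizontal[of "[j]" p] assms(4)
      by (simp add: \<Phi>_single pull distrib_left sum_negf)
  next
    fix p and js :: "'n list" assume "js \<in> multi_indices 2 r"
    then show "\<E> M c r s \<L> (\<iota> p) js v = (- 1) ^ (length js + 1) * detx c \<iota> v *
        (\<Sum>\<sigma>\<in>- range \<iota>. qcoord c \<iota> (\<rho> M s v) (Inr (\<sigma>, {#p#})) * (\<Sum>I\<in>multi_indices (length js) r.
          (- 1) ^ length I * part_sum (zcoord c \<iota> v) I js * E M c \<iota> r s L \<sigma> I (\<rho> M s v)))"
      using horizontal[of js p] unfolding \<Phi>_def multi_indices_def[of 2]
      by (auto simp: pull split: list.splits)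
  qed
qed

end
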